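(* Let $d<0$ be a square-free integer, let $n\ge2$, and let $G=SL_n(\mathcal O_d)$. In principle, a free $\mathbb ZG$-resolution $R^G_\ast$ of $\mathbb Z$ and a contracting homotopy $h_\ast\colon R^G_\ast\simeq\mathbb Z$ can be implemented on a computer, with $R^G_k$ finitely generated for all $k\ge0$. That is, there exist a free $\mathbb ZG$-resolution $R^G_\ast$ of $\mathbb Z$ with every $R^G_k$ finitely generated over $\mathbb ZG$, and a contracting homotopy $h_\ast$ on it, for which arbitrary elements $w\in R^G_k$ ($k\ge 0$) can be represented by finite data and there are algorithms which, given $k$ and $w\in R^G_k$, uniquely determine the images $d_k(w)\in R^G_{k-1}$ (for $k\ge1$) and $h_k(w)\in R^G_{k+1}$.
   Context: $\mathcal O_d$ denotes the ring of integers of the quadratic number field $\mathbb Q(\sqrt d)$; explicitly $\mathcal O_d=\{a+b\omega: a,b\in\mathbb Z\}$, where $\omega=\sqrt d$ if $d\equiv2,3\bmod 4$ and $\omega=\frac{1+\sqrt d}{2}$ if $d\equiv1\bmod4$. A free $\mathbb ZG$-resolution $R^G_\ast$ of the trivial module $\mathbb Z$ is a chain complex of free $\mathbb ZG$-modules $R^G_k$ ($k\ge0$), with $\mathbb ZG$-linear boundary maps $d_k\colon R^G_k\to R^G_{k-1}$ (not to be confused with the integer $d$), such that $H_0(R^G_\ast)\cong\mathbb Z$ (trivial action) and $H_k(R^G_\ast)=0$ for $k>0$. A contracting homotopy $h_\ast\colon R^G_\ast\simeq\mathbb Z$ is a sequence of $\mathbb Z$-linear homomorphisms $h_k\colon R^G_k\to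 R^G_{k+1}$, $k\ge0$ (not required to be $G$-equivariant), satisfying $d_{k+1}h_k+h_{k-1}d_k=1$ for $k>0$ and $d_1h_0=1-\epsilon$, where $\epsilon\colon R^G_0\twoheadrightarrow H_0(R^G_\ast)\cong\mathbb Z\hookrightarrow R^G_0$ is the canonical $\mathbb Z$-linear homomorphism onto a direct summand $\mathbb Z$ of $R^G_0$ (the first map is the quotient map and the second is a $\mathbb Z$-linear section of it). *)

theory Defs
  imports
    "HOL-Library.Nat_Bijection"
    "HOL-Computational_Algebra.Squarefree"
    "HOL-Algebra.Module"
    "HOL-Algebra.AbelCoset"
    "Jordan_Normal_Form.Determinant"
begin

hide_const (open) Polynomial.smult

section \<open>The group $SL_n(\mathcal O_d)$\<close>

definition omega :: "int \<Rightarrow> complex" where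
  "omega d = (if d mod 4 = 1 then (1 + csqrt (of_int d)) / 2 else csqrt (of_int d))"

definition ring_of_integers :: "int \<Rightarrow> complex set" where
  "ring_of_integers d = {of_int a + of_int b * omega d | a b :: int. True}"

definition SL :: "nat \<Rightarrow> int \<Rightarrow> complex mat monoid" where
  "SL n d = \<lparr>carrier = {A \<in> carrier_mat n n. elements_mat A \<subseteq> ring_of_integers d \<and> det A = 1},
             mult = (*), one = 1\<^sub>m n\<rparr>"


section \<open>Integral group rings and left modules\<close>

definition group_ring :: "('g, 'm) monoid_scheme \<Rightarrow> ('g \<Rightarrow> int) ring" where
  "group_ring G =
    \<lparr>carrier = {a. finite {g. a g \<noteq> 0} \<and> {g. a g \<noteq> 0} \<subseteq> carrier G},
     mult = (\<lambda>a b g. \<Sum>(x, y) \<in> {x. a x \<noteq> 0} \<times> {y. b y \<noteq> 0}.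
                        if x \<otimes>\<^bsub>G\<^esub> y = g then a x * b y else 0),
     one = (\<lambda>g. if g = \<one>\<^bsub>G\<^esub> then 1 else 0),
     zero = (\<lambda>_. 0),
     add = (\<lambda>a b g. a g + b g)\<rparr>"

text \<open>
  The locale \<^locale>\<open>module\<close> of the library requires a commutative ring of scalars. We keep its
  record type, in which the multiplicative fields of the module play no role.
\<close>

locale left_module = R?: ring R + M?: abelian_group M for R (structure) and M (structure) +
  assumes smult_closed: "\<lbrakk>a \<in> carrier R; x \<in> carrier M\<rbrakk> \<Longrightarrow> a \<odot>\<^bsub>M\<^esub> x \<in> carrier M"
    and smult_l_distr: "\<lbrakk>a \<in> carrier R; b \<in> carrier R; x \<in> carrier M\<rbrakk> \<Longrightarrow>
      (a \<oplus> b) \<odot>\<^bsub>M\<^esub> x = a \<odot>\<^bsub>M\<^esub> x \<oplus>\<^bsub>M\<^esub> b \<odot>\<^bsub>M\<^esub> x"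
    and smult_r_distr: "\<lbrakk>a \<in> carrier R; x \<in> carrier M; y \<in> carrier M\<rbrakk> \<Longrightarrow>
      a \<odot>\<^bsub>M\<^esub> (x \<oplus>\<^bsub>M\<^esub> y) = a \<odot>\<^bsub>M\<^esub> x \<oplus>\<^bsub>M\<^esub> a \<odot>\<^bsub>M\<^esub> y"
    and smult_assoc1: "\<lbrakk>a \<in> carrier R; b \<in> carrier R; x \<in> carrier M\<rbrakk> \<Longrightarrow>
      (a \<otimes> b) \<odot>\<^bsub>M\<^esub> x = a \<odot>\<^bsub>M\<^esub> (b \<odot>\<^bsub>M\<^esub> x)"
    and smult_one: "x \<in> carrier M \<Longrightarrow> \<one> \<odot>\<^bsub>M\<^esub> x = x"

definition left_module_hom ::
  "'a ring \<Rightarrow> ('a, 'b) module \<Rightarrow> ('a, 'c) module \<Rightarrow> ('b \<Rightarrow> 'c) set" where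
  "left_module_hom S M N =
    {f \<in> hom (add_monoid M) (add_monoid N).
       \<forall>a \<in> carrier S. \<forall>x \<in> carrier M. f (a \<odot>\<^bsub>M\<^esub> x) = a \<odot>\<^bsub>N\<^esub> f x}"

definition left_module_iso :: "'a ring \<Rightarrow> ('a, 'b) module \<Rightarrow> ('a, 'c) module \<Rightarrow> bool" where
  "left_module_iso S M N \<longleftrightarrow>
    (\<exists>f \<in> left_module_hom S M N. bij_betw f (carrier M) (carrier N))"

definition is_basis :: "'a ring \<Rightarrow> ('a, 'b) module \<Rightarrow> 'i set \<Rightarrow> ('i \<Rightarrow> 'b) \<Rightarrow> bool" where
  "is_basis S M I b \<longleftrightarrow>
    b ` I \<subseteq> carrier M \<and>
    (\<forall>x \<in> carrier M. \<exists>!a. (\<forall>i. a i \<in> carrier S) \<and>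
       finite {i. a i \<noteq> \<zero>\<^bsub>S\<^esub>} \<and> {i. a i \<noteq> \<zero>\<^bsub>S\<^esub>} \<subseteq> I \<and>
       x = (\<Oplus>\<^bsub>M\<^esub> i \<in> {i. a i \<noteq> \<zero>\<^bsub>S\<^esub>}. a i \<odot>\<^bsub>M\<^esub> b i))"

definition free_module :: "'a ring \<Rightarrow> ('a, 'b) module \<Rightarrow> bool" where
  "free_module S M \<longleftrightarrow> left_module S M \<and> (\<exists>B. is_basis S M B (\<lambda>x. x))"

text \<open>The integers with trivial \<open>G\<close>-action: the group ring acts through the augmentation.
  The fields \<open>mult\<close> and \<open>one\<close> are irrelevant.\<close>

definition trivial_module :: "('g \<Rightarrow> int, int) module" where
  "trivial_module =
    \<lparr>carrier = UNIV, mult = (*), one = 1, zero = 0, add = (+),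
     smult = (\<lambda>a m. (\<Sum>g | a g \<noteq> 0. a g) * m)\<rparr>"


section \<open>Homology, resolutions and contracting homotopies\<close>

text \<open>A chain complex is given by modules \<open>R k\<close> and maps \<open>D k\<close> from \<open>R k\<close> to \<open>R (k - 1)\<close> for
  \<open>k > 0\<close>; the value \<open>D 0\<close> is never used.\<close>

definition chain_complex ::
  "'a ring \<Rightarrow> (nat \<Rightarrow> ('a, 'b) module) \<Rightarrow> (nat \<Rightarrow> 'b \<Rightarrow> 'b) \<Rightarrow> bool" where
  "chain_complex S R D \<longleftrightarrow>
    (\<forall>k. left_module S (R k)) \<and>
    (\<forall>k. D (Suc k) \<in> left_module_hom S (R (Suc k)) (R k)) \<and>
    (\<forall>k. \<forall>x \<in> carrier (R (Suc (Suc k))). D (Suc k) (D (Suc (Suc k)) x) = \<zero>\<^bsub>R k\<^esub>)"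

definition cycles :: "(nat \<Rightarrow> ('a, 'b) module) \<Rightarrow> (nat \<Rightarrow> 'b \<Rightarrow> 'b) \<Rightarrow> nat \<Rightarrow> 'b set" where
  "cycles R D k =
    (if k = 0 then carrier (R 0) else {x \<in> carrier (R k). D k x = \<zero>\<^bsub>R (k - 1)\<^esub>})"

definition boundaries :: "(nat \<Rightarrow> ('a, 'b) module) \<Rightarrow> (nat \<Rightarrow> 'b \<Rightarrow> 'b) \<Rightarrow> nat \<Rightarrow> 'b set" where
  "boundaries R D k = D (Suc k) ` carrier (R (Suc k))"

definition homology_class ::
  "(nat \<Rightarrow> ('a, 'b) module) \<Rightarrow> (nat \<Rightarrow> 'b \<Rightarrow> 'b) \<Rightarrow> nat \<Rightarrow> 'b \<Rightarrow> 'b set" where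
  "homology_class R D k x = boundaries R D k +>\<^bsub>R k\<^esub> x"

text \<open>The quotient module of cosets of the boundaries in the cycles
  (fields \<open>mult\<close> and \<open>one\<close> irrelevant).\<close>

definition homology ::
  "(nat \<Rightarrow> ('a, 'b) module) \<Rightarrow> (nat \<Rightarrow> 'b \<Rightarrow> 'b) \<Rightarrow> nat \<Rightarrow> ('a, 'b set) module" where
  "homology R D k =
    \<lparr>carrier = homology_class R D k ` cycles R D k,
     mult = (\<lambda>X Y. undefined), one = undefined,
     zero = boundaries R D k,
     add = (\<lambda>X Y. X <+>\<^bsub>R k\<^esub> Y),
     smult = (\<lambda>a X. \<Union>x \<in> X. homology_class R D k (a \<odot>\<^bsub>R k\<^esub> x))\<rparr>"

definition free_resolution ::
  "('g, 'm) monoid_scheme \<Rightarrow> (nat \<Rightarrow> ('g \<Rightarrow> int, 'b) module) \<Rightarrow> (nat \<Rightarrow> 'b \<Rightarrow> 'b) \<Rightarrow> bool" where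
  "free_resolution G R D \<longleftrightarrow>
    chain_complex (group_ring G) R D \<and>
    (\<forall>k. free_module (group_ring G) (R k)) \<and>
    left_module_iso (group_ring G) (homology R D 0) trivial_module \<and>
    (\<forall>k > 0. carrier (homology R D k) = {\<zero>\<^bsub>homology R D k\<^esub>})"

text \<open>Here \<open>s\<close> is the composite of an isomorphism of \<open>H\<^sub>0\<close> with the integers and an additive
  section of the quotient map onto the integers, so \<open>s (homology_class R D 0 x)\<close> is
  $\epsilon(x)$.\<close>

definition contracting_homotopy ::
  "(nat \<Rightarrow> ('a, 'b) module) \<Rightarrow> (nat \<Rightarrow> 'b \<Rightarrow> 'b) \<Rightarrow> (nat \<Rightarrow> 'b \<Rightarrow> 'b) \<Rightarrow> bool" where
  "contracting_homotopy R D h \<longleftrightarrow>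
    (\<forall>k. h k \<in> hom (add_monoid (R k)) (add_monoid (R (Suc k)))) \<and>
    (\<forall>k > 0. \<forall>x \<in> carrier (R k). D (Suc k) (h k x) \<oplus>\<^bsub>R k\<^esub> h (k - 1) (D k x) = x) \<and>
    (\<exists>s \<in> hom (add_monoid (homology R D 0)) (add_monoid (R 0)).
       (\<forall>X \<in> carrier (homology R D 0). homology_class R D 0 (s X) = X) \<and>
       (\<forall>x \<in> carrier (R 0). D 1 (h 0 x) = x \<ominus>\<^bsub>R 0\<^esub> s (homology_class R D 0 x)))"


section \<open>Algorithms: partial recursive functions\<close>

datatype recf =
    Zero
  | Succ
  | Proj nat
  | Comp recf "recf list"
  | PrimRec recf recf
  | Mu recf

text \<open>\<open>rec_eval p xs y\<close>: on input \<open>xs\<close> the program \<open>p\<close> halts with output \<open>y\<close>.\<close>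

inductive rec_eval :: "recf \<Rightarrow> nat list \<Rightarrow> nat \<Rightarrow> bool" where
  Zero: "rec_eval Zero xs 0"
| Succ: "rec_eval Succ [x] (Suc x)"
| Proj: "i < length xs \<Longrightarrow> rec_eval (Proj i) xs (xs ! i)"
| Comp: "\<lbrakk>list_all2 (\<lambda>p y. rec_eval p xs y) ps ys; rec_eval q ys z\<rbrakk>
    \<Longrightarrow> rec_eval (Comp q ps) xs z"
| PrimRec_0: "rec_eval p xs y \<Longrightarrow> rec_eval (PrimRec p q) (0 # xs) y"
| PrimRec_Suc: "\<lbrakk>rec_eval (PrimRec p q) (m # xs) y; rec_eval q (m # y # xs) z\<rbrakk>
    \<Longrightarrow> rec_eval (PrimRec p q) (Suc m # xs) z"
| Mu: "\<lbrakk>rec_eval p (m # xs) 0; \<forall>j < m. \<exists>y. rec_eval p (j # xs) y \<and> y > 0\<rbrakk>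
    \<Longrightarrow> rec_eval (Mu p) xs m"

lemma rec_eval_deterministic:
  "rec_eval p xs y \<Longrightarrow> rec_eval p xs z \<Longrightarrow> y = z"
proof (induction arbitrary: z rule: rec_eval.induct)
  case (Comp xs ps ys q z z')
  from Comp.prems obtain ws where ws: "list_all2 (\<lambda>p y. rec_eval p xs y) ps ws" "rec_eval q ws z'"
    by (cases rule: rec_eval.cases) auto
  have "ys = ws"
    using Comp.IH(1) ws(1) by (auto simp: list_all2_conv_all_nth intro!: nth_equalityI)
  then show ?case using Comp.IH(2) ws(2) by simp
next
  case (PrimRec_0 p xs y q)
  from PrimRec_0.prems show ?case by (cases rule: rec_eval.cases) (auto dest: PrimRec_0.IH)
next
  case (PrimRec_Suc p q m xs y w)
  from PrimRec_Suc.prems show ?case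
    by (cases rule: rec_eval.cases) (use PrimRec_Suc.IH in blast)
next
  case (Mu p m xs)
  from Mu.prems obtain *: "rec_eval p (z # xs) 0" "\<forall>j<z. \<exists>y. rec_eval p (j # xs) y \<and> y > 0"
    by (cases rule: rec_eval.cases) auto
  show ?case
    using Mu.IH *  by (metis linorder_neqE_nat less_irrefl)
qed (auto elim: rec_eval.cases)


section \<open>Finite data for elements of free modules\<close>

text \<open>
  A matrix over $\mathcal O_d$ is stored as the list, in row-major order, of the integer
  coordinates \<open>(a, b)\<close> of its entries \<open>a + b * omega d\<close>. An element of a free module with ordered
  basis \<open>b\<^sub>0, ..., b\<^sub>r\<^sub>-\<^sub>1\<close> is stored as a list of triples \<open>(c, A, i)\<close> standing for the sum of the
  terms \<open>c A b\<^sub>i\<close>. Fixing this representation, rather than allowing an arbitrary enumeration of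
  each module, is essential: the contracting homotopy splits the resolution as a complex of free
  abelian groups, so its maps become computable in a suitable enumeration for trivial reasons.
\<close>

type_synonym mat_data = "(int \<times> int) list"
type_synonym elt_data = "(int \<times> mat_data \<times> nat) list"

definition mat_of_data :: "nat \<Rightarrow> int \<Rightarrow> mat_data \<Rightarrow> complex mat" where
  "mat_of_data n d l =
    mat n n (\<lambda>(i, j). of_int (fst (l ! (i * n + j))) + of_int (snd (l ! (i * n + j))) * omega d)"

definition monomial :: "int \<Rightarrow> 'g \<Rightarrow> 'g \<Rightarrow> int" where
  "monomial c g = (\<lambda>x. if x = g then c else 0)"

definition represents ::
  "nat \<Rightarrow> int \<Rightarrow> (complex mat \<Rightarrow> int, 'b) module \<Rightarrow> nat \<Rightarrow> (nat \<Rightarrow> 'b) \<Rightarrow> elt_data \<Rightarrow> 'b \<Rightarrow> bool" where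
  "represents n d M r b l w \<longleftrightarrow>
    (\<forall>(c, A, i) \<in> set l. length A = n * n \<and> mat_of_data n d A \<in> carrier (SL n d) \<and> i < r) \<and>
    w = foldr (\<lambda>(c, A, i) v. monomial c (mat_of_data n d A) \<odot>\<^bsub>M\<^esub> b i \<oplus>\<^bsub>M\<^esub> v) l \<zero>\<^bsub>M\<^esub>"

definition mat_code :: "mat_data \<Rightarrow> nat" where
  "mat_code l = list_encode (map (\<lambda>(a, b). prod_encode (int_encode a, int_encode b)) l)"

definition elt_code :: "elt_data \<Rightarrow> nat" where
  "elt_code l =
    list_encode (map (\<lambda>(c, A, i). prod_encode (int_encode c, prod_encode (mat_code A, i))) l)"

text \<open>
  The programs take \<open>k\<close> as an input, so they are uniform in the degree. They work on every
  representation of an element and need not halt on inputs that represent nothing.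
\<close>

definition implementable ::
  "nat \<Rightarrow> int \<Rightarrow> (nat \<Rightarrow> (complex mat \<Rightarrow> int, 'b) module) \<Rightarrow> (nat \<Rightarrow> nat) \<Rightarrow> (nat \<Rightarrow> nat \<Rightarrow> 'b) \<Rightarrow>
    (nat \<Rightarrow> 'b \<Rightarrow> 'b) \<Rightarrow> (nat \<Rightarrow> 'b \<Rightarrow> 'b) \<Rightarrow> bool" where
  "implementable n d R r b D h \<longleftrightarrow>
    (\<exists>p. \<forall>k. rec_eval p [k] (r k)) \<and>
    (\<forall>k. \<forall>w \<in> carrier (R k). \<exists>l. represents n d (R k) (r k) (b k) l w) \<and>
    (\<exists>p. \<forall>k > 0. \<forall>w \<in> carrier (R k). \<forall>l. represents n d (R k) (r k) (b k) l w \<longrightarrow>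
       (\<exists>l'. rec_eval p [k, elt_code l] (elt_code l') \<and>
             represents n d (R (k - 1)) (r (k - 1)) (b (k - 1)) l' (D k w))) \<and>
    (\<exists>p. \<forall>k. \<forall>w \<in> carrier (R k). \<forall>l. represents n d (R k) (r k) (b k) l w \<longrightarrow>
       (\<exists>l'. rec_eval p [k, elt_code l] (elt_code l') \<and>
             represents n d (R (Suc k)) (r (Suc k)) (b (Suc k)) l' (h k w)))"

end

theory Submission
  imports Defs "HOL-Analysis.Function_Topology" "HOL-Library.Countable_Set"
    "HOL-Library.Poly_Mapping"
begin

text \<open>
  The convex cone dual to the positive semidefinite Hermitian forms on the lattice \<open>\<O>\<^sub>d\<^sup>n\<close> is covered by
  the sets of functionals that attain their minimum over Ryshkov's polyhedron at a given extreme
  point (a perfect form). The group acts on this cover with finitely many orbits (Voronoi), and each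
  set meets only finitely many others. A Mayer--Vietoris induction over separating hyperplanes
  shows that the nerve is acyclic.

  The stabilisers are finite but not trivial. To obtain a free action, let \<open>f\<^sub>1, ..., f\<^sub>m\<close> represent the
  orbits, index the cover redundantly by pairs \<open>(g, c)\<close>, standing for the form \<open>g f\<^sub>c\<close>, and use ordered
  simplices, that is, arbitrary lists of pairs. The ordered simplices whose first vertex is \<open>(1, c)\<close>
  for some \<open>c\<close> form a finite basis in each degree.

  The boundary is computable because a face is found from a finite table of the neighbours of the
  vertices \<open>(1, c)\<close>. The homotopy is computed by recursion on the degree: on a basis element \<open>x\<close> of the
  underlying abelian group, it is the first chain found in an unbounded search whose boundary is
  \<open>x - h (d x)\<close>. Such a chain exists by acyclicity, and equality of chains is decidable.
\<close>

section \<open>Ordered simplicial complexes and nerves\<close>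

text \<open>The induction over hyperplanes needs a finite nerve, whereas this nerve is infinite. But
  a cycle involves finitely many functionals, and these lie in a convex set on which the values at
  the unit vectors are controlled by one constant and the value at one fixed form is bounded;
  minimisers of such functionals are confined to a finite set. The finiteness statements (orbits,
  neighbours, bounded extreme forms) rest on a pigeonhole approximation whose constants are uniform
  in the form; it takes the place of reduction theory and volumes. Forms are functions on the
  lattice obeying the parallelogram law, so that minimisers come from Tychonoff and no coordinates
  on the space of forms occur. Naming a form by many pairs does not disturb acyclicity, which holds
  for any indexed family of convex sets; the finite stabilisers enter only through the finiteness of
  the set of names of a form. Repeated vertices make every full simplex a cone. The programs are for
  fixed \<open>d\<close> and \<open>n\<close>: the tables of neighbours and of their shifts, the
  list of permutations and the equation of \<open>\<omega>\<close> are constants inside them, so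
  that only finiteness has to be proved.\<close>

text \<open>The alternating sum of faces, in the form d(x s) = s - x d(s). The empty list counts as
  a simplex and is the boundary of every vertex, so this is the augmented complex and acyclicity
  will also determine homology in degree 0.\<close>

primrec simplex_boundary :: "'a list \<Rightarrow> 'a list \<Rightarrow>\<^sub>0 int" where
  "simplex_boundary [] = 0"
| "simplex_boundary (x # xs) =
     frag_of xs - frag_extend (\<lambda>s. frag_of (x # s)) (simplex_boundary xs)"

definition boundary :: "('a list \<Rightarrow>\<^sub>0 int) \<Rightarrow> ('a list \<Rightarrow>\<^sub>0 int)" where
  "boundary = frag_extend simplex_boundary"

definition cone :: "'a \<Rightarrow> ('a list \<Rightarrow>\<^sub>0 int) \<Rightarrow> ('a list \<Rightarrow>\<^sub>0 int)" where
  "cone v = frag_extend (\<lambda>s. frag_of (v # s))"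

lemma boundary_simps [simp]:
  "boundary 0 = 0" "boundary (frag_of s) = simplex_boundary s"
  "boundary (a - b) = boundary a - boundary b"
  "boundary (a + b) = boundary a + boundary b"
  "boundary (- a) = - boundary a"
  "boundary (frag_cmul c a) = frag_cmul c (boundary a)"
  by (simp_all add: boundary_def frag_extend_diff frag_extend_add frag_extend_minus frag_extend_cmul)

lemma cone_simps [simp]:
  "cone v 0 = 0" "cone v (frag_of s) = frag_of (v # s)"
  "cone v (a - b) = cone v a - cone v b"
  by (simp_all add: cone_def frag_extend_diff)

lemma simplex_boundary_Cons: "simplex_boundary (x # xs) = frag_of xs - cone x (simplex_boundary xs)"
  by (simp add: cone_def)

text \<open>The recursion of \<open>simplex_boundary\<close>, extended linearly: coning is a
  contracting homotopy wherever it stays inside the complex.\<close>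

lemma boundary_cone: "boundary (cone v z) = z - cone v (boundary z)"
proof -
  have "Poly_Mapping.keys z \<subseteq> UNIV" by simp
  then show ?thesis
    by (induction z rule: frag_induction) (simp_all add: cone_def simplex_boundary_Cons frag_extend_diff)
qed

lemma boundary_simplex_boundary: "boundary (simplex_boundary xs) = 0"
  by (induction xs) (simp_all add: simplex_boundary_Cons boundary_cone del: simplex_boundary.simps(2))

lemma boundary_boundary: "boundary (boundary z) = 0"
proof -
  have "Poly_Mapping.keys z \<subseteq> UNIV" by simp
  then show ?thesis
    by (induction z rule: frag_induction) (simp_all add: boundary_simplex_boundary)
qed

lemma keys_cone: "Poly_Mapping.keys (cone v z) \<subseteq> (#) v ` Poly_Mapping.keys z"
  unfolding cone_def using keys_frag_extend[of "\<lambda>s. frag_of (v # s)" z] by auto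

lemma keys_simplex_boundary:
  "t \<in> Poly_Mapping.keys (simplex_boundary xs) \<Longrightarrow> set t \<subseteq> set xs \<and> Suc (length t) = length xs"
proof (induction xs arbitrary: t)
  case (Cons x xs)
  then have "t = xs \<or> t \<in> Poly_Mapping.keys (cone x (simplex_boundary xs))"
    using keys_diff[of "frag_of xs"] by (auto simp: simplex_boundary_Cons simp del: simplex_boundary.simps)
  then show ?case using keys_cone[of x "simplex_boundary xs"] Cons.IH by fastforce
qed simp

section \<open>Complexes closed under faces, and acyclicity\<close>

text \<open>Membership depends on the set of vertices alone: permuted lists and lists with
  repetitions belong as well, not only sublists.\<close>

definition face_closed :: "'a list set \<Rightarrow> bool" where
  "face_closed S \<longleftrightarrow> (\<forall>s \<in> S. \<forall>t. set t \<subseteq> set s \<longrightarrow> t \<in> S)"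

lemma keys_boundary:
  assumes "face_closed S" "Poly_Mapping.keys z \<subseteq> S"
  shows "Poly_Mapping.keys (boundary z) \<subseteq> S"
  using keys_frag_extend[of simplex_boundary z] assms keys_simplex_boundary
  unfolding boundary_def face_closed_def by blast

text \<open>Chains of all degrees are mixed here, including multiples of the empty list; the grading
  is recovered in \<open>acyclic_complex_homogeneous\<close>.\<close>

definition acyclic_complex :: "'a list set \<Rightarrow> bool" where
  "acyclic_complex S \<longleftrightarrow>
    (\<forall>z. Poly_Mapping.keys z \<subseteq> S \<longrightarrow> boundary z = 0 \<longrightarrow>
      (\<exists>w. Poly_Mapping.keys w \<subseteq> S \<and> boundary w = z))"

lemma acyclic_complexD:
  assumes "acyclic_complex S" "Poly_Mapping.keys z \<subseteq> S" "boundary z = 0"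
  obtains w where "Poly_Mapping.keys w \<subseteq> S" "boundary w = z"
  using assms unfolding acyclic_complex_def by blast

text \<open>Mayer--Vietoris\<close>

lemma acyclic_complex_Un:
  assumes A: "acyclic_complex A" "face_closed A" and B: "acyclic_complex B" "face_closed B"
    and AB: "acyclic_complex (A \<inter> B)"
  shows "acyclic_complex (A \<union> B)"
  unfolding acyclic_complex_def
proof (intro allI impI)
  fix z :: "'a list \<Rightarrow>\<^sub>0 int"
  assume z: "Poly_Mapping.keys z \<subseteq> A \<union> B" "boundary z = 0"
  obtain a b where ab: "Poly_Mapping.keys a \<subseteq> A" "Poly_Mapping.keys b \<subseteq> B" "a + b = z"
    using frag_split[OF z(1)] by blast
  have eq: "boundary a = - boundary b" using z(2) ab(3) by (metis boundary_simps(4) eq_neg_iff_add_eq_0)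
  have "Poly_Mapping.keys (boundary a) \<subseteq> A \<inter> B"
    using keys_boundary[OF A(2) ab(1)] keys_boundary[OF B(2) ab(2)] by (simp add: eq)
  then obtain w where w: "Poly_Mapping.keys w \<subseteq> A \<inter> B" "boundary w = boundary a"
    using acyclic_complexD[OF AB] boundary_boundary by blast
  have "Poly_Mapping.keys (a - w) \<subseteq> A" "Poly_Mapping.keys (b + w) \<subseteq> B"
    using keys_diff[of a w] Poly_Mapping.keys_add[of b w] ab w by blast+
  moreover have "boundary (a - w) = 0" "boundary (b + w) = 0" using w eq by simp_all
  ultimately obtain u v where "Poly_Mapping.keys u \<subseteq> A" "boundary u = a - w"
    "Poly_Mapping.keys v \<subseteq> B" "boundary v = b + w"
    using acyclic_complexD A(1) B(1) by metis
  then show "\<exists>w. Poly_Mapping.keys w \<subseteq> A \<union> B \<and> boundary w = z"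
    using ab(3) Poly_Mapping.keys_add[of u v] by (intro exI[of _ "u + v"]) auto
qed

text \<open>A full simplex is a cone over each of its vertices; prepending \<open>v\<close> never
  leaves the set of lists because repetitions are allowed.\<close>

lemma acyclic_complex_lists:
  assumes "v \<in> V"
  shows "acyclic_complex (lists V)"
  unfolding acyclic_complex_def
proof (intro allI impI)
  fix z :: "'a list \<Rightarrow>\<^sub>0 int"
  assume "Poly_Mapping.keys z \<subseteq> lists V" "boundary z = 0"
  then show "\<exists>w. Poly_Mapping.keys w \<subseteq> lists V \<and> boundary w = z"
    by (intro exI[of _ "cone v z"] conjI subset_trans[OF keys_cone]) (use assms in \<open>auto simp: boundary_cone lists_eq_set subset_iff\<close>)
qed

text \<open>A point of \<open>X\<close> is a family of reals, and the simplices are spanned by indices at which a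
  common point attains its minimum: the nerve of the cover of \<open>X\<close> by the sets
  \<open>{x \<in> X. x i is minimal}\<close>.\<close>

definition min_nerve :: "'i set \<Rightarrow> ('i \<Rightarrow> real) set \<Rightarrow> 'i list set" where
  "min_nerve I X = {s. \<exists>x \<in> X. \<forall>i \<in> set s. i \<in> I \<and> (\<forall>j \<in> I. x i \<le> x j)}"

section \<open>Nerves of covers by convex sets\<close>

definition family_convex :: "('i \<Rightarrow> real) set \<Rightarrow> bool" where
  "family_convex X \<longleftrightarrow>
    (\<forall>x \<in> X. \<forall>y \<in> X. \<forall>t \<in> {0..1}. (\<lambda>i. (1 - t) * x i + t * y i) \<in> X)"

lemma face_closed_min_nerve: "face_closed (min_nerve I X)"
  unfolding face_closed_def min_nerve_def by blast

lemma min_nerve_mono: "X \<subseteq> Y \<Longrightarrow> min_nerve I X \<subseteq> min_nerve I Y"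
  unfolding min_nerve_def by blast

definition lin_form :: "('i \<Rightarrow> real) \<Rightarrow> 'i set \<Rightarrow> ('i \<Rightarrow> real) \<Rightarrow> real" where
  "lin_form c F x = (\<Sum>i\<in>F. c i * x i)"

lemma lin_form_comb:
  "lin_form c F (\<lambda>i. (1 - t) * x i + t * y i) = (1 - t) * lin_form c F x + t * lin_form c F y"
  by (simp add: lin_form_def flip: sum.distrib sum_distrib_left) (simp add: algebra_simps sum.distrib sum_subtractf sum_distrib_left)

lemma segment_zero:
  fixes a b :: real
  assumes "a \<le> 0" "0 \<le> b"
  obtains t where "t \<in> {0..1}" "(1 - t) * a + t * b = 0"
proof (cases "a = b")
  case True then show ?thesis using assms that[of 0] by auto
next
  case False
  then have "b - a > 0" using assms by auto
  then show ?thesis using assms that[of "- a / (b - a)"]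
    by (auto simp: field_simps)
qed

text \<open>The points at which a given set of indices is minimal form a convex set, so if it meets
  both closed half-spaces it meets the hyperplane. This is what makes the intersection of the two
  nerves a nerve again.\<close>

lemma min_nerve_halfspaces:
  assumes X: "family_convex X"
  shows "min_nerve I X = min_nerve I {x\<in>X. lin_form c F x \<ge> 0} \<union> min_nerve I {x\<in>X. lin_form c F x \<le> 0}"
    and "min_nerve I {x\<in>X. lin_form c F x = 0} =
      min_nerve I {x\<in>X. lin_form c F x \<ge> 0} \<inter> min_nerve I {x\<in>X. lin_form c F x \<le> 0}"
proof -
  show "min_nerve I X = min_nerve I {x\<in>X. lin_form c F x \<ge> 0} \<union> min_nerve I {x\<in>X. lin_form c F x \<le> 0}"
    unfolding min_nerve_def using linorder_linear by blast
  have "s \<in> min_nerve I {x\<in>X. lin_form c F x = 0}"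
    if "s \<in> min_nerve I {x\<in>X. lin_form c F x \<ge> 0}" "s \<in> min_nerve I {x\<in>X. lin_form c F x \<le> 0}" for s
  proof -
    obtain x y where x: "x \<in> X" "lin_form c F x \<le> 0" "\<forall>i \<in> set s. i \<in> I \<and> (\<forall>j \<in> I. x i \<le> x j)"
      and y: "y \<in> X" "lin_form c F y \<ge> 0" "\<forall>i \<in> set s. i \<in> I \<and> (\<forall>j \<in> I. y i \<le> y j)"
      using \<open>s \<in> min_nerve I {x\<in>X. lin_form c F x \<ge> 0}\<close> \<open>s \<in> min_nerve I {x\<in>X. lin_form c F x \<le> 0}\<close>
      unfolding min_nerve_def by auto
    obtain t where t: "t \<in> {0..1}" "(1 - t) * lin_form c F x + t * lin_form c F y = 0"
      using segment_zero x y by blast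
    let ?z = "\<lambda>i. (1 - t) * x i + t * y i"
    have "?z \<in> X" using X x y t unfolding family_convex_def by blast
    moreover have "lin_form c F ?z = 0" using t by (simp add: lin_form_comb)
    moreover have "\<forall>i \<in> set s. i \<in> I \<and> (\<forall>j \<in> I. ?z i \<le> ?z j)"
      using x(3) y(3) t(1) by (auto intro!: add_mono mult_left_mono)
    ultimately show ?thesis unfolding min_nerve_def mem_Collect_eq
      by (intro bexI[of _ ?z]) simp_all
  qed
  moreover have "min_nerve I {x\<in>X. lin_form c F x = 0} \<subseteq> min_nerve I {x\<in>X. lin_form c F x \<ge> 0}"
    "min_nerve I {x\<in>X. lin_form c F x = 0} \<subseteq> min_nerve I {x\<in>X. lin_form c F x \<le> 0}"
    by (auto intro!: min_nerve_mono)
  ultimately show "min_nerve I {x\<in>X. lin_form c F x = 0} =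
      min_nerve I {x\<in>X. lin_form c F x \<ge> 0} \<inter> min_nerve I {x\<in>X. lin_form c F x \<le> 0}"
    by blast
qed

lemma family_convex_halfspaces:
  assumes X: "family_convex X"
  shows "family_convex {x\<in>X. lin_form c F x \<ge> 0}" "family_convex {x\<in>X. lin_form c F x \<le> 0}"
    "family_convex {x\<in>X. lin_form c F x = 0}"
  using X unfolding family_convex_def
  by (auto simp: lin_form_comb add_nonpos_nonpos mult_nonneg_nonpos)

text \<open>If the nerve is not a full simplex, a minimal non-face \<open>insert k T\<close> provides a separating
  hyperplane: at a point where all of \<open>T\<close> is minimal, \<open>x k\<close> exceeds the average of \<open>x\<close> over
  \<open>T\<close>, and where \<open>k\<close> is minimal it is smaller. Each half, and their intersection, has a smaller
  nerve.\<close>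

theorem acyclic_min_nerve:
  assumes "family_convex X" "X \<noteq> {}" "\<And>x. x \<in> X \<Longrightarrow> \<exists>i \<in> I. \<forall>j \<in> I. x i \<le> x j"
    and "finite (set ` min_nerve I X)"
  shows "acyclic_complex (min_nerve I X)"
  using assms
proof (induction "card (set ` min_nerve I X)" arbitrary: X rule: less_induct)
  case less
  note X = less.prems(1) and ne = less.prems(2) and att = less.prems(3) and fin = less.prems(4)
  \<comment> \<open>The induction runs over the abstract complex of vertex sets, which is finite
    although the set of lists is not.\<close>
  have in_nerve: "s \<in> min_nerve I X \<longleftrightarrow> set s \<in> set ` min_nerve I X" for s
    unfolding min_nerve_def by auto
  have sub: "A \<subseteq> B \<Longrightarrow> B \<in> set ` min_nerve I X \<Longrightarrow> A \<in> set ` min_nerve I X" for A B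
  proof -
    assume "A \<subseteq> B" "B \<in> set ` min_nerve I X"
    then obtain s where s: "B = set s" "s \<in> min_nerve I X" by auto
    obtain t where "set t = A" using \<open>A \<subseteq> B\<close> s finite_list finite_subset by (metis List.finite_set)
    then show ?thesis
      using s \<open>A \<subseteq> B\<close> face_closed_min_nerve[of I X] unfolding face_closed_def by (metis image_eqI)
  qed
  define V where "V = {i. {i} \<in> set ` min_nerve I X}"
  have "finite (\<Union> (set ` min_nerve I X))" using fin by (rule finite_Union) auto
  moreover have "V \<subseteq> \<Union> (set ` min_nerve I X)" unfolding V_def by blast
  ultimately have finV: "finite V" by (rule finite_subset[rotated])
  have VN: "A \<subseteq> V" if "A \<in> set ` min_nerve I X" for A
    using sub[OF _ that] by (auto simp: V_def)
  show ?case
  proof (cases "V \<in> set ` min_nerve I X")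
    case True
    obtain x i where "x \<in> X" "i \<in> I" "\<forall>j \<in> I. x i \<le> x j" using ne att by blast
    then have "[i] \<in> min_nerve I X" unfolding min_nerve_def by auto
    then have "i \<in> V" using in_nerve[of "[i]"] by (simp add: V_def)
    moreover have "s \<in> min_nerve I X \<longleftrightarrow> set s \<subseteq> V" for s
      using in_nerve[of s] VN[of "set s"] sub[OF _ True, of "set s"] by blast
    then have "min_nerve I X = lists V" by (auto simp: lists_eq_set)
    ultimately show ?thesis using acyclic_complex_lists by metis
  next
    case False
    let ?P = "\<lambda>A. A \<subseteq> V \<and> A \<notin> set ` min_nerve I X"
    obtain S where S: "?P S" and least: "\<And>A. ?P A \<Longrightarrow> card S \<le> card A"
      using ex_has_least_nat[of ?P V card] False by auto
    have finS: "finite S" using S finV finite_subset by auto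
    have "[] \<in> min_nerve I X" using ne unfolding min_nerve_def by auto
    then have "S \<noteq> {}" using S by (metis image_eqI list.set(1))
    then obtain k where k: "k \<in> S" by auto
    define T where "T = S - {k}"
    have TN: "T \<in> set ` min_nerve I X"
    proof (rule ccontr)
      assume "T \<notin> set ` min_nerve I X"
      moreover have "T \<subseteq> V" using S T_def by blast
      ultimately have "card S \<le> card T" using least by blast
      then show False using k finS by (metis T_def card_Diff1_less not_less)
    qed
    have ST: "S = insert k T" "k \<notin> T" "finite T" using k finS T_def by auto
    have kN: "{k} \<in> set ` min_nerve I X" using S k V_def by auto
    then have Tne: "T \<noteq> {}" using S ST by auto
    define c where "c = (\<lambda>i. if i = k then real (card T) else -1)"
    have lf: "lin_form c S x = (\<Sum>i\<in>T. x k - x i)" for x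
    proof -
      have "lin_form c S x = real (card T) * x k + (\<Sum>i\<in>T. c i * x i)"
        using ST by (simp add: lin_form_def c_def)
      also have "(\<Sum>i\<in>T. c i * x i) = (\<Sum>i\<in>T. - x i)"
        using ST by (intro sum.cong) (auto simp: c_def)
      finally show ?thesis by (simp add: sum_subtractf sum_negf)
    qed
    have no_common: False
      if "x \<in> X" "\<forall>i \<in> S. i \<in> I \<and> (\<forall>j \<in> I. x i \<le> x j)" for x
    proof -
      obtain s where "set s = S" using finS finite_list by blast
      then have "s \<in> min_nerve I X" using that unfolding min_nerve_def by auto
      then show False using S \<open>set s = S\<close> by (metis image_eqI)
    qed
    have SI: "S \<subseteq> I"
      using S unfolding V_def min_nerve_def by auto
    have kneg: "lin_form c S x < 0" if x: "x \<in> X" "\<forall>j \<in> I. x k \<le> x j" for x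
    proof -
      have "\<exists>i \<in> T. x i \<noteq> x k"
        using no_common[OF x(1)] x(2) ST(1) SI by fastforce
      then have "\<exists>i \<in> T. x k - x i < 0" using x(2) SI ST by (force simp: order.strict_iff_order)
      moreover have "\<forall>i \<in> T. x k - x i \<le> 0" using x(2) SI ST by auto
      ultimately have "(\<Sum>i\<in>T. x k - x i) < (\<Sum>i\<in>T. 0)"
        using ST(3) by (intro sum_strict_mono_ex1) auto
      then show ?thesis by (simp add: lf)
    qed
    have Tpos: "lin_form c S x > 0" if x: "x \<in> X" "\<forall>i \<in> T. \<forall>j \<in> I. x i \<le> x j" for x
    proof -
      have "x k > x i" if "i \<in> T" for i
      proof (rule ccontr)
        assume "\<not> x k > x i"
        then have "\<forall>j\<in>I. x k \<le> x j" using x(2) that by force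
        then show False using no_common[OF x(1)] x(2) SI ST(1) by auto
      qed
      then have "(\<Sum>i\<in>T. x k - x i) > 0" using ST(3) Tne by (intro sum_pos) auto
      then show ?thesis by (simp add: lf)
    qed
    let ?P = "{x\<in>X. lin_form c S x \<ge> 0}" and ?M = "{x\<in>X. lin_form c S x \<le> 0}"
      and ?Z = "{x\<in>X. lin_form c S x = 0}"
    obtain y where y: "y \<in> X" "\<forall>j \<in> I. y k \<le> y j" using kN unfolding min_nerve_def by auto
    obtain z where z: "z \<in> X" "\<forall>i \<in> T. \<forall>j \<in> I. z i \<le> z j" using TN unfolding min_nerve_def by auto
    have nes: "?P \<noteq> {}" "?M \<noteq> {}" "?Z \<noteq> {}"
    proof -
      have "y \<in> ?M" "z \<in> ?P" using y z kneg Tpos by (auto intro: less_imp_le)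
      then show "?P \<noteq> {}" "?M \<noteq> {}" by blast+
      obtain t where t: "t \<in> {0..1}" "(1 - t) * lin_form c S y + t * lin_form c S z = 0"
        using segment_zero kneg[OF y] Tpos[OF z] by (metis less_imp_le)
      then have "(\<lambda>i. (1 - t) * y i + t * z i) \<in> ?Z"
        using X y z unfolding family_convex_def by (simp add: lin_form_comb)
      then show "?Z \<noteq> {}" by blast
    qed
    \<comment> \<open>The strict decrease: the positive half loses the vertex \<open>k\<close>, the
      negative half loses the face \<open>T\<close>, and the hyperplane lies in the positive
      half.\<close>
    have kP: "{k} \<notin> set ` min_nerve I ?P"
    proof
      assume "{k} \<in> set ` min_nerve I ?P"
      then obtain x where "x \<in> ?P" "\<forall>j \<in> I. x k \<le> x j" unfolding min_nerve_def by auto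
      then show False using kneg[of x] by simp
    qed
    have TM: "T \<notin> set ` min_nerve I ?M"
    proof
      assume "T \<in> set ` min_nerve I ?M"
      then obtain x where "x \<in> ?M" "\<forall>i \<in> T. \<forall>j \<in> I. x i \<le> x j" unfolding min_nerve_def by auto
      then show False using Tpos[of x] by simp
    qed
    have "set ` min_nerve I ?P \<subseteq> set ` min_nerve I X" "set ` min_nerve I ?M \<subseteq> set ` min_nerve I X"
      and ZP: "set ` min_nerve I ?Z \<subseteq> set ` min_nerve I ?P"
      by (intro image_mono min_nerve_mono; auto)+
    then have lt: "set ` min_nerve I ?P \<subset> set ` min_nerve I X"
      "set ` min_nerve I ?M \<subset> set ` min_nerve I X"
      using kN TN kP TM by (metis psubsetI)+
    note lt = this order.strict_trans1[OF ZP lt(1)]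
    have ac: "acyclic_complex (min_nerve I Y)"
      if Y: "family_convex Y" "Y \<noteq> {}" "Y \<subseteq> X" "set ` min_nerve I Y \<subset> set ` min_nerve I X" for Y
    proof (rule less.hyps[OF psubset_card_mono[OF fin Y(4)] Y(1,2)])
      show "\<exists>i\<in>I. \<forall>j\<in>I. x i \<le> x j" if "x \<in> Y" for x using att Y(3) that by blast
      show "finite (set ` min_nerve I Y)" by (rule finite_subset[OF psubset_imp_subset[OF Y(4)] fin])
    qed
    have "acyclic_complex (min_nerve I ?P)" "acyclic_complex (min_nerve I ?M)"
      by (intro ac family_convex_halfspaces[OF X] nes lt; blast)+
    moreover have "acyclic_complex (min_nerve I ?P \<inter> min_nerve I ?M)"
      unfolding min_nerve_halfspaces(2)[OF X, symmetric]
      by (intro ac family_convex_halfspaces[OF X] nes lt; blast)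
    ultimately have "acyclic_complex (min_nerve I ?P \<union> min_nerve I ?M)"
      by (intro acyclic_complex_Un face_closed_min_nerve)
    then show ?thesis unfolding min_nerve_halfspaces(1)[OF X, symmetric] .
  qed
qed

text \<open>A cycle has finitely many simplices. Points witnessing them lie in a convex
  \<open>T\<close> with finite nerve, where the cycle already bounds.\<close>

corollary acyclic_min_nerve_locally_finite:
  assumes ne: "X \<noteq> {}" and att: "\<And>x. x \<in> X \<Longrightarrow> \<exists>i \<in> I. \<forall>j \<in> I. x i \<le> x j"
    and fin: "\<And>Y. finite Y \<Longrightarrow> Y \<subseteq> X \<Longrightarrow>
      \<exists>T. Y \<subseteq> T \<and> T \<subseteq> X \<and> family_convex T \<and> finite (set ` min_nerve I T)"
  shows "acyclic_complex (min_nerve I X)"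
  unfolding acyclic_complex_def
proof (intro allI impI)
  fix z :: "'a list \<Rightarrow>\<^sub>0 int"
  assume z: "Poly_Mapping.keys z \<subseteq> min_nerve I X" "boundary z = 0"
  have "\<forall>s \<in> Poly_Mapping.keys z. \<exists>x \<in> X. \<forall>i \<in> set s. i \<in> I \<and> (\<forall>j \<in> I. x i \<le> x j)"
    using z(1) unfolding min_nerve_def by blast
  then obtain p where p: "\<And>s. s \<in> Poly_Mapping.keys z \<Longrightarrow>
      p s \<in> X \<and> (\<forall>i \<in> set s. i \<in> I \<and> (\<forall>j \<in> I. p s i \<le> p s j))"
    by metis
  \<comment> \<open>Keeps \<open>T\<close> nonempty when the cycle is zero.\<close>
  obtain x0 where "x0 \<in> X" using ne by auto
  then obtain T where T: "insert x0 (p ` Poly_Mapping.keys z) \<subseteq> T" "T \<subseteq> X" "family_convex T"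
    "finite (set ` min_nerve I T)"
    using fin[of "insert x0 (p ` Poly_Mapping.keys z)"] p by auto
  then have "acyclic_complex (min_nerve I T)" using att by (intro acyclic_min_nerve) auto
  moreover have "Poly_Mapping.keys z \<subseteq> min_nerve I T"
    using p T(1) unfolding min_nerve_def by blast
  ultimately show "\<exists>w. Poly_Mapping.keys w \<subseteq> min_nerve I X \<and> boundary w = z"
    using z(2) min_nerve_mono[OF T(2)] by (meson acyclic_complexD order_trans)
qed

section \<open>Hermitian forms over imaginary quadratic orders\<close>

locale imaginary_quadratic =
  fixes d :: int
  assumes neg: "d < 0"
begin

abbreviation \<O> :: "complex set" where "\<O> \<equiv> ring_of_integers d"
abbreviation \<omega> :: complex where "\<omega> \<equiv> omega d"

lemma csqrt_d: "csqrt (of_int d) = \<i> * of_real (sqrt (real_of_int (- d)))"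
  using csqrt_of_real_nonpos[of "of_int d"] neg by simp

lemma Im_omega_pos: "Im \<omega> > 0"
  using neg by (simp add: omega_def csqrt_d)

text \<open>The minimal equation of \<open>\<omega>\<close>: \<open>t\<close> is its trace and
  \<open>- N\<close> its norm.\<close>

lemma omega_quadratic:
  obtains t N :: int where "\<omega> * \<omega> = of_int t * \<omega> + of_int N" "cnj \<omega> = of_int t - \<omega>"
proof (cases "d mod 4 = 1")
  case True
  define m where "m = d div 4"
  have d: "d = 4 * m + 1" using True m_def by presburger
  have sq: "csqrt (of_int d) * csqrt (of_int d) = of_int d" by (metis power2_csqrt power2_eq_square)
  have w: "\<omega> = (1 + csqrt (of_int d)) / 2" using True by (simp add: omega_def)
  have "\<omega> * \<omega> = of_int 1 * \<omega> + of_int m"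
    using sq unfolding w by (simp add: field_simps) (simp add: d)
  moreover have "cnj \<omega> = of_int 1 - \<omega>"
    unfolding w by (simp add: csqrt_d complex_eq_iff)
  ultimately show ?thesis using that by blast
next
  case False
  have "\<omega> * \<omega> = of_int 0 * \<omega> + of_int d" "cnj \<omega> = of_int 0 - \<omega>"
    using False by (simp_all add: omega_def power2_csqrt flip: power2_eq_square) (simp add: csqrt_d)
  then show ?thesis using that by blast
qed

lemma O_I: "of_int a + of_int b * \<omega> \<in> \<O>"
  unfolding ring_of_integers_def by blast

lemma O_E:
  assumes "x \<in> \<O>" obtains a b :: int where "x = of_int a + of_int b * \<omega>"
  using assms unfolding ring_of_integers_def by blast

lemma O_of_int [simp]: "of_int a \<in> \<O>" using O_I[of a 0] by simp
lemma O_0 [simp]: "0 \<in> \<O>" using O_of_int[of 0] by simp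
lemma O_1 [simp]: "1 \<in> \<O>" using O_of_int[of 1] by simp
lemma O_of_nat [simp]: "of_nat a \<in> \<O>" using O_of_int[of "int a"] by simp

lemma O_add [intro]: assumes "x \<in> \<O>" "y \<in> \<O>" shows "x + y \<in> \<O>"
proof -
  obtain a b a' b' :: int where "x = of_int a + of_int b * \<omega>" "y = of_int a' + of_int b' * \<omega>"
    using assms O_E by metis
  then have "x + y = of_int (a + a') + of_int (b + b') * \<omega>" by (simp add: algebra_simps)
  then show ?thesis using O_I by metis
qed

lemma O_mult [intro]: assumes "x \<in> \<O>" "y \<in> \<O>" shows "x * y \<in> \<O>"
proof -
  obtain a b a' b' :: int where xy: "x = of_int a + of_int b * \<omega>" "y = of_int a' + of_int b' * \<omega>"
    using assms O_E by metis
  obtain t N :: int where tN: "\<omega> * \<omega> = of_int t * \<omega> + of_int N" using omega_quadratic by metis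
  have "x * y = of_int a * of_int a' + (of_int a * of_int b' + of_int b * of_int a') * \<omega>
      + of_int b * of_int b' * (\<omega> * \<omega>)"
    unfolding xy by (simp add: algebra_simps)
  also have "\<dots> = of_int (a * a' + b * b' * N) + of_int (a * b' + b * a' + b * b' * t) * \<omega>"
    unfolding tN by (simp add: algebra_simps)
  finally show ?thesis using O_I by metis
qed

lemma O_minus [intro]: "x \<in> \<O> \<Longrightarrow> - x \<in> \<O>"
  using O_mult[of "of_int (-1)" x] by (simp del: of_int_minus)  simp

lemma O_diff [intro]: "x \<in> \<O> \<Longrightarrow> y \<in> \<O> \<Longrightarrow> x - y \<in> \<O>"
  using O_add[of x "- y"] O_minus by simp

lemma O_sum: "(\<And>i. i \<in> I \<Longrightarrow> f i \<in> \<O>) \<Longrightarrow> sum f I \<in> \<O>"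
  by (induction I rule: infinite_finite_induct) auto

lemma O_prod: "(\<And>i. i \<in> I \<Longrightarrow> f i \<in> \<O>) \<Longrightarrow> prod f I \<in> \<O>"
  by (induction I rule: infinite_finite_induct) auto

lemma O_power: "x \<in> \<O> \<Longrightarrow> x ^ k \<in> \<O>"
  by (induction k) auto

text \<open>The norm \<open>x * cnj x\<close> of a nonzero element is a positive integer.\<close>

lemma O_norm_ge_1:
  assumes "x \<in> \<O>" "x \<noteq> 0" shows "1 \<le> cmod x"
proof -
  obtain a b :: int where x: "x = of_int a + of_int b * \<omega>" using assms O_E by metis
  obtain t N :: int where tN: "\<omega> * \<omega> = of_int t * \<omega> + of_int N" "cnj \<omega> = of_int t - \<omega>"
    using omega_quadratic by metis
  have "x * cnj x = of_int a * of_int a + of_int a * of_int b * of_int t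
      + of_int b * of_int b * (of_int t * \<omega> - \<omega> * \<omega>)"
    unfolding x by (simp add: tN(2) algebra_simps)
  also have "\<dots> = of_int (a * a + a * b * t - b * b * N)" unfolding tN(1) by simp
  finally have "complex_of_real ((cmod x)\<^sup>2) = of_real (of_int (a * a + a * b * t - b * b * N))"
    by (simp only: complex_norm_square of_real_of_int_eq)
  then have eq: "(cmod x)\<^sup>2 = of_int (a * a + a * b * t - b * b * N)" using of_real_eq_iff by blast
  moreover have "(cmod x)\<^sup>2 > 0" using assms(2) by simp
  ultimately have "1 \<le> (cmod x)\<^sup>2" by (metis int_one_le_iff_zero_less of_int_0_less_iff of_int_1_le_iff)
  then show ?thesis by (simp add: power2_nonneg_ge_1_iff)
qed

lemma finite_O_bounded: "finite {x \<in> \<O>. cmod x \<le> r}"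
proof -
  define m where "m = \<lceil>r / Im \<omega>\<rceil>"
  define k where "k = \<lceil>r + of_int m * cmod \<omega>\<rceil>"
  have "{x \<in> \<O>. cmod x \<le> r} \<subseteq> (\<lambda>(a, b). of_int a + of_int b * \<omega>) ` ({-k..k} \<times> {-m..m})"
  proof
    fix x assume "x \<in> {x \<in> \<O>. cmod x \<le> r}"
    then obtain a b :: int where x: "x = of_int a + of_int b * \<omega>" "cmod x \<le> r" using O_E by blast
    have "\<bar>real_of_int b\<bar> * Im \<omega> = \<bar>Im x\<bar>" using Im_omega_pos by (simp add: x abs_mult)
    also have "\<dots> \<le> r" using x(2) abs_Im_le_cmod order_trans by blast
    finally have "\<bar>real_of_int b\<bar> \<le> r / Im \<omega>" using Im_omega_pos by (simp add: field_simps)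
    then have b: "\<bar>b\<bar> \<le> m" unfolding m_def by linarith
    have "\<bar>real_of_int a\<bar> = cmod (x - of_int b * \<omega>)" by (simp add: x)
    also have "\<dots> \<le> cmod x + \<bar>real_of_int b\<bar> * cmod \<omega>"
      using norm_triangle_ineq4[of x "of_int b * \<omega>"] by (simp add: norm_mult)
    also have "\<dots> \<le> r + of_int m * cmod \<omega>"
      using x(2) b by (intro add_mono mult_right_mono) auto
    finally have "\<bar>a\<bar> \<le> k" unfolding k_def by linarith
    then show "x \<in> (\<lambda>(a, b). of_int a + of_int b * \<omega>) ` ({-k..k} \<times> {-m..m})"
      using b x(1) by (intro image_eqI[of _ _ "(a, b)"]) auto
  qed
  then show ?thesis by (rule finite_subset) simp
qed

lemma countable_O: "countable \<O>"
proof -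
  have "\<O> \<subseteq> (\<lambda>(a, b). of_int a + of_int b * \<omega>) ` (UNIV :: (int \<times> int) set)"
    unfolding ring_of_integers_def by auto
  then show ?thesis by (rule countable_subset) simp
qed

text \<open>Dirichlet's box principle: the multiples of \<open>u\<close> by 0, ..., \<open>K\<close>
  are sorted by the fractional parts of their \<open>2 * n\<close> real coordinates into
  \<open>K\<close> boxes, so two of them share a box. The essential point is that \<open>K\<close>
  is independent of \<open>u\<close>.\<close>

lemma simultaneous_approximation:
  fixes n :: nat and e :: real
  assumes "e > 0"
  obtains K :: nat where "K \<ge> 1" "\<And>u :: nat \<Rightarrow> complex. \<exists>t \<in> {1..K}. \<exists>a. \<forall>i<n.
    a i \<in> \<O> \<and> cmod (of_nat t * u i - a i) \<le> e"
proof -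
  \<comment> \<open>Two points in a common box of side \<open>1 / N\<close> differ by at most
    \<open>(1 + cmod \<omega>) / N\<close>, which this choice brings below \<open>e\<close>.\<close>
  define N where "N = nat \<lceil>(1 + cmod \<omega>) / e\<rceil> + 1"
  have "(1 + cmod \<omega>) / e \<le> real N" unfolding N_def by linarith
  then have "1 + cmod \<omega> \<le> real N * e" using assms by (simp only: pos_divide_le_eq)
  moreover have "N > 0" by (simp add: N_def)
  ultimately have N: "(1 + cmod \<omega>) / real N \<le> e" "N > 0"
    by (simp_all add: pos_divide_le_eq mult.commute)
  define K where "K = (N * N) ^ n"
  have "\<exists>t \<in> {1..K}. \<exists>a. \<forall>i<n. a i \<in> \<O> \<and> cmod (of_nat t * u i - a i) \<le> e"
    for u :: "nat \<Rightarrow> complex"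
  proof -
    define r where "r = (\<lambda>i. Im (u i) / Im \<omega>)"
    define s where "s = (\<lambda>i. Re (u i) - r i * Re \<omega>)"
    have u: "u i = of_real (s i) + of_real (r i) * \<omega>" for i
      using Im_omega_pos by (simp add: complex_eq_iff r_def s_def)
    let ?f = "\<lambda>x::real. nat \<lfloor>real N * frac x\<rfloor>"
    have f_less: "?f x < N" for x
      using N frac_lt_1[of x] frac_ge_0[of x]
      by (simp add: nat_less_iff floor_less_iff)
    have f_close: "\<bar>frac x - frac y\<bar> \<le> 1 / real N" if "?f x = ?f y" for x y
    proof -
      have "\<lfloor>real N * frac x\<rfloor> = \<lfloor>real N * frac y\<rfloor>" using that frac_ge_0 N by (simp add: eq_nat_nat_iff)
      then have "\<bar>real N * frac x - real N * frac y\<bar> \<le> 1" by linarith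
      then have "real N * \<bar>frac x - frac y\<bar> \<le> 1"
        by (metis abs_mult abs_of_nat right_diff_distrib)
      then show ?thesis using N by (simp add: field_simps)
    qed
    define p where "p = (\<lambda>k::nat. restrict (\<lambda>i. (?f (real k * s i), ?f (real k * r i))) {..<n})"
    have sub: "p ` {0..K} \<subseteq> PiE {..<n} (\<lambda>_. {..<N} \<times> {..<N})"
      unfolding p_def using f_less by (intro image_subsetI restrict_PiE_iff[THEN iffD2]) auto
    have "card (p ` {0..K}) \<le> card (PiE {..<n} (\<lambda>_. {..<N} \<times> {..<N}))"
      by (intro card_mono sub finite_PiE) auto
    also have "\<dots> = K" by (simp add: card_PiE K_def)
    finally have "\<not> inj_on p {0..K}" using card_image[of p "{0..K}"] by auto
    then obtain k l where kl: "k < l" "l \<le> K" "p k = p l"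
      unfolding inj_on_def by (metis atLeastAtMost_iff linorder_neqE_nat)
    let ?a = "\<lambda>i. of_int (\<lfloor>real l * s i\<rfloor> - \<lfloor>real k * s i\<rfloor>) + of_int (\<lfloor>real l * r i\<rfloor> - \<lfloor>real k * r i\<rfloor>) * \<omega>"
    have "cmod (of_nat (l - k) * u i - ?a i) \<le> e" if "i < n" for i
    proof -
      have eq: "?f (real k * s i) = ?f (real l * s i)" "?f (real k * r i) = ?f (real l * r i)"
        using fun_cong[OF kl(3), of i] that by (simp_all add: p_def)
      have "of_nat (l - k) * u i - ?a i = of_real (frac (real l * s i) - frac (real k * s i))
          + of_real (frac (real l * r i) - frac (real k * r i)) * \<omega>"
        using kl(1) by (simp add: u frac_def of_nat_diff algebra_simps)
      also have "cmod \<dots> \<le> \<bar>frac (real l * s i) - frac (real k * s i)\<bar> +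
          \<bar>frac (real l * r i) - frac (real k * r i)\<bar> * cmod \<omega>"
        by (metis norm_triangle_ineq norm_mult norm_of_real real_norm_def)
      also have "\<dots> \<le> 1 / real N + 1 / real N * cmod \<omega>"
        using f_close[OF eq(1)[symmetric]] f_close[OF eq(2)[symmetric]]
        by (intro add_mono mult_right_mono) auto
      also have "\<dots> \<le> e" using N(1) by (simp add: add_divide_distrib)
      finally show ?thesis .
    qed
    moreover have "?a i \<in> \<O>" for i by (rule O_I)
    moreover have "l - k \<in> {1..K}" using kl by auto
    ultimately show ?thesis by (intro bexI[of _ "l - k"] exI[of _ ?a] allI impI conjI)
  qed
  moreover have "K \<ge> 1" unfolding K_def using N(2) by (simp add: Suc_leI)
  ultimately show ?thesis by (rule that[rotated])
qed

end

section \<open>Semidefinite forms on the lattice\<close>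

locale bianchi_lattice = imaginary_quadratic +
  fixes n :: nat
begin

definition lattice :: "complex vec set" where
  "lattice = {v \<in> carrier_vec n. \<forall>i<n. v $ i \<in> \<O>}"

text \<open>A positive semidefinite Hermitian form is given by its values on the lattice, extended by 0.
  Forms thus lie in a product space, where Tychonoff's theorem applies.\<close>

definition psd_form :: "(complex vec \<Rightarrow> real) \<Rightarrow> bool" where
  "psd_form q \<longleftrightarrow> (\<forall>v. v \<notin> lattice \<longrightarrow> q v = 0) \<and> (\<forall>v \<in> lattice. 0 \<le> q v) \<and>
    (\<forall>v \<in> lattice. \<forall>w \<in> lattice. q (v + w) + q (v - w) = 2 * q v + 2 * q w) \<and>
    (\<forall>c \<in> \<O>. \<forall>v \<in> lattice. q (c \<cdot>\<^sub>v v) = (cmod c)\<^sup>2 * q v)"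

text \<open>Ryshkov's polyhedron; the minimum is at least 1 rather than normalised.\<close>

definition ryshkov :: "(complex vec \<Rightarrow> real) set" where
  "ryshkov = {q. psd_form q \<and> (\<forall>v \<in> lattice. v \<noteq> 0\<^sub>v n \<longrightarrow> 1 \<le> q v)}"

lemma lattice_carrier: "v \<in> lattice \<Longrightarrow> v \<in> carrier_vec n" by (simp add: lattice_def)
lemma lattice_dim [simp]: "v \<in> lattice \<Longrightarrow> dim_vec v = n" by (simp add: lattice_def)
lemma lattice_index: "v \<in> lattice \<Longrightarrow> i < n \<Longrightarrow> v $ i \<in> \<O>" by (simp add: lattice_def)
lemma lattice_add: "v \<in> lattice \<Longrightarrow> w \<in> lattice \<Longrightarrow> v + w \<in> lattice"
  by (auto simp: lattice_def)
lemma lattice_diff: "v \<in> lattice \<Longrightarrow> w \<in> lattice \<Longrightarrow> v - w \<in> lattice"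
  by (auto simp: lattice_def)
lemma lattice_smult: "c \<in> \<O> \<Longrightarrow> v \<in> lattice \<Longrightarrow> c \<cdot>\<^sub>v v \<in> lattice"
  by (auto simp: lattice_def)
lemma lattice_0 [simp]: "0\<^sub>v n \<in> lattice" by (simp add: lattice_def)
lemma lattice_unit: "i < n \<Longrightarrow> unit_vec n i \<in> lattice" by (auto simp: lattice_def unit_vec_def)
lemma lattice_vec: "(\<And>i. i < n \<Longrightarrow> f i \<in> \<O>) \<Longrightarrow> vec n f \<in> lattice" by (simp add: lattice_def)

lemma psd_nonneg: "psd_form q \<Longrightarrow> 0 \<le> q v" unfolding psd_form_def by (metis order_refl)
lemma psd_outside: "psd_form q \<Longrightarrow> v \<notin> lattice \<Longrightarrow> q v = 0" unfolding psd_form_def by blast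
lemma psd_smult: "psd_form q \<Longrightarrow> c \<in> \<O> \<Longrightarrow> v \<in> lattice \<Longrightarrow> q (c \<cdot>\<^sub>v v) = (cmod c)\<^sup>2 * q v"
  unfolding psd_form_def by blast
lemma psd_parallelogram: "psd_form q \<Longrightarrow> v \<in> lattice \<Longrightarrow> w \<in> lattice \<Longrightarrow>
    q (v + w) + q (v - w) = 2 * q v + 2 * q w"
  unfolding psd_form_def by blast

lemma psd_0: assumes "psd_form q" shows "q (0\<^sub>v n) = 0"
proof -
  have "0 \<cdot>\<^sub>v 0\<^sub>v n = (0\<^sub>v n :: complex vec)" by auto
  then show ?thesis using psd_smult[OF assms, of 0 "0\<^sub>v n"] by simp
qed

lemma psd_add_le: "psd_form q \<Longrightarrow> v \<in> lattice \<Longrightarrow> w \<in> lattice \<Longrightarrow> q (v + w) \<le> 2 * q v + 2 * q w"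
  using psd_parallelogram[of q v w] psd_nonneg[of q "v - w"] by linarith

lemma psd_diff_le: "psd_form q \<Longrightarrow> v \<in> lattice \<Longrightarrow> w \<in> lattice \<Longrightarrow> q (v - w) \<le> 2 * q v + 2 * q w"
  using psd_parallelogram[of q v w] psd_nonneg[of q "v + w"] by linarith

text \<open>Iteration of \<open>psd_add_le\<close>. The crude factor \<open>2 ^ k\<close> takes the
  place of Cauchy-Schwarz; later arguments only require a constant that does not depend on the
  form.\<close>

lemma psd_sum_le:
  assumes q: "psd_form q" and w: "\<And>i. i < k \<Longrightarrow> w i \<in> lattice"
  shows "vec n (\<lambda>r. \<Sum>i<k. w i $ r) \<in> lattice \<and>
    q (vec n (\<lambda>r. \<Sum>i<k. w i $ r)) \<le> 2 ^ k * (\<Sum>i<k. q (w i))"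
  using w
proof (induction k)
  case 0
  have "vec n (\<lambda>r. \<Sum>i<0. w i $ r) = 0\<^sub>v n" by auto
  then show ?case using psd_0[OF q] by simp
next
  case (Suc k)
  let ?s = "vec n (\<lambda>r. \<Sum>i<k. w i $ r)"
  have s: "?s \<in> lattice" "q ?s \<le> 2 ^ k * (\<Sum>i<k. q (w i))" using Suc by auto
  have wk: "w k \<in> lattice" using Suc by auto
  have eq: "vec n (\<lambda>r. \<Sum>i<Suc k. w i $ r) = ?s + w k" using wk by auto
  have "q (?s + w k) \<le> 2 * q ?s + 2 * q (w k)" using psd_add_le[OF q s(1) wk] .
  also have "\<dots> \<le> 2 * (2 ^ k * (\<Sum>i<k. q (w i))) + 2 ^ Suc k * q (w k)"
    using s(2) psd_nonneg[OF q, of "w k"] by (intro add_mono mult_right_mono) auto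
  finally show ?case unfolding eq using lattice_add[OF s(1) wk] by (simp add: algebra_simps)
qed

text \<open>The values at the unit vectors control a form everywhere, so bounding these
  \<open>n\<close> numbers amounts to bounding the form.\<close>

lemma psd_coordinates_le:
  assumes q: "psd_form q" and v: "v \<in> lattice"
  shows "q v \<le> 2 ^ n * (\<Sum>i<n. (cmod (v $ i))\<^sup>2 * q (unit_vec n i))"
proof -
  have "v = vec n (\<lambda>r. \<Sum>i<n. (v $ i \<cdot>\<^sub>v unit_vec n i) $ r)"
  proof (rule eq_vecI)
    fix r assume "r < dim_vec (vec n (\<lambda>r. \<Sum>i<n. (v $ i \<cdot>\<^sub>v unit_vec n i) $ r))"
    then have r: "r < n" by simp
    have "(\<Sum>i<n. (v $ i \<cdot>\<^sub>v unit_vec n i) $ r) = (\<Sum>i<n. if i = r then v $ i else 0)"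
      using r by (intro sum.cong) (auto simp: unit_vec_def)
    then show "v $ r = vec n (\<lambda>r. \<Sum>i<n. (v $ i \<cdot>\<^sub>v unit_vec n i) $ r) $ r" using r by simp
  qed (use v in simp)
  then have "q v \<le> 2 ^ n * (\<Sum>i<n. q (v $ i \<cdot>\<^sub>v unit_vec n i))"
    using psd_sum_le[OF q, of n "\<lambda>i. v $ i \<cdot>\<^sub>v unit_vec n i"] v
    by (metis (no_types, lifting) lattice_index lattice_smult lattice_unit)
  also have "(\<Sum>i<n. q (v $ i \<cdot>\<^sub>v unit_vec n i)) = (\<Sum>i<n. (cmod (v $ i))\<^sup>2 * q (unit_vec n i))"
    using q v by (intro sum.cong refl psd_smult) (auto intro: lattice_index lattice_unit)
  finally show ?thesis .
qed

text \<open>Rank-one forms. They add up to \<open>standard_form\<close>, and in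
  \<open>min_vectors_span\<close> they are the directions in which a minimiser is perturbed.\<close>

lemma psd_lin_form:
  assumes "l \<in> carrier_vec n"
  shows "psd_form (\<lambda>v. if v \<in> lattice then (cmod (l \<bullet> v))\<^sup>2 else 0)" (is "psd_form ?q")
proof -
  have "?q (v + w) + ?q (v - w) = 2 * ?q v + 2 * ?q w" if v: "v \<in> lattice" and w: "w \<in> lattice" for v w
  proof -
    have "l \<bullet> (v + w) = l \<bullet> v + l \<bullet> w" "l \<bullet> (v - w) = l \<bullet> v - l \<bullet> w"
      using assms lattice_carrier[OF v] lattice_carrier[OF w]
      by (auto simp: scalar_prod_add_distrib scalar_prod_minus_distrib)
    then show ?thesis
      using v w by (simp add: lattice_add lattice_diff cmod_power2) (simp add: power2_eq_square algebra_simps)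
  qed
  moreover have "?q (c \<cdot>\<^sub>v v) = (cmod c)\<^sup>2 * ?q v" if "c \<in> \<O>" "v \<in> lattice" for c v
    using that assms lattice_carrier[OF that(2)]
    by (simp add: lattice_smult norm_mult power_mult_distrib)
  ultimately show ?thesis unfolding psd_form_def by simp
qed

lemma psd_comb:
  assumes "psd_form p" "psd_form q" "0 \<le> a" "0 \<le> b"
  shows "psd_form (\<lambda>v. a * p v + b * q v)"
proof -
  have "a * p (v + w) + b * q (v + w) + (a * p (v - w) + b * q (v - w)) =
      2 * (a * p v + b * q v) + 2 * (a * p w + b * q w)" if "v \<in> lattice" "w \<in> lattice" for v w
  proof -
    have "a * p (v + w) + b * q (v + w) + (a * p (v - w) + b * q (v - w)) =
        a * (p (v + w) + p (v - w)) + b * (q (v + w) + q (v - w))" by (simp add: algebra_simps)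
    then show ?thesis
      unfolding psd_parallelogram[OF assms(1) that] psd_parallelogram[OF assms(2) that]
      by (simp add: algebra_simps)
  qed
  moreover have "a * p (c \<cdot>\<^sub>v v) + b * q (c \<cdot>\<^sub>v v) = (cmod c)\<^sup>2 * (a * p v + b * q v)"
    if "c \<in> \<O>" "v \<in> lattice" for c v
    unfolding psd_smult[OF assms(1) that] psd_smult[OF assms(2) that] by (simp add: algebra_simps)
  moreover have "0 \<le> a * p v + b * q v" for v
    using assms psd_nonneg by (intro add_nonneg_nonneg mult_nonneg_nonneg) auto
  moreover have "a * p v + b * q v = 0" if "v \<notin> lattice" for v
    using psd_outside[OF assms(1) that] psd_outside[OF assms(2) that] by simp
  ultimately show ?thesis unfolding psd_form_def by blast
qed

lemma psd_sum:
  assumes "\<And>i. i \<in> I \<Longrightarrow> psd_form (f i)" shows "psd_form (\<lambda>v. \<Sum>i\<in>I. f i v)"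
  using assms
proof (induction I rule: infinite_finite_induct)
  case (insert x F)
  then show ?case using psd_comb[of "f x" "\<lambda>v. \<Sum>i\<in>F. f i v" 1 1] by simp
qed (simp_all add: psd_form_def)

definition standard_form :: "complex vec \<Rightarrow> real" where
  "standard_form v = (\<Sum>i<n. if v \<in> lattice then (cmod (unit_vec n i \<bullet> v))\<^sup>2 else 0)"

lemma psd_standard_form: "psd_form standard_form"
proof -
  have "psd_form (\<lambda>v. \<Sum>i<n. if v \<in> lattice then (cmod (unit_vec n i \<bullet> v))\<^sup>2 else 0)"
    by (intro psd_sum psd_lin_form) simp
  then show ?thesis unfolding standard_form_def .
qed

lemma nonzero_index:
  assumes "v \<in> lattice" "v \<noteq> 0\<^sub>v n" obtains i where "i < n" "v $ i \<noteq> 0"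
  using assms by (metis eq_vecI index_zero_vec lattice_dim)

text \<open>A nonzero lattice vector has a nonzero entry, of modulus at least 1. The polyhedron is
  thus nonempty, and the value at this form bounds the minimum of every functional from
  above.\<close>

lemma standard_form_ryshkov: "standard_form \<in> ryshkov"
proof -
  have "1 \<le> standard_form v" if v: "v \<in> lattice" "v \<noteq> 0\<^sub>v n" for v
  proof -
    obtain i where i: "i < n" "v $ i \<noteq> 0" using nonzero_index v by blast
    have "1 \<le> (cmod (unit_vec n i \<bullet> v))\<^sup>2"
      using O_norm_ge_1[OF lattice_index[OF v(1) i(1)] i(2)] lattice_carrier[OF v(1)] i
      by (simp add: scalar_prod_left_unit)
    also have "\<dots> \<le> standard_form v"
      unfolding standard_form_def using v i(1)
        member_le_sum[of i "{..<n}" "\<lambda>i. (cmod (unit_vec n i \<bullet> v))\<^sup>2"] by simp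
    finally show ?thesis .
  qed
  then show ?thesis unfolding ryshkov_def using psd_standard_form by simp
qed

lemma ryshkov_psd: "f \<in> ryshkov \<Longrightarrow> psd_form f" by (simp add: ryshkov_def)
lemma ryshkov_ge_1: "f \<in> ryshkov \<Longrightarrow> v \<in> lattice \<Longrightarrow> v \<noteq> 0\<^sub>v n \<Longrightarrow> 1 \<le> f v" by (simp add: ryshkov_def)

lemma finite_bounded_lattice: "finite {v \<in> lattice. \<forall>i<n. cmod (v $ i) \<le> r}"
proof -
  have "{v \<in> lattice. \<forall>i<n. cmod (v $ i) \<le> r} \<subseteq> vec n ` PiE {..<n} (\<lambda>_. {x \<in> \<O>. cmod x \<le> r})"
  proof
    fix v assume v: "v \<in> {v \<in> lattice. \<forall>i<n. cmod (v $ i) \<le> r}"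
    then have "v = vec n (restrict (\<lambda>i. v $ i) {..<n})" by auto
    moreover have "restrict (\<lambda>i. v $ i) {..<n} \<in> PiE {..<n} (\<lambda>_. {x \<in> \<O>. cmod x \<le> r})"
      using v lattice_index by (auto simp: restrict_PiE_iff)
    ultimately show "v \<in> vec n ` PiE {..<n} (\<lambda>_. {x \<in> \<O>. cmod x \<le> r})" by blast
  qed
  then show ?thesis by (rule finite_subset) (intro finite_imageI finite_PiE finite_O_bounded; simp)
qed

lemma countable_lattice: "countable lattice"
proof -
  have "lattice \<subseteq> (\<lambda>xs. vec n (\<lambda>i. xs ! i)) ` lists \<O>"
  proof
    fix v assume v: "v \<in> lattice"
    then have "v = vec n (\<lambda>i. map (\<lambda>i. v $ i) [0..<n] ! i)" by auto
    moreover have "map (\<lambda>i. v $ i) [0..<n] \<in> lists \<O>"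
      using lattice_index[OF v] by auto
    ultimately show "v \<in> (\<lambda>xs. vec n (\<lambda>i. xs ! i)) ` lists \<O>" by (rule image_eqI)
  qed
  then show ?thesis
    by (rule countable_subset) (intro countable_image countable_lists countable_O)
qed

text \<open>Approximate the direction of \<open>v\<close> by a lattice vector \<open>a\<close>: a multiple of \<open>v\<close> is then close to
  a multiple of \<open>a\<close>, on which \<open>f\<close> is bounded below.\<close>

lemma coercive:
  obtains C where "C > 0" "\<And>f v i. f \<in> ryshkov \<Longrightarrow> \<forall>i<n. f (unit_vec n i) \<le> U \<Longrightarrow> v \<in> lattice \<Longrightarrow>
    i < n \<Longrightarrow> (cmod (v $ i))\<^sup>2 \<le> C * f v"
proof -
  define B where "B = max U 1"
  have B: "B \<ge> 1" "U \<le> B" by (simp_all add: B_def)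
  define A where "A = 2 ^ n * real (Suc n) * B"
  have A: "A \<ge> 1"
    unfolding A_def using B(1) by (intro mult_ge1_I) auto
  \<comment> \<open>This accuracy makes the error \<open>2 * f r\<close> at most half of
    \<open>(real m)\<^sup>2\<close>, and being at most 1/4 it also keeps the approximating vector
    nonzero.\<close>
  define e where "e = 1 / (4 * A)"
  have e: "e > 0" "e \<le> 1 / 4" "4 * A * e = 1" using A by (simp_all add: e_def field_simps)
  have e2: "2 * A * e\<^sup>2 \<le> 1 / 2"
  proof -
    have "2 * A * e\<^sup>2 = (4 * A * e) * e / 2" by (simp add: power2_eq_square)
    then show ?thesis using e by simp
  qed
  obtain K :: nat where K: "K \<ge> 1" "\<And>u :: nat \<Rightarrow> complex. \<exists>t \<in> {1..K}. \<exists>a. \<forall>i<n.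
    a i \<in> \<O> \<and> cmod (of_nat t * u i - a i) \<le> e"
    using simultaneous_approximation[OF e(1)] by metis
  have "(cmod (v $ i))\<^sup>2 \<le> 4 * (real K)\<^sup>2 * f v"
    if f: "f \<in> ryshkov" and U: "\<forall>i<n. f (unit_vec n i) \<le> U" and v: "v \<in> lattice" and i: "i < n" for f v i
  proof (cases "v = 0\<^sub>v n")
    case True
    then show ?thesis using psd_0[OF ryshkov_psd[OF f]] i by simp
  next
    case False
    note psd = ryshkov_psd[OF f]
    define \<mu> where "\<mu> = Max ((\<lambda>i. cmod (v $ i)) ` {..<n})"
    have le_\<mu>: "cmod (v $ j) \<le> \<mu>" if "j < n" for j unfolding \<mu>_def using that by simp
    have "\<mu> \<in> (\<lambda>i. cmod (v $ i)) ` {..<n}" unfolding \<mu>_def using i by (intro Max_in) auto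
    then obtain k where k: "k < n" "cmod (v $ k) = \<mu>" by auto
    obtain j where "j < n" "v $ j \<noteq> 0" using nonzero_index False v by blast
    then have "1 \<le> \<mu>" using O_norm_ge_1 lattice_index[OF v] le_\<mu> order_trans by blast
    \<comment> \<open>An integral scale for \<open>v\<close>, so that multiplication by it preserves
      the lattice; as \<open>\<mu>\<close> is at least 1, rounding up costs at most a factor
      2.\<close>
    define m where "m = nat \<lceil>\<mu>\<rceil>"
    have m: "\<mu> \<le> real m" "real m \<le> 2 * \<mu>" "real m > 0"
      using \<open>1 \<le> \<mu>\<close> unfolding m_def by linarith+
    obtain t a where t: "t \<in> {1..K}" and a: "\<And>i. i < n \<Longrightarrow> a i \<in> \<O>"
        "\<And>i. i < n \<Longrightarrow> cmod (of_nat t * (v $ i / of_nat m) - a i) \<le> e"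
      using K(2)[of "\<lambda>i. v $ i / of_nat m"] by metis
    define x where "x = vec n a"
    have x: "x \<in> lattice" unfolding x_def using a(1) by (rule lattice_vec)
    have "cmod (of_nat t * (v $ k / of_nat m)) \<ge> 1 / 2"
    proof -
      have "1 / 2 \<le> \<mu> / real m" using m by (simp add: field_simps)
      also have "\<dots> \<le> real t * (\<mu> / real m)" using t m \<open>1 \<le> \<mu>\<close> mult_right_mono[of 1 "real t" "\<mu> / real m"] by simp
      finally show ?thesis using k by (simp add: norm_mult norm_divide)
    qed
    then have "a k \<noteq> 0" using a(2)[OF k(1)] e(2) by auto
    then have "x \<noteq> 0\<^sub>v n" using k(1) by (metis index_vec index_zero_vec(1) x_def)
    then have fx: "1 \<le> f x" using ryshkov_ge_1[OF f x] by simp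
    define r where "r = of_nat t \<cdot>\<^sub>v v - of_nat m \<cdot>\<^sub>v x"
    have r: "r \<in> lattice" unfolding r_def using v x by (intro lattice_diff lattice_smult) auto
    have ri: "(cmod (r $ i))\<^sup>2 \<le> (real m)\<^sup>2 * e\<^sup>2" if "i < n" for i
    proof -
      have "r $ i = of_nat m * (of_nat t * (v $ i / of_nat m) - a i)"
        using that v m(3) by (simp add: r_def x_def field_simps)
      then have "cmod (r $ i) \<le> real m * e" using a(2)[OF that] m(3) by (simp add: norm_mult)
      then show ?thesis by (simp add: power_mono flip: power_mult_distrib)
    qed
    have "f r \<le> 2 ^ n * (\<Sum>i<n. (cmod (r $ i))\<^sup>2 * f (unit_vec n i))"
      by (rule psd_coordinates_le[OF psd r])
    also have "\<dots> \<le> 2 ^ n * (\<Sum>i<n. (real m)\<^sup>2 * e\<^sup>2 * B)"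
      using ri U B psd_nonneg[OF psd] by (intro mult_left_mono sum_mono mult_mono) (auto intro: order_trans)
    also have "\<dots> = (real m)\<^sup>2 * (2 ^ n * real n * B * e\<^sup>2)" by simp
    also have "\<dots> \<le> (real m)\<^sup>2 * (A * e\<^sup>2)"
      using B(1) by (intro mult_left_mono mult_right_mono) (auto simp: A_def)
    finally have fr: "2 * f r \<le> (real m)\<^sup>2 / 2"
      using mult_left_mono[OF e2, of "(real m)\<^sup>2"] by (simp add: algebra_simps)
    have mx: "of_nat m \<cdot>\<^sub>v x = of_nat t \<cdot>\<^sub>v v - r" unfolding r_def using v x by (intro eq_vecI) auto
    \<comment> \<open>Since \<open>f x\<close> is at least 1, the value at
      \<open>m x = t v - r\<close> is at least \<open>(real m)\<^sup>2\<close>; the parallelogram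
      law splits it into \<open>f (t v)\<close> and an error that is absorbed.\<close>
    have "(real m)\<^sup>2 \<le> (real m)\<^sup>2 * f x" using fx by (simp add: mult_le_cancel_left1)
    also have "\<dots> = f (of_nat m \<cdot>\<^sub>v x)" using psd_smult[OF psd _ x, of "of_nat m"] by simp
    also have "\<dots> \<le> 2 * f (of_nat t \<cdot>\<^sub>v v) + 2 * f r"
      unfolding mx using v r by (intro psd_diff_le[OF psd] lattice_smult) auto
    also have "f (of_nat t \<cdot>\<^sub>v v) = (real t)\<^sup>2 * f v" using psd_smult[OF psd _ v, of "of_nat t"] by simp
    finally have "(real m)\<^sup>2 \<le> 4 * ((real t)\<^sup>2 * f v)" using fr by linarith
    also have "\<dots> \<le> 4 * ((real K)\<^sup>2 * f v)"
      using t psd_nonneg[OF psd, of v] by (intro mult_left_mono mult_right_mono power_mono) auto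
    finally have "(real m)\<^sup>2 \<le> 4 * (real K)\<^sup>2 * f v" by simp
    moreover have "(cmod (v $ i))\<^sup>2 \<le> (real m)\<^sup>2"
      using le_\<mu>[OF i] m(1) by (intro power_mono) auto
    ultimately show ?thesis by linarith
  qed
  moreover have "4 * (real K)\<^sup>2 > 0" using K(1) by simp
  ultimately show ?thesis by (rule that[rotated])
qed

section \<open>Perfect forms\<close>

definition min_vectors :: "(complex vec \<Rightarrow> real) \<Rightarrow> complex vec set" where
  "min_vectors f = {v \<in> lattice. f v = 1}"

definition extreme_form :: "(complex vec \<Rightarrow> real) \<Rightarrow> bool" where
  "extreme_form f \<longleftrightarrow>
    (\<forall>h. (\<lambda>v. f v + h v) \<in> ryshkov \<and> (\<lambda>v. f v - h v) \<in> ryshkov \<longrightarrow> h = (\<lambda>_. 0))"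

text \<open>By \<open>coercive\<close> the form \<open>f\<close> dominates the squares of the
  coordinates, and these dominate any semidefinite form by
  \<open>psd_coordinates_le\<close>.\<close>

lemma psd_le_ryshkov:
  assumes f: "f \<in> ryshkov" and q: "psd_form q"
  obtains C where "C > 0" "\<And>v. v \<in> lattice \<Longrightarrow> q v \<le> C * f v"
proof -
  define U where "U = (\<Sum>i<n. f (unit_vec n i))"
  have U: "\<forall>i<n. f (unit_vec n i) \<le> U"
    unfolding U_def using psd_nonneg[OF ryshkov_psd[OF f]] by (auto intro: member_le_sum)
  obtain C where C: "C > 0" "\<And>f v i. f \<in> ryshkov \<Longrightarrow> \<forall>i<n. f (unit_vec n i) \<le> U \<Longrightarrow>
      v \<in> lattice \<Longrightarrow> i < n \<Longrightarrow> (cmod (v $ i))\<^sup>2 \<le> C * f v"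
    by (fact coercive[of U])
  let ?D = "2 ^ n * (\<Sum>i<n. C * q (unit_vec n i))"
  have "q v \<le> (?D + 1) * f v" if v: "v \<in> lattice" for v
  proof -
    have "q v \<le> 2 ^ n * (\<Sum>i<n. (cmod (v $ i))\<^sup>2 * q (unit_vec n i))"
      by (rule psd_coordinates_le[OF q v])
    also have "\<dots> \<le> 2 ^ n * (\<Sum>i<n. C * f v * q (unit_vec n i))"
      using C(2)[OF f U v] psd_nonneg[OF q] by (intro mult_left_mono sum_mono mult_right_mono) auto
    also have "\<dots> = ?D * f v" by (simp add: sum_distrib_left algebra_simps)
    also have "\<dots> \<le> (?D + 1) * f v"
      using psd_nonneg[OF ryshkov_psd[OF f], of v] by (simp add: algebra_simps)
    finally show ?thesis .
  qed
  moreover have "?D + 1 > 0"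
    using C(1) psd_nonneg[OF q] by (intro add_nonneg_pos mult_nonneg_nonneg sum_nonneg) auto
  ultimately show ?thesis by (rule that[rotated])
qed

text \<open>Comparison with \<open>standard_form\<close> bounds all coordinates, and the lattice is
  discrete.\<close>

lemma finite_sublevel: 
  assumes "f \<in> ryshkov" shows "finite {v \<in> lattice. f v \<le> r}"
proof -
  obtain C where C: "C > 0" "\<And>v. v \<in> lattice \<Longrightarrow> standard_form v \<le> C * f v"
    by (fact psd_le_ryshkov[OF assms psd_standard_form])
  have "cmod (v $ i) \<le> sqrt (C * r)" if v: "v \<in> lattice" "f v \<le> r" and i: "i < n" for v i
  proof -
    have "(cmod (v $ i))\<^sup>2 \<le> standard_form v"
      unfolding standard_form_def using v i lattice_carrier[OF v(1)]
        member_le_sum[of i "{..<n}" "\<lambda>i. (cmod (unit_vec n i \<bullet> v))\<^sup>2"]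
      by (simp add: scalar_prod_left_unit)
    also have "\<dots> \<le> C * f v" using C v by blast
    also have "\<dots> \<le> C * r" using C(1) v by simp
    finally show ?thesis by (rule real_le_rsqrt)
  qed
  then have "{v \<in> lattice. f v \<le> r} \<subseteq> {v \<in> lattice. \<forall>i<n. cmod (v $ i) \<le> sqrt (C * r)}" by blast
  then show ?thesis by (rule finite_subset) (rule finite_bounded_lattice)
qed

text \<open>The lattice vectors on which \<open>f\<close> is not minimal have \<open>f\<close>-values bounded away from 1.\<close>

lemma ryshkov_perturb:
  assumes f: "f \<in> ryshkov" and C: "C > 0"
  obtains t where "t > 0" "\<And>p q. psd_form p \<Longrightarrow> psd_form q \<Longrightarrow> (\<And>v. v \<in> lattice \<Longrightarrow> q v \<le> C * f v) \<Longrightarrow>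
    (\<And>v. v \<in> min_vectors f \<Longrightarrow> q v \<le> p v) \<Longrightarrow> (\<lambda>v. f v + t * (p v - q v)) \<in> ryshkov"
proof -
  note psd = ryshkov_psd[OF f]
  obtain g where g: "g > 0" "\<And>v. v \<in> lattice \<Longrightarrow> v \<noteq> 0\<^sub>v n \<Longrightarrow> v \<notin> min_vectors f \<Longrightarrow> 1 + g \<le> f v"
  proof -
    let ?S = "{v \<in> lattice. f v \<le> 2} \<inter> {v. v \<noteq> 0\<^sub>v n \<and> v \<notin> min_vectors f}"
    \<comment> \<open>The gap above the value 1. Only the finitely many values up to 2 have to be
      inspected; the inserted 2 keeps the set nonempty and takes care of all larger values.\<close>
    let ?g = "Min (insert 2 (f ` ?S)) - 1"
    have fin: "finite (insert 2 (f ` ?S))" using finite_sublevel[OF f] by auto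
    have "\<forall>x \<in> insert 2 (f ` ?S). x > 1"
      using ryshkov_ge_1[OF f] unfolding min_vectors_def by force
    then have "?g > 0" using fin Min_gr_iff[OF fin] by auto
    moreover have "1 + ?g \<le> f v" if "v \<in> lattice" "v \<noteq> 0\<^sub>v n" "v \<notin> min_vectors f" for v
    proof (cases "f v \<le> 2")
      case True
      then show ?thesis using that fin by (auto intro!: Min_le)
    next
      case False
      have "Min (insert 2 (f ` ?S)) \<le> 2" using fin by (intro Min_le) auto
      then show ?thesis using False by linarith
    qed
    ultimately show ?thesis by (rule that)
  qed
  \<comment> \<open>Chosen so that \<open>t * C\<close> is at most \<open>g / (1 + g)\<close>:
    subtracting \<open>t * q\<close> then lowers a value that is at least \<open>1 + g\<close> to no
    less than 1.\<close>
  define t where "t = g / ((1 + g) * (C + 1))"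
  have t: "t > 0" using g C by (simp add: t_def)
  have tC: "(1 - t * C) * (1 + g) \<ge> 1" "t * C \<le> 1"
  proof -
    have "g / (x * y) * C * x = g * (C / y)" if "x \<noteq> 0" for x y :: real using that by simp
    from this[of "1 + g" "C + 1"] have "t * C * (1 + g) = g * (C / (C + 1))" using g unfolding t_def by simp
    also have "\<dots> \<le> g * 1" using g C by (intro mult_left_mono) auto
    finally show "(1 - t * C) * (1 + g) \<ge> 1" by (simp add: algebra_simps)
    then show "t * C \<le> 1" using g
      by (smt (verit) mult_nonneg_nonneg mult_minus_left)
  qed
  have "(\<lambda>v. f v + t * (p v - q v)) \<in> ryshkov"
    if p: "psd_form p" and q: "psd_form q" and qC: "\<And>v. v \<in> lattice \<Longrightarrow> q v \<le> C * f v"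
      and le: "\<And>v. v \<in> min_vectors f \<Longrightarrow> q v \<le> p v" for p q
  proof -
    let ?h = "\<lambda>v. f v + t * (p v - q v)"
    have ge: "1 \<le> ?h v" if v: "v \<in> lattice" "v \<noteq> 0\<^sub>v n" for v
    proof (cases "v \<in> min_vectors f")
      case True
      then have "0 \<le> t * (p v - q v)" using le t by simp
      then show ?thesis using ryshkov_ge_1[OF f v] by linarith
    next
      case False
      have "1 \<le> (1 - t * C) * (1 + g)" by (rule tC)
      also have "\<dots> \<le> (1 - t * C) * f v" using g(2)[OF v False] tC(2) by (intro mult_left_mono) auto
      also have "\<dots> = f v - t * (C * f v)" by (simp add: algebra_simps)
      also have "\<dots> \<le> f v - t * q v" using qC[OF v(1)] t by simp
      also have "\<dots> \<le> ?h v" using psd_nonneg[OF p, of v] t by (simp add: algebra_simps)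
      finally show ?thesis .
    qed
    have h0: "?h (0\<^sub>v n) = 0" using psd_0[OF p] psd_0[OF q] psd_0[OF psd] by simp
    have "?h (v + w) + ?h (v - w) = 2 * ?h v + 2 * ?h w" if "v \<in> lattice" "w \<in> lattice" for v w
    proof -
      have "?h (v + w) + ?h (v - w) = (f (v + w) + f (v - w)) + t * ((p (v + w) + p (v - w)) - (q (v + w) + q (v - w)))"
        by (simp add: algebra_simps)
      then show ?thesis
        unfolding psd_parallelogram[OF p that] psd_parallelogram[OF q that] psd_parallelogram[OF psd that]
        by (simp add: algebra_simps)
    qed
    moreover have "?h (c \<cdot>\<^sub>v v) = (cmod c)\<^sup>2 * ?h v" if "c \<in> \<O>" "v \<in> lattice" for c v
      unfolding psd_smult[OF p that] psd_smult[OF q that] psd_smult[OF psd that]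
      by (simp add: algebra_simps)
    moreover have "0 \<le> ?h v" if "v \<in> lattice" for v
      using ge[OF that] h0 by (cases "v = 0\<^sub>v n") auto
    moreover have "?h v = 0" if "v \<notin> lattice" for v
      using psd_outside[OF p that] psd_outside[OF q that] psd_outside[OF psd that] by simp
    ultimately have "psd_form ?h" unfolding psd_form_def by blast
    then show ?thesis using ge unfolding ryshkov_def by blast
  qed
  then show ?thesis by (rule that[OF t])
qed

text \<open>If two forms share their minimal vectors, their difference vanishes there, and by
  \<open>ryshkov_perturb\<close> a small multiple of it may be added to and subtracted from
  \<open>f\<close> within the polyhedron. Extremality makes it zero.\<close>

lemma extreme_form_unique:
  assumes f: "f \<in> ryshkov" "extreme_form f" and g: "g \<in> ryshkov" "min_vectors f = min_vectors g"
  shows "f = g"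
proof -
  obtain C where C: "C > 0" "\<And>v. v \<in> lattice \<Longrightarrow> g v \<le> C * f v"
    by (fact psd_le_ryshkov[OF f(1) ryshkov_psd[OF g(1)]])
  \<comment> \<open>Both \<open>f\<close> and \<open>g\<close> are subtracted in turn, and both are
    at most \<open>C + 1\<close> times \<open>f\<close>.\<close>
  have C1: "C + 1 > 0" using C by simp
  obtain t where t: "t > 0" "\<And>p q. psd_form p \<Longrightarrow> psd_form q \<Longrightarrow> (\<And>v. v \<in> lattice \<Longrightarrow> q v \<le> (C + 1) * f v) \<Longrightarrow>
    (\<And>v. v \<in> min_vectors f \<Longrightarrow> q v \<le> p v) \<Longrightarrow> (\<lambda>v. f v + t * (p v - q v)) \<in> ryshkov"
    by (fact ryshkov_perturb[OF f(1) C1])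
  have le: "g v \<le> (C + 1) * f v" "f v \<le> (C + 1) * f v" if "v \<in> lattice" for v
    using C(2)[OF that] psd_nonneg[OF ryshkov_psd[OF f(1)], of v] mult_nonneg_nonneg[of C "f v"] C(1)
    by (simp_all add: algebra_simps)
  have eq: "f v = g v" if "v \<in> min_vectors f" for v
    using that g(2) unfolding min_vectors_def by auto
  have 1: "(\<lambda>v. f v + t * (g v - f v)) \<in> ryshkov"
    by (rule t(2)[OF ryshkov_psd[OF g(1)] ryshkov_psd[OF f(1)]]) (simp_all add: le eq)
  have 2: "(\<lambda>v. f v + t * (f v - g v)) \<in> ryshkov"
    by (rule t(2)[OF ryshkov_psd[OF f(1)] ryshkov_psd[OF g(1)]]) (simp_all add: le eq)
  have "(\<lambda>v. f v + t * (f v - g v)) = (\<lambda>v. f v - t * (g v - f v))"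
    by (auto simp: algebra_simps)
  with 1 2 have "(\<lambda>v. t * (g v - f v)) = (\<lambda>_. 0)"
    using f(2)[unfolded extreme_form_def, rule_format, of "\<lambda>v. t * (g v - f v)"] by simp
  then have "t * (g v - f v) = 0" for v by (rule fun_cong)
  then have "g v - f v = 0" for v using t(1) by simp
  then have "f v = g v" for v by (metis right_minus_eq)
  then show ?thesis ..
qed

text \<open>The bound at the unit vectors puts all minimal vectors into one finite box, and an
  extreme form is determined by its set of minimal vectors.\<close>

lemma finite_extreme_forms:
  "finite {f \<in> ryshkov. extreme_form f \<and> (\<forall>i<n. f (unit_vec n i) \<le> U)}" (is "finite ?S")
proof -
  obtain C where C: "C > 0" "\<And>f v i. f \<in> ryshkov \<Longrightarrow> \<forall>i<n. f (unit_vec n i) \<le> U \<Longrightarrow>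
      v \<in> lattice \<Longrightarrow> i < n \<Longrightarrow> (cmod (v $ i))\<^sup>2 \<le> C * f v"
    by (fact coercive[of U])
  let ?T = "{v \<in> lattice. \<forall>i<n. cmod (v $ i) \<le> sqrt C}"
  have "min_vectors f \<subseteq> ?T" if "f \<in> ?S" for f
  proof
    fix v assume v: "v \<in> min_vectors f"
    then have "cmod (v $ i) \<le> sqrt C" if "i < n" for i
      using C(2)[of f v i] \<open>f \<in> ?S\<close> that by (intro real_le_rsqrt) (auto simp: min_vectors_def)
    then show "v \<in> ?T" using v unfolding min_vectors_def by auto
  qed
  then have "min_vectors ` ?S \<subseteq> Pow ?T" by blast
  then have "finite (min_vectors ` ?S)" by (rule finite_subset) (simp add: finite_bounded_lattice)
  moreover have "inj_on min_vectors ?S" by (intro inj_onI) (auto intro: extreme_form_unique)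
  ultimately show ?thesis by (rule finite_imageD)
qed

text \<open>The interior of the cone dual to the positive semidefinite forms.\<close>

definition dual_cone :: "((complex vec \<Rightarrow> real) \<Rightarrow> real) set" where
  "dual_cone = {\<phi>. continuous_on UNIV \<phi> \<and>
    (\<forall>a b p q. \<phi> (\<lambda>v. a * p v + b * q v) = a * \<phi> p + b * \<phi> q) \<and>
    (\<forall>v \<in> lattice. \<exists>c>0. \<forall>q. psd_form q \<longrightarrow> c * q v \<le> \<phi> q)}"

definition minimizes :: "((complex vec \<Rightarrow> real) \<Rightarrow> real) \<Rightarrow> (complex vec \<Rightarrow> real) \<Rightarrow> bool" where
  "minimizes \<phi> f \<longleftrightarrow> f \<in> ryshkov \<and> (\<forall>q \<in> ryshkov. \<phi> f \<le> \<phi> q)"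

lemma dual_cone_comb: "\<phi> \<in> dual_cone \<Longrightarrow> \<phi> (\<lambda>v. a * p v + b * q v) = a * \<phi> p + b * \<phi> q"
  by (simp add: dual_cone_def)

lemma dual_cone_add: "\<phi> \<in> dual_cone \<Longrightarrow> \<phi> (\<lambda>v. p v + q v) = \<phi> p + \<phi> q"
  using dual_cone_comb[of \<phi> 1 p 1 q] by simp

lemma dual_cone_diff: "\<phi> \<in> dual_cone \<Longrightarrow> \<phi> (\<lambda>v. p v - q v) = \<phi> p - \<phi> q"
  using dual_cone_comb[of \<phi> 1 p "-1" q] by simp

text \<open>If \<open>l\<close> vanished on all minimal vectors, a small multiple of the form
  \<open>(cmod (l \<bullet> v))\<^sup>2\<close> could be subtracted from \<open>f\<close> inside the
  polyhedron. Unless \<open>l\<close> is zero this lowers \<open>\<phi>\<close>, which is strictly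
  positive on that form, contrary to minimality.\<close>

lemma min_vectors_span:
  assumes \<phi>: "\<phi> \<in> dual_cone" and f: "minimizes \<phi> f" and l: "l \<in> carrier_vec n"
    and van: "\<And>v. v \<in> min_vectors f \<Longrightarrow> l \<bullet> v = 0"
  shows "l = 0\<^sub>v n"
proof -
  let ?q = "\<lambda>v. if v \<in> lattice then (cmod (l \<bullet> v))\<^sup>2 else 0"
  let ?z = "\<lambda>v :: complex vec. 0 :: real"
  have q: "psd_form ?q" by (rule psd_lin_form[OF l])
  have z: "psd_form ?z" by (simp add: psd_form_def)
  have fr: "f \<in> ryshkov" using f by (simp add: minimizes_def)
  obtain C where C: "C > 0" "\<And>v. v \<in> lattice \<Longrightarrow> ?q v \<le> C * f v"
    by (fact psd_le_ryshkov[OF fr q])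
  obtain t where t: "t > 0" "\<And>p q. psd_form p \<Longrightarrow> psd_form q \<Longrightarrow> (\<And>v. v \<in> lattice \<Longrightarrow> q v \<le> C * f v) \<Longrightarrow>
    (\<And>v. v \<in> min_vectors f \<Longrightarrow> q v \<le> p v) \<Longrightarrow> (\<lambda>v. f v + t * (p v - q v)) \<in> ryshkov"
    by (fact ryshkov_perturb[OF fr C(1)])
  have "(\<lambda>v. f v + t * (?z v - ?q v)) \<in> ryshkov"
    by (rule t(2)[OF z q C(2)]) (simp_all add: van)
  then have "\<phi> f \<le> \<phi> (\<lambda>v. f v + t * (?z v - ?q v))"
    using f unfolding minimizes_def by blast
  also have "(\<lambda>v. f v + t * (?z v - ?q v)) = (\<lambda>v. 1 * f v + (- t) * ?q v)" by auto
  also have "\<phi> \<dots> = 1 * \<phi> f + (- t) * \<phi> ?q" by (rule dual_cone_comb[OF \<phi>])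
  finally have "t * \<phi> ?q \<le> 0" by simp
  then have "\<phi> ?q \<le> 0" using t(1) by (simp add: mult_le_0_iff)
  show ?thesis
  proof (rule eq_vecI)
    fix i assume "i < dim_vec (0\<^sub>v n :: complex vec)"
    then have i: "i < n" by simp
    have "\<exists>c>0. \<forall>q. psd_form q \<longrightarrow> c * q (unit_vec n i) \<le> \<phi> q"
      using \<phi> lattice_unit[OF i] unfolding dual_cone_def by simp
    then obtain c where c0: "c > 0" "\<forall>q. psd_form q \<longrightarrow> c * q (unit_vec n i) \<le> \<phi> q" by blast
    note c = c0(1) c0(2)[rule_format, OF q]
    have "x \<le> 0" if "c * x \<le> 0" for x using that c(1) by (simp add: mult_le_0_iff)
    from this[OF order_trans[OF c(2) \<open>\<phi> ?q \<le> 0\<close>]] have "?q (unit_vec n i) \<le> 0" .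
    then have "(cmod (l \<bullet> unit_vec n i))\<^sup>2 \<le> 0"
      unfolding if_P[OF lattice_unit[OF i]] .
    then have "l \<bullet> unit_vec n i = 0" by simp
    then show "l $ i = 0\<^sub>v n $ i" unfolding scalar_prod_right_unit[OF i] index_zero_vec(1)[OF i] .
  qed (use l in simp)
qed

end

section \<open>Existence of extreme minimisers\<close>

text \<open>The minimisers inherit all hypotheses on \<open>A\<close>, so that minimisation can be
  repeated infinitely often with other functions.\<close>

lemma compact_argmin:
  fixes g :: "'a::topological_space \<Rightarrow> real"
  assumes "compact A" "A \<noteq> {}" "closed A" "continuous_on UNIV g"
  shows "compact {q \<in> A. \<forall>r \<in> A. g q \<le> g r}" "{q \<in> A. \<forall>r \<in> A. g q \<le> g r} \<noteq> {}"
    "closed {q \<in> A. \<forall>r \<in> A. g q \<le> g r}"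
proof -
  obtain m where m: "m \<in> A" "\<forall>r \<in> A. g m \<le> g r"
    using continuous_attains_inf[OF assms(1,2)] continuous_on_subset[OF assms(4)] by blast
  have eq: "{q \<in> A. \<forall>r \<in> A. g q \<le> g r} = A \<inter> {q. g q \<le> g m}"
    using m by (auto intro: order_trans)
  have cl: "closed {q. g q \<le> g m}"
    by (rule closed_Collect_le[OF assms(4) continuous_on_const])
  show "compact {q \<in> A. \<forall>r \<in> A. g q \<le> g r}" "closed {q \<in> A. \<forall>r \<in> A. g q \<le> g r}"
    unfolding eq using assms cl by (auto intro: compact_Int_closed)
  show "{q \<in> A. \<forall>r \<in> A. g q \<le> g r} \<noteq> {}" using m by blast
qed

lemma compact_pi:
  fixes S :: "'a \<Rightarrow> real set"
  assumes "\<And>i. compact (S i)"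
  shows "compact {f. \<forall>i. f i \<in> S i}"
proof -
  have "compactin (product_topology (\<lambda>_. euclidean) UNIV) (PiE UNIV S)"
    using assms by (auto simp: compactin_PiE)
  then have "compact (PiE UNIV S)" by (simp add: euclidean_product_topology)
  moreover have "PiE UNIV S = {f. \<forall>i. f i \<in> S i}" by auto
  ultimately show ?thesis by simp
qed

context bianchi_lattice begin

text \<open>Each defining condition is an equation or weak inequality between finitely many values
  of \<open>q\<close>, hence closed in the product topology.\<close>

lemma closed_ryshkov: "closed ryshkov"
proof -
  have cont [continuous_intros]: "continuous_on UNIV (\<lambda>q :: complex vec \<Rightarrow> real. q v)" for v
    by (rule continuous_on_product_coordinates)
  have "ryshkov = (\<Inter>v \<in> - lattice. {q. q v = 0}) \<inter> (\<Inter>v \<in> lattice. {q. 0 \<le> q v}) \<inter>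
      (\<Inter>v \<in> lattice. \<Inter>w \<in> lattice. {q. q (v + w) + q (v - w) = 2 * q v + 2 * q w}) \<inter>
      (\<Inter>c \<in> \<O>. \<Inter>v \<in> lattice. {q. q (c \<cdot>\<^sub>v v) = (cmod c)\<^sup>2 * q v}) \<inter>
      (\<Inter>v \<in> lattice - {0\<^sub>v n}. {q. 1 \<le> q v})"
    unfolding ryshkov_def psd_form_def by auto
  also have "closed \<dots>"
    by (intro closed_Int closed_INT ballI closed_Collect_eq closed_Collect_le continuous_intros)
  finally show ?thesis .
qed

text \<open>Minimise \<open>\<phi>\<close> and then, lexicographically, the values at all lattice vectors in turn.\<close>

lemma exists_extreme_minimizer:
  assumes \<phi>: "\<phi> \<in> dual_cone"
  obtains f where "minimizes \<phi> f" "extreme_form f"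
proof -
  have cont: "continuous_on UNIV \<phi>" using \<phi> by (simp add: dual_cone_def)
  have "\<forall>v \<in> lattice. \<exists>c>0. \<forall>q. psd_form q \<longrightarrow> c * q v \<le> \<phi> q" using \<phi> by (simp add: dual_cone_def)
  then obtain c where c: "\<And>v. v \<in> lattice \<Longrightarrow> c v > 0"
      "\<And>v q. v \<in> lattice \<Longrightarrow> psd_form q \<Longrightarrow> c v * q v \<le> \<phi> q" by metis
  \<comment> \<open>On this sublevel set the defining bounds of \<open>dual_cone\<close> confine
    every value \<open>q v\<close> to a compact interval, so Tychonoff applies.\<close>
  define K where "K = {q \<in> ryshkov. \<phi> q \<le> \<phi> standard_form}"
  define B where "B = (\<lambda>v. if v \<in> lattice then \<phi> standard_form / c v else 0)"
  have "q v \<in> {0..B v}" if "q \<in> K" for q v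
  proof (cases "v \<in> lattice")
    case True
    have "q v * c v \<le> \<phi> standard_form" using c(2)[OF True, of q] that by (simp add: K_def ryshkov_def mult.commute)
    then show ?thesis using c(1)[OF True] True psd_nonneg[of q v] that
      by (simp add: B_def K_def ryshkov_def pos_le_divide_eq)
  next
    case False
    then show ?thesis using that psd_outside[of q v] by (simp add: B_def K_def ryshkov_def)
  qed
  then have "K \<subseteq> {q. \<forall>v. q v \<in> {0..B v}}" by blast
  moreover have "compact {q. \<forall>v. q v \<in> {0..B v}}" by (rule compact_pi) simp
  moreover have clK: "closed K"
  proof -
    have "K = ryshkov \<inter> {q. \<phi> q \<le> \<phi> standard_form}" by (auto simp: K_def)
    then show ?thesis by (simp add: closed_Int closed_ryshkov closed_Collect_le[OF cont continuous_on_const])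
  qed
  ultimately have coK: "compact K" by (metis compact_Int_closed inf.absorb_iff2)
  have neK: "K \<noteq> {}" using standard_form_ryshkov by (auto simp: K_def)
  define K' where "K' = {q \<in> K. \<forall>r \<in> K. \<phi> q \<le> \<phi> r}"
  define e where "e = from_nat_into lattice"
  define F where "F = rec_nat K' (\<lambda>j A. {q \<in> A. \<forall>r \<in> A. q (e j) \<le> r (e j)})"
  have F0: "F 0 = K'" and FS: "F (Suc j) = {q \<in> F j. \<forall>r \<in> F j. q (e j) \<le> r (e j)}" for j
    by (simp_all add: F_def)
  have F: "compact (F j) \<and> closed (F j) \<and> F j \<noteq> {}" for j
  proof (induction j)
    case 0
    then show ?case unfolding F0 K'_def using compact_argmin[OF coK neK clK cont] by blast
  next
    case (Suc j)
    have "continuous_on UNIV (\<lambda>q :: complex vec \<Rightarrow> real. q (e j))"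
      by (rule continuous_on_product_coordinates)
    from compact_argmin[OF _ _ _ this, of "F j"] Suc show ?case unfolding FS by simp
  qed
  have mono: "F l \<subseteq> F j" if "j \<le> l" for j l
    using that by (induction rule: dec_induct) (auto simp: FS)
  have "F 0 \<inter> \<Inter>(range F) \<noteq> {}"
  proof (rule compact_imp_fip)
    fix A assume "finite A" "A \<subseteq> range F"
    then obtain J where J: "finite J" "A = F ` J" by (meson finite_subset_image)
    have "F (Max (insert 0 J)) \<subseteq> F j" if "j \<in> insert 0 J" for j
      by (rule mono) (use J(1) that in simp)
    then have "F (Max (insert 0 J)) \<subseteq> F 0 \<inter> \<Inter>A" unfolding J(2) by blast
    then show "F 0 \<inter> \<Inter>A \<noteq> {}" using F by blast
  qed (use F in auto)
  then obtain f where f: "f \<in> F j" for j by blast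
  have fK: "f \<in> K'" using f[of 0] F0 by simp
  have min: "\<phi> f \<le> \<phi> q" if "q \<in> ryshkov" for q
  proof (cases "q \<in> K")
    case True then show ?thesis using fK by (simp add: K'_def)
  next
    case False then show ?thesis using fK that by (simp add: K'_def K_def)
  qed
  have fr: "f \<in> ryshkov" using fK by (simp add: K'_def K_def)
  have "h = (\<lambda>_. 0)" if h: "(\<lambda>v. f v + h v) \<in> ryshkov" "(\<lambda>v. f v - h v) \<in> ryshkov" for h
  proof -
    have "\<phi> f \<le> \<phi> f + \<phi> h" "\<phi> f \<le> \<phi> f - \<phi> h"
      using min[OF h(1)] min[OF h(2)] by (simp_all add: dual_cone_add[OF \<phi>] dual_cone_diff[OF \<phi>])
    then have "\<phi> h = 0" by simp
    then have K': "(\<lambda>v. f v + h v) \<in> K'" "(\<lambda>v. f v - h v) \<in> K'"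
      using fK h unfolding K'_def K_def
      by (simp_all add: dual_cone_add[OF \<phi>] dual_cone_diff[OF \<phi>])
    \<comment> \<open>Both perturbed forms survive every stage: \<open>f\<close> minimises the value
      at \<open>e j\<close> within \<open>F j\<close>, so neither sign of \<open>h (e j)\<close> is
      possible.\<close>
    have "(\<lambda>v. f v + h v) \<in> F j \<and> (\<lambda>v. f v - h v) \<in> F j \<and> (\<forall>i<j. h (e i) = 0)" for j
    proof (induction j)
      case 0 then show ?case using K' F0 by simp
    next
      case (Suc j)
      have "f (e j) \<le> r (e j)" if "r \<in> F j" for r
        using f[of "Suc j"] that unfolding FS by blast
      from this[of "\<lambda>v. f v + h v"] this[of "\<lambda>v. f v - h v"] Suc
      have "f (e j) \<le> f (e j) + h (e j)" "f (e j) \<le> f (e j) - h (e j)" by blast+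
      then have "h (e j) = 0" by simp
      then show ?case using Suc f[of "Suc j"] unfolding FS by (auto simp: less_Suc_eq)
    qed
    then have he: "h (e j) = 0" for j by blast
    show ?thesis
    proof
      fix v show "h v = 0"
      proof (cases "v \<in> lattice")
        case True
        then obtain j where "v = e j"
          using from_nat_into_surj[OF countable_lattice] e_def by metis
        then show ?thesis using he by simp
      next
        case False
        then show ?thesis using psd_outside[OF ryshkov_psd[OF h(1)]] psd_outside[OF ryshkov_psd[OF fr]] by fastforce
      qed
    qed
  qed
  then show ?thesis using that fr min unfolding minimizes_def extreme_form_def by blast
qed

end

section \<open>Bases of minimal vectors and the index of their span\<close>

text \<open>Exchange, starting from the identity matrix. With the other columns fixed, the
  determinant is a linear functional \<open>l\<close> of column \<open>k\<close>, with cofactors as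
  coefficients. It is nonzero at the present column, hence at some vector of
  \<open>M\<close>.\<close>

lemma spanning_matrix:
  fixes M :: "'a::field vec set"
  assumes span: "\<And>l. l \<in> carrier_vec n \<Longrightarrow> (\<And>v. v \<in> M \<Longrightarrow> l \<bullet> v = 0) \<Longrightarrow> l = 0\<^sub>v n"
    and M: "M \<subseteq> carrier_vec n"
  obtains V where "V \<in> carrier_mat n n" "det V \<noteq> 0" "\<And>j. j < n \<Longrightarrow> col V j \<in> M"
proof -
  have "\<exists>V \<in> carrier_mat n n. det V \<noteq> 0 \<and> (\<forall>j<k. col V j \<in> M)" if "k \<le> n" for k
    using that
  proof (induction k)
    case 0
    show ?case by (intro bexI[of _ "1\<^sub>m n"]) auto
  next
    case (Suc k)
    then obtain V where V: "V \<in> carrier_mat n n" "det V \<noteq> 0" "\<forall>j<k. col V j \<in> M" and k: "k < n" by auto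
    define W where "W = (\<lambda>v. mat n n (\<lambda>(i, j). if j = k then v $ i else V $$ (i, j)))"
    define l where "l = vec n (\<lambda>i. cofactor V i k)"
    have W: "W v \<in> carrier_mat n n" for v by (simp add: W_def)
    have cof: "cofactor (W v) i k = cofactor V i k" if "i < n" for v i
    proof -
      have "mat_delete (W v) i k = mat_delete V i k"
        using V k that by (intro eq_matI) (auto simp: mat_delete_def W_def)
      then show ?thesis by (simp add: cofactor_def)
    qed
    have det: "det (W v) = l \<bullet> v" if "v \<in> carrier_vec n" for v
    proof -
      have "det (W v) = (\<Sum>i<n. W v $$ (i, k) * cofactor (W v) i k)"
        by (rule laplace_expansion_column[OF W k])
      also have "\<dots> = (\<Sum>i<n. l $ i * v $ i)"
        using k by (intro sum.cong) (auto simp: W_def l_def cof[unfolded W_def] mult.commute)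
      finally show ?thesis using that by (simp add: scalar_prod_def lessThan_atLeast0)
    qed
    have "W (col V k) = V" using V k by (intro eq_matI) (auto simp: W_def)
    then have "l \<bullet> col V k \<noteq> 0" using det[of "col V k"] V k by auto
    then have "l \<noteq> 0\<^sub>v n" using V k by auto
    moreover have "l \<in> carrier_vec n" by (simp add: l_def)
    ultimately obtain v where v: "v \<in> M" "l \<bullet> v \<noteq> 0" using span by blast
    have "det (W v) \<noteq> 0" using det[of v] v M by auto
    moreover have "col (W v) j \<in> M" if "j < Suc k" for j
    proof (cases "j = k")
      case True
      then have "col (W v) j = v" using v(1) M k by (intro eq_vecI) (auto simp: W_def)
      then show ?thesis using v(1) by simp
    next
      case False
      then have "col (W v) j = col V j" using that k V(1) by (intro eq_vecI) (auto simp: W_def)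
      then show ?thesis using V(3) that False by simp
    qed
    ultimately show ?case using W by blast
  qed
  then show ?thesis using that by blast
qed

context imaginary_quadratic begin

definition integral_mat :: "complex mat \<Rightarrow> bool" where
  "integral_mat A \<longleftrightarrow> (\<forall>i<dim_row A. \<forall>j<dim_col A. A $$ (i, j) \<in> \<O>)"

lemma integral_matD: "integral_mat A \<Longrightarrow> i < dim_row A \<Longrightarrow> j < dim_col A \<Longrightarrow> A $$ (i, j) \<in> \<O>"
  by (simp add: integral_mat_def)

lemma integral_mat_mult: "integral_mat A \<Longrightarrow> integral_mat B \<Longrightarrow> dim_col A = dim_row B \<Longrightarrow> integral_mat (A * B)"
  by (auto simp: integral_mat_def scalar_prod_def intro!: O_sum O_mult)

lemma integral_mat_add: "integral_mat A \<Longrightarrow> integral_mat B \<Longrightarrow> dim_row A = dim_row B \<Longrightarrow>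
    dim_col A = dim_col B \<Longrightarrow> integral_mat (A + B)"
  by (auto simp: integral_mat_def)

lemma integral_mat_one: "integral_mat (1\<^sub>m k)"
  by (auto simp: integral_mat_def)

lemma integral_det: assumes "integral_mat A" shows "det A \<in> \<O>"
proof -
  have "A $$ (i, p i) \<in> \<O>" if "p permutes {0..<dim_row A}" "i < dim_row A" "dim_row A = dim_col A" for p i
    using that permutes_in_image[OF that(1), of i] assms by (simp add: integral_mat_def)
  then show ?thesis
    unfolding det_def by (auto intro!: O_sum O_mult O_prod simp: sign_def)
qed

lemma integral_adj: "integral_mat A \<Longrightarrow> integral_mat (adj_mat A)"
  unfolding integral_mat_def
  by (auto simp: adj_mat_def cofactor_def intro!: O_mult O_power integral_det[unfolded integral_mat_def])
     (auto simp: mat_delete_def)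

end

context bianchi_lattice begin

abbreviation G :: "complex mat monoid" where "G \<equiv> SL n d"

lemma SL_iff: "A \<in> carrier G \<longleftrightarrow> A \<in> carrier_mat n n \<and> integral_mat A \<and> det A = 1"
  by (auto simp: SL_def integral_mat_def elements_mat_def UN_subset_iff image_subset_iff)

lemma SL_mult: "A \<in> carrier G \<Longrightarrow> B \<in> carrier G \<Longrightarrow> A * B \<in> carrier G"
  by (auto simp: SL_iff det_mult intro: integral_mat_mult)

lemma SL_one: "1\<^sub>m n \<in> carrier G"
  by (simp add: SL_iff integral_mat_one)

text \<open>For determinant 1 the adjugate is the inverse and is visibly integral; it serves as the
  inverse throughout.\<close>

lemma SL_adj: assumes "A \<in> carrier G"
  shows "adj_mat A \<in> carrier G" "A * adj_mat A = 1\<^sub>m n" "adj_mat A * A = 1\<^sub>m n"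
proof -
  have A: "A \<in> carrier_mat n n" "integral_mat A" "det A = 1" using assms SL_iff by auto
  show 1: "A * adj_mat A = 1\<^sub>m n" "adj_mat A * A = 1\<^sub>m n"
    using adj_mat[OF A(1)] A(3) by auto
  have "det A * det (adj_mat A) = 1" using 1(1) det_mult[OF A(1) adj_mat(1)[OF A(1)]] by simp
  then show "adj_mat A \<in> carrier G"
    using A adj_mat(1)[OF A(1)] integral_adj[OF A(2)] by (simp add: SL_iff)
qed

lemma mult_mat_vec_lattice:
  assumes "A \<in> carrier_mat n n" "integral_mat A" "v \<in> lattice" shows "A *\<^sub>v v \<in> lattice"
  using assms unfolding lattice_def integral_mat_def
  by (auto simp: scalar_prod_def intro!: O_sum O_mult)

lemma psd_columns_le:
  assumes q: "psd_form q" and V: "V \<in> carrier_mat n n" "\<And>j. j < n \<Longrightarrow> col V j \<in> lattice"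
    and a: "a \<in> lattice"
  shows "q (V *\<^sub>v a) \<le> 2 ^ n * (\<Sum>j<n. (cmod (a $ j))\<^sup>2 * q (col V j))"
proof -
  have "V *\<^sub>v a = vec n (\<lambda>r. \<Sum>j<n. (a $ j \<cdot>\<^sub>v col V j) $ r)"
    using V(1) a by (intro eq_vecI) (auto simp: scalar_prod_def lessThan_atLeast0 mult.commute intro!: sum.cong)
  then have "q (V *\<^sub>v a) \<le> 2 ^ n * (\<Sum>j<n. q (a $ j \<cdot>\<^sub>v col V j))"
    using psd_sum_le[OF q, of n "\<lambda>j. a $ j \<cdot>\<^sub>v col V j"] V(2) lattice_index[OF a] lattice_smult by simp
  also have "(\<Sum>j<n. q (a $ j \<cdot>\<^sub>v col V j)) = (\<Sum>j<n. (cmod (a $ j))\<^sup>2 * q (col V j))"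
    using V(2) lattice_index[OF a] by (intro sum.cong refl psd_smult[OF q]) auto
  finally show ?thesis .
qed

lemma columns_integral:
  assumes "V \<in> carrier_mat n n" "\<And>j. j < n \<Longrightarrow> col V j \<in> lattice" shows "integral_mat V"
  unfolding integral_mat_def
proof (intro allI impI)
  fix i j assume "i < dim_row V" "j < dim_col V"
  then show "V $$ (i, j) \<in> \<O>" using lattice_index[OF assms(2), of j i] assms(1) by auto
qed

text \<open>The sublattice spanned by linearly independent minimal vectors has bounded index: among the
  multiples of any lattice vector one is, by simultaneous approximation of its coordinates, so
  close to the sublattice that it lies in it.\<close>

lemma minimal_vectors_index:
  obtains D :: nat where "D \<ge> 1"
    "\<And>f V w. f \<in> ryshkov \<Longrightarrow> V \<in> carrier_mat n n \<Longrightarrow> det V \<noteq> 0 \<Longrightarrow>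
      (\<And>j. j < n \<Longrightarrow> col V j \<in> min_vectors f) \<Longrightarrow> w \<in> lattice \<Longrightarrow>
      \<exists>a \<in> lattice. of_nat D \<cdot>\<^sub>v w = V *\<^sub>v a"
proof -
  \<comment> \<open>Small enough for \<open>2 ^ n * n * e\<^sup>2 < 1\<close>, the strict inequality
    that will force the remainder to vanish.\<close>
  define e :: real where "e = 1 / (2 ^ n * real (Suc n))"
  have e: "e > 0" "2 ^ n * (real n * e\<^sup>2) < 1"
  proof -
    have "1 \<le> 2 ^ n * real (Suc n)" by (intro mult_ge1_I) auto
    then have "e \<le> 1" unfolding e_def by simp
    show "e > 0" by (simp add: e_def)
    have "2 ^ n * real n * e = real n / real (Suc n)" unfolding e_def by simp
    then have "2 ^ n * real n * e < 1" by simp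
    moreover have "2 ^ n * real n * e * e \<le> 2 ^ n * real n * e * 1"
      using \<open>e \<le> 1\<close> \<open>e > 0\<close> by (intro mult_left_mono) auto
    ultimately have "2 ^ n * real n * e * e < 1" by linarith
    then show "2 ^ n * (real n * e\<^sup>2) < 1" by (simp add: power2_eq_square algebra_simps)
  qed
  obtain K :: nat where K: "K \<ge> 1" "\<And>u :: nat \<Rightarrow> complex. \<exists>t \<in> {1..K}. \<exists>a. \<forall>i<n.
    a i \<in> \<O> \<and> cmod (of_nat t * u i - a i) \<le> e"
    by (fact simultaneous_approximation[OF e(1)])
  have "\<exists>a \<in> lattice. of_nat (fact K) \<cdot>\<^sub>v w = V *\<^sub>v a"
    if f: "f \<in> ryshkov" and V: "V \<in> carrier_mat n n" "det V \<noteq> 0"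
      and cols: "\<And>j. j < n \<Longrightarrow> col V j \<in> min_vectors f" and w: "w \<in> lattice" for f V w
  proof -
    note psd = ryshkov_psd[OF f]
    have colsL: "\<And>j. j < n \<Longrightarrow> col V j \<in> lattice" and cols1: "\<And>j. j < n \<Longrightarrow> f (col V j) = 1"
      using cols by (auto simp: min_vectors_def)
    have intV: "integral_mat V" by (rule columns_integral[OF V(1) colsL])
    define \<delta> where "\<delta> = det V"
    have \<delta>: "\<delta> \<in> \<O>" "\<delta> \<noteq> 0" using integral_det[OF intV] V(2) by (simp_all add: \<delta>_def)
    \<comment> \<open>Cramer's rule: the quotients of the entries of \<open>b\<close> by
      \<open>\<delta>\<close> are the coordinates of \<open>w\<close> in the basis of
      columns.\<close>
    define b where "b = adj_mat V *\<^sub>v w"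
    have adj: "adj_mat V \<in> carrier_mat n n" "V * adj_mat V = \<delta> \<cdot>\<^sub>m 1\<^sub>m n"
      using adj_mat[OF V(1)] by (simp_all add: \<delta>_def)
    have b: "b \<in> lattice"
      unfolding b_def by (intro mult_mat_vec_lattice adj integral_adj intV w)
    have Vb: "V *\<^sub>v b = \<delta> \<cdot>\<^sub>v w"
    proof -
      have "V *\<^sub>v b = (V * adj_mat V) *\<^sub>v w"
        unfolding b_def using assoc_mult_mat_vec[OF V(1) adj(1) lattice_carrier[OF w]] by simp
      also have "\<dots> = \<delta> \<cdot>\<^sub>v (1\<^sub>m n *\<^sub>v w)"
        unfolding adj(2) using lattice_carrier[OF w] by (intro eq_vecI) auto
      finally show ?thesis using lattice_carrier[OF w] by simp
    qed
    obtain t a where t: "t \<in> {1..K}" and a: "\<And>i. i < n \<Longrightarrow> a i \<in> \<O>"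
        "\<And>i. i < n \<Longrightarrow> cmod (of_nat t * (b $ i / \<delta>) - a i) \<le> e"
      using K(2)[of "\<lambda>i. b $ i / \<delta>"] by blast
    define x where "x = vec n a"
    have x: "x \<in> lattice" unfolding x_def using a(1) by (rule lattice_vec)
    have Vx: "V *\<^sub>v x \<in> lattice" by (rule mult_mat_vec_lattice[OF V(1) intV x])
    \<comment> \<open>The remainder is a lattice vector, yet \<open>\<delta> y = V r\<close> with
      all entries of \<open>r\<close> small, so its value is below 1 and it must be zero.\<close>
    define y where "y = of_nat t \<cdot>\<^sub>v w - V *\<^sub>v x"
    have y: "y \<in> lattice" unfolding y_def using w Vx by (intro lattice_diff lattice_smult) auto
    define r where "r = of_nat t \<cdot>\<^sub>v b - \<delta> \<cdot>\<^sub>v x"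
    have r: "r \<in> lattice" unfolding r_def using b x \<delta> by (intro lattice_diff lattice_smult) auto
    have yr: "\<delta> \<cdot>\<^sub>v y = V *\<^sub>v r"
    proof -
      note c = lattice_carrier[OF b] lattice_carrier[OF x] lattice_carrier[OF w]
      have "V *\<^sub>v r = of_nat t \<cdot>\<^sub>v (V *\<^sub>v b) - \<delta> \<cdot>\<^sub>v (V *\<^sub>v x)"
        unfolding r_def using c V(1)
        by (simp add: mult_minus_distrib_mat_vec[OF V(1)] mult_mat_vec[OF V(1)])
      also have "\<dots> = \<delta> \<cdot>\<^sub>v y" unfolding Vb y_def using c V(1) Vx
        by (intro eq_vecI) (auto simp: algebra_simps)
      finally show ?thesis ..
    qed
    have ri: "(cmod (r $ j))\<^sup>2 \<le> (cmod \<delta>)\<^sup>2 * e\<^sup>2" if j: "j < n" for j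
    proof -
      have "r $ j = \<delta> * (of_nat t * (b $ j / \<delta>) - a j)"
        using j b \<delta>(2) by (simp add: r_def x_def field_simps)
      then have "cmod (r $ j) \<le> cmod \<delta> * e" using a(2)[OF j] by (simp add: norm_mult mult_left_mono)
      then show ?thesis by (simp add: power_mono flip: power_mult_distrib)
    qed
    have "y = 0\<^sub>v n"
    proof (rule ccontr)
      assume "y \<noteq> 0\<^sub>v n"
      then have fy: "1 \<le> f y" using ryshkov_ge_1[OF f y] by simp
      have "(cmod \<delta>)\<^sup>2 * 1 \<le> (cmod \<delta>)\<^sup>2 * f y" using fy by (intro mult_left_mono) auto
      also have "\<dots> = f (V *\<^sub>v r)" using psd_smult[OF psd \<delta>(1) y] yr by simp
      also have "\<dots> \<le> 2 ^ n * (\<Sum>j<n. (cmod (r $ j))\<^sup>2 * f (col V j))"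
        by (rule psd_columns_le[OF psd V(1) colsL r])
      also have "\<dots> \<le> 2 ^ n * (\<Sum>j<n. (cmod \<delta>)\<^sup>2 * e\<^sup>2)"
        using ri cols1 by (intro mult_left_mono sum_mono) auto
      also have "\<dots> = (cmod \<delta>)\<^sup>2 * (2 ^ n * (real n * e\<^sup>2))" by simp
      also have "\<dots> < (cmod \<delta>)\<^sup>2 * 1" using e(2) \<delta>(2) by (intro mult_strict_left_mono) auto
      finally show False by simp
    qed
    then have tw: "of_nat t \<cdot>\<^sub>v w = V *\<^sub>v x"
    proof -
      have "(of_nat t \<cdot>\<^sub>v w) $ i = (V *\<^sub>v x) $ i" if "i < n" for i
        using arg_cong[OF \<open>y = 0\<^sub>v n\<close>, of "\<lambda>u. u $ i"] that w Vx V(1) unfolding y_def by simp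
      then show ?thesis using w Vx V(1) by (intro eq_vecI) auto
    qed
    \<comment> \<open>The multiplier \<open>t\<close> varies with the vector but never exceeds
      \<open>K\<close>; the factorial of \<open>K\<close> works for all forms, bases and vectors at
      once.\<close>
    have "t dvd fact K" using t by (intro dvd_fact) auto
    then obtain s where s: "fact K = t * s" by (elim dvdE)
    have "of_nat (fact K) \<cdot>\<^sub>v w = of_nat s \<cdot>\<^sub>v (of_nat t \<cdot>\<^sub>v w)"
      unfolding s by (simp add: smult_smult_assoc mult.commute)
    also have "\<dots> = V *\<^sub>v (of_nat s \<cdot>\<^sub>v x)"
      unfolding tw using mult_mat_vec[OF V(1) lattice_carrier[OF x]] by simp
    finally show ?thesis using x by (intro bexI[of _ "of_nat s \<cdot>\<^sub>v x"] lattice_smult) auto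
  qed
  moreover have "(fact K :: nat) \<ge> 1" by (simp add: Suc_leI)
  ultimately show ?thesis by (rule that[rotated])
qed

section \<open>Finiteness modulo \<open>SL\<^sub>n\<close>\<close>

definition act :: "complex mat \<Rightarrow> (complex vec \<Rightarrow> real) \<Rightarrow> complex vec \<Rightarrow> real" where
  "act g q = (\<lambda>v. if v \<in> lattice then q (g *\<^sub>v v) else 0)"

lemma SL_carrier: "g \<in> carrier G \<Longrightarrow> g \<in> carrier_mat n n" by (simp add: SL_iff)

lemma SL_lattice: "g \<in> carrier G \<Longrightarrow> v \<in> lattice \<Longrightarrow> g *\<^sub>v v \<in> lattice"
  by (auto simp: SL_iff intro: mult_mat_vec_lattice)

lemma SL_adj_vec:
  assumes "g \<in> carrier G" "v \<in> lattice"
  shows "adj_mat g *\<^sub>v (g *\<^sub>v v) = v" "g *\<^sub>v (adj_mat g *\<^sub>v v) = v"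
  using SL_adj[OF assms(1)] lattice_carrier[OF assms(2)]
    assoc_mult_mat_vec[OF SL_carrier[OF SL_adj(1)[OF assms(1)]] SL_carrier[OF assms(1)] lattice_carrier[OF assms(2)]]
    assoc_mult_mat_vec[OF SL_carrier[OF assms(1)] SL_carrier[OF SL_adj(1)[OF assms(1)]] lattice_carrier[OF assms(2)]]
  by simp_all

lemma act_psd: assumes g: "g \<in> carrier G" and q: "psd_form q" shows "psd_form (act g q)"
proof -
  have "act g q (v + w) + act g q (v - w) = 2 * act g q v + 2 * act g q w"
    if v: "v \<in> lattice" and w: "w \<in> lattice" for v w
    using psd_parallelogram[OF q SL_lattice[OF g v] SL_lattice[OF g w]] lattice_carrier[OF v]
      lattice_carrier[OF w] SL_carrier[OF g] lattice_add[OF v w] lattice_diff[OF v w] v w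
    by (simp add: act_def mult_add_distrib_mat_vec mult_minus_distrib_mat_vec)
  moreover have "act g q (c \<cdot>\<^sub>v v) = (cmod c)\<^sup>2 * act g q v" if "c \<in> \<O>" "v \<in> lattice" for c v
    using psd_smult[OF q that(1) SL_lattice[OF g that(2)]] lattice_smult[OF that] that
      mult_mat_vec[OF SL_carrier[OF g] lattice_carrier[OF that(2)]]
    by (simp add: act_def)
  moreover have "0 \<le> act g q v" "v \<notin> lattice \<Longrightarrow> act g q v = 0" for v
    using psd_nonneg[OF q] by (simp_all add: act_def)
  ultimately show ?thesis unfolding psd_form_def by blast
qed

lemma act_ryshkov: assumes g: "g \<in> carrier G" and q: "q \<in> ryshkov" shows "act g q \<in> ryshkov"
proof -
  have "1 \<le> act g q v" if v: "v \<in> lattice" "v \<noteq> 0\<^sub>v n" for v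
  proof -
    have "g *\<^sub>v v \<noteq> 0\<^sub>v n"
    proof
      assume "g *\<^sub>v v = 0\<^sub>v n"
      then have "adj_mat g *\<^sub>v 0\<^sub>v n = v" using SL_adj_vec(1)[OF g v(1)] by simp
      moreover have "adj_mat g *\<^sub>v 0\<^sub>v n = 0\<^sub>v n"
        using SL_carrier[OF SL_adj(1)[OF g]] by (intro eq_vecI) auto
      ultimately show False using v(2) by simp
    qed
    then show ?thesis using ryshkov_ge_1[OF q SL_lattice[OF g v(1)]] v(1) by (simp add: act_def)
  qed
  then show ?thesis using act_psd[OF g ryshkov_psd[OF q]] by (simp add: ryshkov_def)
qed

lemma act_mult:
  assumes "g \<in> carrier G" "h \<in> carrier G" shows "act (g * h) q = act h (act g q)"
proof
  fix v show "act (g * h) q v = act h (act g q) v"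
    using assoc_mult_mat_vec[OF SL_carrier[OF assms(1)] SL_carrier[OF assms(2)]] SL_lattice[OF assms(2)]
      lattice_carrier
    by (simp add: act_def)
qed

lemma act_one: assumes "\<And>v. v \<notin> lattice \<Longrightarrow> q v = 0" shows "act (1\<^sub>m n) q = q"
proof
  fix v show "act (1\<^sub>m n) q v = q v"
    using assms[of v] lattice_carrier[of v] by (simp add: act_def)
qed

text \<open>Stated for functions vanishing off the lattice, since \<open>act_extreme\<close> applies
  it to a perturbation that may take both signs.\<close>

lemma act_adj:
  assumes "g \<in> carrier G" "\<And>v. v \<notin> lattice \<Longrightarrow> q v = 0"
  shows "act (adj_mat g) (act g q) = q" "act g (act (adj_mat g) q) = q"
proof -
  have one: "act (1\<^sub>m n) q = q" using act_one assms(2) by blast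
  show "act (adj_mat g) (act g q) = q"
    using act_mult[OF assms(1) SL_adj(1)[OF assms(1)], of q] unfolding SL_adj(2)[OF assms(1)] one by (rule sym)
  show "act g (act (adj_mat g) q) = q"
    using act_mult[OF SL_adj(1)[OF assms(1)] assms(1), of q] unfolding SL_adj(3)[OF assms(1)] one by (rule sym)
qed

lemma act_adj_psd:
  assumes "g \<in> carrier G" "psd_form q"
  shows "act (adj_mat g) (act g q) = q" "act g (act (adj_mat g) q) = q"
  using act_adj[OF assms(1)] psd_outside[OF assms(2)] by blast+

lemma act_linear: "act g (\<lambda>v. a * p v + b * q v) = (\<lambda>v. a * act g p v + b * act g q v)"
  by (auto simp: act_def)

text \<open>The inverse substitution carries a perturbation of the translate to a perturbation of
  \<open>f\<close> inside the polyhedron.\<close>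

lemma act_extreme:
  assumes g: "g \<in> carrier G" and f: "f \<in> ryshkov" "extreme_form f" shows "extreme_form (act g f)"
  unfolding extreme_form_def
proof (intro allI impI, elim conjE)
  fix h assume h: "(\<lambda>v. act g f v + h v) \<in> ryshkov" "(\<lambda>v. act g f v - h v) \<in> ryshkov"
  have out: "h v = 0" if "v \<notin> lattice" for v
    using psd_outside[OF ryshkov_psd[OF h(1)] that] that by (simp add: act_def)
  let ?h = "act (adj_mat g) h"
  have 1: "act (adj_mat g) (\<lambda>v. act g f v + h v) = (\<lambda>v. f v + ?h v)"
    using act_linear[of "adj_mat g" 1 "act g f" 1 h] act_adj_psd[OF g ryshkov_psd[OF f(1)]] by simp
  have 2: "act (adj_mat g) (\<lambda>v. act g f v - h v) = (\<lambda>v. f v - ?h v)"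
    using act_linear[of "adj_mat g" 1 "act g f" "-1" h] act_adj_psd[OF g ryshkov_psd[OF f(1)]] by simp
  have "(\<lambda>v. f v + ?h v) \<in> ryshkov" "(\<lambda>v. f v - ?h v) \<in> ryshkov"
    using act_ryshkov[OF SL_adj(1)[OF g] h(1)] act_ryshkov[OF SL_adj(1)[OF g] h(2)]
    unfolding 1 2 .
  then have "?h = (\<lambda>_. 0)" using f(2) unfolding extreme_form_def by simp
  then have "act g ?h = (\<lambda>_. 0)" by (auto simp: act_def)
  then show "h = (\<lambda>_. 0)" using act_adj(2)[OF g out] by simp
qed

lemma act_dual_cone:
  assumes g: "g \<in> carrier G" and \<phi>: "\<phi> \<in> dual_cone" shows "(\<lambda>q. \<phi> (act g q)) \<in> dual_cone"
proof -
  have "continuous_on UNIV (\<lambda>q. act g q v)" for v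
    by (cases "v \<in> lattice") (simp_all add: act_def)
  then have "continuous_on UNIV (act g)" by (rule continuous_on_coordinatewise_then_product)
  then have "continuous_on UNIV (\<lambda>q. \<phi> (act g q))"
    using \<phi> continuous_on_compose2[of UNIV \<phi> UNIV "act g"] by (simp add: dual_cone_def)
  moreover have "\<phi> (act g (\<lambda>v. a * p v + b * q v)) = a * \<phi> (act g p) + b * \<phi> (act g q)" for a b p q
    using dual_cone_comb[OF \<phi>] by (simp add: act_linear)
  moreover have "\<exists>c>0. \<forall>q. psd_form q \<longrightarrow> c * q v \<le> \<phi> (act g q)" if v: "v \<in> lattice" for v
  proof -
    \<comment> \<open>The constant at \<open>v\<close> is the one that \<open>\<phi>\<close> has at
      the preimage of \<open>v\<close>, because \<open>act g q\<close> takes there the value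
      \<open>q v\<close>.\<close>
    have w: "adj_mat g *\<^sub>v v \<in> lattice" by (rule SL_lattice[OF SL_adj(1)[OF g] v])
    then have "\<exists>c>0. \<forall>q. psd_form q \<longrightarrow> c * q (adj_mat g *\<^sub>v v) \<le> \<phi> q" using \<phi> by (simp add: dual_cone_def)
    then obtain c where c: "c > 0" "\<forall>q. psd_form q \<longrightarrow> c * q (adj_mat g *\<^sub>v v) \<le> \<phi> q" by blast
    have "c * q v \<le> \<phi> (act g q)" if "psd_form q" for q
      using c(2)[rule_format, OF act_psd[OF g that]] w SL_adj_vec(2)[OF g v] by (simp add: act_def)
    then show ?thesis using c(1) by blast
  qed
  ultimately show ?thesis unfolding dual_cone_def by blast
qed

lemma act_minimizes:
  assumes g: "g \<in> carrier G" and f: "minimizes \<phi> f"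
  shows "minimizes (\<lambda>q. \<phi> (act (adj_mat g) q)) (act g f)"
  using f act_ryshkov[OF g] act_ryshkov[OF SL_adj(1)[OF g]] act_adj_psd(1)[OF g ryshkov_psd]
  unfolding minimizes_def by simp

section \<open>Finitely many orbits of perfect forms\<close>

text \<open>The functional is the source of the basis of minimal vectors in
  \<open>minimal_basis\<close>; extremality is what bounds the number of forms.\<close>

definition perfect_forms :: "(complex vec \<Rightarrow> real) set" where
  "perfect_forms = {f. extreme_form f \<and> (\<exists>\<phi> \<in> dual_cone. minimizes \<phi> f)}"

lemma perfect_ryshkov: "f \<in> perfect_forms \<Longrightarrow> f \<in> ryshkov"
  by (auto simp: perfect_forms_def minimizes_def)

lemma act_perfect:
  assumes g: "g \<in> carrier G" and f: "f \<in> perfect_forms" shows "act g f \<in> perfect_forms"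
proof -
  obtain \<phi> where "\<phi> \<in> dual_cone" "minimizes \<phi> f" using f by (auto simp: perfect_forms_def)
  then have "\<exists>\<phi> \<in> dual_cone. minimizes \<phi> (act g f)"
    using act_minimizes[OF g] act_dual_cone[OF SL_adj(1)[OF g]] by blast
  then show ?thesis using act_extreme[OF g perfect_ryshkov[OF f]] f by (simp add: perfect_forms_def)
qed

lemma minimal_basis:
  assumes "\<phi> \<in> dual_cone" "minimizes \<phi> f"
  obtains V where "V \<in> carrier_mat n n" "det V \<noteq> 0" "\<And>j. j < n \<Longrightarrow> col V j \<in> min_vectors f"
proof -
  have "min_vectors f \<subseteq> carrier_vec n" using lattice_carrier by (auto simp: min_vectors_def)
  then show ?thesis using spanning_matrix[of n "min_vectors f"] min_vectors_span[OF assms] that by blast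
qed

definition scaled_inverse :: "nat \<Rightarrow> complex mat \<Rightarrow> complex mat \<Rightarrow> bool" where
  "scaled_inverse D V A \<longleftrightarrow> A \<in> carrier_mat n n \<and> integral_mat A \<and>
    V * A = of_nat D \<cdot>\<^sub>m 1\<^sub>m n \<and> A * V = of_nat D \<cdot>\<^sub>m 1\<^sub>m n"

text \<open>The columns of \<open>A\<close> are the coordinates of the multiples by \<open>D\<close>
  of the unit vectors, integral by \<open>minimal_vectors_index\<close>. One \<open>D\<close> serves
  all forms and bases.\<close>

lemma minimal_vectors_scaled_inverse:
  obtains D :: nat where "D \<ge> 1"
    "\<And>f V. f \<in> ryshkov \<Longrightarrow> V \<in> carrier_mat n n \<Longrightarrow> det V \<noteq> 0 \<Longrightarrow>
      (\<And>j. j < n \<Longrightarrow> col V j \<in> min_vectors f) \<Longrightarrow> \<exists>A. scaled_inverse D V A"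
proof -
  obtain D :: nat where D: "D \<ge> 1"
    "\<And>f V w. f \<in> ryshkov \<Longrightarrow> V \<in> carrier_mat n n \<Longrightarrow> det V \<noteq> 0 \<Longrightarrow>
      (\<And>j. j < n \<Longrightarrow> col V j \<in> min_vectors f) \<Longrightarrow> w \<in> lattice \<Longrightarrow>
      \<exists>a \<in> lattice. of_nat D \<cdot>\<^sub>v w = V *\<^sub>v a"
    by (fact minimal_vectors_index)
  have "\<exists>A. scaled_inverse D V A"
    if f: "f \<in> ryshkov" and V: "V \<in> carrier_mat n n" "det V \<noteq> 0"
      and cols: "\<And>j. j < n \<Longrightarrow> col V j \<in> min_vectors f" for f V
  proof -
    have "\<forall>i. \<exists>a. i < n \<longrightarrow> a \<in> lattice \<and> of_nat D \<cdot>\<^sub>v unit_vec n i = V *\<^sub>v a"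
      using D(2)[OF f V cols] lattice_unit by blast
    then obtain a where a: "\<And>i. i < n \<Longrightarrow> a i \<in> lattice"
        "\<And>i. i < n \<Longrightarrow> of_nat D \<cdot>\<^sub>v unit_vec n i = V *\<^sub>v a i" by metis
    define A where "A = mat n n (\<lambda>(r, i). a i $ r)"
    have A: "A \<in> carrier_mat n n" "integral_mat A"
      using a(1) lattice_index by (auto simp: A_def integral_mat_def)
    have cA: "col A i = a i" if "i < n" for i
      using that a(1)[OF that] by (intro eq_vecI) (auto simp: A_def)
    have VA: "V * A = of_nat D \<cdot>\<^sub>m 1\<^sub>m n"
    proof (rule eq_matI)
      fix i j assume "i < dim_row (of_nat D \<cdot>\<^sub>m 1\<^sub>m n :: complex mat)" "j < dim_col (of_nat D \<cdot>\<^sub>m 1\<^sub>m n :: complex mat)"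
      then have ij: "i < n" "j < n" by auto
      have "(V * A) $$ (i, j) = (V *\<^sub>v a j) $ i" using ij V(1) A(1) cA[OF ij(2)] by simp
      also have "\<dots> = (of_nat D \<cdot>\<^sub>v unit_vec n j) $ i" using a(2)[OF ij(2)] by simp
      finally show "(V * A) $$ (i, j) = (of_nat D \<cdot>\<^sub>m 1\<^sub>m n) $$ (i, j)" using ij by (auto simp: unit_vec_def)
    qed (use V A in auto)
    let ?B = "(1 / of_nat D) \<cdot>\<^sub>m A"
    have D0: "(of_nat D :: complex) \<noteq> 0" using D(1) by simp
    have "V * ?B = (1 / of_nat D) \<cdot>\<^sub>m (V * A)" by (rule mult_smult_distrib[OF V(1) A(1)])
    also have "\<dots> = 1\<^sub>m n" unfolding VA using D0 by (intro eq_matI) auto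
    finally have "?B * V = 1\<^sub>m n" using mat_mult_left_right_inverse[OF V(1), of ?B] A(1) by simp
    then have "of_nat D \<cdot>\<^sub>m (?B * V) = of_nat D \<cdot>\<^sub>m 1\<^sub>m n" by simp
    moreover have "of_nat D \<cdot>\<^sub>m (?B * V) = A * V"
      using V(1) A(1) D0 by (intro eq_matI) (auto simp: scalar_prod_def sum_distrib_left)
    ultimately show ?thesis using VA A unfolding scaled_inverse_def by auto
  qed
  then show ?thesis by (rule that[OF D(1)])
qed

text \<open>The multiple by \<open>D\<close> of a unit vector is a combination of minimal vectors,
  of value 1, with coefficients from a column of \<open>A\<close>. The resulting bound depends on
  \<open>A\<close> alone, hence is common to all forms sharing the basis.\<close>

lemma unit_vec_bound:
  assumes f: "f \<in> ryshkov" and V: "V \<in> carrier_mat n n" "\<And>j. j < n \<Longrightarrow> col V j \<in> min_vectors f"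
    and A: "scaled_inverse D V A" and D: "D \<ge> 1" and i: "i < n"
  shows "f (unit_vec n i) \<le> 2 ^ n * (\<Sum>j<n. \<Sum>k<n. (cmod (A $$ (j, k)))\<^sup>2)"
proof -
  note psd = ryshkov_psd[OF f]
  have A': "A \<in> carrier_mat n n" "integral_mat A" "V * A = of_nat D \<cdot>\<^sub>m 1\<^sub>m n"
    using A by (auto simp: scaled_inverse_def)
  have cA: "col A i \<in> lattice" using A' i by (auto simp: lattice_def integral_mat_def)
  have "V *\<^sub>v col A i = col (V * A) i" using V(1) A'(1) i by simp
  also have "\<dots> = of_nat D \<cdot>\<^sub>v unit_vec n i" unfolding A'(3) using i by (intro eq_vecI) (auto simp: unit_vec_def)
  finally have eq: "of_nat D \<cdot>\<^sub>v unit_vec n i = V *\<^sub>v col A i" ..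
  have "f (unit_vec n i) \<le> (real D)\<^sup>2 * f (unit_vec n i)"
    using D psd_nonneg[OF psd, of "unit_vec n i"] by (simp add: mult_le_cancel_right1 self_le_power)
  also have "\<dots> = f (V *\<^sub>v col A i)" using psd_smult[OF psd _ lattice_unit[OF i], of "of_nat D"] eq by simp
  also have "\<dots> \<le> 2 ^ n * (\<Sum>j<n. (cmod (col A i $ j))\<^sup>2 * f (col V j))"
    using V(2) by (intro psd_columns_le[OF psd V(1) _ cA]) (auto simp: min_vectors_def)
  also have "\<dots> = 2 ^ n * (\<Sum>j<n. (cmod (A $$ (j, i)))\<^sup>2)"
    using V(2) A'(1) i by (auto simp: min_vectors_def intro!: sum.cong)
  also have "\<dots> \<le> 2 ^ n * (\<Sum>j<n. \<Sum>k<n. (cmod (A $$ (j, k)))\<^sup>2)"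
    using i by (intro mult_left_mono sum_mono) (auto intro: member_le_sum)
  finally show ?thesis .
qed

text \<open>The class modulo \<open>D\<close>, recorded by reduced coordinates in order to have
  finitely many values.\<close>

definition residue :: "nat \<Rightarrow> complex \<Rightarrow> int \<times> int" where
  "residue D x = (SOME p. \<exists>a b. x = of_int a + of_int b * \<omega> \<and> p = (a mod int D, b mod int D))"

lemma residue_E:
  assumes "x \<in> \<O>"
  obtains a b where "x = of_int a + of_int b * \<omega>" "residue D x = (a mod int D, b mod int D)"
proof -
  have "\<exists>p a b. x = of_int a + of_int b * \<omega> \<and> p = (a mod int D, b mod int D)"
    using assms O_E by metis
  from someI_ex[OF this] show ?thesis using that unfolding residue_def by blast
qed

lemma residue_eq:
  assumes "x \<in> \<O>" "y \<in> \<O>" "residue D x = residue D y"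
  shows "\<exists>z \<in> \<O>. x - y = of_nat D * z"
proof -
  obtain a b where x: "x = of_int a + of_int b * \<omega>" "residue D x = (a mod int D, b mod int D)"
    using residue_E[OF assms(1)] by blast
  obtain a' b' where y: "y = of_int a' + of_int b' * \<omega>" "residue D y = (a' mod int D, b' mod int D)"
    using residue_E[OF assms(2)] by blast
  have "int D dvd a - a'" "int D dvd b - b'"
    using assms(3) x(2) y(2) by (simp_all add: mod_eq_dvd_iff)
  then obtain k l where "a - a' = int D * k" "b - b' = int D * l" by (elim dvdE)
  then have "a = a' + int D * k" "b = b' + int D * l" by simp_all
  then have "x - y = of_nat D * (of_int k + of_int l * \<omega>)"
    using x(1) y(1) by (simp add: algebra_simps)
  then show ?thesis using O_I by blast
qed

lemma residue_range: "D \<ge> 1 \<Longrightarrow> x \<in> \<O> \<Longrightarrow> residue D x \<in> {0..<int D} \<times> {0..<int D}"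
  by (rule residue_E[of x D]) auto

text \<open>Write \<open>V = W + D X\<close> with \<open>X\<close> integral. As \<open>A\<close> is
  \<open>D\<close> times the inverse of \<open>W\<close>, the quotient of \<open>V\<close> by
  \<open>W\<close> is \<open>1 + X A\<close>: integral, and of determinant 1.\<close>

lemma congruent_bases:
  assumes V: "V \<in> carrier_mat n n" "integral_mat V" and W: "W \<in> carrier_mat n n" "integral_mat W"
    and A: "scaled_inverse D W A" and det: "det V = det W" "det W \<noteq> 0"
    and res: "\<And>i j. i < n \<Longrightarrow> j < n \<Longrightarrow> residue D (V $$ (i, j)) = residue D (W $$ (i, j))"
  obtains g where "g \<in> carrier G" "g * W = V"
proof -
  have A': "A \<in> carrier_mat n n" "integral_mat A" "A * W = of_nat D \<cdot>\<^sub>m 1\<^sub>m n"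
    using A by (auto simp: scaled_inverse_def)
  define z where "z = (\<lambda>p. SOME z. z \<in> \<O> \<and> V $$ p - W $$ p = of_nat D * z)"
  have z: "z (i, j) \<in> \<O> \<and> V $$ (i, j) - W $$ (i, j) = of_nat D * z (i, j)" if "i < n" "j < n" for i j
  proof -
    have "\<exists>z. z \<in> \<O> \<and> V $$ (i, j) - W $$ (i, j) = of_nat D * z"
      using residue_eq[OF _ _ res[OF that]] integral_matD[OF V(2)] integral_matD[OF W(2)] V(1) W(1) that
      by auto
    from someI_ex[OF this] show ?thesis unfolding z_def .
  qed
  define X where "X = mat n n z"
  have X: "X \<in> carrier_mat n n" "integral_mat X" using z by (auto simp: X_def integral_mat_def)
  define g where "g = 1\<^sub>m n + X * A"
  have g: "g \<in> carrier_mat n n" "integral_mat g"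
    using X A' by (auto simp: g_def intro!: integral_mat_add integral_mat_mult integral_mat_one)
  have "g * W = 1\<^sub>m n * W + X * A * W"
    unfolding g_def using X(1) A'(1) W(1) by (intro add_mult_distrib_mat) auto
  also have "X * A * W = X * (A * W)" using X(1) A'(1) W(1) by (rule assoc_mult_mat)
  also have "\<dots> = of_nat D \<cdot>\<^sub>m X"
    unfolding A'(3) using X(1) mult_smult_distrib[OF X(1) one_carrier_mat] by simp
  also have "1\<^sub>m n * W + of_nat D \<cdot>\<^sub>m X = V"
  proof (rule eq_matI)
    fix i j assume "i < dim_row V" "j < dim_col V"
    then have ij: "i < n" "j < n" using V by auto
    have "V $$ (i, j) = W $$ (i, j) + of_nat D * z (i, j)" using z[OF ij] by (metis add.commute diff_add_cancel)
    then show "(1\<^sub>m n * W + of_nat D \<cdot>\<^sub>m X) $$ (i, j) = V $$ (i, j)"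
      using ij W(1) by (simp add: X_def)
  qed (use V X W in auto)
  finally have gW: "g * W = V" .
  then have "det g * det W = det W" using det_mult[OF g(1) W(1)] det by simp
  then have "det g = 1" using det(2) by simp
  then show ?thesis using that gW g by (simp add: SL_iff)
qed

lemma min_vectors_act:
  assumes g: "g \<in> carrier G" and W: "W \<in> carrier_mat n n" "integral_mat W" and j: "j < n"
    and c: "col (g * W) j \<in> min_vectors f"
  shows "col W j \<in> min_vectors (act g f)"
proof -
  have "col W j \<in> lattice" using W j by (auto simp: lattice_def integral_mat_def)
  moreover have "col (g * W) j = g *\<^sub>v col W j" using SL_carrier[OF g] W(1) j by simp
  ultimately show ?thesis using c by (simp add: min_vectors_def act_def)
qed

lemma min_basis_integral:
  "V \<in> carrier_mat n n \<Longrightarrow> (\<And>j. j < n \<Longrightarrow> col V j \<in> min_vectors f) \<Longrightarrow> integral_mat V"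
  by (rule columns_integral) (auto simp: min_vectors_def)

text \<open>Each perfect form gets a basis of minimal vectors. Bases with equal determinant and
  equal residues modulo \<open>D\<close> differ by a group element, and there are finitely many such
  invariants. Once the form is moved so that it shares the basis of a chosen representative,
  \<open>unit_vec_bound\<close> leaves finitely many possibilities.\<close>

lemma finite_perfect_orbits:
  obtains S where "finite S" "S \<subseteq> perfect_forms" "\<And>f. f \<in> perfect_forms \<Longrightarrow> \<exists>g \<in> carrier G. act g f \<in> S"
proof -
  obtain D :: nat where D: "D \<ge> 1"
    "\<And>f V. f \<in> ryshkov \<Longrightarrow> V \<in> carrier_mat n n \<Longrightarrow> det V \<noteq> 0 \<Longrightarrow>
      (\<And>j. j < n \<Longrightarrow> col V j \<in> min_vectors f) \<Longrightarrow> \<exists>A. scaled_inverse D V A"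
    by (fact minimal_vectors_scaled_inverse)
  define V where "V = (\<lambda>f. SOME V. V \<in> carrier_mat n n \<and> det V \<noteq> 0 \<and> (\<forall>j<n. col V j \<in> min_vectors f))"
  have V': "V f \<in> carrier_mat n n \<and> det (V f) \<noteq> 0 \<and> (\<forall>j<n. col (V f) j \<in> min_vectors f)"
    if f: "f \<in> perfect_forms" for f
  proof -
    obtain \<phi> where \<phi>: "\<phi> \<in> dual_cone" "minimizes \<phi> f" using f by (auto simp: perfect_forms_def)
    obtain W where "W \<in> carrier_mat n n" "det W \<noteq> 0" "\<And>j. j < n \<Longrightarrow> col W j \<in> min_vectors f"
      by (fact minimal_basis[OF \<phi>])
    then have "\<exists>V. V \<in> carrier_mat n n \<and> det V \<noteq> 0 \<and> (\<forall>j<n. col V j \<in> min_vectors f)" by blast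
    from someI_ex[OF this] show ?thesis unfolding V_def .
  qed
  then have V: "\<And>f. f \<in> perfect_forms \<Longrightarrow> V f \<in> carrier_mat n n"
    "\<And>f. f \<in> perfect_forms \<Longrightarrow> det (V f) \<noteq> 0"
    "\<And>f j. f \<in> perfect_forms \<Longrightarrow> j < n \<Longrightarrow> col (V f) j \<in> min_vectors f" by blast+
  have intV: "integral_mat (V f)" if "f \<in> perfect_forms" for f
    using min_basis_integral V(1,3) that by blast
  define A where "A = (\<lambda>f. SOME B. scaled_inverse D (V f) B)"
  have A: "scaled_inverse D (V f) (A f)" if "f \<in> perfect_forms" for f
    unfolding A_def
    using someI_ex[OF D(2)[OF perfect_ryshkov[OF that] V(1)[OF that] V(2)[OF that] V(3)[OF that]]] .
  \<comment> \<open>The determinants of \<open>V f\<close> and \<open>A f\<close> multiply to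
    \<open>D ^ n\<close>, and that of \<open>A f\<close> is a nonzero integral element, of modulus
    at least 1.\<close>
  have detV: "det (V f) \<in> {x \<in> \<O>. cmod x \<le> real D ^ n}" if f: "f \<in> perfect_forms" for f
  proof -
    have A': "A f \<in> carrier_mat n n" "integral_mat (A f)" "V f * A f = of_nat D \<cdot>\<^sub>m 1\<^sub>m n"
      using A[OF f] by (auto simp: scaled_inverse_def)
    have "det (V f) * det (A f) = of_nat D ^ n"
      using det_mult[OF V(1)[OF f] A'(1)] unfolding A'(3) by (simp add: det_smult)
    then have eq: "cmod (det (V f)) * cmod (det (A f)) = real D ^ n"
      by (metis norm_mult norm_of_nat norm_power)
    then have "det (A f) \<noteq> 0" using D(1) by auto
    then have "1 \<le> cmod (det (A f))" using O_norm_ge_1 integral_det A'(2) by blast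
    then have "cmod (det (V f)) * 1 \<le> real D ^ n" unfolding eq[symmetric] by (intro mult_left_mono) auto
    then show ?thesis using integral_det[OF intV[OF f]] by simp
  qed
  \<comment> \<open>Exactly the data that \<open>congruent_bases\<close> compares.\<close>
  define key where "key = (\<lambda>f. (det (V f), restrict (\<lambda>p. residue D (V f $$ p)) ({..<n} \<times> {..<n})))"
  have "key ` perfect_forms \<subseteq> {x \<in> \<O>. cmod x \<le> real D ^ n} \<times>
      PiE ({..<n} \<times> {..<n}) (\<lambda>_. {0..<int D} \<times> {0..<int D})"
  proof (intro image_subsetI)
    fix f assume f: "f \<in> perfect_forms"
    have "V f $$ p \<in> \<O>" if "p \<in> {..<n} \<times> {..<n}" for p
      using integral_matD[OF intV[OF f], of "fst p" "snd p"] V(1)[OF f] that by auto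
    then have res: "residue D (V f $$ p) \<in> {0..<int D} \<times> {0..<int D}" if "p \<in> {..<n} \<times> {..<n}" for p
      using residue_range[OF D(1)] that by blast
    show "key f \<in> {x \<in> \<O>. cmod x \<le> real D ^ n} \<times>
      PiE ({..<n} \<times> {..<n}) (\<lambda>_. {0..<int D} \<times> {0..<int D})"
      unfolding key_def
      by (intro SigmaI detV[OF f] restrict_PiE_iff[THEN iffD2] ballI res)
  qed
  then have finkey: "finite (key ` perfect_forms)"
    by (rule finite_subset) (intro finite_cartesian_product finite_O_bounded finite_PiE; simp)
  define U where "U = (\<lambda>f. 2 ^ n * (\<Sum>j<n. \<Sum>k<n. (cmod (A f $$ (j, k)))\<^sup>2))"
  define T where "T = (\<lambda>f. {h \<in> perfect_forms. \<forall>i<n. h (unit_vec n i) \<le> U f})"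
  define rep where "rep = inv_into perfect_forms key"
  have finT: "finite (T f)" for f
    by (rule finite_subset[OF _ finite_extreme_forms[of "U f"]])
       (auto simp: T_def perfect_forms_def minimizes_def)
  let ?S = "\<Union>\<kappa> \<in> key ` perfect_forms. T (rep \<kappa>)"
  have "\<exists>g \<in> carrier G. act g f \<in> ?S" if f: "f \<in> perfect_forms" for f
  proof -
    define h where "h = rep (key f)"
    have h: "h \<in> perfect_forms" "key h = key f"
      unfolding h_def rep_def
      using f inv_into_into[of "key f" key perfect_forms] f_inv_into_f[of "key f" key perfect_forms]
      by simp_all
    have "residue D (V f $$ (i, j)) = residue D (V h $$ (i, j))" if "i < n" "j < n" for i j
    proof -
      have "snd (key f) (i, j) = snd (key h) (i, j)" using h(2) by simp
      then show ?thesis using that by (simp add: key_def)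
    qed
    moreover have "det (V f) = det (V h)" using h(2) by (simp add: key_def)
    ultimately obtain g where g: "g \<in> carrier G" "g * V h = V f"
      using congruent_bases[OF V(1)[OF f] intV[OF f] V(1)[OF h(1)] intV[OF h(1)] A[OF h(1)] _ V(2)[OF h(1)]]
      by blast
    have gf: "act g f \<in> perfect_forms" by (rule act_perfect[OF g(1) f])
    have "col (V h) j \<in> min_vectors (act g f)" if "j < n" for j
      using min_vectors_act[OF g(1) V(1)[OF h(1)] intV[OF h(1)] that] V(3)[OF f that] g(2) by simp
    then have "act g f (unit_vec n i) \<le> U h" if "i < n" for i
      unfolding U_def
      using unit_vec_bound[OF perfect_ryshkov[OF gf] V(1)[OF h(1)] _ A[OF h(1)] D(1) that] by blast
    then have "act g f \<in> T h" using gf by (simp add: T_def)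
    then show ?thesis using g(1) f unfolding h_def by blast
  qed
  moreover have "finite ?S" using finkey finT by blast
  moreover have "?S \<subseteq> perfect_forms" unfolding T_def by blast
  ultimately show ?thesis using that by blast
qed

section \<open>Local finiteness of the cover\<close>

text \<open>Values at nonzero vectors are at least 1, so the mean equals 1 only where both values
  do. The midpoint thus yields a basis of minimal vectors common to both forms.\<close>

lemma minimizes_midpoint:
  assumes \<phi>: "\<phi> \<in> dual_cone" and f: "minimizes \<phi> f" "minimizes \<phi> g"
  shows "minimizes \<phi> (\<lambda>v. 1 / 2 * f v + 1 / 2 * g v)"
    "min_vectors (\<lambda>v. 1 / 2 * f v + 1 / 2 * g v) \<subseteq> min_vectors f \<inter> min_vectors g"
proof -
  let ?s = "\<lambda>v. 1 / 2 * f v + 1 / 2 * g v"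
  have fg: "f \<in> ryshkov" "g \<in> ryshkov" "\<phi> f = \<phi> g" using f by (auto simp: minimizes_def intro: antisym)
  have "psd_form ?s" by (rule psd_comb[OF ryshkov_psd[OF fg(1)] ryshkov_psd[OF fg(2)]]) auto
  moreover have "1 \<le> ?s v" if "v \<in> lattice" "v \<noteq> 0\<^sub>v n" for v
    using ryshkov_ge_1[OF fg(1) that] ryshkov_ge_1[OF fg(2) that] by simp
  ultimately have "?s \<in> ryshkov" by (simp add: ryshkov_def)
  moreover have "\<phi> ?s = \<phi> f" unfolding dual_cone_comb[OF \<phi>] using fg(3) by simp
  ultimately show "minimizes \<phi> ?s" using f by (simp add: minimizes_def)
  show "min_vectors ?s \<subseteq> min_vectors f \<inter> min_vectors g"
  proof
    fix v assume v: "v \<in> min_vectors ?s"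
    then have vL: "v \<in> lattice" and s: "1 / 2 * f v + 1 / 2 * g v = 1" by (auto simp: min_vectors_def)
    have "v \<noteq> 0\<^sub>v n" using s psd_0[OF ryshkov_psd[OF fg(1)]] psd_0[OF ryshkov_psd[OF fg(2)]] by auto
    then have "f v = 1" "g v = 1"
      using s ryshkov_ge_1[OF fg(1) vL] ryshkov_ge_1[OF fg(2) vL] by auto
    then show "v \<in> min_vectors f \<inter> min_vectors g" using vL by (simp add: min_vectors_def)
  qed
qed

text \<open>A neighbour shares with \<open>f\<close> a basis of minimal vectors. There are finitely
  many such bases, and each bounds the neighbour at the unit vectors by a constant of its
  own.\<close>

lemma finite_neighbours:
  assumes f: "f \<in> perfect_forms"
  shows "finite {g \<in> perfect_forms. \<exists>\<phi> \<in> dual_cone. minimizes \<phi> f \<and> minimizes \<phi> g}"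
proof -
  obtain D :: nat where D: "D \<ge> 1"
    "\<And>f V. f \<in> ryshkov \<Longrightarrow> V \<in> carrier_mat n n \<Longrightarrow> det V \<noteq> 0 \<Longrightarrow>
      (\<And>j. j < n \<Longrightarrow> col V j \<in> min_vectors f) \<Longrightarrow> \<exists>A. scaled_inverse D V A"
    by (fact minimal_vectors_scaled_inverse)
  let ?Vs = "{V \<in> carrier_mat n n. det V \<noteq> 0 \<and> (\<forall>j<n. col V j \<in> min_vectors f)}"
  have finM: "finite (min_vectors f)"
    by (rule finite_subset[OF _ finite_sublevel[OF perfect_ryshkov[OF f], of 1]]) (auto simp: min_vectors_def)
  have "?Vs \<subseteq> (\<lambda>c. mat n n (\<lambda>(i, j). c j $ i)) ` PiE {..<n} (\<lambda>_. min_vectors f)"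
  proof
    fix V assume V: "V \<in> ?Vs"
    then have "V = mat n n (\<lambda>(i, j). restrict (col V) {..<n} j $ i)" by (intro eq_matI) auto
    moreover have "restrict (col V) {..<n} \<in> PiE {..<n} (\<lambda>_. min_vectors f)" using V by auto
    ultimately show "V \<in> (\<lambda>c. mat n n (\<lambda>(i, j). c j $ i)) ` PiE {..<n} (\<lambda>_. min_vectors f)" by (rule image_eqI)
  qed
  then have finV: "finite ?Vs" by (rule finite_subset) (intro finite_imageI finite_PiE finM; simp)
  define A where "A = (\<lambda>V. SOME B. scaled_inverse D V B)"
  have A: "scaled_inverse D V (A V)" if "V \<in> ?Vs" for V
    unfolding A_def using that by (intro someI_ex[OF D(2)[OF perfect_ryshkov[OF f]]]) auto
  define U where "U = (\<lambda>V. 2 ^ n * (\<Sum>j<n. \<Sum>k<n. (cmod (A V $$ (j, k)))\<^sup>2))"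
  let ?T = "\<lambda>V. {h \<in> ryshkov. extreme_form h \<and> (\<forall>i<n. h (unit_vec n i) \<le> U V)}"
  have "g \<in> (\<Union>V \<in> ?Vs. ?T V)"
    if g: "g \<in> perfect_forms" and \<phi>: "\<phi> \<in> dual_cone" "minimizes \<phi> f" "minimizes \<phi> g" for g \<phi>
  proof -
    obtain V where V: "V \<in> carrier_mat n n" "det V \<noteq> 0"
        "\<And>j. j < n \<Longrightarrow> col V j \<in> min_vectors (\<lambda>v. 1 / 2 * f v + 1 / 2 * g v)"
      using minimal_basis[OF \<phi>(1) minimizes_midpoint(1)[OF \<phi>]] by blast
    then have Vs: "V \<in> ?Vs" and Vg: "\<And>j. j < n \<Longrightarrow> col V j \<in> min_vectors g"
      using minimizes_midpoint(2)[OF \<phi>] by blast+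
    have "g (unit_vec n i) \<le> U V" if "i < n" for i
      unfolding U_def using unit_vec_bound[OF perfect_ryshkov[OF g] V(1) Vg A[OF Vs] D(1) that] .
    then show ?thesis using Vs g perfect_ryshkov[OF g] by (auto simp: perfect_forms_def)
  qed
  then have "{g \<in> perfect_forms. \<exists>\<phi> \<in> dual_cone. minimizes \<phi> f \<and> minimizes \<phi> g} \<subseteq> (\<Union>V \<in> ?Vs. ?T V)"
    by blast
  moreover have "finite (\<Union>V \<in> ?Vs. ?T V)" using finV finite_extreme_forms by blast
  ultimately show ?thesis by (rule finite_subset)
qed

text \<open>Column \<open>j\<close> of \<open>g\<close> is a lattice vector whose
  \<open>f\<close>-value is that of \<open>h\<close> at unit vector \<open>j\<close>, so it lies in
  a finite sublevel set. With equal forms this says that stabilisers are finite.\<close>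

lemma finite_transporter:
  assumes f: "f \<in> ryshkov" and h: "h \<in> ryshkov"
  shows "finite {g \<in> carrier G. act g f = h}"
proof -
  define U where "U = (\<Sum>i<n. h (unit_vec n i))"
  let ?L = "{v \<in> lattice. f v \<le> U}"
  have "{g \<in> carrier G. act g f = h} \<subseteq> (\<lambda>c. mat n n (\<lambda>(i, j). c j $ i)) ` PiE {..<n} (\<lambda>_. ?L)"
  proof
    fix g assume "g \<in> {g \<in> carrier G. act g f = h}"
    then have g: "g \<in> carrier G" "act g f = h" by auto
    have gc: "g \<in> carrier_mat n n" "integral_mat g" using g(1) by (auto simp: SL_iff)
    have "col g j \<in> ?L" if j: "j < n" for j
    proof -
      have "g *\<^sub>v unit_vec n j = col g j" using gc(1) j by (intro eq_vecI) auto
      then have "f (col g j) = h (unit_vec n j)"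
        using g(2) lattice_unit[OF j] by (auto simp: act_def)
      also have "\<dots> \<le> U" unfolding U_def using j psd_nonneg[OF ryshkov_psd[OF h]] by (intro member_le_sum) auto
      finally show ?thesis using gc j by (auto simp: lattice_def integral_mat_def)
    qed
    then have "restrict (col g) {..<n} \<in> PiE {..<n} (\<lambda>_. ?L)" by auto
    moreover have "g = mat n n (\<lambda>(i, j). restrict (col g) {..<n} j $ i)" using gc(1) by (intro eq_matI) auto
    ultimately show "g \<in> (\<lambda>c. mat n n (\<lambda>(i, j). c j $ i)) ` PiE {..<n} (\<lambda>_. ?L)" by blast
  qed
  then show ?thesis by (rule finite_subset) (intro finite_imageI finite_PiE finite_sublevel[OF f]; simp)
qed

end

section \<open>The simplicial model\<close>

lemma uniform_positive_constant:
  fixes P :: "'a \<Rightarrow> real \<Rightarrow> bool"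
  assumes "finite A" "\<And>a. a \<in> A \<Longrightarrow> \<exists>c>0. P a c" "\<And>a c c'. P a c \<Longrightarrow> 0 < c' \<Longrightarrow> c' \<le> c \<Longrightarrow> P a c'"
  shows "\<exists>c>0. \<forall>a \<in> A. P a c"
  using assms(1,2)
proof (induction A rule: finite_induct)
  case empty
  show ?case by (intro exI[of _ 1]) simp
next
  case (insert x F)
  then obtain c c' where c: "c > 0" "\<forall>a \<in> F. P a c" "c' > 0" "P x c'" by blast
  then have "P x (min c c')" "\<forall>a \<in> F. P a (min c c')"
    using assms(3)[of x c' "min c c'"] assms(3)[of _ c "min c c'"] by simp_all
  then show ?case using c by (intro exI[of _ "min c c'"]) simp
qed

context bianchi_lattice begin

lemma SL_inverse_unique:
  assumes "A \<in> carrier G" "B \<in> carrier G" "A * B = 1\<^sub>m n" shows "adj_mat A = B"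
proof -
  note c = SL_carrier[OF assms(1)] SL_carrier[OF assms(2)] SL_carrier[OF SL_adj(1)[OF assms(1)]]
  have "adj_mat A = adj_mat A * (A * B)" using c assms(3) by simp
  also have "\<dots> = adj_mat A * A * B" using c by (intro assoc_mult_mat[symmetric])
  also have "\<dots> = B" using c SL_adj(3)[OF assms(1)] by simp
  finally show ?thesis .
qed

lemma adj_adj: "g \<in> carrier G \<Longrightarrow> adj_mat (adj_mat g) = g"
  by (rule SL_inverse_unique) (simp_all add: SL_adj)

lemma adj_mult:
  assumes "g \<in> carrier G" "h \<in> carrier G" shows "adj_mat (g * h) = adj_mat h * adj_mat g"
proof (rule SL_inverse_unique)
  note c = SL_carrier[OF assms(1)] SL_carrier[OF assms(2)] SL_carrier[OF SL_adj(1)[OF assms(1)]]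
    SL_carrier[OF SL_adj(1)[OF assms(2)]]
  have "g * h * (adj_mat h * adj_mat g) = g * (h * (adj_mat h * adj_mat g))"
    using c by (intro assoc_mult_mat) auto
  also have "h * (adj_mat h * adj_mat g) = h * adj_mat h * adj_mat g"
    using c by (intro assoc_mult_mat[symmetric]) auto
  finally show "g * h * (adj_mat h * adj_mat g) = 1\<^sub>m n" using c SL_adj assms by simp
qed (use assms SL_mult SL_adj in auto)

lemma SL_ops: "x \<otimes>\<^bsub>G\<^esub> y = x * y" "\<one>\<^bsub>G\<^esub> = 1\<^sub>m n"
  by (simp_all add: SL_def)

lemma SL_group: "group G"
proof (rule groupI, unfold SL_ops)
  fix x assume x: "x \<in> carrier G"
  show "\<exists>y \<in> carrier G. y * x = 1\<^sub>m n" using SL_adj(1,3)[OF x] by blast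
  show "1\<^sub>m n * x = x" by (rule left_mult_one_mat[OF SL_carrier[OF x]])
next
  fix x y z assume x: "x \<in> carrier G" "y \<in> carrier G" "z \<in> carrier G"
  show "x * y * z = x * (y * z)"
    by (rule assoc_mult_mat[OF SL_carrier[OF x(1)] SL_carrier[OF x(2)] SL_carrier[OF x(3)]])
qed (simp_all only: SL_mult SL_one)

lemma dual_cone_convex:
  assumes \<phi>: "\<phi> \<in> dual_cone" and \<psi>: "\<psi> \<in> dual_cone" and t: "t \<in> {0..1}"
  shows "(\<lambda>q. (1 - t) * \<phi> q + t * \<psi> q) \<in> dual_cone"
proof -
  have "continuous_on UNIV (\<lambda>q. (1 - t) * \<phi> q + t * \<psi> q)"
    using \<phi> \<psi> by (auto simp: dual_cone_def intro!: continuous_intros)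
  moreover have "(1 - t) * \<phi> (\<lambda>v. a * p v + b * q v) + t * \<psi> (\<lambda>v. a * p v + b * q v) =
      a * ((1 - t) * \<phi> p + t * \<psi> p) + b * ((1 - t) * \<phi> q + t * \<psi> q)" for a b p q
    unfolding dual_cone_comb[OF \<phi>] dual_cone_comb[OF \<psi>] by (simp add: algebra_simps)
  moreover have "\<exists>c>0. \<forall>q. psd_form q \<longrightarrow> c * q v \<le> (1 - t) * \<phi> q + t * \<psi> q" if v: "v \<in> lattice" for v
  proof -
    have "\<exists>c>0. \<forall>q. psd_form q \<longrightarrow> c * q v \<le> \<phi> q" "\<exists>c>0. \<forall>q. psd_form q \<longrightarrow> c * q v \<le> \<psi> q"
      using \<phi> \<psi> v by (simp_all add: dual_cone_def)
    then obtain a b where ab: "a > 0" "\<forall>q. psd_form q \<longrightarrow> a * q v \<le> \<phi> q"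
      "b > 0" "\<forall>q. psd_form q \<longrightarrow> b * q v \<le> \<psi> q" by blast
    have "min a b * q v \<le> (1 - t) * \<phi> q + t * \<psi> q" if q: "psd_form q" for q
    proof -
      have "min a b * q v \<le> a * q v" "min a b * q v \<le> b * q v"
        using psd_nonneg[OF q, of v] by (auto intro!: mult_right_mono)
      then have "min a b * q v \<le> \<phi> q" "min a b * q v \<le> \<psi> q" using ab q by force+
      then have "(1 - t) * (min a b * q v) + t * (min a b * q v) \<le> (1 - t) * \<phi> q + t * \<psi> q"
        using t by (intro add_mono mult_left_mono) auto
      then show ?thesis by (simp add: algebra_simps)
    qed
    then show ?thesis using ab by (intro exI[of _ "min a b"]) simp
  qed
  ultimately show ?thesis unfolding dual_cone_def by blast
qed

text \<open>The sum of the values at the unit vectors dominates every single value by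
  \<open>psd_coordinates_le\<close>.\<close>

lemma dual_cone_nonempty: "dual_cone \<noteq> {}"
proof -
  let ?\<phi> = "\<lambda>q :: complex vec \<Rightarrow> real. \<Sum>i<n. q (unit_vec n i)"
  have "continuous_on UNIV ?\<phi>"
    by (intro continuous_on_sum continuous_on_product_coordinates)
  moreover have "?\<phi> (\<lambda>v. a * p v + b * q v) = a * ?\<phi> p + b * ?\<phi> q" for a b p q
    by (simp add: sum.distrib sum_distrib_left)
  moreover have "\<exists>c>0. \<forall>q. psd_form q \<longrightarrow> c * q v \<le> ?\<phi> q" if v: "v \<in> lattice" for v
  proof -
    define M where "M = 1 + (\<Sum>i<n. (cmod (v $ i))\<^sup>2)"
    have M: "M > 0" unfolding M_def by (intro add_pos_nonneg sum_nonneg) auto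
    have "(cmod (v $ i))\<^sup>2 \<le> M" if "i < n" for i
    proof -
      have "(cmod (v $ i))\<^sup>2 \<le> (\<Sum>i<n. (cmod (v $ i))\<^sup>2)" using that by (intro member_le_sum) auto
      then show ?thesis by (simp add: M_def)
    qed
    then have "q v \<le> 2 ^ n * (\<Sum>i<n. M * q (unit_vec n i))" if "psd_form q" for q
      using psd_nonneg[OF that] M
      by (intro order_trans[OF psd_coordinates_le[OF that v]] mult_left_mono sum_mono mult_right_mono) auto
    then have "q v \<le> (2 ^ n * M) * ?\<phi> q" if "psd_form q" for q
      using that by (simp add: sum_distrib_left mult.assoc)
    then have "1 / (2 ^ n * M) * q v \<le> ?\<phi> q" if "psd_form q" for q
      using that M by (simp add: field_simps)
    then show ?thesis using M by (intro exI[of _ "1 / (2 ^ n * M)"]) simp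
  qed
  ultimately have "?\<phi> \<in> dual_cone" unfolding dual_cone_def by blast
  then show ?thesis by blast
qed

text \<open>All that the algebra and the algorithms use of the geometry. The last clause is local
  finiteness; it gives the finite tables and the finite rank in each degree.\<close>

theorem simplicial_model:
  obtains m :: nat and S :: "(complex mat \<times> nat) list set" where
    "0 < m" "acyclic_complex S" "S \<subseteq> lists (carrier G \<times> {..<m})" "face_closed S"
    "\<And>g s. g \<in> carrier G \<Longrightarrow> s \<in> S \<Longrightarrow> map (\<lambda>(h, c). (g * h, c)) s \<in> S"
    "\<And>x. x \<in> carrier G \<times> {..<m} \<Longrightarrow> [x] \<in> S"
    "\<And>x. finite {y. [x, y] \<in> S}"
proof -
  obtain R where R: "finite R" "R \<subseteq> perfect_forms"
      "\<And>f. f \<in> perfect_forms \<Longrightarrow> \<exists>g \<in> carrier G. act g f \<in> R"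
    by (fact finite_perfect_orbits)
  obtain fs where fs: "set fs = R" using finite_list R(1) by blast
  define m where "m = length fs"
  define I where "I = carrier G \<times> {..<m}"
  \<comment> \<open>Substitution is a right action; the inverse makes left translation of the index
    correspond to a left action on forms.\<close>
  define ev where "ev = (\<lambda>(g, c). act (adj_mat g) (fs ! c))"
  have fs_perfect: "fs ! c \<in> perfect_forms" if "c < m" for c
    using that fs R(2) unfolding m_def by auto
  have ev_perfect: "ev i \<in> perfect_forms" if "i \<in> I" for i
    using that fs_perfect act_perfect[OF SL_adj(1)] by (auto simp: I_def ev_def)
  note ev_ryshkov = perfect_ryshkov[OF ev_perfect]
  have ev_surj: "\<exists>i \<in> I. ev i = f" if f: "f \<in> perfect_forms" for f
  proof -
    obtain g where g: "g \<in> carrier G" "act g f \<in> R" using R(3)[OF f] by blast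
    then obtain c where c: "c < m" "fs ! c = act g f" using fs unfolding m_def by (metis in_set_conv_nth)
    then have "ev (g, c) = f"
      using act_adj_psd(1)[OF g(1) ryshkov_psd[OF perfect_ryshkov[OF f]]] by (simp add: ev_def)
    then show ?thesis using g c by (intro bexI[of _ "(g, c)"]) (simp_all add: I_def)
  qed
  \<comment> \<open>Minimality among the indexed forms is minimality on the whole polyhedron, since
    some minimiser is extreme, hence perfect, hence indexed.\<close>
  have min_iff: "(\<forall>j \<in> I. \<phi> (ev i) \<le> \<phi> (ev j)) \<longleftrightarrow> minimizes \<phi> (ev i)" if \<phi>: "\<phi> \<in> dual_cone" and i: "i \<in> I" for \<phi> i
  proof
    assume le: "\<forall>j \<in> I. \<phi> (ev i) \<le> \<phi> (ev j)"
    obtain f where f: "minimizes \<phi> f" "extreme_form f" by (fact exists_extreme_minimizer[OF \<phi>])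
    then have "f \<in> perfect_forms" using \<phi> by (auto simp: perfect_forms_def)
    then obtain j where "j \<in> I" "ev j = f" using ev_surj by blast
    then have "\<phi> (ev i) \<le> \<phi> f" using le by blast
    then show "minimizes \<phi> (ev i)"
      using f(1) ev_ryshkov[OF i] by (auto simp: minimizes_def intro: order_trans)
  next
    assume "minimizes \<phi> (ev i)"
    then show "\<forall>j \<in> I. \<phi> (ev i) \<le> \<phi> (ev j)" using ev_ryshkov by (simp add: minimizes_def)
  qed
  have att: "\<exists>i \<in> I. \<forall>j \<in> I. \<phi> (ev i) \<le> \<phi> (ev j)" if \<phi>: "\<phi> \<in> dual_cone" for \<phi>
  proof -
    obtain f where f: "minimizes \<phi> f" "extreme_form f" by (fact exists_extreme_minimizer[OF \<phi>])
    then have "f \<in> perfect_forms" using \<phi> by (auto simp: perfect_forms_def)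
    then obtain j where "j \<in> I" "ev j = f" using ev_surj by blast
    then show ?thesis using min_iff[OF \<phi>] f(1) by blast
  qed
  \<comment> \<open>A form has many names \<open>(g, c)\<close>, but finitely many, because
    transporters are finite.\<close>
  have fin_fibre: "finite {i \<in> I. ev i \<in> H}" if H: "finite H" for H
  proof -
    have "{i \<in> I. ev i \<in> H} \<subseteq> (\<Union>h \<in> H \<inter> ryshkov. \<Union>c<m. {g \<in> carrier G. act g h = fs ! c} \<times> {c})"
    proof
      fix i assume i: "i \<in> {i \<in> I. ev i \<in> H}"
      obtain g c where gc: "i = (g, c)" "g \<in> carrier G" "c < m" using i by (auto simp: I_def)
      have "act g (ev i) = fs ! c"
        using act_adj_psd(2)[OF gc(2) ryshkov_psd[OF perfect_ryshkov[OF fs_perfect[OF gc(3)]]]]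
        by (simp add: ev_def gc)
      then show "i \<in> (\<Union>h \<in> H \<inter> ryshkov. \<Union>c<m. {g \<in> carrier G. act g h = fs ! c} \<times> {c})"
        using gc i ev_ryshkov by blast
    qed
    moreover have "finite (\<Union>h \<in> H \<inter> ryshkov. \<Union>c<m. {g \<in> carrier G. act g h = fs ! c} \<times> {c})"
      using H finite_transporter perfect_ryshkov[OF fs_perfect] by (intro finite_UN_I finite_SigmaI) auto
    ultimately show ?thesis by (rule finite_subset)
  qed
  \<comment> \<open>A functional becomes the family of its values at the indexed forms, the shape of
    point that \<open>min_nerve\<close> expects.\<close>
  define X where "X = (\<lambda>\<phi> i. \<phi> (ev i) :: real) ` dual_cone"
  define S where "S = min_nerve I X"
  have S_iff: "s \<in> S \<longleftrightarrow> (\<exists>\<phi> \<in> dual_cone. \<forall>i \<in> set s. i \<in> I \<and> minimizes \<phi> (ev i))" for s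
  proof -
    have "s \<in> S \<longleftrightarrow> (\<exists>\<phi> \<in> dual_cone. \<forall>i \<in> set s. i \<in> I \<and> (\<forall>j \<in> I. \<phi> (ev i) \<le> \<phi> (ev j)))"
      by (simp add: S_def min_nerve_def X_def)
    then show ?thesis using min_iff by blast
  qed
  have "0 < m" using dual_cone_nonempty att unfolding I_def by fastforce
  moreover have "acyclic_complex S"
    unfolding S_def
  proof (rule acyclic_min_nerve_locally_finite)
    show "X \<noteq> {}" using dual_cone_nonempty by (simp add: X_def)
    show "\<exists>i\<in>I. \<forall>j\<in>I. x i \<le> x j" if "x \<in> X" for x using att that by (auto simp: X_def)
    fix Y assume Y: "finite Y" "Y \<subseteq> X"
    then obtain \<Phi> where \<Phi>: "\<Phi> \<subseteq> dual_cone" "finite \<Phi>" "Y = (\<lambda>\<phi> i. \<phi> (ev i)) ` \<Phi>"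
      unfolding X_def by (meson finite_subset_image)
    have "\<exists>c>0. \<forall>a \<in> \<Phi> \<times> {..<n}. \<forall>q. psd_form q \<longrightarrow> c * q (unit_vec n (snd a)) \<le> fst a q"
    proof (rule uniform_positive_constant)
      show "finite (\<Phi> \<times> {..<n})" using \<Phi>(2) by simp
      show "\<exists>c>0. \<forall>q. psd_form q \<longrightarrow> c * q (unit_vec n (snd a)) \<le> fst a q" if "a \<in> \<Phi> \<times> {..<n}" for a
        using that \<Phi>(1) lattice_unit unfolding dual_cone_def by auto
      show "\<forall>q. psd_form q \<longrightarrow> c' * q (unit_vec n (snd a)) \<le> fst a q"
        if "\<forall>q. psd_form q \<longrightarrow> c * q (unit_vec n (snd a)) \<le> fst a q" "0 < c'" "c' \<le> c" for a c c'
        using that psd_nonneg mult_right_mono[OF that(3)] order_trans by blast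
    qed
    then obtain c where c: "c > 0"
        "\<And>\<phi> i q. \<phi> \<in> \<Phi> \<Longrightarrow> i < n \<Longrightarrow> psd_form q \<Longrightarrow> c * q (unit_vec n i) \<le> \<phi> q" by force
    define B where "B = (\<Sum>\<phi>\<in>\<Phi>. \<bar>\<phi> standard_form\<bar>)"
    \<comment> \<open>A convex piece of the cone with uniform constants. For \<open>\<phi>\<close>
      in it, a minimiser has values at most \<open>B / c\<close> at the unit vectors, because
      \<open>c\<close> times such a value is at most its \<open>\<phi>\<close>-value, which is at
      most \<open>\<phi> standard_form\<close>.\<close>
    define T where "T = {\<phi> \<in> dual_cone. (\<forall>i<n. \<forall>q. psd_form q \<longrightarrow> c * q (unit_vec n i) \<le> \<phi> q) \<and> \<phi> standard_form \<le> B}"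
    let ?T = "(\<lambda>\<phi> i. \<phi> (ev i)) ` T"
    have B: "\<phi> standard_form \<le> B" if "\<phi> \<in> \<Phi>" for \<phi>
    proof -
      have "\<bar>\<phi> standard_form\<bar> \<le> B" unfolding B_def using that \<Phi>(2) by (intro member_le_sum) auto
      then show ?thesis by linarith
    qed
    have "\<Phi> \<subseteq> T" using \<Phi>(1) c(2) B unfolding T_def by blast
    then have "Y \<subseteq> ?T" unfolding \<Phi>(3) by (rule image_mono)
    moreover have "?T \<subseteq> X" unfolding X_def by (rule image_mono) (auto simp: T_def)
    moreover have "family_convex ?T"
      unfolding family_convex_def
    proof (intro ballI)
      fix x y and t :: real assume "x \<in> ?T" "y \<in> ?T" and t: "t \<in> {0..1}"
      then obtain \<phi> \<psi> where \<phi>: "\<phi> \<in> T" "x = (\<lambda>i. \<phi> (ev i))" and \<psi>: "\<psi> \<in> T" "y = (\<lambda>i. \<psi> (ev i))" by blast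
      have "c * q (unit_vec n i) \<le> (1 - t) * \<phi> q + t * \<psi> q" if "i < n" "psd_form q" for i q
      proof -
        have "(1 - t) * (c * q (unit_vec n i)) + t * (c * q (unit_vec n i)) \<le> (1 - t) * \<phi> q + t * \<psi> q"
          using \<phi>(1) \<psi>(1) t that by (intro add_mono mult_left_mono) (auto simp: T_def)
        then show ?thesis by (simp add: algebra_simps)
      qed
      moreover have "(1 - t) * \<phi> standard_form + t * \<psi> standard_form \<le> B"
      proof -
        have "(1 - t) * \<phi> standard_form + t * \<psi> standard_form \<le> (1 - t) * B + t * B"
          using \<phi>(1) \<psi>(1) t by (intro add_mono mult_left_mono) (auto simp: T_def)
        then show ?thesis by (simp add: algebra_simps)
      qed
      moreover have "(\<lambda>q. (1 - t) * \<phi> q + t * \<psi> q) \<in> dual_cone"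
        using dual_cone_convex[OF _ _ t] \<phi>(1) \<psi>(1) by (simp add: T_def)
      ultimately have "(\<lambda>q. (1 - t) * \<phi> q + t * \<psi> q) \<in> T" unfolding T_def by simp
      then show "(\<lambda>i. (1 - t) * x i + t * y i) \<in> ?T" unfolding \<phi>(2) \<psi>(2) by (rule rev_image_eqI) simp
    qed
    moreover have "finite (set ` min_nerve I ?T)"
    proof -
      let ?H = "{f \<in> ryshkov. extreme_form f \<and> (\<forall>i<n. f (unit_vec n i) \<le> B / c)}"
      have "i \<in> {i \<in> I. ev i \<in> ?H}" if i: "i \<in> I" and \<phi>: "\<phi> \<in> T" and le: "\<forall>j \<in> I. \<phi> (ev i) \<le> \<phi> (ev j)" for i \<phi>
      proof -
        have "minimizes \<phi> (ev i)" using min_iff[OF _ i] le \<phi> by (simp add: T_def)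
        then have "\<phi> (ev i) \<le> B" using \<phi> standard_form_ryshkov by (auto simp: minimizes_def T_def intro: order_trans)
        have "ev i (unit_vec n k) \<le> B / c" if "k < n" for k
        proof -
          have "c * ev i (unit_vec n k) \<le> \<phi> (ev i)"
            using \<phi> that ryshkov_psd[OF ev_ryshkov[OF i]] by (simp add: T_def)
          then show ?thesis using \<open>\<phi> (ev i) \<le> B\<close> c(1) by (simp add: pos_le_divide_eq mult.commute)
        qed
        then show ?thesis using i ev_ryshkov[OF i] ev_perfect[OF i] by (simp add: perfect_forms_def)
      qed
      then have "set ` min_nerve I ?T \<subseteq> Pow {i \<in> I. ev i \<in> ?H}" unfolding min_nerve_def by blast
      then show ?thesis by (rule finite_subset) (intro finite_Pow_iff[THEN iffD2] fin_fibre finite_extreme_forms)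
    qed
    ultimately show "\<exists>T. Y \<subseteq> T \<and> T \<subseteq> X \<and> family_convex T \<and> finite (set ` min_nerve I T)" by blast
  qed
  moreover have "S \<subseteq> lists (carrier G \<times> {..<m})" by (auto simp: S_iff I_def)
  moreover have "face_closed S" unfolding S_def by (rule face_closed_min_nerve)
  moreover have "map (\<lambda>(h, c). (g * h, c)) s \<in> S" if g: "g \<in> carrier G" and s: "s \<in> S" for g s
  proof -
    obtain \<phi> where \<phi>: "\<phi> \<in> dual_cone" "\<forall>i \<in> set s. i \<in> I \<and> minimizes \<phi> (ev i)" using s S_iff by blast
    note a = SL_adj(1)[OF g]
    let ?\<phi> = "\<lambda>q. \<phi> (act g q)"
    have "(g * h, c) \<in> I \<and> minimizes ?\<phi> (ev (g * h, c))" if hc: "(h, c) \<in> set s" for h c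
    proof -
      have h: "h \<in> carrier G" and c: "c < m" and min: "minimizes \<phi> (ev (h, c))" using \<phi>(2) hc by (auto simp: I_def)
      have "ev (g * h, c) = act (adj_mat g) (ev (h, c))"
        by (simp add: ev_def adj_mult[OF g h] act_mult[OF SL_adj(1)[OF h] a])
      moreover have "minimizes ?\<phi> (act (adj_mat g) (ev (h, c)))"
        using act_minimizes[OF a min] by (simp add: adj_adj[OF g])
      ultimately show ?thesis using SL_mult[OF g h] c by (simp add: I_def)
    qed
    then have "\<forall>i \<in> set (map (\<lambda>(h, c). (g * h, c)) s). i \<in> I \<and> minimizes ?\<phi> (ev i)" by auto
    then show ?thesis using S_iff act_dual_cone[OF g \<phi>(1)] by blast
  qed
  moreover have "[x] \<in> S" if "x \<in> carrier G \<times> {..<m}" for x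
    using ev_perfect[of x] that S_iff[of "[x]"] by (auto simp: perfect_forms_def I_def)
  moreover have "finite {y. [x, y] \<in> S}" for x
  proof (cases "x \<in> I")
    case True
    have "{y. [x, y] \<in> S} \<subseteq> {i \<in> I. ev i \<in> {g \<in> perfect_forms. \<exists>\<phi> \<in> dual_cone. minimizes \<phi> (ev x) \<and> minimizes \<phi> g}}"
      using ev_perfect by (auto simp: S_iff)
    then show ?thesis by (rule finite_subset) (intro fin_fibre finite_neighbours ev_perfect True)
  next
    case False
    then have "{y. [x, y] \<in> S} = {}" by (auto simp: S_iff)
    then show ?thesis by (simp only: finite.emptyI)
  qed
  ultimately show ?thesis by (rule that)
qed

end

section \<open>Free modules over group rings\<close>

text \<open>Coefficient sequences that vanish from \<open>r\<close> on, rather than tuples of length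
  \<open>r\<close>: all degrees of the resolution then share one type.\<close>

definition free_mod :: "('g, 'm) monoid_scheme \<Rightarrow> nat \<Rightarrow> ('g \<Rightarrow> int, nat \<Rightarrow> 'g \<Rightarrow> int) module" where
  "free_mod G r =
    \<lparr>carrier = {w. (\<forall>i. w i \<in> carrier (group_ring G)) \<and> (\<forall>i\<ge>r. w i = (\<lambda>_. 0))},
     mult = (\<lambda>v w. v), one = (\<lambda>_ _. 0), zero = (\<lambda>_ _. 0),
     add = (\<lambda>v w i g. v i g + w i g),
     smult = (\<lambda>a w i. a \<otimes>\<^bsub>group_ring G\<^esub> w i)\<rparr>"

lemma free_mod_simps:
  "w \<in> carrier (free_mod G r) \<longleftrightarrow> (\<forall>i. w i \<in> carrier (group_ring G)) \<and> (\<forall>i\<ge>r. w i = (\<lambda>_. 0))"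
  "\<zero>\<^bsub>free_mod G r\<^esub> = (\<lambda>_ _. 0)"
  "v \<oplus>\<^bsub>free_mod G r\<^esub> w = (\<lambda>i g. v i g + w i g)"
  "a \<odot>\<^bsub>free_mod G r\<^esub> w = (\<lambda>i. a \<otimes>\<^bsub>group_ring G\<^esub> w i)"
  by (simp_all add: free_mod_def)

definition unit_elt :: "('g, 'm) monoid_scheme \<Rightarrow> nat \<Rightarrow> nat \<Rightarrow> 'g \<Rightarrow> int" where
  "unit_elt G i = (\<lambda>j. if j = i then \<one>\<^bsub>group_ring G\<^esub> else (\<lambda>_. 0))"

section \<open>Convolution in the group ring\<close>

context group
begin

abbreviation ZG :: "('a \<Rightarrow> int) ring" where "ZG \<equiv> group_ring G"

lemma ZG_carrier: "a \<in> carrier ZG \<longleftrightarrow> finite {g. a g \<noteq> 0} \<and> {g. a g \<noteq> 0} \<subseteq> carrier G"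
  by (simp add: group_ring_def)

lemma ZG_ops:
  "\<zero>\<^bsub>ZG\<^esub> = (\<lambda>_. 0)" "a \<oplus>\<^bsub>ZG\<^esub> b = (\<lambda>g. a g + b g)" "\<one>\<^bsub>ZG\<^esub> = (\<lambda>g. if g = \<one> then 1 else 0)"
  by (simp_all add: group_ring_def)

lemma ZG_zero: "(\<lambda>_. 0) \<in> carrier ZG" by (simp add: ZG_carrier)

lemma ZG_add: assumes "a \<in> carrier ZG" "b \<in> carrier ZG" shows "(\<lambda>g. a g + b g) \<in> carrier ZG"
proof -
  have "{g. a g + b g \<noteq> 0} \<subseteq> {g. a g \<noteq> 0} \<union> {g. b g \<noteq> 0}" by auto
  then show ?thesis using assms unfolding ZG_carrier by (meson finite_UnI finite_subset le_sup_iff order_trans)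
qed

lemma ZG_uminus: "a \<in> carrier ZG \<Longrightarrow> (\<lambda>g. - a g) \<in> carrier ZG" by (simp add: ZG_carrier)

lemma ZG_one: "\<one>\<^bsub>ZG\<^esub> \<in> carrier ZG" by (simp add: ZG_carrier ZG_ops)

text \<open>Lets products of elements with different supports be expanded over common index
  sets.\<close>

lemma ZG_mult_superset:
  assumes "finite A" "{g. a g \<noteq> 0} \<subseteq> A" "finite B" "{g. b g \<noteq> 0} \<subseteq> B"
  shows "(a \<otimes>\<^bsub>ZG\<^esub> b) g = (\<Sum>x\<in>A. \<Sum>y\<in>B. if x \<otimes> y = g then a x * b y else 0)"
proof -
  have "(a \<otimes>\<^bsub>ZG\<^esub> b) g = (\<Sum>p \<in> {x. a x \<noteq> 0} \<times> {y. b y \<noteq> 0}. if fst p \<otimes> snd p = g then a (fst p) * b (snd p) else 0)"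
    by (simp add: group_ring_def case_prod_unfold)
  also have "\<dots> = (\<Sum>p \<in> A \<times> B. if fst p \<otimes> snd p = g then a (fst p) * b (snd p) else 0)"
    using assms by (intro sum.mono_neutral_left) auto
  also have "\<dots> = (\<Sum>x\<in>A. \<Sum>y\<in>B. if x \<otimes> y = g then a x * b y else 0)"
    by (simp add: sum.cartesian_product case_prod_unfold)
  finally show ?thesis .
qed

lemma ZG_mult_support:
  assumes "a \<in> carrier ZG" "b \<in> carrier ZG"
  shows "{g. (a \<otimes>\<^bsub>ZG\<^esub> b) g \<noteq> 0} \<subseteq> (\<lambda>(x, y). x \<otimes> y) ` ({x. a x \<noteq> 0} \<times> {y. b y \<noteq> 0})"
proof
  fix g assume g: "g \<in> {g. (a \<otimes>\<^bsub>ZG\<^esub> b) g \<noteq> 0}"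
  show "g \<in> (\<lambda>(x, y). x \<otimes> y) ` ({x. a x \<noteq> 0} \<times> {y. b y \<noteq> 0})"
  proof (rule ccontr)
    assume n: "g \<notin> (\<lambda>(x, y). x \<otimes> y) ` ({x. a x \<noteq> 0} \<times> {y. b y \<noteq> 0})"
    have "(a \<otimes>\<^bsub>ZG\<^esub> b) g = (\<Sum>x\<in>{x. a x \<noteq> 0}. \<Sum>y\<in>{y. b y \<noteq> 0}. if x \<otimes> y = g then a x * b y else 0)"
      using assms by (intro ZG_mult_superset) (auto simp: ZG_carrier)
    also have "\<dots> = 0" using n by (intro sum.neutral ballI) auto
    finally show False using g by simp
  qed
qed

lemma ZG_mult_closed: assumes "a \<in> carrier ZG" "b \<in> carrier ZG" shows "a \<otimes>\<^bsub>ZG\<^esub> b \<in> carrier ZG"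
proof -
  have "finite ((\<lambda>(x, y). x \<otimes> y) ` ({x. a x \<noteq> 0} \<times> {y. b y \<noteq> 0}))"
    "(\<lambda>(x, y). x \<otimes> y) ` ({x. a x \<noteq> 0} \<times> {y. b y \<noteq> 0}) \<subseteq> carrier G"
    using assms by (auto simp: ZG_carrier)
  then show ?thesis using ZG_mult_support[OF assms] unfolding ZG_carrier by (meson finite_subset order_trans)
qed

text \<open>A convolution tested against a function \<open>F\<close>. With suitable
  \<open>F\<close>, both bracketings of a threefold product unfold to the same triple sum.\<close>

lemma sum_ZG_mult:
  fixes F :: "'a \<Rightarrow> int"
  assumes a: "a \<in> carrier ZG" and b: "b \<in> carrier ZG"
    and Z: "finite Z" "(\<lambda>(x, y). x \<otimes> y) ` ({x. a x \<noteq> 0} \<times> {y. b y \<noteq> 0}) \<subseteq> Z"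
  shows "(\<Sum>z\<in>Z. (a \<otimes>\<^bsub>ZG\<^esub> b) z * F z) =
    (\<Sum>x | a x \<noteq> 0. \<Sum>y | b y \<noteq> 0. a x * b y * F (x \<otimes> y))"
proof -
  have fin: "finite {x. a x \<noteq> 0}" "finite {x. b x \<noteq> 0}" using a b by (auto simp: ZG_carrier)
  have "(\<Sum>z\<in>Z. (a \<otimes>\<^bsub>ZG\<^esub> b) z * F z) =
      (\<Sum>z\<in>Z. \<Sum>x | a x \<noteq> 0. \<Sum>y | b y \<noteq> 0. if x \<otimes> y = z then a x * b y * F z else 0)"
    by (intro sum.cong refl)
       (simp add: ZG_mult_superset[OF fin(1) order_refl fin(2) order_refl] sum_distrib_right
        if_distrib[of "\<lambda>t. t * _"] cong: if_cong)
  also have "\<dots> = (\<Sum>x | a x \<noteq> 0. \<Sum>y | b y \<noteq> 0. \<Sum>z\<in>Z. if x \<otimes> y = z then a x * b y * F z else 0)"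
    by (subst sum.swap) (intro sum.cong refl sum.swap)
  also have "\<dots> = (\<Sum>x | a x \<noteq> 0. \<Sum>y | b y \<noteq> 0. a x * b y * F (x \<otimes> y))"
  proof (intro sum.cong refl)
    fix x y assume "x \<in> {x. a x \<noteq> 0}" "y \<in> {y. b y \<noteq> 0}"
    then have "x \<otimes> y \<in> Z" using Z(2) by auto
    then show "(\<Sum>z\<in>Z. if x \<otimes> y = z then a x * b y * F z else 0) = a x * b y * F (x \<otimes> y)"
      using Z(1) by (simp add: sum.delta)
  qed
  finally show ?thesis .
qed

lemma ZG_mult_assoc:
  assumes a: "a \<in> carrier ZG" and b: "b \<in> carrier ZG" and c: "c \<in> carrier ZG"
  shows "(a \<otimes>\<^bsub>ZG\<^esub> b) \<otimes>\<^bsub>ZG\<^esub> c = a \<otimes>\<^bsub>ZG\<^esub> (b \<otimes>\<^bsub>ZG\<^esub> c)"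
proof
  fix g
  have fin: "finite {x. a x \<noteq> 0}" "finite {x. b x \<noteq> 0}" "finite {x. c x \<noteq> 0}"
    and sub: "{x. a x \<noteq> 0} \<subseteq> carrier G" "{x. b x \<noteq> 0} \<subseteq> carrier G" "{x. c x \<noteq> 0} \<subseteq> carrier G"
    using a b c by (auto simp: ZG_carrier)
  let ?AB = "(\<lambda>(x, y). x \<otimes> y) ` ({x. a x \<noteq> 0} \<times> {y. b y \<noteq> 0})"
  let ?BC = "(\<lambda>(x, y). x \<otimes> y) ` ({x. b x \<noteq> 0} \<times> {y. c y \<noteq> 0})"
  have AB: "finite ?AB" and BC: "finite ?BC" using fin by auto
  have "((a \<otimes>\<^bsub>ZG\<^esub> b) \<otimes>\<^bsub>ZG\<^esub> c) g =
      (\<Sum>z\<in>?AB. \<Sum>w | c w \<noteq> 0. if z \<otimes> w = g then (a \<otimes>\<^bsub>ZG\<^esub> b) z * c w else 0)"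
    by (rule ZG_mult_superset[OF AB ZG_mult_support[OF a b] fin(3) order_refl])
  also have "\<dots> = (\<Sum>z\<in>?AB. (a \<otimes>\<^bsub>ZG\<^esub> b) z * (\<Sum>w | c w \<noteq> 0. if z \<otimes> w = g then c w else 0))"
    by (simp add: sum_distrib_left if_distrib[of "\<lambda>t. _ * t"] cong: if_cong)
  also have "\<dots> = (\<Sum>x | a x \<noteq> 0. \<Sum>y | b y \<noteq> 0. a x * b y * (\<Sum>w | c w \<noteq> 0. if x \<otimes> y \<otimes> w = g then c w else 0))"
    by (rule sum_ZG_mult[OF a b AB order_refl])
  also have "\<dots> = (\<Sum>x | a x \<noteq> 0. \<Sum>y | b y \<noteq> 0. \<Sum>w | c w \<noteq> 0. if x \<otimes> (y \<otimes> w) = g then a x * b y * c w else 0)"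
  proof (intro sum.cong refl)
    fix x y assume xy: "x \<in> {x. a x \<noteq> 0}" "y \<in> {y. b y \<noteq> 0}"
    show "a x * b y * (\<Sum>w | c w \<noteq> 0. if x \<otimes> y \<otimes> w = g then c w else 0) =
        (\<Sum>w | c w \<noteq> 0. if x \<otimes> (y \<otimes> w) = g then a x * b y * c w else 0)"
      unfolding sum_distrib_left
    proof (intro sum.cong refl)
      fix w assume "w \<in> {w. c w \<noteq> 0}"
      then have "x \<otimes> y \<otimes> w = x \<otimes> (y \<otimes> w)" using xy sub by (intro m_assoc) auto
      then show "a x * b y * (if x \<otimes> y \<otimes> w = g then c w else 0) =
          (if x \<otimes> (y \<otimes> w) = g then a x * b y * c w else 0)" by simp
    qed
  qed
  also have "\<dots> = (\<Sum>x | a x \<noteq> 0. a x * (\<Sum>y | b y \<noteq> 0. \<Sum>w | c w \<noteq> 0. b y * c w * (if x \<otimes> (y \<otimes> w) = g then 1 else 0)))"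
    by (simp add: sum_distrib_left if_distrib[of "\<lambda>t. _ * t"] mult.assoc cong: if_cong)
  also have "\<dots> = (\<Sum>x | a x \<noteq> 0. a x * (\<Sum>z\<in>?BC. (b \<otimes>\<^bsub>ZG\<^esub> c) z * (if x \<otimes> z = g then 1 else 0)))"
    by (simp only: sum_ZG_mult[OF b c BC order_refl])
  also have "\<dots> = (\<Sum>x | a x \<noteq> 0. \<Sum>z\<in>?BC. if x \<otimes> z = g then a x * (b \<otimes>\<^bsub>ZG\<^esub> c) z else 0)"
    by (simp add: sum_distrib_left if_distrib[of "\<lambda>t. _ * t"] cong: if_cong)
  also have "\<dots> = (a \<otimes>\<^bsub>ZG\<^esub> (b \<otimes>\<^bsub>ZG\<^esub> c)) g"
    by (rule ZG_mult_superset[OF fin(1) order_refl BC ZG_mult_support[OF b c], symmetric])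
  finally show "((a \<otimes>\<^bsub>ZG\<^esub> b) \<otimes>\<^bsub>ZG\<^esub> c) g = (a \<otimes>\<^bsub>ZG\<^esub> (b \<otimes>\<^bsub>ZG\<^esub> c)) g" .
qed

lemma ZG_distrib:
  assumes a: "a \<in> carrier ZG" and b: "b \<in> carrier ZG" and c: "c \<in> carrier ZG"
  shows "(\<lambda>g. a g + b g) \<otimes>\<^bsub>ZG\<^esub> c = (\<lambda>g. (a \<otimes>\<^bsub>ZG\<^esub> c) g + (b \<otimes>\<^bsub>ZG\<^esub> c) g)"
    "c \<otimes>\<^bsub>ZG\<^esub> (\<lambda>g. a g + b g) = (\<lambda>g. (c \<otimes>\<^bsub>ZG\<^esub> a) g + (c \<otimes>\<^bsub>ZG\<^esub> b) g)"
proof -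
  let ?A = "{x. a x \<noteq> 0} \<union> {x. b x \<noteq> 0}" and ?C = "{x. c x \<noteq> 0}"
  have fin: "finite ?A" "finite ?C" using a b c by (auto simp: ZG_carrier)
  have l: "(h \<otimes>\<^bsub>ZG\<^esub> c) g = (\<Sum>x\<in>?A. \<Sum>y\<in>?C. if x \<otimes> y = g then h x * c y else 0)"
    "(c \<otimes>\<^bsub>ZG\<^esub> h) g = (\<Sum>x\<in>?C. \<Sum>y\<in>?A. if x \<otimes> y = g then c x * h y else 0)"
    if "{x. h x \<noteq> 0} \<subseteq> ?A" for h g
    using ZG_mult_superset[OF fin(1) that fin(2) order_refl] ZG_mult_superset[OF fin(2) order_refl fin(1) that]
    by auto
  have s: "{x. a x \<noteq> 0} \<subseteq> ?A" "{x. b x \<noteq> 0} \<subseteq> ?A" "{x. a x + b x \<noteq> 0} \<subseteq> ?A" by auto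
  show "(\<lambda>g. a g + b g) \<otimes>\<^bsub>ZG\<^esub> c = (\<lambda>g. (a \<otimes>\<^bsub>ZG\<^esub> c) g + (b \<otimes>\<^bsub>ZG\<^esub> c) g)"
    by (rule ext) (auto simp: l[OF s(1)] l[OF s(2)] l[OF s(3)] algebra_simps simp flip: sum.distrib intro!: sum.cong)
  show "c \<otimes>\<^bsub>ZG\<^esub> (\<lambda>g. a g + b g) = (\<lambda>g. (c \<otimes>\<^bsub>ZG\<^esub> a) g + (c \<otimes>\<^bsub>ZG\<^esub> b) g)"
    by (rule ext) (auto simp: l[OF s(1)] l[OF s(2)] l[OF s(3)] algebra_simps simp flip: sum.distrib intro!: sum.cong)
qed

text \<open>Left multiplication as a combination of left translates, the form that matches the
  translation of simplices in \<open>smult_chain\<close>.\<close>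

lemma ZG_mult_translates:
  assumes a: "a \<in> carrier ZG" and b: "b \<in> carrier ZG" and g: "g \<in> carrier G"
  shows "(a \<otimes>\<^bsub>ZG\<^esub> b) g = (\<Sum>x | a x \<noteq> 0. a x * b (inv x \<otimes> g))"
proof -
  have fin: "finite {x. a x \<noteq> 0}" "finite {x. b x \<noteq> 0}"
    and sub: "{x. a x \<noteq> 0} \<subseteq> carrier G" "{x. b x \<noteq> 0} \<subseteq> carrier G"
    using a b by (auto simp: ZG_carrier)
  have "(a \<otimes>\<^bsub>ZG\<^esub> b) g = (\<Sum>x | a x \<noteq> 0. \<Sum>y | b y \<noteq> 0. if x \<otimes> y = g then a x * b y else 0)"
    by (rule ZG_mult_superset[OF fin(1) order_refl fin(2) order_refl])
  also have "\<dots> = (\<Sum>x | a x \<noteq> 0. a x * b (inv x \<otimes> g))"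
  proof (intro sum.cong refl)
    fix x assume "x \<in> {x. a x \<noteq> 0}"
    then have x: "x \<in> carrier G" using sub by auto
    have "(\<Sum>y | b y \<noteq> 0. if x \<otimes> y = g then a x * b y else 0) =
        (\<Sum>y | b y \<noteq> 0. if y = inv x \<otimes> g then a x * b y else 0)"
    proof (intro sum.cong refl)
      fix y assume "y \<in> {y. b y \<noteq> 0}"
      then have "y \<in> carrier G" using sub by auto
      then have "x \<otimes> y = g \<longleftrightarrow> y = inv x \<otimes> g" using x g by (metis inv_closed inv_solve_left m_closed)
      then show "(if x \<otimes> y = g then a x * b y else 0) = (if y = inv x \<otimes> g then a x * b y else 0)" by simp
    qed
    also have "\<dots> = a x * b (inv x \<otimes> g)" using fin(2) by (simp add: sum.delta')
    finally show "(\<Sum>y | b y \<noteq> 0. if x \<otimes> y = g then a x * b y else 0) = a x * b (inv x \<otimes> g)" .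
  qed
  finally show ?thesis .
qed

lemma ZG_outside: "a \<in> carrier ZG \<Longrightarrow> g \<notin> carrier G \<Longrightarrow> a g = 0" by (auto simp: ZG_carrier)

lemma ZG_mult_one: assumes a: "a \<in> carrier ZG"
  shows "\<one>\<^bsub>ZG\<^esub> \<otimes>\<^bsub>ZG\<^esub> a = a" "a \<otimes>\<^bsub>ZG\<^esub> \<one>\<^bsub>ZG\<^esub> = a"
proof -
  have fin: "finite {x. a x \<noteq> 0}" and sub: "{x. a x \<noteq> 0} \<subseteq> carrier G" using a by (auto simp: ZG_carrier)
  have s: "{x. \<one>\<^bsub>ZG\<^esub> x \<noteq> 0} \<subseteq> {\<one>}" by (auto simp: ZG_ops)
  show "\<one>\<^bsub>ZG\<^esub> \<otimes>\<^bsub>ZG\<^esub> a = a"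
  proof
    fix g
    have "(\<one>\<^bsub>ZG\<^esub> \<otimes>\<^bsub>ZG\<^esub> a) g = (\<Sum>y | a y \<noteq> 0. if \<one> \<otimes> y = g then a y else 0)"
      using ZG_mult_superset[OF _ s fin order_refl, of g] by (simp add: ZG_ops cong: if_cong)
    also have "\<dots> = (\<Sum>y | a y \<noteq> 0. if y = g then a y else 0)"
      using sub by (intro sum.cong refl) auto
    finally show "(\<one>\<^bsub>ZG\<^esub> \<otimes>\<^bsub>ZG\<^esub> a) g = a g" using fin by (simp add: sum.delta')
  qed
  show "a \<otimes>\<^bsub>ZG\<^esub> \<one>\<^bsub>ZG\<^esub> = a"
  proof
    fix g
    have "(a \<otimes>\<^bsub>ZG\<^esub> \<one>\<^bsub>ZG\<^esub>) g = (\<Sum>y | a y \<noteq> 0. if y \<otimes> \<one> = g then a y else 0)"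
      using ZG_mult_superset[OF fin order_refl _ s, of g] by (simp add: ZG_ops cong: if_cong)
    also have "\<dots> = (\<Sum>y | a y \<noteq> 0. if y = g then a y else 0)"
      using sub by (intro sum.cong refl) auto
    finally show "(a \<otimes>\<^bsub>ZG\<^esub> \<one>\<^bsub>ZG\<^esub>) g = a g" using fin by (simp add: sum.delta')
  qed
qed

lemma ZG_mult_zero: "a \<otimes>\<^bsub>ZG\<^esub> (\<lambda>_. 0) = (\<lambda>_. 0)"
  by (simp add: group_ring_def)

lemma ZG_ring: "ring ZG"
proof (rule ringI)
  show "abelian_group ZG"
  proof (rule abelian_groupI)
    fix a assume a: "a \<in> carrier ZG"
    show "\<exists>b \<in> carrier ZG. b \<oplus>\<^bsub>ZG\<^esub> a = \<zero>\<^bsub>ZG\<^esub>"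
      using ZG_uminus[OF a] by (intro bexI[of _ "\<lambda>g. - a g"]) (simp_all add: ZG_ops)
  qed (simp_all add: ZG_ops ZG_add ZG_zero add_ac)
  show "monoid ZG"
    by (rule monoidI) (simp_all add: ZG_mult_closed ZG_one ZG_mult_assoc ZG_mult_one)
qed (simp_all add: ZG_ops ZG_distrib)

section \<open>Standard free modules\<close>

lemma free_mod_abelian: "abelian_group (free_mod G r)"
proof (rule abelian_groupI)
  fix v assume v: "v \<in> carrier (free_mod G r)"
  then show "\<exists>w \<in> carrier (free_mod G r). w \<oplus>\<^bsub>free_mod G r\<^esub> v = \<zero>\<^bsub>free_mod G r\<^esub>"
    by (intro bexI[of _ "\<lambda>i g. - v i g"]) (simp_all add: free_mod_simps ZG_uminus)
qed (simp_all add: free_mod_simps ZG_add ZG_zero add_ac)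

lemma free_mod_module: "left_module ZG (free_mod G r)"
proof (intro left_module.intro left_module_axioms.intro ZG_ring free_mod_abelian)
qed (simp_all add: free_mod_simps ZG_mult_closed ZG_mult_zero ZG_ops(1,2) ZG_distrib ZG_mult_assoc ZG_mult_one)

lemma unit_elt_carrier: "i < r \<Longrightarrow> unit_elt G i \<in> carrier (free_mod G r)"
  by (auto simp: unit_elt_def free_mod_simps ZG_one ZG_zero)

lemma smult_unit_elt: "a \<in> carrier ZG \<Longrightarrow> a \<odot>\<^bsub>free_mod G r\<^esub> unit_elt G i = (\<lambda>j. if j = i then a else (\<lambda>_. 0))"
  by (auto simp: free_mod_simps unit_elt_def ZG_mult_one ZG_mult_zero)

text \<open>Coordinate \<open>e y\<close> of a combination is its coefficient at \<open>y\<close>.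
  The index set is left open because the basis occurs both as a set of elements, for freeness, and
  as a family indexed by numbers.\<close>

lemma free_mod_is_basis:
  assumes e: "bij_betw e J {..<r}" and v: "\<And>y. y \<in> J \<Longrightarrow> v y = unit_elt G (e y)"
  shows "is_basis ZG (free_mod G r) J v"
proof -
  let ?M = "free_mod G r"
  interpret M: abelian_group ?M by (rule free_mod_abelian)
  have vc: "v y \<in> carrier ?M" if "y \<in> J" for y
    using e that v[OF that] bij_betwE[OF e] by (auto intro: unit_elt_carrier)
  have smc: "a y \<odot>\<^bsub>?M\<^esub> v y \<in> carrier ?M" if "a y \<in> carrier ZG" "y \<in> J" for a :: "'c \<Rightarrow> 'a \<Rightarrow> int" and y
    using left_module.smult_closed[OF free_mod_module] that vc by blast
  have fs: "(\<Oplus>\<^bsub>?M\<^esub> y \<in> A. a y \<odot>\<^bsub>?M\<^esub> v y) = (\<lambda>j. if j \<in> e ` A then a (inv_into J e j) else (\<lambda>_. 0))"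
    if A: "finite A" "A \<subseteq> J" and a: "\<And>y. a y \<in> carrier ZG" for A a
    using A
  proof (induction A rule: finite_induct)
    case empty
    show ?case by (simp add: free_mod_simps)
  next
    case (insert y F)
    have yF: "e y \<notin> e ` F" "inv_into J e (e y) = y"
      using insert e by (auto simp: bij_betw_def inj_on_def)
    have "(\<Oplus>\<^bsub>?M\<^esub> y \<in> insert y F. a y \<odot>\<^bsub>?M\<^esub> v y) = a y \<odot>\<^bsub>?M\<^esub> v y \<oplus>\<^bsub>?M\<^esub> (\<Oplus>\<^bsub>?M\<^esub> y \<in> F. a y \<odot>\<^bsub>?M\<^esub> v y)"
      using insert smc[of a, OF a] by (intro M.finsum_insert) auto
    also have "a y \<odot>\<^bsub>?M\<^esub> v y = (\<lambda>j. if j = e y then a y else (\<lambda>_. 0))"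
      using smult_unit_elt[OF a[of y]] v[of y] insert by simp
    also have "(\<Oplus>\<^bsub>?M\<^esub> y \<in> F. a y \<odot>\<^bsub>?M\<^esub> v y) = (\<lambda>j. if j \<in> e ` F then a (inv_into J e j) else (\<lambda>_. 0))"
      using insert by simp
    also have "(\<lambda>j. if j = e y then a y else (\<lambda>_. 0)) \<oplus>\<^bsub>?M\<^esub> \<dots> =
        (\<lambda>j. if j \<in> e ` insert y F then a (inv_into J e j) else (\<lambda>_. 0))"
      unfolding free_mod_simps(3) using yF by (auto simp: fun_eq_iff)
    finally show ?case .
  qed
  have "\<exists>!a. (\<forall>i. a i \<in> carrier ZG) \<and> finite {i. a i \<noteq> \<zero>\<^bsub>ZG\<^esub>} \<and> {i. a i \<noteq> \<zero>\<^bsub>ZG\<^esub>} \<subseteq> J \<and>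
       x = (\<Oplus>\<^bsub>?M\<^esub> i \<in> {i. a i \<noteq> \<zero>\<^bsub>ZG\<^esub>}. a i \<odot>\<^bsub>?M\<^esub> v i)" if x: "x \<in> carrier ?M" for x
  proof (rule ex1I)
    let ?a = "\<lambda>y. if y \<in> J then x (e y) else (\<lambda>_. 0)"
    have fin: "finite J" using e bij_betw_finite by blast
    have sub: "{i. ?a i \<noteq> \<zero>\<^bsub>ZG\<^esub>} \<subseteq> J" by (auto simp: ZG_ops)
    have ac: "?a y \<in> carrier ZG" for y using x by (simp add: free_mod_simps ZG_zero)
    have "x j = (if j \<in> e ` {i. ?a i \<noteq> \<zero>\<^bsub>ZG\<^esub>} then ?a (inv_into J e j) else (\<lambda>_. 0))" for j
    proof (cases "j < r")
      case True
      then have "j \<in> e ` J" using e by (simp add: bij_betw_def)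
      then obtain y where y: "y \<in> J" "e y = j" by blast
      then have "inv_into J e j = y" using e by (auto simp: bij_betw_def)
      then show ?thesis using y by (force simp: ZG_ops)
    next
      case False
      then have "j \<notin> e ` J" using e by (simp add: bij_betw_def)
      then have "j \<notin> e ` {i. ?a i \<noteq> \<zero>\<^bsub>ZG\<^esub>}" using image_mono[OF sub, of e] by blast
      then show ?thesis using False x by (simp add: free_mod_simps)
    qed
    then show "(\<forall>i. ?a i \<in> carrier ZG) \<and> finite {i. ?a i \<noteq> \<zero>\<^bsub>ZG\<^esub>} \<and> {i. ?a i \<noteq> \<zero>\<^bsub>ZG\<^esub>} \<subseteq> J \<and>
       x = (\<Oplus>\<^bsub>?M\<^esub> i \<in> {i. ?a i \<noteq> \<zero>\<^bsub>ZG\<^esub>}. ?a i \<odot>\<^bsub>?M\<^esub> v i)"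
      unfolding fs[OF finite_subset[OF sub fin] sub ac] using ac finite_subset[OF sub fin] sub by blast
    fix b assume b: "(\<forall>i. b i \<in> carrier ZG) \<and> finite {i. b i \<noteq> \<zero>\<^bsub>ZG\<^esub>} \<and> {i. b i \<noteq> \<zero>\<^bsub>ZG\<^esub>} \<subseteq> J \<and>
       x = (\<Oplus>\<^bsub>?M\<^esub> i \<in> {i. b i \<noteq> \<zero>\<^bsub>ZG\<^esub>}. b i \<odot>\<^bsub>?M\<^esub> v i)"
    then have x': "x = (\<lambda>j. if j \<in> e ` {i. b i \<noteq> \<zero>\<^bsub>ZG\<^esub>} then b (inv_into J e j) else (\<lambda>_. 0))"
      using fs[of "{i. b i \<noteq> \<zero>\<^bsub>ZG\<^esub>}" b] by simp
    show "b = ?a"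
    proof
      fix y
      show "b y = ?a y"
      proof (cases "y \<in> J")
        case True
        then have i: "inv_into J e (e y) = y" using e by (auto simp: bij_betw_def)
        have "x (e y) = b y"
        proof (cases "b y = \<zero>\<^bsub>ZG\<^esub>")
          case by0: True
          then have "e y \<notin> e ` {i. b i \<noteq> \<zero>\<^bsub>ZG\<^esub>}"
            using b e \<open>y \<in> J\<close> by (auto simp: bij_betw_def dest: inj_onD)
          then show ?thesis using x' by0 by (simp add: ZG_ops)
        next
          case False
          then show ?thesis using x' i by simp
        qed
        then show ?thesis using True by simp
      next
        case False
        then show ?thesis using b by (auto simp: ZG_ops)
      qed
    qed
  qed
  then show ?thesis unfolding is_basis_def using vc by blast
qed

lemma free_mod_free: "free_module ZG (free_mod G r)"
proof -
  have inj: "inj_on (unit_elt G) {..<r}"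
  proof (rule inj_onI)
    fix i j assume "unit_elt G i = unit_elt G j"
    then have "unit_elt G i i \<one> = unit_elt G j i \<one>" by simp
    then show "i = j" by (simp add: unit_elt_def ZG_ops split: if_splits)
  qed
  have "is_basis ZG (free_mod G r) (unit_elt G ` {..<r}) (\<lambda>x. x)"
    by (rule free_mod_is_basis[where e = "inv_into {..<r} (unit_elt G)"])
       (use bij_betw_inv_into[OF inj_on_imp_bij_betw[OF inj]] in \<open>simp_all add: f_inv_into_f\<close>)
  then show ?thesis unfolding free_module_def using free_mod_module by blast
qed

end

lemma boundary_sum: "boundary (sum f A) = (\<Sum>x\<in>A. boundary (f x))"
  by (induction A rule: infinite_finite_induct) simp_all

lemma keys_boundary_length:
  assumes "Poly_Mapping.keys z \<subseteq> {s. length s = Suc k}"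
  shows "Poly_Mapping.keys (boundary z) \<subseteq> {s. length s = k}"
  using keys_frag_extend[of simplex_boundary z] assms keys_simplex_boundary
  unfolding boundary_def by fastforce

text \<open>The boundary is homogeneous, so a filling may be taken in a single dimension.\<close>

lemma acyclic_complex_homogeneous:
  assumes S: "acyclic_complex S" "Poly_Mapping.keys z \<subseteq> S \<inter> {s. length s = k}" "boundary z = 0"
  obtains w where "Poly_Mapping.keys w \<subseteq> S \<inter> {s. length s = Suc k}" "boundary w = z"
proof -
  obtain w where w: "Poly_Mapping.keys w \<subseteq> S" "boundary w = z"
    using acyclic_complexD[OF S(1) _ S(3)] S(2) by blast
  have "Poly_Mapping.keys w \<subseteq> (S \<inter> {s. length s = Suc k}) \<union> {s. length s \<noteq> Suc k}" using w(1) by blast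
  then obtain a b where ab: "Poly_Mapping.keys a \<subseteq> S \<inter> {s. length s = Suc k}"
      "Poly_Mapping.keys b \<subseteq> {s. length s \<noteq> Suc k}" "a + b = w"
    by (rule frag_split)
  \<comment> \<open>The boundary lowers length by exactly 1, so the part \<open>b\<close> of the
    wrong lengths contributes nothing in length \<open>k\<close>; but its boundary is
    \<open>z - boundary a\<close>, all of length \<open>k\<close>, and hence zero.\<close>
  have "Poly_Mapping.keys (boundary b) \<subseteq> {s. length s \<noteq> k}"
    using keys_frag_extend[of simplex_boundary b] ab(2) keys_simplex_boundary
    unfolding boundary_def by fastforce
  moreover have "Poly_Mapping.keys (boundary b) \<subseteq> {s. length s = k}"
  proof -
    have "boundary b = z - boundary a" using ab(3) w(2) by auto
    moreover have "Poly_Mapping.keys (boundary a) \<subseteq> {s. length s = k}"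
      using ab(1) by (intro keys_boundary_length) auto
    ultimately show ?thesis using keys_diff[of z "boundary a"] S(2) by auto
  qed
  ultimately have "Poly_Mapping.keys (boundary b) = {}" by blast
  then have "boundary b = 0" by simp
  then show ?thesis using that ab w(2) by force
qed

section \<open>The resolution of an acyclic complex with free action\<close>

text \<open>Freeness is visible at the first vertex: translation acts simply transitively on its
  group component, so the simplices that begin over the identity represent each orbit once. The map
  \<open>\<tau> k\<close> enumerates them.\<close>

locale simplicial_resolution = group G for G (structure) +
  fixes m :: nat and S :: "('a \<times> nat) list set" and r :: "nat \<Rightarrow> nat" and \<tau> :: "nat \<Rightarrow> nat \<Rightarrow> ('a \<times> nat) list"
  assumes m_pos: "0 < m"
    and acyclic: "acyclic_complex S"
    and S_lists: "S \<subseteq> lists (carrier G \<times> {..<m})"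
    and S_faces: "face_closed S"
    and S_translate: "\<And>g s. g \<in> carrier G \<Longrightarrow> s \<in> S \<Longrightarrow> map (\<lambda>(h, c). (g \<otimes> h, c)) s \<in> S"
    and S_vertex: "\<And>x. x \<in> carrier G \<times> {..<m} \<Longrightarrow> [x] \<in> S"
    and enum: "\<And>k. bij_betw (\<tau> k) {..<r k} {s \<in> S. length s = Suc k \<and> fst (hd s) = \<one>}"
begin

definition translate :: "'a \<Rightarrow> ('a \<times> nat) list \<Rightarrow> ('a \<times> nat) list" where
  "translate g s = map (\<lambda>(h, c). (g \<otimes> h, c)) s"

definition simplices :: "nat \<Rightarrow> ('a \<times> nat) list set" where
  "simplices k = {s \<in> S. length s = Suc k}"

definition cell :: "nat \<Rightarrow> nat \<Rightarrow> 'a \<Rightarrow> ('a \<times> nat) list" where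
  "cell k i g = translate g (\<tau> k i)"

abbreviation glists :: "('a \<times> nat) list set" where "glists \<equiv> lists (carrier G \<times> {..<m})"

lemma translate_simps [simp]:
  "translate g [] = []" "translate g ((h, c) # s) = (g \<otimes> h, c) # translate g s"
  "length (translate g s) = length s"
  by (simp_all add: translate_def)

lemma translate_mult: "x \<in> carrier G \<Longrightarrow> y \<in> carrier G \<Longrightarrow> s \<in> glists \<Longrightarrow>
    translate x (translate y s) = translate (x \<otimes> y) s"
  by (induction s) (auto simp: m_assoc)

lemma translate_one: "s \<in> glists \<Longrightarrow> translate \<one> s = s"
  by (induction s) auto

lemma translate_inv: "x \<in> carrier G \<Longrightarrow> s \<in> glists \<Longrightarrow> translate (inv x) (translate x s) = s"
    "x \<in> carrier G \<Longrightarrow> s \<in> glists \<Longrightarrow> translate x (translate (inv x) s) = s"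
  by (simp_all add: translate_mult translate_one)

lemma translate_S: "g \<in> carrier G \<Longrightarrow> s \<in> S \<Longrightarrow> translate g s \<in> S"
  using S_translate by (simp add: translate_def)

lemma S_glists: "s \<in> S \<Longrightarrow> s \<in> glists" using S_lists by blast

lemma tau: assumes "i < r k"
  shows "\<tau> k i \<in> S" "length (\<tau> k i) = Suc k" "fst (hd (\<tau> k i)) = \<one>"
  using bij_betwE[OF enum[of k]] assms by auto

lemma cell_simplices: "i < r k \<Longrightarrow> g \<in> carrier G \<Longrightarrow> cell k i g \<in> simplices k"
  using tau translate_S by (simp add: cell_def simplices_def)

lemma hd_cell:
  assumes "i < r k" "g \<in> carrier G" shows "fst (hd (cell k i g)) = g"
proof -
  obtain h c t where s: "\<tau> k i = (h, c) # t" using tau(2)[OF assms(1)] by (metis length_Suc_conv prod.exhaust)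
  then show ?thesis using tau(3)[OF assms(1)] assms(2) by (simp add: cell_def)
qed

text \<open>The group element is read off the first vertex, after which translation by it can be
  undone.\<close>

lemma cell_inj:
  assumes "cell k i g = cell k j h" "i < r k" "j < r k" "g \<in> carrier G" "h \<in> carrier G"
  shows "i = j \<and> g = h"
proof -
  have "g = h" using hd_cell assms by metis
  then have "\<tau> k i = \<tau> k j"
    using assms translate_inv(1)[of g] S_glists[OF tau(1)] unfolding cell_def by metis
  then show ?thesis using \<open>g = h\<close> enum[of k] assms(2,3) by (auto simp: bij_betw_def inj_on_def)
qed

text \<open>The inverse of the first group component moves a simplex to one of the enumerated
  representatives.\<close>

lemma cell_surj:
  assumes "s \<in> simplices k" obtains i g where "i < r k" "g \<in> carrier G" "s = cell k i g"
proof -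
  have s: "s \<in> S" "length s = Suc k" using assms by (auto simp: simplices_def)
  obtain g c t where gt: "s = (g, c) # t" using s(2) by (metis length_Suc_conv prod.exhaust)
  have g: "g \<in> carrier G" using S_glists[OF s(1)] gt by auto
  have "translate (inv g) s \<in> {s \<in> S. length s = Suc k \<and> fst (hd s) = \<one>}"
    using s translate_S[OF inv_closed[OF g] s(1)] g by (simp add: gt)
  then obtain i where "i < r k" "\<tau> k i = translate (inv g) s"
    using enum[of k] by (metis (no_types, lifting) bij_betw_iff_bijections lessThan_iff)
  then show ?thesis using that g translate_inv(2)[OF g S_glists[OF s(1)]] by (metis cell_def)
qed

definition coords :: "nat \<Rightarrow> ('a \<times> nat) list \<Rightarrow> nat \<times> 'a" where
  "coords k s = (SOME p. fst p < r k \<and> snd p \<in> carrier G \<and> s = cell k (fst p) (snd p))"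

lemma coords_cell: assumes "i < r k" "g \<in> carrier G" shows "coords k (cell k i g) = (i, g)"
proof -
  have "fst (coords k (cell k i g)) < r k \<and> snd (coords k (cell k i g)) \<in> carrier G \<and>
      cell k i g = cell k (fst (coords k (cell k i g))) (snd (coords k (cell k i g)))"
    unfolding coords_def by (rule someI[of _ "(i, g)"]) (simp add: assms)
  then show ?thesis using cell_inj assms by (metis prod.collapse)
qed

abbreviation M :: "nat \<Rightarrow> ('a \<Rightarrow> int, nat \<Rightarrow> 'a \<Rightarrow> int) module" where "M k \<equiv> free_mod G (r k)"

text \<open>Together with \<open>of_chain\<close> this identifies the free module with the degree
  \<open>k\<close> chains, where boundaries, fillings and homotopies are constructed.\<close>

definition to_chain :: "nat \<Rightarrow> (nat \<Rightarrow> 'a \<Rightarrow> int) \<Rightarrow> (('a \<times> nat) list \<Rightarrow>\<^sub>0 int)" where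
  "to_chain k w = Abs_poly_mapping
    (\<lambda>s. if s \<in> simplices k then w (fst (coords k s)) (snd (coords k s)) else 0)"

definition of_chain :: "nat \<Rightarrow> (('a \<times> nat) list \<Rightarrow>\<^sub>0 int) \<Rightarrow> nat \<Rightarrow> 'a \<Rightarrow> int" where
  "of_chain k z = (\<lambda>i g. if i < r k \<and> g \<in> carrier G then Poly_Mapping.lookup z (cell k i g) else 0)"

lemma lookup_to_chain:
  assumes w: "w \<in> carrier (M k)"
  shows "Poly_Mapping.lookup (to_chain k w) s =
    (if s \<in> simplices k then w (fst (coords k s)) (snd (coords k s)) else 0)"
proof -
  have "{s. (if s \<in> simplices k then w (fst (coords k s)) (snd (coords k s)) else 0) \<noteq> 0} \<subseteq>
      (\<Union>i<r k. cell k i ` {g. w i g \<noteq> 0})"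
  proof
    fix s assume s: "s \<in> {s. (if s \<in> simplices k then w (fst (coords k s)) (snd (coords k s)) else 0) \<noteq> 0}"
    then have "s \<in> simplices k" by (auto split: if_splits)
    then obtain i g where "i < r k" "g \<in> carrier G" "s = cell k i g" by (rule cell_surj)
    then show "s \<in> (\<Union>i<r k. cell k i ` {g. w i g \<noteq> 0})" using s coords_cell by (auto split: if_splits)
  qed
  moreover have "finite (\<Union>i<r k. cell k i ` {g. w i g \<noteq> 0})"
    using w by (auto simp: free_mod_simps ZG_carrier)
  ultimately have "finite {s. (if s \<in> simplices k then w (fst (coords k s)) (snd (coords k s)) else 0) \<noteq> 0}"
    by (rule finite_subset)
  from lookup_Abs_poly_mapping[OF this] show ?thesis unfolding to_chain_def by simp
qed

lemma lookup_to_chain_cell: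
  assumes "w \<in> carrier (M k)" "i < r k" "g \<in> carrier G"
  shows "Poly_Mapping.lookup (to_chain k w) (cell k i g) = w i g"
  using assms by (simp add: lookup_to_chain cell_simplices coords_cell)

lemma keys_to_chain: "w \<in> carrier (M k) \<Longrightarrow> Poly_Mapping.keys (to_chain k w) \<subseteq> simplices k"
  by (auto simp: in_keys_iff lookup_to_chain split: if_splits)

lemma of_chain_to_chain: assumes w: "w \<in> carrier (M k)" shows "of_chain k (to_chain k w) = w"
proof (intro ext)
  fix i g show "of_chain k (to_chain k w) i g = w i g"
  proof (cases "i < r k \<and> g \<in> carrier G")
    case True
    then show ?thesis using lookup_to_chain_cell[OF w] by (simp add: of_chain_def)
  next
    case False
    then show ?thesis using w ZG_outside[of "w i" g] by (auto simp: of_chain_def free_mod_simps)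
  qed
qed

lemma of_chain_carrier: assumes "Poly_Mapping.keys z \<subseteq> simplices k" shows "of_chain k z \<in> carrier (M k)"
proof -
  have "of_chain k z i \<in> carrier ZG" for i
  proof -
    have "{g. of_chain k z i g \<noteq> 0} \<subseteq> (\<lambda>s. fst (hd s)) ` Poly_Mapping.keys z"
    proof
      fix g assume "g \<in> {g. of_chain k z i g \<noteq> 0}"
      then have g: "i < r k" "g \<in> carrier G" "Poly_Mapping.lookup z (cell k i g) \<noteq> 0"
        by (auto simp: of_chain_def split: if_splits)
      then show "g \<in> (\<lambda>s. fst (hd s)) ` Poly_Mapping.keys z"
        using hd_cell[OF g(1,2)] by (intro image_eqI[of _ _ "cell k i g"]) (auto simp: in_keys_iff)
    qed
    then have "finite {g. of_chain k z i g \<noteq> 0}" by (rule finite_subset) simp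
    then show ?thesis by (auto simp: ZG_carrier of_chain_def split: if_splits)
  qed
  then show ?thesis by (auto simp: free_mod_simps of_chain_def)
qed

lemma to_chain_of_chain:
  assumes z: "Poly_Mapping.keys z \<subseteq> simplices k" shows "to_chain k (of_chain k z) = z"
proof (rule poly_mapping_eqI)
  fix s
  show "Poly_Mapping.lookup (to_chain k (of_chain k z)) s = Poly_Mapping.lookup z s"
  proof (cases "s \<in> simplices k")
    case True
    then obtain i g where ig: "i < r k" "g \<in> carrier G" "s = cell k i g" by (rule cell_surj)
    show ?thesis
      unfolding ig(3) lookup_to_chain_cell[OF of_chain_carrier[OF z] ig(1,2)] using ig by (simp add: of_chain_def)
  next
    case False
    then have "Poly_Mapping.lookup z s = 0" using z by (auto simp: in_keys_iff)
    then show ?thesis using False by (simp add: lookup_to_chain[OF of_chain_carrier[OF z]])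
  qed
qed

lemma M_add: "v \<in> carrier (M k) \<Longrightarrow> w \<in> carrier (M k) \<Longrightarrow> (\<lambda>i g. v i g + w i g) \<in> carrier (M k)"
  by (simp add: free_mod_simps ZG_add)

lemma to_chain_add: "v \<in> carrier (M k) \<Longrightarrow> w \<in> carrier (M k) \<Longrightarrow>
    to_chain k (\<lambda>i g. v i g + w i g) = to_chain k v + to_chain k w"
  by (rule poly_mapping_eqI) (simp add: lookup_to_chain M_add lookup_add)

lemma of_chain_add: "of_chain k (z + z') = (\<lambda>i g. of_chain k z i g + of_chain k z' i g)"
  by (auto simp: of_chain_def lookup_add fun_eq_iff)

lemma of_chain_0: "of_chain k 0 = (\<lambda>_ _. 0)" by (auto simp: of_chain_def fun_eq_iff)

lemma to_chain_0: "to_chain k (\<lambda>_ _. 0) = 0"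
  by (rule poly_mapping_eqI) (simp add: lookup_to_chain free_mod_simps ZG_zero)

definition translate_chain :: "'a \<Rightarrow> (('a \<times> nat) list \<Rightarrow>\<^sub>0 int) \<Rightarrow> (('a \<times> nat) list \<Rightarrow>\<^sub>0 int)" where
  "translate_chain g = frag_extend (\<lambda>s. frag_of (translate g s))"

lemma translate_chain_simps [simp]:
  "translate_chain g 0 = 0" "translate_chain g (frag_of s) = frag_of (translate g s)"
  "translate_chain g (a - b) = translate_chain g a - translate_chain g b"
  "translate_chain g (frag_cmul c a) = frag_cmul c (translate_chain g a)"
  by (simp_all add: translate_chain_def frag_extend_diff frag_extend_cmul)

lemma translate_chain_cone: "translate_chain g (cone (h, c) z) = cone (g \<otimes> h, c) (translate_chain g z)"
proof -
  have "Poly_Mapping.keys z \<subseteq> UNIV" by simp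
  then show ?thesis by (induction z rule: frag_induction) simp_all
qed

lemma translate_simplex_boundary: "simplex_boundary (translate g s) = translate_chain g (simplex_boundary s)"
  by (induction s)
     (auto simp: simplex_boundary_Cons translate_chain_cone simp del: simplex_boundary.simps(2))

lemma boundary_translate_chain: "boundary (translate_chain g z) = translate_chain g (boundary z)"
proof -
  have "Poly_Mapping.keys z \<subseteq> UNIV" by simp
  then show ?thesis by (induction z rule: frag_induction) (simp_all add: translate_simplex_boundary)
qed

lemma lookup_translate_chain:
  assumes "Poly_Mapping.keys z \<subseteq> glists" "s \<in> glists" "x \<in> carrier G"
  shows "Poly_Mapping.lookup (translate_chain x z) s = Poly_Mapping.lookup z (translate (inv x) s)"
  using assms(1)
proof (induction z rule: frag_induction)
  case (one t)
  have "translate x t = s \<longleftrightarrow> t = translate (inv x) s"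
    using translate_inv(1)[OF assms(3) one] translate_inv(2)[OF assms(3,2)] by auto
  then show ?case by (cases "translate x t = s") (auto simp: lookup_single when_def)
qed (simp_all add: lookup_minus)

lemma keys_translate_chain:
  assumes "Poly_Mapping.keys z \<subseteq> simplices k" "x \<in> carrier G"
  shows "Poly_Mapping.keys (translate_chain x z) \<subseteq> simplices k"
proof
  fix t assume "t \<in> Poly_Mapping.keys (translate_chain x z)"
  then obtain s where "s \<in> Poly_Mapping.keys z" "t = translate x s"
    using keys_frag_extend[of "\<lambda>s. frag_of (translate x s)" z] unfolding translate_chain_def by auto
  then show "t \<in> simplices k" using assms translate_S by (auto simp: simplices_def)
qed

lemma simplices_glists: "simplices k \<subseteq> glists" using S_lists by (auto simp: simplices_def)

text \<open>The scalar action is the linear extension of the translation of simplices; linearity of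
  the boundary then follows from its compatibility with translation.\<close>

lemma smult_chain:
  assumes a: "a \<in> carrier ZG" and w: "w \<in> carrier (M k)"
  shows "to_chain k (a \<odot>\<^bsub>M k\<^esub> w) = (\<Sum>x | a x \<noteq> 0. frag_cmul (a x) (translate_chain x (to_chain k w)))"
    (is "_ = ?z")
proof -
  have z: "Poly_Mapping.keys ?z \<subseteq> simplices k"
    using keys_translate_chain[OF keys_to_chain[OF w]] a
    by (intro order_trans[OF keys_sum] UN_least order_trans[OF keys_cmul]) (auto simp: ZG_carrier)
  have aw: "a \<odot>\<^bsub>M k\<^esub> w \<in> carrier (M k)"
    by (rule left_module.smult_closed[OF free_mod_module a w])
  have "of_chain k ?z = a \<odot>\<^bsub>M k\<^esub> w"
  proof (intro ext)
    fix i g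
    show "of_chain k ?z i g = (a \<odot>\<^bsub>M k\<^esub> w) i g"
    proof (cases "i < r k \<and> g \<in> carrier G")
      case True
      then have ig: "i < r k" "g \<in> carrier G" by auto
      have "Poly_Mapping.lookup (translate_chain x (to_chain k w)) (cell k i g) = w i (inv x \<otimes> g)"
        if x: "x \<in> carrier G" for x
      proof -
        have "translate (inv x) (cell k i g) = cell k i (inv x \<otimes> g)"
          unfolding cell_def using ig x tau(1)[OF ig(1)] by (intro translate_mult) (auto dest: S_glists)
        moreover have "cell k i g \<in> glists" using cell_simplices[OF ig] simplices_glists by blast
        ultimately show ?thesis
          using lookup_translate_chain[OF order_trans[OF keys_to_chain[OF w] simplices_glists] _ x]
            lookup_to_chain_cell[OF w ig(1), of "inv x \<otimes> g"] x ig(2) by simp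
      qed
      then have "of_chain k ?z i g = (\<Sum>x | a x \<noteq> 0. a x * w i (inv x \<otimes> g))"
        using True a by (auto simp: of_chain_def Poly_Mapping.lookup_sum ZG_carrier intro!: sum.cong)
      then show ?thesis
        using ZG_mult_translates[OF a _ ig(2), of "w i"] w by (simp add: free_mod_simps)
    next
      case False
      then show ?thesis
        using aw ZG_outside[of "(a \<odot>\<^bsub>M k\<^esub> w) i" g] by (auto simp: of_chain_def free_mod_simps(1))
    qed
  qed
  then show ?thesis using to_chain_of_chain[OF z] by simp
qed

section \<open>Boundary maps and exactness\<close>

definition D :: "nat \<Rightarrow> (nat \<Rightarrow> 'a \<Rightarrow> int) \<Rightarrow> nat \<Rightarrow> 'a \<Rightarrow> int" where
  "D k w = of_chain (k - 1) (boundary (to_chain k w))"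

lemma keys_boundary_simplices:
  assumes "Poly_Mapping.keys z \<subseteq> simplices (Suc k)" shows "Poly_Mapping.keys (boundary z) \<subseteq> simplices k"
proof -
  have z: "Poly_Mapping.keys z \<subseteq> S" "Poly_Mapping.keys z \<subseteq> {s. length s = Suc (Suc k)}"
    using assms by (auto simp: simplices_def)
  show ?thesis
    using keys_boundary[OF S_faces z(1)] keys_boundary_length[OF z(2)] by (auto simp: simplices_def)
qed

lemma to_chain_D:
  assumes "w \<in> carrier (M (Suc k))" shows "to_chain k (D (Suc k) w) = boundary (to_chain (Suc k) w)"
  unfolding D_def using to_chain_of_chain[OF keys_boundary_simplices[OF keys_to_chain[OF assms]]] by simp

lemma D_carrier: "w \<in> carrier (M (Suc k)) \<Longrightarrow> D (Suc k) w \<in> carrier (M k)"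
  unfolding D_def using of_chain_carrier[OF keys_boundary_simplices[OF keys_to_chain]] by simp

lemma D_hom: "D (Suc k) \<in> left_module_hom ZG (M (Suc k)) (M k)"
proof -
  have "D (Suc k) (v \<oplus>\<^bsub>M (Suc k)\<^esub> w) = D (Suc k) v \<oplus>\<^bsub>M k\<^esub> D (Suc k) w"
    if "v \<in> carrier (M (Suc k))" "w \<in> carrier (M (Suc k))" for v w
    using that by (simp add: free_mod_simps(3) D_def to_chain_add of_chain_add)
  moreover have "D (Suc k) (a \<odot>\<^bsub>M (Suc k)\<^esub> w) = a \<odot>\<^bsub>M k\<^esub> D (Suc k) w"
    if a: "a \<in> carrier ZG" and w: "w \<in> carrier (M (Suc k))" for a w
  proof -
    have "boundary (to_chain (Suc k) (a \<odot>\<^bsub>M (Suc k)\<^esub> w)) = to_chain k (a \<odot>\<^bsub>M k\<^esub> D (Suc k) w)"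
      unfolding smult_chain[OF a w] smult_chain[OF a D_carrier[OF w]]
      by (simp add: boundary_sum boundary_translate_chain to_chain_D[OF w])
    then show ?thesis
      using of_chain_to_chain[OF left_module.smult_closed[OF free_mod_module a D_carrier[OF w]]]
      by (simp add: D_def)
  qed
  ultimately show ?thesis
    unfolding left_module_hom_def hom_def using D_carrier by auto
qed

lemma D_D: assumes "w \<in> carrier (M (Suc (Suc k)))" shows "D (Suc k) (D (Suc (Suc k)) w) = (\<lambda>_ _. 0)"
  using to_chain_D[OF assms] by (simp add: D_def[of "Suc k"] boundary_boundary of_chain_0)

lemma chain_complex: "chain_complex ZG M D"
  unfolding chain_complex_def using free_mod_module D_hom D_D by (auto simp: free_mod_simps)

lemma fill:
  assumes x: "x \<in> carrier (M k)" and z: "boundary (to_chain k x) = 0"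
  obtains w where "w \<in> carrier (M (Suc k))" "D (Suc k) w = x"
proof -
  have "Poly_Mapping.keys (to_chain k x) \<subseteq> S \<inter> {s. length s = Suc k}"
    using keys_to_chain[OF x] by (auto simp: simplices_def)
  then obtain z where z: "Poly_Mapping.keys z \<subseteq> S \<inter> {s. length s = Suc (Suc k)}" "boundary z = to_chain k x"
    using acyclic_complex_homogeneous[OF acyclic _ z] by metis
  then have zs: "Poly_Mapping.keys z \<subseteq> simplices (Suc k)" by (auto simp: simplices_def)
  have "D (Suc k) (of_chain (Suc k) z) = x"
    by (simp add: D_def to_chain_of_chain[OF zs] z(2) of_chain_to_chain[OF x])
  then show ?thesis using that of_chain_carrier[OF zs] by blast
qed

text \<open>One direction is that the boundary squares to zero, the other is acyclicity. In degree 0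
  the boundary is the augmented one, so the boundaries there are the elements of augmentation
  zero.\<close>

lemma boundaries_iff:
  "x \<in> boundaries M D k \<longleftrightarrow> x \<in> carrier (M k) \<and> boundary (to_chain k x) = 0"
proof
  assume "x \<in> boundaries M D k"
  then obtain w where w: "w \<in> carrier (M (Suc k))" "x = D (Suc k) w" by (auto simp: boundaries_def)
  then show "x \<in> carrier (M k) \<and> boundary (to_chain k x) = 0"
    using D_carrier[OF w(1)] to_chain_D[OF w(1)] by (simp add: boundary_boundary)
next
  assume "x \<in> carrier (M k) \<and> boundary (to_chain k x) = 0"
  then obtain w where "w \<in> carrier (M (Suc k))" "D (Suc k) w = x" using fill by blast
  then show "x \<in> boundaries M D k" unfolding boundaries_def by blast
qed

section \<open>Homology in degree 0\<close>

text \<open>The coefficient of the empty simplex in the boundary, which is the sum of all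
  coefficients since each vertex has the empty list as boundary.\<close>

definition augmentation :: "(nat \<Rightarrow> 'a \<Rightarrow> int) \<Rightarrow> int" where
  "augmentation w = Poly_Mapping.lookup (boundary (to_chain 0 w)) []"

lemma boundary_to_chain_0:
  assumes "w \<in> carrier (M 0)"
  shows "boundary (to_chain 0 w) = frag_cmul (augmentation w) (frag_of [])"
proof (rule poly_mapping_eqI)
  fix s
  have "Poly_Mapping.keys (to_chain 0 w) \<subseteq> {s. length s = Suc 0}"
    using keys_to_chain[OF assms] by (auto simp: simplices_def)
  then have "Poly_Mapping.keys (boundary (to_chain 0 w)) \<subseteq> {s. length s = 0}"
    by (rule keys_boundary_length)
  then have "Poly_Mapping.lookup (boundary (to_chain 0 w)) s = 0" if "s \<noteq> []"
    using that by (auto simp: in_keys_iff)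
  then show "Poly_Mapping.lookup (boundary (to_chain 0 w)) s =
      Poly_Mapping.lookup (frag_cmul (augmentation w) (frag_of [])) s"
    by (cases "s = []") (simp_all add: augmentation_def lookup_single)
qed

lemma augmentation_add: "v \<in> carrier (M 0) \<Longrightarrow> w \<in> carrier (M 0) \<Longrightarrow>
    augmentation (\<lambda>i g. v i g + w i g) = augmentation v + augmentation w"
  by (simp add: augmentation_def to_chain_add lookup_add)

lemma augmentation_smult:
  assumes a: "a \<in> carrier ZG" and w: "w \<in> carrier (M 0)"
  shows "augmentation (a \<odot>\<^bsub>M 0\<^esub> w) = (\<Sum>x | a x \<noteq> 0. a x) * augmentation w"
  unfolding augmentation_def smult_chain[OF a w]
  by (simp add: boundary_sum boundary_translate_chain boundary_to_chain_0[OF w] Poly_Mapping.lookup_sum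
      sum_distrib_right)

lemma M_uminus: "w \<in> carrier (M k) \<Longrightarrow> (\<lambda>i g. - w i g) \<in> carrier (M k)"
  by (simp add: free_mod_simps ZG_uminus)

lemma to_chain_uminus: assumes "w \<in> carrier (M k)" shows "to_chain k (\<lambda>i g. - w i g) = - to_chain k w"
  by (rule poly_mapping_eqI) (simp add: lookup_to_chain[OF assms] lookup_to_chain[OF M_uminus[OF assms]])

lemma M_a_minus:
  assumes "v \<in> carrier (M k)" "w \<in> carrier (M k)"
  shows "v \<ominus>\<^bsub>M k\<^esub> w = (\<lambda>i g. v i g - w i g)"
proof -
  interpret A: abelian_group "M k" by (rule free_mod_abelian)
  have "\<ominus>\<^bsub>M k\<^esub> w = (\<lambda>i g. - w i g)"
    using assms(2) M_uminus[OF assms(2)] by (intro A.minus_equality) (simp_all add: free_mod_simps(2,3))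
  then show ?thesis by (simp add: a_minus_def free_mod_simps(3))
qed

lemma homology_class_iff:
  assumes x: "x \<in> carrier (M k)"
  shows "homology_class M D k x = {y \<in> carrier (M k). boundary (to_chain k y) = boundary (to_chain k x)}"
proof (intro equalityI subsetI)
  fix y assume "y \<in> homology_class M D k x"
  then obtain b where b: "b \<in> boundaries M D k" "y = (\<lambda>i g. b i g + x i g)"
    by (auto simp: homology_class_def a_r_coset_def r_coset_def free_mod_simps(3))
  then show "y \<in> {y \<in> carrier (M k). boundary (to_chain k y) = boundary (to_chain k x)}"
    using x by (auto simp: boundaries_iff M_add to_chain_add)
next
  fix y assume y: "y \<in> {y \<in> carrier (M k). boundary (to_chain k y) = boundary (to_chain k x)}"
  let ?b = "\<lambda>i g. y i g + - x i g"
  have "?b \<in> boundaries M D k"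
    unfolding boundaries_iff
    using y M_add[OF _ M_uminus[OF x]] to_chain_add[OF _ M_uminus[OF x]] to_chain_uminus[OF x] by simp
  moreover have "y = ?b \<oplus>\<^bsub>M k\<^esub> x" by (simp add: free_mod_simps(3))
  ultimately show "y \<in> homology_class M D k x"
    unfolding homology_class_def a_r_coset_def r_coset_def by auto
qed

lemma homology_class_0:
  assumes "x \<in> carrier (M 0)"
  shows "homology_class M D 0 x = {y \<in> carrier (M 0). augmentation y = augmentation x}"
proof -
  have "boundary (to_chain 0 y) = boundary (to_chain 0 x) \<longleftrightarrow> augmentation y = augmentation x"
    if y: "y \<in> carrier (M 0)" for y
  proof
    assume "augmentation y = augmentation x"
    then show "boundary (to_chain 0 y) = boundary (to_chain 0 x)"
      unfolding boundary_to_chain_0[OF y] boundary_to_chain_0[OF assms] by simp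
  qed (simp add: augmentation_def)
  then show ?thesis unfolding homology_class_iff[OF assms] by blast
qed

lemma homology_pos:
  assumes "k > 0" shows "carrier (homology M D k) = {\<zero>\<^bsub>homology M D k\<^esub>}"
proof -
  obtain l where k: "k = Suc l" using assms gr0_conv_Suc by auto
  have cyc: "x \<in> cycles M D k \<longleftrightarrow> x \<in> boundaries M D k" for x
  proof -
    have "D k x = (\<lambda>_ _. 0) \<longleftrightarrow> boundary (to_chain k x) = 0" if x: "x \<in> carrier (M k)"
      using to_chain_D[of x l] to_chain_0[of l] x unfolding k by (auto simp: D_def of_chain_0)
    then show ?thesis unfolding boundaries_iff by (auto simp: cycles_def k free_mod_simps(2))
  qed
  have "homology_class M D k x = boundaries M D k" if "x \<in> boundaries M D k" for x
    using that by (auto simp: homology_class_iff boundaries_iff)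
  moreover have "(\<lambda>_ _. 0) \<in> boundaries M D k"
    by (simp add: boundaries_iff to_chain_0 free_mod_simps ZG_zero)
  ultimately show ?thesis unfolding homology_def using cyc by auto
qed

lemma of_chain_diff: "of_chain k (z - z') = (\<lambda>i g. of_chain k z i g - of_chain k z' i g)"
  by (auto simp: of_chain_def lookup_minus fun_eq_iff)

text \<open>The vertex with group component one and label 0, available by \<open>m_pos\<close>. Its
  multiples split the augmentation.\<close>

definition base_point :: "nat \<Rightarrow> 'a \<Rightarrow> int" where
  "base_point = of_chain 0 (frag_of [(\<one>, 0)])"

definition multiple :: "int \<Rightarrow> (nat \<Rightarrow> 'a \<Rightarrow> int) \<Rightarrow> nat \<Rightarrow> 'a \<Rightarrow> int" where
  "multiple c w = (\<lambda>i g. c * w i g)"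

lemma keys_base: "Poly_Mapping.keys (frag_cmul c (frag_of [(\<one>, 0)])) \<subseteq> simplices 0"
proof -
  have "[(\<one>, 0)] \<in> simplices 0" using S_vertex[of "(\<one>, 0)"] m_pos by (simp add: simplices_def)
  then show ?thesis using keys_cmul[of c "frag_of [(\<one>, 0)]"] by auto
qed

lemma multiple_base: "multiple c base_point = of_chain 0 (frag_cmul c (frag_of [(\<one>, 0)]))"
  by (auto simp: multiple_def base_point_def of_chain_def fun_eq_iff)

lemma multiple_base_carrier: "multiple c base_point \<in> carrier (M 0)"
  unfolding multiple_base by (rule of_chain_carrier[OF keys_base])

lemma to_chain_multiple_base: "to_chain 0 (multiple c base_point) = frag_cmul c (frag_of [(\<one>, 0)])"
  unfolding multiple_base by (rule to_chain_of_chain[OF keys_base])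

lemma augmentation_multiple_base: "augmentation (multiple c base_point) = c"
  unfolding augmentation_def to_chain_multiple_base by simp

definition class_augmentation :: "(nat \<Rightarrow> 'a \<Rightarrow> int) set \<Rightarrow> int" where
  "class_augmentation X = augmentation (SOME x. x \<in> X)"

lemma class_augmentation:
  assumes "x \<in> carrier (M 0)" shows "class_augmentation (homology_class M D 0 x) = augmentation x"
proof -
  have "(SOME y. y \<in> homology_class M D 0 x) \<in> homology_class M D 0 x"
    by (rule someI[of _ x]) (simp add: homology_class_0[OF assms] assms)
  then show ?thesis unfolding class_augmentation_def homology_class_0[OF assms] by simp
qed

lemma homology_0_carrier: "carrier (homology M D 0) = homology_class M D 0 ` carrier (M 0)"
  by (simp add: homology_def cycles_def)

lemma homology_0_add:
  assumes x: "x \<in> carrier (M 0)" and y: "y \<in> carrier (M 0)"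
  shows "homology_class M D 0 x \<oplus>\<^bsub>homology M D 0\<^esub> homology_class M D 0 y =
    homology_class M D 0 (\<lambda>i g. x i g + y i g)"
proof -
  have "homology_class M D 0 x \<oplus>\<^bsub>homology M D 0\<^esub> homology_class M D 0 y =
      (\<Union>a \<in> homology_class M D 0 x. \<Union>b \<in> homology_class M D 0 y. {\<lambda>i g. a i g + b i g})"
    by (simp add: homology_def set_add_def set_mult_def free_mod_simps(3))
  also have "\<dots> = homology_class M D 0 (\<lambda>i g. x i g + y i g)"
  proof (intro equalityI subsetI)
    fix z assume "z \<in> homology_class M D 0 (\<lambda>i g. x i g + y i g)"
    then have z: "z \<in> carrier (M 0)" "augmentation z = augmentation x + augmentation y"
      using x y by (auto simp: homology_class_0 M_add augmentation_add)
    let ?b = "\<lambda>i g. z i g + - x i g"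
    have "?b \<in> carrier (M 0)" by (rule M_add[OF z(1) M_uminus[OF x]])
    moreover have "augmentation ?b = augmentation y"
      using augmentation_add[OF z(1) M_uminus[OF x]] z(2)
      by (simp add: augmentation_def to_chain_uminus[OF x])
    ultimately have "?b \<in> homology_class M D 0 y" using y by (simp add: homology_class_0)
    moreover have "x \<in> homology_class M D 0 x" using x by (simp add: homology_class_0)
    moreover have "z = (\<lambda>i g. x i g + ?b i g)" by auto
    ultimately show "z \<in> (\<Union>a \<in> homology_class M D 0 x. \<Union>b \<in> homology_class M D 0 y. {\<lambda>i g. a i g + b i g})"
      by blast
  qed (use x y in \<open>auto simp: homology_class_0 M_add augmentation_add\<close>)
  finally show ?thesis .
qed

text \<open>All representatives have the same augmentation and so have their multiples by
  \<open>a\<close>; the union that defines the scalar action on classes therefore has a single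
  member.\<close>

lemma homology_0_smult:
  assumes a: "a \<in> carrier ZG" and x: "x \<in> carrier (M 0)"
  shows "a \<odot>\<^bsub>homology M D 0\<^esub> homology_class M D 0 x = homology_class M D 0 (a \<odot>\<^bsub>M 0\<^esub> x)"
proof -
  have c: "a \<odot>\<^bsub>M 0\<^esub> y \<in> carrier (M 0)" if "y \<in> carrier (M 0)" for y
    using left_module.smult_closed[OF free_mod_module a that] .
  have "homology_class M D 0 (a \<odot>\<^bsub>M 0\<^esub> y) = homology_class M D 0 (a \<odot>\<^bsub>M 0\<^esub> x)"
    if "y \<in> homology_class M D 0 x" for y
    using that x a c by (simp add: homology_class_0 augmentation_smult)
  moreover have "homology_class M D 0 x \<noteq> {}" using x by (auto simp: homology_class_0)
  ultimately have "(\<Union>y \<in> homology_class M D 0 x. homology_class M D 0 (a \<odot>\<^bsub>M 0\<^esub> y)) =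
      homology_class M D 0 (a \<odot>\<^bsub>M 0\<^esub> x)"
    by (intro SUP_eq_const)
  then show ?thesis by (simp add: homology_def)
qed

lemma homology_0_iso: "left_module_iso ZG (homology M D 0) trivial_module"
proof -
  have "class_augmentation \<in> left_module_hom ZG (homology M D 0) trivial_module"
  proof -
    have "class_augmentation (X \<oplus>\<^bsub>homology M D 0\<^esub> Y) = class_augmentation X + class_augmentation Y"
      if XY: "X \<in> carrier (homology M D 0)" "Y \<in> carrier (homology M D 0)" for X Y
    proof -
      obtain x y where "x \<in> carrier (M 0)" "X = homology_class M D 0 x"
        "y \<in> carrier (M 0)" "Y = homology_class M D 0 y" using XY by (auto simp: homology_0_carrier)
      then show ?thesis by (simp add: homology_0_add class_augmentation M_add augmentation_add)
    qed
    moreover have "class_augmentation (a \<odot>\<^bsub>homology M D 0\<^esub> X) = (\<Sum>x | a x \<noteq> 0. a x) * class_augmentation X"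
      if aX: "a \<in> carrier ZG" "X \<in> carrier (homology M D 0)" for a X
    proof -
      obtain x where x: "x \<in> carrier (M 0)" "X = homology_class M D 0 x" using aX by (auto simp: homology_0_carrier)
      show ?thesis
        unfolding x(2) homology_0_smult[OF aX(1) x(1)] class_augmentation[OF x(1)]
          class_augmentation[OF left_module.smult_closed[OF free_mod_module aX(1) x(1)]]
        by (rule augmentation_smult[OF aX(1) x(1)])
    qed
    ultimately show ?thesis by (simp add: left_module_hom_def hom_def trivial_module_def)
  qed
  moreover have "bij_betw class_augmentation (carrier (homology M D 0)) (carrier trivial_module)"
    unfolding bij_betw_def
  proof
    show "inj_on class_augmentation (carrier (homology M D 0))"
    proof (rule inj_onI)
      fix X Y assume XY: "X \<in> carrier (homology M D 0)" "Y \<in> carrier (homology M D 0)"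
        and eq: "class_augmentation X = class_augmentation Y"
      obtain x y where x: "x \<in> carrier (M 0)" "X = homology_class M D 0 x"
        and y: "y \<in> carrier (M 0)" "Y = homology_class M D 0 y" using XY by (auto simp: homology_0_carrier)
      have "augmentation x = augmentation y" using eq x y by (simp add: class_augmentation)
      then show "X = Y" unfolding x(2) y(2) homology_class_0[OF x(1)] homology_class_0[OF y(1)] by simp
    qed
    have "c \<in> class_augmentation ` carrier (homology M D 0)" for c
      unfolding homology_0_carrier image_image
      by (rule image_eqI[OF _ multiple_base_carrier[of c]])
         (simp add: class_augmentation[OF multiple_base_carrier] augmentation_multiple_base)
    then show "class_augmentation ` carrier (homology M D 0) = carrier trivial_module"
      by (auto simp: trivial_module_def)
  qed
  ultimately show ?thesis unfolding left_module_iso_def by blast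
qed

theorem free_resolution: "free_resolution G M D"
  unfolding free_resolution_def using chain_complex free_mod_free homology_0_iso homology_pos by blast

text \<open>The empty list is a simplex of degree \<open>-1\<close>, so \<open>H []\<close> is the section of the augmentation.\<close>

definition homotopy_operator :: "(('a \<times> nat) list \<Rightarrow> ('a \<times> nat) list \<Rightarrow>\<^sub>0 int) \<Rightarrow> bool" where
  "homotopy_operator H \<longleftrightarrow> H [] = frag_of [(\<one>, 0)] \<and>
    (\<forall>k. \<forall>s \<in> simplices k. Poly_Mapping.keys (H s) \<subseteq> simplices (Suc k) \<and>
      boundary (H s) = frag_of s - frag_extend H (simplex_boundary s))"

definition homotopy :: "(('a \<times> nat) list \<Rightarrow> ('a \<times> nat) list \<Rightarrow>\<^sub>0 int) \<Rightarrow> nat \<Rightarrow> (nat \<Rightarrow> 'a \<Rightarrow> int) \<Rightarrow> nat \<Rightarrow> 'a \<Rightarrow> int" where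
  "homotopy H k w = of_chain (Suc k) (frag_extend H (to_chain k w))"

text \<open>The identity d H = 1 - H d extends linearly from simplices to chains. In degree 0 the
  boundary is a multiple of the empty simplex, and \<open>H\<close> turns it into that multiple of
  the base vertex, which is the term \<open>s\<close> of the definition.\<close>

theorem contracting_homotopy:
  assumes H: "homotopy_operator H" shows "contracting_homotopy M D (homotopy H)"
proof -
  have keysH: "Poly_Mapping.keys (frag_extend H z) \<subseteq> simplices (Suc k)"
    if z: "Poly_Mapping.keys z \<subseteq> simplices k" for z k
    using keys_frag_extend[of H z] z H unfolding homotopy_operator_def by blast
  have bH: "boundary (frag_extend H z) = z - frag_extend H (boundary z)"
    if z: "Poly_Mapping.keys z \<subseteq> simplices k" for z k
    using z
  proof (induction z rule: frag_induction)
    case (one s)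
    then show ?case using H by (simp add: homotopy_operator_def)
  next
    case (diff a b)
    then show ?case by (simp add: frag_extend_diff)
  qed simp
  have car: "homotopy H k w \<in> carrier (M (Suc k))" if "w \<in> carrier (M k)" for k w
    unfolding homotopy_def by (rule of_chain_carrier[OF keysH[OF keys_to_chain[OF that]]])
  have Dh: "D (Suc k) (homotopy H k w) = of_chain k (to_chain k w - frag_extend H (boundary (to_chain k w)))"
    if "w \<in> carrier (M k)" for k w
    unfolding D_def homotopy_def to_chain_of_chain[OF keysH[OF keys_to_chain[OF that]]]
    by (simp add: bH[OF keys_to_chain[OF that]])
  have hom: "homotopy H k \<in> hom (add_monoid (M k)) (add_monoid (M (Suc k)))" for k
    unfolding hom_def using car
    by (auto simp: homotopy_def free_mod_simps(3) to_chain_add frag_extend_add of_chain_add)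
  have pos: "D (Suc k) (homotopy H k x) \<oplus>\<^bsub>M k\<^esub> homotopy H (k - 1) (D k x) = x"
    if k: "k > 0" and x: "x \<in> carrier (M k)" for k x
  proof -
    obtain l where l: "k = Suc l" using k gr0_conv_Suc by auto
    have "homotopy H (k - 1) (D k x) = of_chain k (frag_extend H (boundary (to_chain k x)))"
      using to_chain_D[of x l] x by (simp add: homotopy_def l)
    then have "D (Suc k) (homotopy H k x) \<oplus>\<^bsub>M k\<^esub> homotopy H (k - 1) (D k x) =
        of_chain k (to_chain k x - frag_extend H (boundary (to_chain k x)) + frag_extend H (boundary (to_chain k x)))"
      by (simp only: Dh[OF x] free_mod_simps(3) of_chain_add)
    then show ?thesis by (simp add: of_chain_to_chain[OF x])
  qed
  let ?s = "\<lambda>X. multiple (class_augmentation X) base_point"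
  have sh: "?s \<in> hom (add_monoid (homology M D 0)) (add_monoid (M 0))"
  proof -
    have "?s (X \<oplus>\<^bsub>homology M D 0\<^esub> Y) = ?s X \<oplus>\<^bsub>M 0\<^esub> ?s Y"
      if XY: "X \<in> carrier (homology M D 0)" "Y \<in> carrier (homology M D 0)" for X Y
    proof -
      obtain x y where "x \<in> carrier (M 0)" "X = homology_class M D 0 x"
        "y \<in> carrier (M 0)" "Y = homology_class M D 0 y" using XY by (auto simp: homology_0_carrier)
      then show ?thesis
        by (simp add: homology_0_add class_augmentation M_add augmentation_add multiple_def
            free_mod_simps(3) algebra_simps)
    qed
    then show ?thesis by (simp add: hom_def multiple_base_carrier)
  qed
  have sc: "homology_class M D 0 (?s X) = X" if X: "X \<in> carrier (homology M D 0)" for X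
  proof -
    obtain x where x: "x \<in> carrier (M 0)" "X = homology_class M D 0 x" using X by (auto simp: homology_0_carrier)
    show ?thesis
      unfolding x(2) homology_class_0[OF multiple_base_carrier] homology_class_0[OF x(1)]
        augmentation_multiple_base class_augmentation[OF x(1), unfolded homology_class_0[OF x(1)]] ..
  qed
  have sd: "D 1 (homotopy H 0 x) = x \<ominus>\<^bsub>M 0\<^esub> ?s (homology_class M D 0 x)"
    if x: "x \<in> carrier (M 0)" for x
  proof -
    have "frag_extend H (boundary (to_chain 0 x)) = frag_cmul (augmentation x) (frag_of [(\<one>, 0)])"
      using H unfolding boundary_to_chain_0[OF x] frag_extend_cmul frag_extend_of homotopy_operator_def by simp
    then have "D 1 (homotopy H 0 x) = of_chain 0 (to_chain 0 x - frag_cmul (augmentation x) (frag_of [(\<one>, 0)]))"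
      using Dh[OF x] by simp
    also have "\<dots> = (\<lambda>i g. x i g - multiple (augmentation x) base_point i g)"
      unfolding multiple_base of_chain_diff of_chain_to_chain[OF x] ..
    finally show ?thesis
      unfolding M_a_minus[OF x multiple_base_carrier] class_augmentation[OF x] .
  qed
  show ?thesis
    unfolding contracting_homotopy_def by (intro conjI allI impI ballI bexI[of _ ?s] hom pos sh sc sd)
qed

end

section \<open>Computable functions\<close>

lemma rec_eval_comp1: "rec_eval p xs y \<Longrightarrow> rec_eval q [y] z \<Longrightarrow> rec_eval (Comp q [p]) xs z"
  by (rule rec_eval.Comp[of xs _ "[y]"]) simp_all

lemma rec_eval_comp2: "rec_eval p xs y \<Longrightarrow> rec_eval p' xs y' \<Longrightarrow> rec_eval q [y, y'] z \<Longrightarrow>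
    rec_eval (Comp q [p, p']) xs z"
  by (rule rec_eval.Comp[of xs _ "[y, y']"]) simp_all

lemma rec_eval_proj0: "rec_eval (Proj 0) (x # xs) x" using rec_eval.Proj[of 0 "x # xs"] by simp
lemma rec_eval_proj1: "rec_eval (Proj (Suc 0)) (x # y # xs) y" using rec_eval.Proj[of "Suc 0" "x # y # xs"] by simp
lemma rec_eval_proj2: "rec_eval (Proj 2) (x # y # z # xs) z" using rec_eval.Proj[of 2 "x # y # z # xs"] by simp

lemma const_program: "\<exists>p. \<forall>xs. rec_eval p xs c"
proof (induction c)
  case 0
  show ?case using rec_eval.Zero by blast
next
  case (Suc c)
  then show ?case using rec_eval_comp1 rec_eval.Succ by blast
qed

lemma primrec_program:
  assumes "\<And>x. rec_eval p [x] (f x 0)" "\<And>x m. rec_eval q [m, f x m, x] (f x (Suc m))"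
  shows "rec_eval (PrimRec p q) [m, x] (f x m)"
proof (induction m)
  case 0
  show ?case by (rule rec_eval.PrimRec_0) (rule assms)
next
  case (Suc m)
  show ?case by (rule rec_eval.PrimRec_Suc[OF Suc]) (rule assms)
qed

lemma add_program: "\<exists>p. \<forall>m x. rec_eval p [m, x] (x + m)"
proof -
  have "rec_eval (PrimRec (Proj 0) (Comp Succ [Proj (Suc 0)])) [m, x] (x + m)" for m x
    by (rule primrec_program[where f = "\<lambda>x m. x + m"])
       (simp_all add: rec_eval_proj0 rec_eval_comp1[OF rec_eval_proj1 rec_eval.Succ])
  then show ?thesis by blast
qed

lemma pred_program: "\<exists>p. \<forall>m x. rec_eval p [m, x] (m - 1)"
proof -
  have "rec_eval (PrimRec Zero (Proj 0)) [m, x] (m - 1)" for m x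
    by (rule primrec_program[where f = "\<lambda>x m. m - 1"]) (simp_all add: rec_eval.Zero rec_eval_proj0)
  then show ?thesis by blast
qed

lemma diff_program: "\<exists>p. \<forall>m x. rec_eval p [m, x] (x - m)"
proof -
  obtain q where q: "\<And>m x. rec_eval q [m, x] (m - 1)" using pred_program by blast
  have "rec_eval (PrimRec (Proj 0) (Comp q [Proj (Suc 0), Proj (Suc 0)])) [m, x] (x - m)" for m x
  proof (rule primrec_program[where f = "\<lambda>x m. x - m"])
    show "rec_eval (Comp q [Proj (Suc 0), Proj (Suc 0)]) [m, x - m, x] (x - Suc m)" for m x
      using rec_eval_comp2[OF rec_eval_proj1 rec_eval_proj1 q, of m "x - m" "[x]"] by simp
  qed (simp add: rec_eval_proj0)
  then show ?thesis by blast
qed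

lemma mult_program: "\<exists>p. \<forall>m x. rec_eval p [m, x] (x * m)"
proof -
  obtain q where q: "\<And>m x. rec_eval q [m, x] (x + m)" using add_program by blast
  have "rec_eval (PrimRec Zero (Comp q [Proj (Suc 0), Proj 2])) [m, x] (x * m)" for m x
  proof (rule primrec_program[where f = "\<lambda>x m. x * m"])
    show "rec_eval (Comp q [Proj (Suc 0), Proj 2]) [m, x * m, x] (x * Suc m)" for m x
      using rec_eval_comp2[OF rec_eval_proj1 rec_eval_proj2 q, of m "x * m" x "[]"] by simp
  qed (simp add: rec_eval.Zero)
  then show ?thesis by blast
qed

lemma triangle_program: "\<exists>p. \<forall>m. rec_eval p [m] (triangle m)"
proof -
  obtain q where q: "\<And>m x. rec_eval q [m, x] (x + m)" using add_program by blast
  have "rec_eval (PrimRec Zero (Comp q [Comp Succ [Proj 0], Proj (Suc 0)])) [m, x] (triangle m)" for m x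
  proof (rule primrec_program[where f = "\<lambda>x m. triangle m"])
    show "rec_eval (Comp q [Comp Succ [Proj 0], Proj (Suc 0)]) [m, triangle m, x] (triangle (Suc m))" for m x
      using rec_eval_comp2[OF rec_eval_comp1[OF rec_eval_proj0 rec_eval.Succ] rec_eval_proj1 q] by simp
  qed (simp add: rec_eval.Zero triangle_def)
  then show ?thesis using rec_eval_comp2[OF rec_eval_proj0 rec_eval_proj0] by blast
qed

lemma pair_program: "\<exists>p. \<forall>m n. rec_eval p [m, n] (prod_encode (m, n))"
proof -
  obtain a where a: "\<And>m x. rec_eval a [m, x] (x + m)" using add_program by blast
  obtain t where t: "\<And>m. rec_eval t [m] (triangle m)" using triangle_program by blast
  have "rec_eval (Comp a [Proj 0, Comp t [Comp a [Proj (Suc 0), Proj 0]]]) [m, n] (prod_encode (m, n))" for m n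
    using rec_eval_comp2[OF rec_eval_proj0 rec_eval_comp1[OF rec_eval_comp2[OF rec_eval_proj1 rec_eval_proj0 a] t] a]
    by (simp add: prod_encode_def)
  then show ?thesis by blast
qed

lemma mu_program:
  assumes "\<And>x m. rec_eval p [m, x] (f x m)" "\<And>x. \<exists>m. f x m = (0 :: nat)"
  shows "rec_eval (Mu p) [x] (LEAST m. f x m = 0)"
proof (rule rec_eval.Mu)
  have "f x (LEAST m. f x m = 0) = 0" using assms(2) by (rule LeastI_ex)
  then show "rec_eval p ((LEAST m. f x m = 0) # [x]) 0" using assms(1) by metis
  show "\<forall>j<LEAST m. f x m = 0. \<exists>y. rec_eval p (j # [x]) y \<and> y > 0"
    using assms(1) not_less_Least by blast
qed

lemma triangle_mono: "i \<le> j \<Longrightarrow> triangle i \<le> triangle j"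
  by (induction rule: dec_induct) simp_all

text \<open>The code of \<open>(a, b)\<close> is \<open>triangle (a + b) + a\<close>, so the
  diagonal \<open>a + b\<close> is the first \<open>s\<close> whose successor has a triangular
  number above the code.\<close>

lemma diagonal_least:
  "(LEAST s. Suc (prod_encode (a, b)) - triangle (Suc s) = 0) = a + b"
proof (rule Least_equality)
  show "Suc (prod_encode (a, b)) - triangle (Suc (a + b)) = 0" by (simp add: prod_encode_def)
  fix s assume s: "Suc (prod_encode (a, b)) - triangle (Suc s) = 0"
  show "a + b \<le> s"
  proof (rule ccontr)
    assume "\<not> a + b \<le> s"
    then have "triangle (Suc s) \<le> triangle (a + b)" by (intro triangle_mono) simp
    then show False using s by (simp add: prod_encode_def)
  qed
qed

text \<open>Search for the diagonal; then \<open>a\<close> is the excess of the code over the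
  triangular number, and \<open>b\<close> is what remains of the diagonal.\<close>

lemma unpair_programs:
  "\<exists>p. \<forall>a b. rec_eval p [prod_encode (a, b)] a" "\<exists>p. \<forall>a b. rec_eval p [prod_encode (a, b)] b"
proof -
  obtain s where s: "\<And>m x. rec_eval s [m, x] (x - m)" using diff_program by blast
  obtain t where t: "\<And>m. rec_eval t [m] (triangle m)" using triangle_program by blast
  let ?d = "Mu (Comp s [Comp t [Comp Succ [Proj 0]], Comp Succ [Proj (Suc 0)]])"
  have d: "rec_eval ?d [x] (LEAST m. Suc x - triangle (Suc m) = 0)" for x
  proof (rule mu_program)
    show "rec_eval (Comp s [Comp t [Comp Succ [Proj 0]], Comp Succ [Proj (Suc 0)]]) [m, x] (Suc x - triangle (Suc m))" for x m
      by (rule rec_eval_comp2[OF rec_eval_comp1[OF rec_eval_comp1[OF rec_eval_proj0 rec_eval.Succ] t]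
            rec_eval_comp1[OF rec_eval_proj1 rec_eval.Succ] s])
    show "\<exists>m. Suc x - triangle (Suc m) = 0" for x
      by (intro exI[of _ x]) (induction x; simp)
  qed
  have d': "rec_eval ?d [prod_encode (a, b)] (a + b)" for a b
    using d[of "prod_encode (a, b)"] unfolding diagonal_least .
  let ?f = "Comp s [Comp t [?d], Proj 0]"
  have f: "rec_eval ?f [prod_encode (a, b)] a" for a b
    using rec_eval_comp2[OF rec_eval_comp1[OF d' t] rec_eval_proj0 s, of a b] by (simp add: prod_encode_def)
  then show "\<exists>p. \<forall>a b. rec_eval p [prod_encode (a, b)] a" by blast
  have "rec_eval (Comp s [?f, ?d]) [prod_encode (a, b)] b" for a b
    using rec_eval_comp2[OF f d' s, of a b] by simp
  then show "\<exists>p. \<forall>a b. rec_eval p [prod_encode (a, b)] b" by blast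
qed


section \<open>Computability through encodings\<close>

text \<open>A program tracks \<open>f\<close> on codes. In the rules below, the source encoding
  \<open>e\<close> belongs to an arbitrary context on which all ingredients of an expression may
  depend, so that programs arise by recursion over the expression.\<close>

definition cf :: "('a \<Rightarrow> nat) \<Rightarrow> ('b \<Rightarrow> nat) \<Rightarrow> ('a \<Rightarrow> 'b) \<Rightarrow> bool" where
  "cf e1 e2 f \<longleftrightarrow> (\<exists>p. \<forall>x. rec_eval p [e1 x] (e2 (f x)))"

abbreviation (input) e_nat :: "nat \<Rightarrow> nat" where "e_nat \<equiv> (\<lambda>n. n)"

definition e_prod :: "('a \<Rightarrow> nat) \<Rightarrow> ('b \<Rightarrow> nat) \<Rightarrow> 'a \<times> 'b \<Rightarrow> nat" where
  "e_prod e1 e2 p = prod_encode (e1 (fst p), e2 (snd p))"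

definition e_list :: "('a \<Rightarrow> nat) \<Rightarrow> 'a list \<Rightarrow> nat" where
  "e_list e xs = list_encode (map e xs)"

definition e_bool :: "bool \<Rightarrow> nat" where "e_bool b = (if b then 1 else 0)"

named_theorems cf_intros

lemma cfI: assumes "\<And>x. rec_eval p [e1 x] (e2 (f x))" shows "cf e1 e2 f"
  unfolding cf_def by (rule exI[of _ p], rule allI, rule assms)

lemma cfE: assumes "cf e1 e2 f" obtains p where "\<And>x. rec_eval p [e1 x] (e2 (f x))"
proof -
  obtain p where p: "\<forall>x. rec_eval p [e1 x] (e2 (f x))" using assms[unfolded cf_def] by (rule exE)
  show ?thesis by (rule that, rule spec[OF p])
qed

lemma cf_id [cf_intros]: "cf e e (\<lambda>x. x)"
  by (rule cfI[OF rec_eval_proj0])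

lemma cf_const [cf_intros]: "cf e e2 (\<lambda>_. c)"
proof -
  obtain p where "\<And>xs. rec_eval p xs (e2 c)" using const_program by blast
  then show ?thesis by (rule cfI)
qed

lemma cf_compose: assumes "cf e2 e3 g" "cf e e2 f" shows "cf e e3 (\<lambda>x. g (f x))"
proof -
  obtain p where p: "\<And>x. rec_eval p [e2 x] (e3 (g x))" by (fact cfE[OF assms(1)])
  obtain q where q: "\<And>x. rec_eval q [e x] (e2 (f x))" by (fact cfE[OF assms(2)])
  show ?thesis by (rule cfI, rule rec_eval_comp1[OF q p])
qed

lemma cf_pair [cf_intros]: assumes "cf e e1 f" "cf e e2 g" shows "cf e (e_prod e1 e2) (\<lambda>x. (f x, g x))"
proof -
  obtain p where p: "\<And>x. rec_eval p [e x] (e1 (f x))" by (fact cfE[OF assms(1)])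
  obtain q where q: "\<And>x. rec_eval q [e x] (e2 (g x))" by (fact cfE[OF assms(2)])
  obtain r where r: "\<And>m n. rec_eval r [m, n] (prod_encode (m, n))" using pair_program by blast
  show ?thesis
  proof (rule cfI)
    show "rec_eval (Comp r [p, q]) [e x] (e_prod e1 e2 (f x, g x))" for x
      unfolding e_prod_def fst_conv snd_conv by (rule rec_eval_comp2[OF p q r])
  qed
qed

lemma cf_fst [cf_intros]: assumes "cf e (e_prod e1 e2) f" shows "cf e e1 (\<lambda>x. fst (f x))"
proof -
  obtain p where p: "\<And>a b. rec_eval p [prod_encode (a, b)] a" using unpair_programs(1) by blast
  have "cf (e_prod e1 e2) e1 fst" unfolding e_prod_def by (rule cfI, rule p)
  then show ?thesis by (rule cf_compose[OF _ assms])
qed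

lemma cf_snd [cf_intros]: assumes "cf e (e_prod e1 e2) f" shows "cf e e2 (\<lambda>x. snd (f x))"
proof -
  obtain p where p: "\<And>a b. rec_eval p [prod_encode (a, b)] b" using unpair_programs(2) by blast
  have "cf (e_prod e1 e2) e2 snd" unfolding e_prod_def by (rule cfI, rule p)
  then show ?thesis by (rule cf_compose[OF _ assms])
qed

text \<open>Passes from one paired argument to two separate ones, as the programs in
  \<open>implementable\<close> require.\<close>

lemma cf_two_args:
  assumes "cf (e_prod e1 e2) e3 f" shows "\<exists>p. \<forall>x y. rec_eval p [e1 x, e2 y] (e3 (f (x, y)))"
proof -
  obtain p where p: "\<And>x. rec_eval p [e_prod e1 e2 x] (e3 (f x))" by (fact cfE[OF assms])
  obtain q where q: "\<And>m n. rec_eval q [m, n] (prod_encode (m, n))" using pair_program by blast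
  have "rec_eval (Comp p [q]) [e1 x, e2 y] (e3 (f (x, y)))" for x y
    by (rule rec_eval_comp1[OF q p[of "(x, y)", unfolded e_prod_def fst_conv snd_conv]])
  then show ?thesis by blast
qed

lemma cf_binary:
  assumes "\<exists>p. \<forall>m n. rec_eval p [m, n] (h m n)" "cf e e_nat f" "cf e e_nat g"
  shows "cf e e_nat (\<lambda>x. h (f x) (g x))"
proof -
  obtain r where r: "\<And>m n. rec_eval r [m, n] (h m n)" using assms(1) by blast
  obtain p where p: "\<And>x. rec_eval p [e x] (f x)" by (fact cfE[OF assms(2)])
  obtain q where q: "\<And>x. rec_eval q [e x] (g x)" by (fact cfE[OF assms(3)])
  show ?thesis by (rule cfI, rule rec_eval_comp2[OF p q r])
qed

lemma cf_plus [cf_intros]: "cf e e_nat f \<Longrightarrow> cf e e_nat g \<Longrightarrow> cf e e_nat (\<lambda>x. f x + g x)"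
  using cf_binary[OF add_program, of e g f] by simp

lemma cf_times [cf_intros]: "cf e e_nat f \<Longrightarrow> cf e e_nat g \<Longrightarrow> cf e e_nat (\<lambda>x. f x * g x)"
  using cf_binary[OF mult_program, of e g f] by simp

lemma cf_minus [cf_intros]: "cf e e_nat f \<Longrightarrow> cf e e_nat g \<Longrightarrow> cf e e_nat (\<lambda>x. f x - g x)"
  using cf_binary[OF diff_program, of e g f] by simp

lemma cf_Suc [cf_intros]: "cf e e_nat f \<Longrightarrow> cf e e_nat (\<lambda>x. Suc (f x))"
  using cf_plus[OF _ cf_const[of _ _ 1]] by simp

lemma cf_rec_nat [cf_intros]:
  assumes g: "cf e e2 g" and s: "cf (e_prod e (e_prod e_nat e2)) e2 (\<lambda>p. s (fst p) (fst (snd p)) (snd (snd p)))"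
    and k: "cf e e_nat k"
  shows "cf e e2 (\<lambda>x. rec_nat (g x) (s x) (k x))"
proof -
  obtain pg where pg: "\<And>x. rec_eval pg [e x] (e2 (g x))" by (fact cfE[OF g])
  obtain ps where ps': "\<And>p. rec_eval ps [e_prod e (e_prod e_nat e2) p] (e2 (s (fst p) (fst (snd p)) (snd (snd p))))"
    by (fact cfE[OF s])
  have ps: "rec_eval ps [prod_encode (e x, prod_encode (n, e2 a))] (e2 (s x n a))" for x n a
    using ps'[of "(x, n, a)"] by (simp add: e_prod_def)
  obtain pk where pk: "\<And>x. rec_eval pk [e x] (k x)" by (fact cfE[OF k])
  obtain q where q: "\<And>m n. rec_eval q [m, n] (prod_encode (m, n))" using pair_program by blast
  \<comment> \<open>\<open>PrimRec\<close> supplies counter, value and context in this order,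
    whereas the step expects context, counter and value.\<close>
  let ?s = "Comp ps [Comp q [Proj 2, Comp q [Proj 0, Proj (Suc 0)]]]"
  have step: "rec_eval ?s [n, e2 a, e x] (e2 (s x n a))" for n a x
    by (rule rec_eval_comp1[OF rec_eval_comp2[OF rec_eval_proj2 rec_eval_comp2[OF rec_eval_proj0 rec_eval_proj1 q] q] ps])
  have "rec_eval (PrimRec pg ?s) [n, e x] (e2 (rec_nat (g x) (s x) n))" for n x
  proof (induction n)
    case 0
    show ?case using rec_eval.PrimRec_0[OF pg[of x]] by simp
  next
    case (Suc n)
    show ?case using rec_eval.PrimRec_Suc[OF Suc step] by simp
  qed
  then have "rec_eval (Comp (PrimRec pg ?s) [pk, Proj 0]) [e x] (e2 (rec_nat (g x) (s x) (k x)))" for x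
    by (rule rec_eval_comp2[OF pk rec_eval_proj0])
  then show ?thesis by (rule cfI)
qed

text \<open>Primitive recursion on the code 0 or 1 of the condition, with the positive branch as
  constant step.\<close>

lemma cf_if [cf_intros]:
  assumes "cf e e_bool c" "cf e e2 f" "cf e e2 g"
  shows "cf e e2 (\<lambda>x. if c x then f x else g x)"
proof -
  have "cf e e_nat (\<lambda>x. e_bool (c x))" using assms(1) unfolding cf_def .
  then have "cf e e2 (\<lambda>x. rec_nat (g x) (\<lambda>_ _. f x) (e_bool (c x)))"
    by (intro cf_rec_nat assms(3) cf_compose[OF assms(2)]) (rule cf_fst cf_id)+
  moreover have "rec_nat (g x) (\<lambda>_ _. f x) (e_bool (c x)) = (if c x then f x else g x)" for x
    by (simp add: e_bool_def)
  ultimately show ?thesis by simp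
qed

lemma cf_bool_of_nat: assumes "cf e e_nat f" "\<And>x. f x = 0 \<or> f x = 1" shows "cf e e_bool (\<lambda>x. f x = 1)"
proof -
  have "e_bool (f x = 1) = f x" for x using assms(2)[of x] by (auto simp: e_bool_def)
  then show ?thesis using assms(1) unfolding cf_def by simp
qed

lemma cf_not [cf_intros]: assumes "cf e e_bool c" shows "cf e e_bool (\<lambda>x. \<not> c x)"
proof -
  have "cf e e_bool (\<lambda>x. if c x then False else True)"
    by (rule cf_if[OF assms cf_const cf_const])
  moreover have "(\<lambda>x. if c x then False else True) = (\<lambda>x. \<not> c x)" by auto
  ultimately show ?thesis by simp
qed

lemma cf_and [cf_intros]: assumes "cf e e_bool c" "cf e e_bool c'" shows "cf e e_bool (\<lambda>x. c x \<and> c' x)"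
proof -
  have "cf e e_bool (\<lambda>x. if c x then c' x else False)"
    by (rule cf_if[OF assms cf_const])
  moreover have "(\<lambda>x. if c x then c' x else False) = (\<lambda>x. c x \<and> c' x)" by auto
  ultimately show ?thesis by simp
qed

lemma cf_or [cf_intros]: assumes "cf e e_bool c" "cf e e_bool c'" shows "cf e e_bool (\<lambda>x. c x \<or> c' x)"
proof -
  have "cf e e_bool (\<lambda>x. if c x then True else c' x)"
    by (rule cf_if[OF assms(1) cf_const assms(2)])
  moreover have "(\<lambda>x. if c x then True else c' x) = (\<lambda>x. c x \<or> c' x)" by auto
  ultimately show ?thesis by simp
qed

lemma cf_is_zero: assumes "cf e e_nat f" shows "cf e e_bool (\<lambda>x. f x = 0)"
proof -
  have "cf e e_bool (\<lambda>x. 1 - f x = 1)" by (rule cf_bool_of_nat) (auto intro: cf_intros assms)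
  moreover have "(1 - f x = 1) = (f x = 0)" for x by auto
  ultimately show ?thesis by simp
qed

lemma cf_le [cf_intros]: "cf e e_nat f \<Longrightarrow> cf e e_nat g \<Longrightarrow> cf e e_bool (\<lambda>x. f x \<le> g x)"
  using cf_is_zero[OF cf_minus] by simp

lemma cf_less [cf_intros]: "cf e e_nat f \<Longrightarrow> cf e e_nat g \<Longrightarrow> cf e e_bool (\<lambda>x. f x < g x)"
  using cf_le[OF cf_Suc, of e f g] by (simp add: Suc_le_eq)

lemma cf_eq_nat [cf_intros]: "cf e e_nat f \<Longrightarrow> cf e e_nat g \<Longrightarrow> cf e e_bool (\<lambda>x. f x = g x)"
  using cf_and[OF cf_le cf_le, of e f g g f] by (simp add: order_eq_iff)

lemma cf_eq: assumes "inj e1" "cf e e1 f" "cf e e1 g" shows "cf e e_bool (\<lambda>x. f x = g x)"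
proof -
  have "cf e e_nat (\<lambda>x. e1 (f x))" "cf e e_nat (\<lambda>x. e1 (g x))" using assms(2,3) unfolding cf_def .
  then have "cf e e_bool (\<lambda>x. e1 (f x) = e1 (g x))" by (rule cf_eq_nat)
  then show ?thesis using assms(1) by (simp add: inj_eq)
qed

text \<open>The rule \<open>mu_program\<close> speaks of every number as input, so each number has
  to be the code of some context. If several contexts share a code, determinism of programs gives
  them the same truth values.\<close>

lemma cf_least:
  assumes P: "cf (e_prod e e_nat) e_bool (\<lambda>p. P (fst p) (snd p))" and ex: "\<And>x. \<exists>n. P x n"
    and sur: "\<And>c. \<exists>x. e x = c"
  shows "cf e e_nat (\<lambda>x. LEAST n. P x n)"
proof -
  obtain p where p: "\<And>x y. rec_eval p [e x, y] (e_bool (\<not> P x y))"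
    using cf_two_args[OF cf_not[OF P]] by auto
  define x_of where "x_of = (\<lambda>c. SOME x. e x = c)"
  have x_of: "e (x_of c) = c" for c unfolding x_of_def using someI_ex[OF sur] .
  have "rec_eval (Comp p [Proj (Suc 0), Proj 0]) [n, c] (e_bool (\<not> P (x_of c) n))" for c n
    using rec_eval_comp2[OF rec_eval_proj1 rec_eval_proj0] p[of "x_of c" n] unfolding x_of by blast
  then have m: "rec_eval (Mu (Comp p [Proj (Suc 0), Proj 0])) [c] (LEAST n. e_bool (\<not> P (x_of c) n) = 0)" for c
    by (rule mu_program) (use ex in \<open>auto simp: e_bool_def\<close>)
  have "rec_eval (Mu (Comp p [Proj (Suc 0), Proj 0])) [e x] (LEAST n. P x n)" for x
  proof -
    have eq: "(e_bool (\<not> P (x_of (e x)) n) = 0) = P x n" for n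
    proof -
      have "e_bool (\<not> P (x_of (e x)) n) = e_bool (\<not> P x n)"
        using p[of x n] p[of "x_of (e x)" n] unfolding x_of by (rule rec_eval_deterministic[rotated])
      then show ?thesis by (auto simp: e_bool_def split: if_splits)
    qed
    show ?thesis using m[of "e x"] unfolding eq .
  qed
  then show ?thesis by (rule cfI)
qed

section \<open>Integers\<close>

abbreviation e_int :: "int \<Rightarrow> nat" where "e_int \<equiv> int_encode"

lemma cf_mod2: assumes "cf e e_nat f" shows "cf e e_nat (\<lambda>x. f x mod 2)"
proof -
  have "cf e e_nat (\<lambda>x. rec_nat 0 (\<lambda>_ a. 1 - a) (f x))"
    by (rule cf_rec_nat[OF cf_const _ assms]) (rule cf_intros)+
  moreover have "rec_nat 0 (\<lambda>_ a. 1 - a) k = k mod 2" for k :: nat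
    by (induction k) (auto simp: mod_Suc)
  ultimately show ?thesis by simp
qed

lemma cf_div2: assumes "cf e e_nat f" shows "cf e e_nat (\<lambda>x. f x div 2)"
proof -
  have "cf e e_nat (\<lambda>x. rec_nat 0 (\<lambda>k a. a + k mod 2) (f x))"
    by (rule cf_rec_nat[OF cf_const _ assms]) (rule cf_mod2 cf_intros)+
  moreover have "rec_nat 0 (\<lambda>k a. a + k mod 2) k = k div 2" for k :: nat
    by (induction k) (auto, presburger)
  ultimately show ?thesis by simp
qed

text \<open>With \<open>cf_decode\<close>: computing a value and computing its code are the same
  thing, so a function may be programmed on codes directly.\<close>

lemma cf_code: "cf e e1 f \<Longrightarrow> cf e e_nat (\<lambda>x. e1 (f x))" unfolding cf_def .

lemma cf_decode: "cf e e_nat (\<lambda>x. e1 (f x)) \<Longrightarrow> cf e e1 f" unfolding cf_def .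

lemma cf_nat [cf_intros]:
  assumes "cf e e_int f" shows "cf e e_nat (\<lambda>x. nat (f x))"
proof -
  have "cf e e_nat (\<lambda>x. if e_int (f x) mod 2 = 0 then e_int (f x) div 2 else 0)"
    by (rule cf_mod2 cf_div2 cf_intros cf_code[OF assms])+
  moreover have "(if e_int i mod 2 = 0 then e_int i div 2 else 0) = nat i" for i
    by (simp add: int_encode_def sum_encode_def)
  ultimately show ?thesis by simp
qed

lemma cf_nat_uminus:
  assumes "cf e e_int f" shows "cf e e_nat (\<lambda>x. nat (- f x))"
proof -
  have "cf e e_nat (\<lambda>x. if e_int (f x) mod 2 = 0 then 0 else Suc (e_int (f x) div 2))"
    by (rule cf_mod2 cf_div2 cf_intros cf_code[OF assms])+
  moreover have "(if e_int i mod 2 = 0 then 0 else Suc (e_int i div 2)) = nat (- i)" for i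
    by (auto simp: int_encode_def sum_encode_def)
  ultimately show ?thesis by simp
qed

text \<open>Integers are handled as differences of naturals: even codes are the nonnegative
  integers, odd codes the negative ones, and sums and products are formed from positive and negative
  parts.\<close>

lemma cf_nat_diff:
  assumes f: "cf e e_nat f" and g: "cf e e_nat g" shows "cf e e_int (\<lambda>x. int (f x) - int (g x))"
proof (rule cf_decode)
  have "cf e e_nat (\<lambda>x. if g x \<le> f x then 2 * (f x - g x) else Suc (2 * (g x - f x - 1)))"
    by (rule cf_intros f g)+
  moreover have "(if b \<le> a then 2 * (a - b) else Suc (2 * (b - a - 1))) = e_int (int a - int b)" for a b
    by (auto simp: int_encode_def sum_encode_def nat_diff_distrib) 
  ultimately show "cf e e_nat (\<lambda>x. e_int (int (f x) - int (g x)))" by simp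
qed

lemma cf_int_plus [cf_intros]:
  fixes f g :: "_ \<Rightarrow> int"
  assumes "cf e e_int f" "cf e e_int g" shows "cf e e_int (\<lambda>x. f x + g x)"
proof -
  have "cf e e_int (\<lambda>x. int (nat (f x) + nat (g x)) - int (nat (- f x) + nat (- g x)))"
    by (intro cf_nat_diff cf_plus cf_nat cf_nat_uminus assms)
  moreover have eq: "int (nat i + nat j) - int (nat (- i) + nat (- j)) = i + j" for i j by simp
  ultimately show ?thesis unfolding eq by blast
qed

lemma cf_int_times [cf_intros]:
  fixes f g :: "_ \<Rightarrow> int"
  assumes "cf e e_int f" "cf e e_int g" shows "cf e e_int (\<lambda>x. f x * g x)"
proof -
  have "cf e e_int (\<lambda>x. int (nat (f x) * nat (g x) + nat (- f x) * nat (- g x)) -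
      int (nat (f x) * nat (- g x) + nat (- f x) * nat (g x)))"
    by (intro cf_nat_diff cf_plus cf_times cf_nat cf_nat_uminus assms)
  moreover have eq: "int (nat i * nat j + nat (- i) * nat (- j)) - int (nat i * nat (- j) + nat (- i) * nat j) = i * j" for i j
    by (cases "0 \<le> i"; cases "0 \<le> j") simp_all
  ultimately show ?thesis unfolding eq by blast
qed

lemma cf_int_uminus [cf_intros]:
  assumes "cf e e_int f" shows "cf e e_int (\<lambda>x. - f x)"
  using cf_int_times[OF cf_const[of _ _ "-1"] assms] by simp

lemma cf_eq_int [cf_intros]: "cf e e_int f \<Longrightarrow> cf e e_int g \<Longrightarrow> cf e e_bool (\<lambda>x. f x = g x)"
  by (rule cf_eq[OF inj_int_encode])

section \<open>Bijective encodings and lists\<close>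

lemma bij_e_prod: assumes "bij e1" "bij e2" shows "bij (e_prod e1 e2)"
proof -
  have "e_prod e1 e2 = prod_encode \<circ> map_prod e1 e2" by (auto simp: e_prod_def)
  moreover have "bij (map_prod e1 e2)"
    using assms by (simp add: bij_def prod.inj_map map_prod_surj)
  ultimately show ?thesis using bij_prod_encode by (simp add: bij_comp)
qed

lemma bij_e_list: assumes "bij e" shows "bij (e_list e)"
proof -
  have "e_list e = list_encode \<circ> map e" by (auto simp: e_list_def)
  moreover have "bij (map e)"
    using assms by (simp add: bij_def list.inj_map surj_def) (metis ex_map_conv)
  ultimately show ?thesis using bij_list_encode by (simp add: bij_comp)
qed

lemma bij_e_nat: "bij (\<lambda>n :: nat. n)" by (simp add: bij_def inj_on_def)

text \<open>Decoding under a bijective encoding is the identity on codes. It lets an unbounded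
  search over numbers run through all data of a type.\<close>

lemma cf_inv: assumes "bij e1" "cf e e_nat f" shows "cf e e1 (\<lambda>x. inv_into UNIV e1 (f x))"
  by (rule cf_decode) (use assms in \<open>simp add: bij_def surj_f_inv_f\<close>)

lemma cf_Cons [cf_intros]:
  assumes "cf e e1 f" "cf e (e_list e1) l" shows "cf e (e_list e1) (\<lambda>x. f x # l x)"
proof (rule cf_decode)
  have "cf e e_nat (\<lambda>x. Suc (e_prod e_nat e_nat (e1 (f x), e_list e1 (l x))))"
    by (rule cf_Suc[OF cf_code[OF cf_pair[OF cf_code[OF assms(1)] cf_code[OF assms(2)]]]])
  then show "cf e e_nat (\<lambda>x. e_list e1 (f x # l x))"
    by (simp add: e_list_def e_prod_def)
qed

lemma cf_null [cf_intros]: assumes "cf e (e_list e1) l" shows "cf e e_bool (\<lambda>x. l x = [])"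
proof -
  have "cf e e_bool (\<lambda>x. e_list e1 (l x) = 0)" by (rule cf_is_zero[OF cf_code[OF assms]])
  moreover have "e_list e1 xs = 0 \<longleftrightarrow> xs = []" for xs by (cases xs) (simp_all add: e_list_def)
  ultimately show ?thesis by simp
qed

lemma cf_list_tail:
  assumes "cf e (e_list e1) l" shows "cf e (e_prod e_nat e_nat) (\<lambda>x. prod_decode (e_list e1 (l x) - 1))"
proof (rule cf_decode)
  have "e_prod e_nat e_nat (prod_decode k) = k" for k by (simp add: e_prod_def)
  then show "cf e e_nat (\<lambda>x. e_prod e_nat e_nat (prod_decode (e_list e1 (l x) - 1)))"
    using cf_minus[OF cf_code[OF assms] cf_const[of _ _ 1]] by simp
qed

lemma cf_tl [cf_intros]: assumes "cf e (e_list e1) l" shows "cf e (e_list e1) (\<lambda>x. tl (l x))"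
proof (rule cf_decode)
  have "cf e e_nat (\<lambda>x. if l x = [] then 0 else snd (prod_decode (e_list e1 (l x) - 1)))"
    by (rule cf_if[OF cf_null[OF assms] cf_const cf_snd[OF cf_list_tail[OF assms]]])
  moreover have "(if xs = [] then 0 else snd (prod_decode (e_list e1 xs - 1))) = e_list e1 (tl xs)" for xs
    by (cases xs) (simp_all add: e_list_def)
  ultimately show "cf e e_nat (\<lambda>x. e_list e1 (tl (l x)))" by simp
qed

lemma cf_hd [cf_intros]: assumes "cf e (e_list e1) l" shows "cf e e1 (\<lambda>x. hd (l x))"
proof (rule cf_decode)
  \<comment> \<open>The value \<open>hd []\<close> is unspecified but fixed, so its code is a
    constant of the program.\<close>
  have "cf e e_nat (\<lambda>x. if l x = [] then e1 (hd []) else fst (prod_decode (e_list e1 (l x) - 1)))"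
    by (rule cf_if[OF cf_null[OF assms] cf_const cf_fst[OF cf_list_tail[OF assms]]])
  moreover have "(if xs = [] then e1 (hd []) else fst (prod_decode (e_list e1 xs - 1))) = e1 (hd xs)" for xs
    by (cases xs) (simp_all add: e_list_def)
  ultimately show "cf e e_nat (\<lambda>x. e1 (hd (l x)))" by simp
qed

text \<open>The state is the remaining list with the accumulator. The code of the list serves as the
  number of iterations: it is at least the length, and an exhausted list leaves the accumulator
  unchanged.\<close>

lemma cf_foldl [cf_intros]:
  assumes l: "cf e (e_list e1) l" and a: "cf e e2 a"
    and f: "cf (e_prod e (e_prod e2 e1)) e2 (\<lambda>p. f (fst p) (fst (snd p)) (snd (snd p)))"
  shows "cf e e2 (\<lambda>x. foldl (f x) (a x) (l x))"
proof -
  let ?s = "\<lambda>x (_ :: nat) p. (tl (fst p), if fst p = [] then snd p else f x (snd p) (hd (fst p)))"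
  have f': "cf (e_prod e (e_prod e_nat (e_prod (e_list e1) e2))) e2
      (\<lambda>p. f (fst p) (snd (snd (snd p))) (hd (fst (snd (snd p)))))"
  proof -
    have "cf (e_prod e (e_prod e_nat (e_prod (e_list e1) e2))) (e_prod e (e_prod e2 e1))
        (\<lambda>p. (fst p, snd (snd (snd p)), hd (fst (snd (snd p)))))"
      by (rule cf_pair cf_hd cf_fst cf_snd cf_id)+
    from cf_compose[OF f this] show ?thesis by simp
  qed
  have "cf e (e_prod (e_list e1) e2) (\<lambda>x. rec_nat (l x, a x) (?s x) (e_list e1 (l x)))"
  proof (rule cf_rec_nat)
    show "cf (e_prod e (e_prod e_nat (e_prod (e_list e1) e2))) (e_prod (e_list e1) e2)
        (\<lambda>p. ?s (fst p) (fst (snd p)) (snd (snd p)))"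
      by (rule cf_pair cf_tl cf_if cf_null f' cf_fst cf_snd cf_id)+
  qed (rule cf_pair[OF l a] cf_code[OF l])+
  then have "cf e e2 (\<lambda>x. snd (rec_nat (l x, a x) (?s x) (e_list e1 (l x))))" by (rule cf_snd)
  moreover have "snd (rec_nat (xs, b) (?s x) (e_list e1 xs)) = foldl (f x) b xs" for x xs b
  proof -
    have *: "rec_nat (xs, b) (?s x) k = (drop k xs, foldl (f x) b (take k xs))" for k
    proof (induction k)
      case (Suc k)
      then show ?case
        by (cases "k < length xs") (simp_all add: drop_Suc tl_drop take_Suc_conv_app_nth hd_drop_conv_nth)
    qed simp
    have "length xs \<le> e_list e1 xs"
      by (induction xs) (auto simp: e_list_def intro: order_trans[OF _ le_prod_encode_2])
    then show ?thesis using * by simp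
  qed
  ultimately show ?thesis by simp
qed

lemma cf_rev [cf_intros]: assumes "cf e (e_list e1) l" shows "cf e (e_list e1) (\<lambda>x. rev (l x))"
proof -
  have "cf e (e_list e1) (\<lambda>x. foldl (\<lambda>acc y. y # acc) [] (l x))"
    by (rule cf_foldl[OF assms cf_const]) (rule cf_Cons cf_fst cf_snd cf_id)+
  moreover have "foldl (\<lambda>acc y. y # acc) acc xs = rev xs @ acc" for acc xs :: "'b list"
    by (induction xs arbitrary: acc) simp_all
  ultimately show ?thesis by simp
qed

lemma cf_foldr [cf_intros]:
  assumes l: "cf e (e_list e1) l" and a: "cf e e2 a"
    and f: "cf (e_prod e (e_prod e1 e2)) e2 (\<lambda>p. f (fst p) (fst (snd p)) (snd (snd p)))"
  shows "cf e e2 (\<lambda>x. foldr (f x) (l x) (a x))"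
proof -
  have "cf (e_prod e (e_prod e2 e1)) (e_prod e (e_prod e1 e2)) (\<lambda>p. (fst p, snd (snd p), fst (snd p)))"
    by (rule cf_pair cf_fst cf_snd cf_id)+
  from cf_compose[OF f this]
  have f': "cf (e_prod e (e_prod e2 e1)) e2 (\<lambda>p. f (fst p) (snd (snd p)) (fst (snd p)))" by simp
  have "cf e e2 (\<lambda>x. foldl (\<lambda>acc y. f x y acc) (a x) (rev (l x)))"
    by (rule cf_foldl[OF cf_rev[OF l] a f'])
  then show ?thesis by (simp add: foldr_conv_foldl)
qed

lemma cf_map [cf_intros]:
  assumes l: "cf e (e_list e1) l" and h: "cf (e_prod e e1) e2 (\<lambda>p. h (fst p) (snd p))"
  shows "cf e (e_list e2) (\<lambda>x. map (h x) (l x))"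
proof -
  have "cf (e_prod e (e_prod e1 (e_list e2))) (e_prod e e1) (\<lambda>p. (fst p, fst (snd p)))"
    by (rule cf_pair cf_fst cf_snd cf_id)+
  from cf_compose[OF h this]
  have h': "cf (e_prod e (e_prod e1 (e_list e2))) e2 (\<lambda>p. h (fst p) (fst (snd p)))" by simp
  have "cf e (e_list e2) (\<lambda>x. foldr (\<lambda>y acc. h x y # acc) (l x) [])"
    by (rule cf_foldr[OF l cf_const]) (rule cf_Cons h' cf_snd cf_id)+
  moreover have "foldr (\<lambda>y acc. h x y # acc) ys [] = map (h x) ys" for x ys by (induction ys) simp_all
  ultimately show ?thesis by simp
qed

lemma cf_append [cf_intros]:
  assumes "cf e (e_list e1) l" "cf e (e_list e1) l'" shows "cf e (e_list e1) (\<lambda>x. l x @ l' x)"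
proof -
  have "cf e (e_list e1) (\<lambda>x. foldr (\<lambda>y acc. y # acc) (l x) (l' x))"
    by (rule cf_foldr[OF assms]) (rule cf_Cons cf_fst cf_snd cf_id)+
  moreover have "foldr (\<lambda>y acc. y # acc) ys zs = ys @ zs" for ys zs :: "'b list" by (induction ys) simp_all
  ultimately show ?thesis by simp
qed

lemma cf_concat [cf_intros]:
  assumes "cf e (e_list (e_list e1)) l" shows "cf e (e_list e1) (\<lambda>x. concat (l x))"
proof -
  have "cf e (e_list e1) (\<lambda>x. foldr (\<lambda>y acc. y @ acc) (l x) [])"
    by (rule cf_foldr[OF assms cf_const]) (rule cf_append cf_fst cf_snd cf_id)+
  moreover have "foldr (\<lambda>y acc. y @ acc) ys [] = concat ys" for ys :: "'b list list" by (induction ys) simp_all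
  ultimately show ?thesis by simp
qed

lemma cf_filter [cf_intros]:
  assumes l: "cf e (e_list e1) l" and P: "cf (e_prod e e1) e_bool (\<lambda>p. P (fst p) (snd p))"
  shows "cf e (e_list e1) (\<lambda>x. filter (P x) (l x))"
proof -
  have "cf (e_prod e e1) (e_list e1) (\<lambda>p. if P (fst p) (snd p) then [snd p] else [])"
    by (rule cf_if[OF P]) (rule cf_Cons cf_snd cf_id cf_const)+
  then have "cf e (e_list e1) (\<lambda>x. concat (map (\<lambda>y. if P x y then [y] else []) (l x)))"
    by (rule cf_concat[OF cf_map[OF l]])
  moreover have "concat (map (\<lambda>y. if P x y then [y] else []) ys) = filter (P x) ys" for x ys
    by (induction ys) simp_all
  ultimately show ?thesis by simp
qed

lemma cf_length [cf_intros]: assumes "cf e (e_list e1) l" shows "cf e e_nat (\<lambda>x. length (l x))"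
proof -
  have "cf e e_nat (\<lambda>x. foldr (\<lambda>_ n. Suc n) (l x) 0)"
    by (rule cf_foldr[OF assms cf_const]) (rule cf_Suc cf_fst cf_snd cf_id)+
  moreover have "foldr (\<lambda>_ n. Suc n) ys 0 = length ys" for ys :: "'b list" by (induction ys) simp_all
  ultimately show ?thesis by simp
qed

lemma cf_list_all [cf_intros]:
  assumes l: "cf e (e_list e1) l" and P: "cf (e_prod e e1) e_bool (\<lambda>p. P (fst p) (snd p))"
  shows "cf e e_bool (\<lambda>x. list_all (P x) (l x))"
proof -
  have "cf e e_bool (\<lambda>x. filter (\<lambda>y. \<not> P x y) (l x) = [])"
    by (rule cf_null[OF cf_filter[OF l cf_not[OF P]]])
  then show ?thesis by (simp add: filter_empty_conv list_all_iff)
qed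

lemma cf_list_ex [cf_intros]:
  assumes l: "cf e (e_list e1) l" and P: "cf (e_prod e e1) e_bool (\<lambda>p. P (fst p) (snd p))"
  shows "cf e e_bool (\<lambda>x. list_ex (P x) (l x))"
proof -
  have "cf e e_bool (\<lambda>x. \<not> filter (P x) (l x) = [])"
    by (rule cf_not[OF cf_null[OF cf_filter[OF l P]]])
  then show ?thesis by (simp add: filter_empty_conv list_ex_iff)
qed

lemma cf_drop [cf_intros]:
  assumes "cf e e_nat k" "cf e (e_list e1) l" shows "cf e (e_list e1) (\<lambda>x. drop (k x) (l x))"
proof -
  have "cf e (e_list e1) (\<lambda>x. rec_nat (l x) (\<lambda>_ ys. tl ys) (k x))"
    by (rule cf_rec_nat[OF assms(2) _ assms(1)]) (rule cf_tl cf_snd cf_id)+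
  moreover have "rec_nat ys (\<lambda>_ ys. tl ys) i = drop i ys" for ys :: "'b list" and i
    by (induction i) (simp_all add: drop_Suc tl_drop)
  ultimately show ?thesis by simp
qed

lemma cf_sum_list [cf_intros]:
  assumes "cf e (e_list e_int) l" shows "cf e e_int (\<lambda>x. sum_list (l x))"
proof -
  have "cf e e_int (\<lambda>x. foldr (\<lambda>a b. a + b) (l x) 0)"
    by (rule cf_foldr[OF assms cf_const]) (rule cf_int_plus cf_fst cf_snd cf_id)+
  moreover have "foldr (\<lambda>a b. a + b) ys 0 = sum_list ys" for ys :: "int list" by (induction ys) simp_all
  ultimately show ?thesis by simp
qed

text \<open>The list is fixed, so every entry brings a program of its own. This unrolls the loops
  over matrix positions and over permutations.\<close>

lemma cf_map_fixed:
  assumes "\<And>k. k \<in> set ks \<Longrightarrow> cf e e1 (\<lambda>x. f x k)" shows "cf e (e_list e1) (\<lambda>x. map (f x) ks)"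
  using assms
proof (induction ks)
  case Nil
  show ?case using cf_const[of e "e_list e1" "[]"] by simp
next
  case (Cons k ks)
  then have "cf e (e_list e1) (\<lambda>x. f x k # map (f x) ks)" by (intro cf_Cons) auto
  then show ?case by simp
qed

definition lookup_table :: "('a \<times> 'b) list \<Rightarrow> 'a \<Rightarrow> 'b" where
  "lookup_table t y = snd (hd (filter (\<lambda>q. fst q = y) t))"

lemma lookup_table:
  assumes "\<And>q. q \<in> set t \<Longrightarrow> snd q = f (fst q)" "y \<in> fst ` set t" shows "lookup_table t y = f y"
proof -
  have "filter (\<lambda>q. fst q = y) t \<noteq> []" using assms(2) by (auto simp: filter_empty_conv)
  then have "hd (filter (\<lambda>q. fst q = y) t) \<in> set (filter (\<lambda>q. fst q = y) t)" by (rule hd_in_set)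
  then show ?thesis using assms(1) unfolding lookup_table_def by auto
qed

text \<open>First collect the arguments needed in each degree, then tabulate the values upwards.\<close>

lemma cf_tree_recursion:
  fixes F :: "nat \<Rightarrow> 'a \<Rightarrow> 'b"
  assumes bij: "inj e1"
    and F0: "\<And>x. F 0 x = g x" and FS: "\<And>k x. F (Suc k) x = s k x (map (F k) (L k x))"
    and g: "cf e1 e2 g" and L: "cf (e_prod e_nat e1) (e_list e1) (\<lambda>p. L (fst p) (snd p))"
    and s: "cf (e_prod (e_prod e_nat e1) (e_list e2)) e2 (\<lambda>p. s (fst (fst p)) (snd (fst p)) (snd p))"
  shows "cf (e_prod e_nat e1) e2 (\<lambda>p. F (fst p) (snd p))"
proof -
  \<comment> \<open>\<open>?X p j\<close> lists the arguments required in degree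
    \<open>fst p - j\<close>, and \<open>?T p j\<close> tabulates \<open>F j\<close> at the
    arguments required in degree \<open>j\<close>.\<close>
  let ?X = "\<lambda>p j. rec_nat [snd p] (\<lambda>j xs. concat (map (L (fst p - 1 - j)) xs)) j"
  let ?T = "\<lambda>p j. rec_nat (map (\<lambda>y. (y, g y)) (?X p (fst p)))
    (\<lambda>j t. map (\<lambda>y. (y, s j y (map (lookup_table t) (L j y)))) (?X p (fst p - 1 - j))) j"
  let ?e = "e_prod e_nat e1" and ?t = "e_list (e_prod e1 e2)"
  have X: "cf e (e_list e1) (\<lambda>x. ?X (p x) (j x))" if "cf e ?e p" "cf e e_nat j" for e :: "'c \<Rightarrow> nat" and p j
  proof -
    have L': "cf (e_prod (e_prod e (e_prod e_nat (e_list e1))) e1) (e_list e1)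
        (\<lambda>q. L (fst (p (fst (fst q))) - 1 - fst (snd (fst q))) (snd q))"
    proof -
      have p': "cf (e_prod (e_prod e (e_prod e_nat (e_list e1))) e1) ?e (\<lambda>q. p (fst (fst q)))"
        by (rule cf_compose[OF that(1)]) (rule cf_fst cf_id)+
      have "cf (e_prod (e_prod e (e_prod e_nat (e_list e1))) e1) ?e
          (\<lambda>q. (fst (p (fst (fst q))) - 1 - fst (snd (fst q)), snd q))"
        by (rule cf_pair cf_minus cf_const cf_fst[OF p'] cf_fst cf_snd cf_id)+
      from cf_compose[OF L this] show ?thesis by simp
    qed
    show ?thesis
      by (rule cf_rec_nat) (rule that cf_concat cf_map L' cf_Cons cf_const cf_fst cf_snd cf_id)+
  qed
  have lk: "cf (e_prod ?t e1) e2 (\<lambda>q. lookup_table (fst q) (snd q))"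
    unfolding lookup_table_def
    by (rule cf_snd[where ?e1.0 = e1] cf_hd cf_filter cf_eq[OF bij] cf_fst cf_snd cf_id)+
  have T: "cf ?e ?t (\<lambda>p. ?T p (fst p))"
  proof (rule cf_rec_nat)
    have "cf (e_prod ?e e1) e2 (\<lambda>q. g (snd q))" by (rule cf_compose[OF g]) (rule cf_snd cf_id)+
    then show "cf ?e ?t (\<lambda>p. map (\<lambda>y. (y, g y)) (?X p (fst p)))"
      by (intro cf_map[OF X[OF cf_id cf_fst[OF cf_id]]] cf_pair[OF cf_snd[OF cf_id]])
    show "cf ?e e_nat fst" by (rule cf_fst[OF cf_id])
    let ?q = "e_prod ?e (e_prod e_nat ?t)"
    have 1: "cf (e_prod ?q e1) ?e (\<lambda>q. (fst (snd (fst q)), snd q))"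
      by (rule cf_pair cf_fst cf_snd cf_id)+
    have L'': "cf (e_prod ?q e1) (e_list e1) (\<lambda>q. L (fst (snd (fst q))) (snd q))"
      using cf_compose[OF L 1] by simp
    have "cf (e_prod (e_prod ?q e1) e1) (e_prod ?t e1) (\<lambda>q. (snd (snd (fst (fst q))), snd q))"
      by (rule cf_pair cf_fst cf_snd cf_id)+
    from cf_compose[OF lk this]
    have lk': "cf (e_prod (e_prod ?q e1) e1) e2 (\<lambda>q. lookup_table (snd (snd (fst (fst q)))) (snd q))" by simp
    have "cf (e_prod ?q e1) (e_prod ?e (e_list e2))
        (\<lambda>q. ((fst (snd (fst q)), snd q), map (lookup_table (snd (snd (fst q)))) (L (fst (snd (fst q))) (snd q))))"
      by (rule cf_pair[OF 1 cf_map[OF L'' lk']])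
    from cf_compose[OF s this]
    have "cf (e_prod ?q e1) e2
        (\<lambda>q. s (fst (snd (fst q))) (snd q) (map (lookup_table (snd (snd (fst q)))) (L (fst (snd (fst q))) (snd q))))"
      by simp
    then have step: "cf (e_prod ?q e1) (e_prod e1 e2)
        (\<lambda>q. (snd q, s (fst (snd (fst q))) (snd q) (map (lookup_table (snd (snd (fst q)))) (L (fst (snd (fst q))) (snd q)))))"
      by (rule cf_pair[OF cf_snd[OF cf_id]])
    have "cf ?q (e_list e1) (\<lambda>q. ?X (fst q) (fst (fst q) - 1 - fst (snd q)))"
      by (rule X) (rule cf_minus cf_const cf_fst cf_snd cf_id)+
    from cf_map[OF this step]
    show "cf ?q ?t (\<lambda>q. map (\<lambda>y. (y, s (fst (snd q)) y (map (lookup_table (snd (snd q))) (L (fst (snd q)) y))))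
        (?X (fst q) (fst (fst q) - 1 - fst (snd q))))" by simp
  qed
  have "cf ?e e2 (\<lambda>p. lookup_table (?T p (fst p)) (snd p))"
  proof -
    have "cf ?e (e_prod ?t e1) (\<lambda>p. (?T p (fst p), snd p))" by (rule cf_pair[OF T cf_snd[OF cf_id]])
    from cf_compose[OF lk this] show ?thesis by simp
  qed
  moreover have "lookup_table (?T p (fst p)) (snd p) = F (fst p) (snd p)" for p
  proof -
    define k where "k = fst p"
    define X where "X = (\<lambda>j. ?X p j)"
    define T where "T = (\<lambda>j. ?T p j)"
    have XS: "X (Suc j) = concat (map (L (k - 1 - j)) (X j))" for j by (simp add: X_def k_def)
    have T0: "T 0 = map (\<lambda>y. (y, g y)) (X k)" by (simp add: T_def X_def k_def)
    have TS: "T (Suc j) = map (\<lambda>y. (y, s j y (map (lookup_table (T j)) (L j y)))) (X (k - 1 - j))" for j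
      by (simp add: T_def X_def k_def)
    have inv: "(\<forall>q \<in> set (T j). snd q = F j (fst q)) \<and> fst ` set (T j) = set (X (k - j))" if "j \<le> k" for j
      using that
    proof (induction j)
      case 0
      show ?case by (simp add: T0 F0 image_image)
    next
      case (Suc j)
      then have IH: "\<And>q. q \<in> set (T j) \<Longrightarrow> snd q = F j (fst q)" "fst ` set (T j) = set (X (k - j))" by auto
      have eq: "k - j = Suc (k - 1 - j)" "k - 1 - (k - 1 - j) = j" "k - Suc j = k - 1 - j" using Suc.prems by auto
      have "map (lookup_table (T j)) (L j y) = map (F j) (L j y)" if y: "y \<in> set (X (k - 1 - j))" for y
      proof (rule map_cong[OF refl])
        fix u assume u: "u \<in> set (L j y)"
        have "u \<in> set (X (k - j))" unfolding eq(1) XS eq(2) using y u by auto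
        then show "lookup_table (T j) u = F j u" using IH by (intro lookup_table) simp_all
      qed
      then have "s j y (map (lookup_table (T j)) (L j y)) = F (Suc j) y" if "y \<in> set (X (k - 1 - j))" for y
        using that by (simp only: FS)
      then show ?case unfolding eq(3) TS by (simp add: image_image)
    qed
    have "snd p \<in> set (X 0)" by (simp add: X_def)
    then have "lookup_table (T k) (snd p) = F k (snd p)"
      using inv[of k] by (intro lookup_table) simp_all
    then show ?thesis unfolding T_def k_def .
  qed
  ultimately show ?thesis by simp
qed

section \<open>Programs for chains\<close>

text \<open>Agrees with \<open>nth\<close> inside the list and, being built from \<open>hd\<close>
  and \<open>drop\<close>, is computable at every index.\<close>

abbreviation elem_at :: "'a list \<Rightarrow> nat \<Rightarrow> 'a" where "elem_at xs i \<equiv> hd (drop i xs)"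

lemma at_nth: "i < length xs \<Longrightarrow> elem_at xs i = xs ! i" by (rule hd_drop_conv_nth)

definition e_mat :: "mat_data \<Rightarrow> nat" where "e_mat = e_list (e_prod e_int e_int)"
definition e_cell :: "mat_data \<times> nat \<Rightarrow> nat" where "e_cell = e_prod e_mat e_nat"
definition e_elt :: "elt_data \<Rightarrow> nat" where "e_elt = e_list (e_prod e_int e_cell)"

lemma bij_e_mat: "bij e_mat" and bij_e_cell: "bij e_cell" and bij_e_elt: "bij e_elt"
proof -
  show m: "bij e_mat" unfolding e_mat_def by (intro bij_e_list bij_e_prod bij_int_encode)
  show c: "bij e_cell" unfolding e_cell_def by (intro bij_e_prod m bij_e_nat)
  show "bij e_elt" unfolding e_elt_def by (intro bij_e_list bij_e_prod bij_int_encode c)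
qed

lemma elt_code_e_elt: "elt_code = e_elt"
proof -
  have p: "e_prod e1 e2 = (\<lambda>p. prod_encode (e1 (fst p), e2 (snd p)))" for e1 :: "'a \<Rightarrow> nat" and e2 :: "'b \<Rightarrow> nat"
    by (auto simp: e_prod_def)
  have l: "e_list e = (\<lambda>xs. list_encode (map e xs))" for e :: "'a \<Rightarrow> nat"
    by (auto simp: e_list_def)
  show ?thesis
    unfolding e_elt_def e_cell_def e_mat_def p l
    by (auto simp: fun_eq_iff elt_code_def mat_code_def case_prod_unfold)
qed

section \<open>Exact matrix arithmetic on integer data\<close>

context imaginary_quadratic begin

definition omega_coeffs :: "int \<times> int" where
  "omega_coeffs = (SOME p. \<omega> * \<omega> = of_int (fst p) * \<omega> + of_int (snd p))"

lemma omega_coeffs: "\<omega> * \<omega> = of_int (fst omega_coeffs) * \<omega> + of_int (snd omega_coeffs)"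
proof -
  obtain t N :: int where "\<omega> * \<omega> = of_int t * \<omega> + of_int N" using omega_quadratic by metis
  then have "\<exists>p :: int \<times> int. \<omega> * \<omega> = of_int (fst p) * \<omega> + of_int (snd p)" by (metis fst_conv snd_conv)
  from someI_ex[OF this] show ?thesis unfolding omega_coeffs_def .
qed

definition o_val :: "int \<times> int \<Rightarrow> complex" where "o_val p = of_int (fst p) + of_int (snd p) * \<omega>"
definition o_add :: "int \<times> int \<Rightarrow> int \<times> int \<Rightarrow> int \<times> int" where
  "o_add p q = (fst p + fst q, snd p + snd q)"
definition o_mul :: "int \<times> int \<Rightarrow> int \<times> int \<Rightarrow> int \<times> int" where
  "o_mul p q = (fst p * fst q + snd p * snd q * snd omega_coeffs,
    fst p * snd q + snd p * fst q + snd p * snd q * fst omega_coeffs)"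

lemma o_val_add: "o_val (o_add p q) = o_val p + o_val q"
  by (simp add: o_val_def o_add_def algebra_simps)

lemma o_val_mul: "o_val (o_mul p q) = o_val p * o_val q"
proof -
  have "o_val p * o_val q = of_int (fst p) * of_int (fst q) +
      (of_int (fst p) * of_int (snd q) + of_int (snd p) * of_int (fst q)) * \<omega> +
      of_int (snd p) * of_int (snd q) * (\<omega> * \<omega>)"
    by (simp add: o_val_def algebra_simps)
  then show ?thesis unfolding omega_coeffs by (simp add: o_val_def o_mul_def algebra_simps)
qed

text \<open>\<open>Im \<omega>\<close> is positive, so the coordinates of a number are unique.
  Equality of group elements is thereby equality of integer data, on which the decidability of
  equality of chains rests.\<close>

lemma o_val_inj: "o_val p = o_val q \<longleftrightarrow> p = q"
proof
  assume eq: "o_val p = o_val q"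
  have "Im (o_val p) = Im (o_val q)" using eq by simp
  then have s: "snd p = snd q" using Im_omega_pos by (simp add: o_val_def)
  moreover have "fst p = fst q" using eq s by (simp add: o_val_def)
  ultimately show "p = q" by (simp add: prod_eq_iff)
qed simp

lemma o_val_sum: "o_val (foldr o_add ps (0, 0)) = sum_list (map o_val ps)"
  by (induction ps) (simp_all add: o_val_add, simp add: o_val_def)

lemma o_val_prod: "o_val (foldr o_mul ps (1, 0)) = prod_list (map o_val ps)"
  by (induction ps) (simp_all add: o_val_mul, simp add: o_val_def)

lemma cf_o_add: "cf e (e_prod e_int e_int) f \<Longrightarrow> cf e (e_prod e_int e_int) g \<Longrightarrow>
    cf e (e_prod e_int e_int) (\<lambda>x. o_add (f x) (g x))"
  unfolding o_add_def by (rule cf_pair cf_int_plus cf_fst cf_snd | assumption)+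

lemma cf_o_mul:
  assumes "cf e (e_prod e_int e_int) f" "cf e (e_prod e_int e_int) g"
  shows "cf e (e_prod e_int e_int) (\<lambda>x. o_mul (f x) (g x))"
  unfolding o_mul_def
  by (intro cf_pair cf_int_plus cf_int_times cf_const cf_fst[OF assms(1)] cf_fst[OF assms(2)]
      cf_snd[OF assms(1)] cf_snd[OF assms(2)])

end

context bianchi_lattice begin

lemma mat_of_data_index:
  "i < n \<Longrightarrow> j < n \<Longrightarrow> mat_of_data n d l $$ (i, j) = o_val (l ! (i * n + j))"
  by (simp add: mat_of_data_def o_val_def)

lemma mat_of_data_carrier: "mat_of_data n d l \<in> carrier_mat n n" by (simp add: mat_of_data_def)

lemma integral_mat_of_data: "integral_mat (mat_of_data n d l)"
  unfolding integral_mat_def by (auto simp: mat_of_data_def intro: O_I)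

lemma pair_index_less: "i < n \<Longrightarrow> j < n \<Longrightarrow> i * n + j < n * n"
  using mult_le_mono1[of "Suc i" n n] by simp

lemma mat_of_data_inj:
  assumes "length l = n * n" "length l' = n * n" "mat_of_data n d l = mat_of_data n d l'" shows "l = l'"
proof (rule nth_equalityI)
  fix q assume "q < length l"
  then have q: "q < n * n" using assms(1) by simp
  then have "n > 0" by (cases n) auto
  then have ij: "q div n < n" "q mod n < n" using q by (simp_all add: less_mult_imp_div_less)
  then have "o_val (l ! (q div n * n + q mod n)) = o_val (l' ! (q div n * n + q mod n))"
    using mat_of_data_index assms(3) by metis
  then show "l ! q = l' ! q" by (simp add: o_val_inj)
qed (use assms in simp)

lemma mat_of_data_surj:
  assumes "A \<in> carrier_mat n n" "integral_mat A" obtains l where "length l = n * n" "mat_of_data n d l = A"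
proof -
  define c where "c = (\<lambda>x. SOME p. o_val p = x)"
  have c: "o_val (c x) = x" if x: "x \<in> \<O>" for x
  proof -
    obtain a b where "x = of_int a + of_int b * \<omega>" using O_E[OF x] by blast
    then have "o_val (a, b) = x" by (simp add: o_val_def)
    then show ?thesis unfolding c_def by (rule someI)
  qed
  let ?l = "map (\<lambda>q. c (A $$ (q div n, q mod n))) [0..<n * n]"
  have "mat_of_data n d ?l = A"
  proof (rule eq_matI)
    fix i j assume "i < dim_row A" "j < dim_col A"
    then have ij: "i < n" "j < n" using assms by auto
    then show "mat_of_data n d ?l $$ (i, j) = A $$ (i, j)"
      using c integral_matD[OF assms(2)] assms(1) pair_index_less[OF ij] by (simp add: mat_of_data_index)
  qed (use assms in \<open>simp_all add: mat_of_data_def\<close>)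
  then show ?thesis using that[of ?l] by simp
qed

definition m_data :: "complex mat \<Rightarrow> mat_data" where
  "m_data A = (SOME l. length l = n * n \<and> mat_of_data n d l = A)"

lemma m_data:
  assumes "A \<in> carrier G" shows "length (m_data A) = n * n" "mat_of_data n d (m_data A) = A"
proof -
  have "\<exists>l. length l = n * n \<and> mat_of_data n d l = A"
    using mat_of_data_surj assms by (metis SL_iff)
  from someI_ex[OF this] show "length (m_data A) = n * n" "mat_of_data n d (m_data A) = A"
    unfolding m_data_def by blast+
qed

lemma m_data_of: "length l = n * n \<Longrightarrow> mat_of_data n d l \<in> carrier G \<Longrightarrow> m_data (mat_of_data n d l) = l"
  using m_data mat_of_data_inj by metis

definition m_mul :: "mat_data \<Rightarrow> mat_data \<Rightarrow> mat_data" where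
  "m_mul A B = map (\<lambda>q. foldr o_add
    (map (\<lambda>k. o_mul (elem_at A (q div n * n + k)) (elem_at B (k * n + q mod n))) [0..<n]) (0, 0)) [0..<n * n]"

lemma m_mul:
  assumes "length A = n * n" "length B = n * n"
  shows "length (m_mul A B) = n * n" "mat_of_data n d (m_mul A B) = mat_of_data n d A * mat_of_data n d B"
proof -
  show "length (m_mul A B) = n * n" by (simp add: m_mul_def)
  show "mat_of_data n d (m_mul A B) = mat_of_data n d A * mat_of_data n d B"
  proof (rule eq_matI)
    fix i j assume "i < dim_row (mat_of_data n d A * mat_of_data n d B)"
      "j < dim_col (mat_of_data n d A * mat_of_data n d B)"
    then have ij: "i < n" "j < n" by (simp_all add: mat_of_data_def)
    have "mat_of_data n d (m_mul A B) $$ (i, j) =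
        (\<Sum>k\<leftarrow>[0..<n]. o_val (o_mul (elem_at A (i * n + k)) (elem_at B (k * n + j))))"
      unfolding mat_of_data_index[OF ij]
      using ij pair_index_less[OF ij] by (simp add: m_mul_def o_val_sum comp_def)
    also have "\<dots> = (\<Sum>k\<leftarrow>[0..<n]. mat_of_data n d A $$ (i, k) * mat_of_data n d B $$ (k, j))"
      using assms ij pair_index_less
      by (intro arg_cong[of _ _ sum_list] map_cong refl)
         (simp add: o_val_mul mat_of_data_index at_nth)
    also have "\<dots> = (\<Sum>k = 0..<n. mat_of_data n d A $$ (i, k) * mat_of_data n d B $$ (k, j))"
      by (simp add: sum_list_distinct_conv_sum_set)
    also have "\<dots> = (mat_of_data n d A * mat_of_data n d B) $$ (i, j)"
      using ij mat_of_data_carrier[of A] mat_of_data_carrier[of B] by (simp add: scalar_prod_def)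
    finally show "mat_of_data n d (m_mul A B) $$ (i, j) = (mat_of_data n d A * mat_of_data n d B) $$ (i, j)" .
  qed (simp_all add: mat_of_data_def)
qed

lemma cf_at: "cf e e_nat k \<Longrightarrow> cf e (e_list e1) l \<Longrightarrow> cf e e1 (\<lambda>x. elem_at (l x) (k x))"
  by (intro cf_hd cf_drop)

lemma cf_m_mul:
  assumes "cf e e_mat f" "cf e e_mat g" shows "cf e e_mat (\<lambda>x. m_mul (f x) (g x))"
proof -
  have fg: "cf e (e_list (e_prod e_int e_int)) f" "cf e (e_list (e_prod e_int e_int)) g"
    using assms by (simp_all add: e_mat_def)
  have sum: "cf e (e_prod e_int e_int) (\<lambda>x. foldr o_add (h x) (0, 0))"
    if "cf e (e_list (e_prod e_int e_int)) h" for h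
    by (rule cf_foldr[OF that cf_const]) (rule cf_o_add cf_fst cf_snd cf_id)+
  show ?thesis
    unfolding m_mul_def e_mat_def
    by (intro cf_map_fixed sum cf_o_mul cf_at cf_const fg)
qed

definition perms :: "(nat \<Rightarrow> nat) list" where
  "perms = (SOME ps. distinct ps \<and> set ps = {p. p permutes {0..<n}})"

lemma perms: "distinct perms" "set perms = {p. p permutes {0..<n}}"
proof -
  have "\<exists>ps. distinct ps \<and> set ps = {p. p permutes {0..<n}}"
    using finite_distinct_list[OF finite_permutations[of "{0..<n}"]] by auto
  from someI_ex[OF this] show "distinct perms" "set perms = {p. p permutes {0..<n}}"
    unfolding perms_def by blast+
qed

text \<open>The Leibniz formula over a fixed list of permutations; it makes membership in the group
  decidable.\<close>

definition o_det :: "mat_data \<Rightarrow> int \<times> int" where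
  "o_det A = foldr o_add (map (\<lambda>p. o_mul (sign p, 0)
    (foldr o_mul (map (\<lambda>i. elem_at A (i * n + p i)) [0..<n]) (1, 0))) perms) (0, 0)"

lemma o_det: assumes "length A = n * n" shows "o_val (o_det A) = det (mat_of_data n d A)"
proof -
  have "o_val (o_det A) = (\<Sum>p\<leftarrow>perms. of_int (sign p) * (\<Prod>i\<leftarrow>[0..<n]. mat_of_data n d A $$ (i, p i)))"
    unfolding o_det_def o_val_sum map_map comp_def o_val_mul o_val_prod
  proof (intro arg_cong[of _ _ sum_list] map_cong refl arg_cong2[of _ _ _ _ "(*)"] arg_cong[of _ _ prod_list])
    show "o_val (sign p, 0) = of_int (sign p)" for p :: "nat \<Rightarrow> nat" by (simp add: o_val_def)
    fix p i assume "p \<in> set perms" "i \<in> set [0..<n]"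
    then have pi: "i < n" "p i < n" using perms(2) permutes_in_image[of p "{0..<n}" i] by auto
    then show "o_val (elem_at A (i * n + p i)) = mat_of_data n d A $$ (i, p i)"
      using assms pair_index_less[OF pi] by (simp add: mat_of_data_index at_nth)
  qed
  also have "\<dots> = (\<Sum>p | p permutes {0..<n}. of_int (sign p) * (\<Prod>i = 0..<n. mat_of_data n d A $$ (i, p i)))"
    by (simp add: sum_list_distinct_conv_sum_set[OF perms(1)] perms(2) prod.distinct_set_conv_list[symmetric])
  also have "\<dots> = det (mat_of_data n d A)"
    using mat_of_data_carrier[of A] by (simp add: det_def)
  finally show ?thesis .
qed

definition mat_ok :: "mat_data \<Rightarrow> bool" where
  "mat_ok A \<longleftrightarrow> length A = n * n \<and> o_det A = (1, 0)"

lemma mat_ok: "mat_ok A \<longleftrightarrow> length A = n * n \<and> mat_of_data n d A \<in> carrier G"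
proof -
  have "o_det A = (1, 0) \<longleftrightarrow> mat_of_data n d A \<in> carrier G" if "length A = n * n"
  proof -
    have "o_det A = (1, 0) \<longleftrightarrow> o_val (o_det A) = o_val (1, 0)" by (simp only: o_val_inj)
    also have "\<dots> \<longleftrightarrow> det (mat_of_data n d A) = 1" using o_det[OF that] by (simp add: o_val_def)
    finally show ?thesis by (simp add: SL_iff mat_of_data_carrier integral_mat_of_data)
  qed
  then show ?thesis unfolding mat_ok_def by blast
qed

lemma cf_mat_ok: assumes "cf e e_mat f" shows "cf e e_bool (\<lambda>x. mat_ok (f x))"
proof -
  have f: "cf e (e_list (e_prod e_int e_int)) f" using assms by (simp add: e_mat_def)
  have sum: "cf e (e_prod e_int e_int) (\<lambda>x. foldr o_add (h x) (0, 0))"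
    and prod: "cf e (e_prod e_int e_int) (\<lambda>x. foldr o_mul (h x) (1, 0))"
    if "cf e (e_list (e_prod e_int e_int)) h" for h
    by (rule cf_foldr[OF that cf_const], (rule cf_o_add cf_o_mul cf_fst cf_snd cf_id)+)+
  have "cf e (e_prod e_int e_int) (\<lambda>x. o_det (f x))"
    unfolding o_det_def by (intro sum cf_map_fixed cf_o_mul prod cf_at cf_const f)
  then have "cf e e_bool (\<lambda>x. o_det (f x) = (1, 0))"
    by (intro cf_eq[OF bij_is_inj[OF bij_e_prod[OF bij_int_encode bij_int_encode]]] cf_const)
  then show ?thesis unfolding mat_ok_def by (intro cf_and cf_eq_nat cf_length[OF f] cf_const)
qed

end

section \<open>Signed faces as data\<close>

primrec signed_faces :: "'a list \<Rightarrow> (int \<times> 'a list) list" where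
  "signed_faces [] = []"
| "signed_faces (x # xs) = (1, xs) # map (\<lambda>q. (- fst q, x # snd q)) (signed_faces xs)"

lemma signed_faces_map: "signed_faces (map f xs) = map (\<lambda>q. (fst q, map f (snd q))) (signed_faces xs)"
  by (induction xs) (simp_all add: comp_def)

lemma signed_faces_length: "q \<in> set (signed_faces xs) \<Longrightarrow> Suc (length (snd q)) = length xs \<and> set (snd q) \<subseteq> set xs"
proof (induction xs arbitrary: q)
  case (Cons x xs)
  show ?case
  proof (cases "q = (1, xs)")
    case False
    then obtain p where "p \<in> set (signed_faces xs)" "q = (- fst p, x # snd p)" using Cons.prems by auto
    then show ?thesis using Cons.IH[of p] by auto
  qed auto
qed simp

lemma simplex_boundary_signed_faces:
  "simplex_boundary xs = (\<Sum>q\<leftarrow>signed_faces xs. frag_cmul (fst q) (frag_of (snd q)))"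
proof (induction xs)
  case (Cons x xs)
  have "cone x (\<Sum>q\<leftarrow>Q. frag_cmul (fst q) (frag_of (snd q))) =
      (\<Sum>q\<leftarrow>Q. frag_cmul (fst q) (frag_of (x # snd q)))" for Q :: "(int \<times> 'a list) list"
    by (induction Q) (simp_all add: cone_def frag_extend_add frag_extend_cmul)
  moreover have "(\<Sum>q\<leftarrow>Q. frag_cmul (- fst q) (frag_of (x # snd q))) =
      - (\<Sum>q\<leftarrow>Q. frag_cmul (fst q) (frag_of (x # snd q)))" for Q :: "(int \<times> 'a list) list"
    by (induction Q) simp_all
  ultimately show ?case
    by (simp add: simplex_boundary_Cons Cons comp_def del: simplex_boundary.simps(2))
qed simp

text \<open>\<open>foldr\<close> gives no access to the tail, so the accumulator carries the tail
  along with its faces.\<close>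

lemma cf_signed_faces:
  assumes "cf e (e_list e1) l" shows "cf e (e_list (e_prod e_int (e_list e1))) (\<lambda>x. signed_faces (l x))"
proof -
  let ?f = "\<lambda>y p. (y # fst p, (1, fst p) # map (\<lambda>q. (- fst q, y # snd q)) (snd p))"
  let ?t = "e_prod (e_list e1) (e_list (e_prod e_int (e_list e1)))"
  have "cf e ?t (\<lambda>x. foldr ?f (l x) ([], []))"
    by (rule cf_foldr[OF assms cf_const])
       (rule cf_pair cf_Cons cf_map cf_int_uminus cf_fst cf_snd cf_id cf_const)+
  then have "cf e (e_list (e_prod e_int (e_list e1))) (\<lambda>x. snd (foldr ?f (l x) ([], [])))" by (rule cf_snd)
  moreover have "foldr ?f xs ([], []) = (xs, signed_faces xs)" for xs :: "'b list"
    by (induction xs) simp_all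
  ultimately show ?thesis by simp
qed

definition list_index :: "'a list \<Rightarrow> 'a \<Rightarrow> nat" where
  "list_index xs y = foldr (\<lambda>x i. if x = y then 0 else Suc i) xs 0"

lemma list_index: "y \<in> set xs \<Longrightarrow> list_index xs y < length xs \<and> xs ! list_index xs y = y"
  by (induction xs) (auto simp: list_index_def)

lemma cf_list_index:
  assumes "inj e1" "cf e (e_list e1) l" "cf e e1 f" shows "cf e e_nat (\<lambda>x. list_index (l x) (f x))"
proof -
  have "cf (e_prod e (e_prod e1 e_nat)) e1 (\<lambda>p. f (fst p))"
    by (rule cf_compose[OF assms(3) cf_fst[OF cf_id]])
  then show ?thesis
    unfolding list_index_def
    by (intro cf_foldr[OF assms(2) cf_const] cf_if cf_eq[OF assms(1)] cf_const)
       (rule cf_Suc cf_fst cf_snd cf_id | assumption)+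
qed

section \<open>Words for the base simplices\<close>

locale bianchi_complex = bianchi_lattice +
  fixes m :: nat and S :: "(complex mat \<times> nat) list set"
  assumes m_pos: "0 < m"
    and S_acyclic: "acyclic_complex S"
    and S_lists: "S \<subseteq> lists (carrier G \<times> {..<m})"
    and S_closed: "face_closed S"
    and S_translate: "\<And>g s. g \<in> carrier G \<Longrightarrow> s \<in> S \<Longrightarrow> map (\<lambda>(h, c). (g * h, c)) s \<in> S"
    and S_vertex: "\<And>x. x \<in> carrier G \<times> {..<m} \<Longrightarrow> [x] \<in> S"
    and S_finite: "\<And>x. finite {y. [x, y] \<in> S}"
begin

text \<open>The letters are the neighbours of the base vertices \<open>(1, c)\<close>; a simplex with first vertex
  \<open>(1, c)\<close> is stored as a word of indices of letters.\<close>

definition letter_set :: "(complex mat \<times> nat) set" where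
  "letter_set = (\<Union>c<m. {y. [(1\<^sub>m n, c), y] \<in> S})"

definition letters :: "(complex mat \<times> nat) list" where
  "letters = (SOME ys. distinct ys \<and> set ys = letter_set)"

lemma letters: "distinct letters" "set letters = letter_set"
proof -
  have "finite letter_set" unfolding letter_set_def using S_finite by blast
  then have "\<exists>ys. distinct ys \<and> set ys = letter_set" using finite_distinct_list by blast
  from someI_ex[OF this] show "distinct letters" "set letters = letter_set"
    unfolding letters_def by blast+
qed

abbreviation B :: nat where "B \<equiv> length letters"

lemma face: "s \<in> S \<Longrightarrow> set t \<subseteq> set s \<Longrightarrow> t \<in> S"
  using S_closed unfolding face_closed_def by blast

lemma letter_carrier: "a < B \<Longrightarrow> letters ! a \<in> carrier G \<times> {..<m}"
proof -
  assume "a < B"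
  then have "letters ! a \<in> letter_set" using letters(2) nth_mem by blast
  then obtain c where "[(1\<^sub>m n, c), letters ! a] \<in> S" unfolding letter_set_def by blast
  then show ?thesis using S_lists by auto
qed

lemma letter_setI:
  assumes "s \<in> S" "hd s = (1\<^sub>m n, c)" "y \<in> set s" shows "y \<in> letter_set"
proof -
  have "s \<noteq> []" using assms(3) by auto
  then have "(1\<^sub>m n, c) \<in> set s" using assms(2) hd_in_set by metis
  then have "[(1\<^sub>m n, c), y] \<in> S" using face[OF assms(1)] assms(3) by simp
  moreover have "c < m" using calculation S_lists by auto
  ultimately show ?thesis unfolding letter_set_def by blast
qed

abbreviation letter_index :: "complex mat \<times> nat \<Rightarrow> nat" where "letter_index \<equiv> list_index letters"

lemma letter_index: "y \<in> letter_set \<Longrightarrow> letter_index y < B \<and> letters ! letter_index y = y"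
  using list_index letters(2) by metis

abbreviation word_simplex :: "nat list \<Rightarrow> (complex mat \<times> nat) list" where
  "word_simplex w \<equiv> map ((!) letters) w"

text \<open>Words without repetition: there are finitely many, and they decide all others because
  membership in \<open>S\<close> depends on the vertex set alone.\<close>

definition simplex_table :: "nat list list" where
  "simplex_table = (SOME ts. set ts = {w. set w \<subseteq> {..<B} \<and> distinct w \<and> word_simplex w \<in> S})"

lemma simplex_table: "set simplex_table = {w. set w \<subseteq> {..<B} \<and> distinct w \<and> word_simplex w \<in> S}"
proof -
  have "finite {w. set w \<subseteq> {..<B} \<and> distinct w \<and> word_simplex w \<in> S}"
    by (rule finite_subset[OF _ finite_subset_distinct[of "{..<B}"]]) auto
  then have "\<exists>ts. set ts = {w. set w \<subseteq> {..<B} \<and> distinct w \<and> word_simplex w \<in> S}" using finite_list by blast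
  from someI_ex[OF this] show ?thesis unfolding simplex_table_def .
qed

definition base_letters :: "nat list" where
  "base_letters = filter (\<lambda>a. fst (letters ! a) = 1\<^sub>m n) [0..<B]"

definition word_ok :: "nat list \<Rightarrow> bool" where
  "word_ok w \<longleftrightarrow> w \<noteq> [] \<and> list_ex (\<lambda>b. b = hd w) base_letters \<and>
    list_ex (\<lambda>t. list_all (\<lambda>a. list_ex (\<lambda>b. b = a) t) w) simplex_table"

text \<open>Removing repetitions turns a simplex into a table entry with the same letters;
  conversely, a word on the letters of an entry has its vertices among those of a simplex.\<close>

lemma word_ok:
  "word_ok w \<longleftrightarrow> w \<noteq> [] \<and> set w \<subseteq> {..<B} \<and> fst (letters ! hd w) = 1\<^sub>m n \<and> word_simplex w \<in> S"
proof -
  have "(\<exists>t \<in> set simplex_table. set w \<subseteq> set t) \<longleftrightarrow> set w \<subseteq> {..<B} \<and> word_simplex w \<in> S"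
  proof
    assume "\<exists>t \<in> set simplex_table. set w \<subseteq> set t"
    then obtain t where t: "set t \<subseteq> {..<B}" "word_simplex t \<in> S" "set w \<subseteq> set t"
      unfolding simplex_table by blast
    then show "set w \<subseteq> {..<B} \<and> word_simplex w \<in> S" using face[OF t(2), of "word_simplex w"] by auto
  next
    assume w: "set w \<subseteq> {..<B} \<and> word_simplex w \<in> S"
    then have "word_simplex (remdups w) \<in> S" using face[of "word_simplex w"] by auto
    then have "remdups w \<in> set simplex_table" unfolding simplex_table using w by auto
    then show "\<exists>t \<in> set simplex_table. set w \<subseteq> set t" by (rule rev_bexI) simp
  qed
  moreover have "list_ex (\<lambda>t. list_all (\<lambda>a. list_ex (\<lambda>b. b = a) t) w) simplex_table \<longleftrightarrow>
      (\<exists>t \<in> set simplex_table. set w \<subseteq> set t)"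
    by (auto simp: list_ex_iff list_all_iff)
  moreover have "w \<noteq> [] \<Longrightarrow> set w \<subseteq> {..<B} \<Longrightarrow> list_ex (\<lambda>b. b = hd w) base_letters \<longleftrightarrow> fst (letters ! hd w) = 1\<^sub>m n"
    using hd_in_set[of w] by (auto simp: list_ex_iff base_letters_def subset_iff)
  ultimately show ?thesis unfolding word_ok_def by blast
qed

abbreviation e_word :: "nat list \<Rightarrow> nat" where "e_word \<equiv> e_list e_nat"

lemma cf_word_ok: "cf e e_word f \<Longrightarrow> cf e e_bool (\<lambda>x. word_ok (f x))"
proof (erule cf_compose[rotated])
  show "cf e_word e_bool word_ok"
    unfolding word_ok_def
    by (rule cf_and cf_not cf_null cf_list_ex[where ?e1.0 = e_nat, OF cf_const]
        cf_list_ex[where ?e1.0 = e_word, OF cf_const]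
        cf_list_all cf_list_ex cf_eq_nat cf_hd cf_fst cf_snd cf_id)+
qed

definition all_words :: "nat \<Rightarrow> nat list list" where
  "all_words k = product_lists (replicate k [0..<B])"

lemma all_words: "set (all_words k) = {w. length w = k \<and> set w \<subseteq> {..<B}}" "distinct (all_words k)"
proof -
  have "list_all2 (\<lambda>x ys. x \<in> set ys) w (replicate k [0..<B]) \<longleftrightarrow> length w = k \<and> set w \<subseteq> {..<B}" for w
    by (auto simp: list_all2_conv_all_nth set_conv_nth[of w])
  then show "set (all_words k) = {w. length w = k \<and> set w \<subseteq> {..<B}}"
    unfolding all_words_def product_lists_set by blast
  show "distinct (all_words k)"
    unfolding all_words_def by (rule distinct_product_lists) simp
qed

definition words :: "nat \<Rightarrow> nat list list" where
  "words k = filter word_ok (all_words (Suc k))"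

lemma words: "distinct (words k)" "w \<in> set (words k) \<longleftrightarrow> length w = Suc k \<and> word_ok w"
  using all_words(2)[of "Suc k"] all_words(1)[of "Suc k"] word_ok by (auto simp: words_def)

definition rank :: "nat \<Rightarrow> nat" where "rank k = length (words k)"

definition base_simplex :: "nat \<Rightarrow> nat \<Rightarrow> (complex mat \<times> nat) list" where
  "base_simplex k i = word_simplex (words k ! i)"

lemma cf_words: "cf e e_nat f \<Longrightarrow> cf e (e_list e_word) (\<lambda>x. words (f x))"
proof -
  assume f: "cf e e_nat f"
  have "cf e (e_list e_word) (\<lambda>x. rec_nat [[]] (\<lambda>_ ws. concat (map (\<lambda>a. map (\<lambda>w. a # w) ws) [0..<B])) (Suc (f x)))"
    by (rule cf_rec_nat[OF cf_const _ cf_Suc[OF f]])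
       (rule cf_concat cf_map[where ?e1.0 = e_nat, OF cf_const] cf_map cf_Cons cf_fst cf_snd cf_id)+
  moreover have eq: "rec_nat [[]] (\<lambda>_ ws. concat (map (\<lambda>a. map (\<lambda>w. a # w) ws) [0..<B])) k = all_words k" for k
    by (induction k) (simp_all add: all_words_def)
  ultimately have "cf e (e_list e_word) (\<lambda>x. all_words (Suc (f x)))" unfolding eq by blast
  then show ?thesis unfolding words_def
    by (rule cf_filter) (rule cf_word_ok[OF cf_snd[OF cf_id]])
qed

text \<open>Every vertex of a simplex that starts at \<open>(1, c)\<close> is a neighbour of that
  vertex, hence a letter; as letters are listed without repetition, the word is unique.\<close>

lemma base_simplex_bij:
  "bij_betw (base_simplex k) {..<rank k} {s \<in> S. length s = Suc k \<and> fst (hd s) = 1\<^sub>m n}"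
  unfolding bij_betw_def
proof
  have inj: "v = w" if vw: "set v \<subseteq> {..<B}" "set w \<subseteq> {..<B}" "word_simplex v = word_simplex w" for v w
  proof -
    have "inj_on ((!) letters) {..<B}" using letters(1) by (simp add: inj_on_nth)
    then have "inj_on ((!) letters) (set v \<union> set w)" using vw by (auto intro: inj_on_subset)
    then show ?thesis using vw(3) by (metis inj_on_map_eq_map)
  qed
  show "inj_on (base_simplex k) {..<rank k}"
  proof (rule inj_onI)
    fix i j assume ij: "i \<in> {..<rank k}" "j \<in> {..<rank k}" "base_simplex k i = base_simplex k j"
    then have "words k ! i \<in> set (words k)" "words k ! j \<in> set (words k)" by (auto simp: rank_def)
    then have "words k ! i = words k ! j"
      using ij(3) inj word_ok words(2) unfolding base_simplex_def by blast
    then show "i = j" using ij words(1) by (simp add: rank_def nth_eq_iff_index_eq)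
  qed
  show "base_simplex k ` {..<rank k} = {s \<in> S. length s = Suc k \<and> fst (hd s) = 1\<^sub>m n}"
  proof (intro equalityI subsetI)
    fix s assume "s \<in> base_simplex k ` {..<rank k}"
    then obtain i where i: "i < rank k" "s = base_simplex k i" by auto
    then have w: "words k ! i \<in> set (words k)" by (simp add: rank_def)
    then have "length (words k ! i) = Suc k" "word_ok (words k ! i)" using words(2) by auto
    then show "s \<in> {s \<in> S. length s = Suc k \<and> fst (hd s) = 1\<^sub>m n}"
      using word_ok i(2) by (simp add: base_simplex_def hd_map)
  next
    fix s assume "s \<in> {s \<in> S. length s = Suc k \<and> fst (hd s) = 1\<^sub>m n}"
    then have s: "s \<in> S" "length s = Suc k" "fst (hd s) = 1\<^sub>m n" by auto
    have L: "y \<in> letter_set" if "y \<in> set s" for y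
      using letter_setI[OF s(1) _ that, of "snd (hd s)"] s(3) by (metis prod.collapse)
    let ?w = "map letter_index s"
    have ws: "word_simplex ?w = s" using L letter_index by (simp add: map_idI)
    have "?w \<noteq> []" using s(2) by auto
    then have "word_ok ?w"
      unfolding word_ok ws using L letter_index s(1,3) by (auto simp: hd_map)
    then have "?w \<in> set (words k)" using words(2) s(2) by simp
    then obtain i where "i < rank k" "words k ! i = ?w" unfolding rank_def by (metis in_set_conv_nth)
    then show "s \<in> base_simplex k ` {..<rank k}"
      using ws by (intro image_eqI[of _ _ i]) (simp_all add: base_simplex_def)
  qed
qed

sublocale R: simplicial_resolution G m S rank base_simplex
proof (intro simplicial_resolution.intro simplicial_resolution_axioms.intro SL_group)
  show "map (\<lambda>(h, c). (g \<otimes>\<^bsub>G\<^esub> h, c)) s \<in> S" if "g \<in> carrier G" "s \<in> S" for g s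
    using S_translate[OF that] by (simp add: SL_ops)
  show "bij_betw (base_simplex k) {..<rank k} {s \<in> S. length s = Suc k \<and> fst (hd s) = \<one>\<^bsub>G\<^esub>}" for k
    using base_simplex_bij[of k] by (simp add: SL_ops)
qed (fact m_pos S_acyclic S_lists S_closed S_vertex)+

end

section \<open>The boundary on data\<close>

lemma frag_cmul_diff: "frag_cmul c (a - b) = frag_cmul c a - frag_cmul c b"
  using frag_cmul_distrib2[of c "a - b" b] by simp

lemma keys_sum_list:
  "(\<And>t. t \<in> set l \<Longrightarrow> s t \<in> K) \<Longrightarrow> Poly_Mapping.keys (\<Sum>t\<leftarrow>l. frag_cmul (c t) (frag_of (s t))) \<subseteq> K"
proof (induction l)
  case (Cons t l)
  have "Poly_Mapping.keys (frag_cmul (c t) (frag_of (s t))) \<subseteq> K"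
    using keys_cmul[of "c t" "frag_of (s t)"] Cons.prems[of t] by auto
  moreover have "Poly_Mapping.keys (\<Sum>t\<leftarrow>l. frag_cmul (c t) (frag_of (s t))) \<subseteq> K"
    using Cons.prems by (intro Cons.IH) simp
  ultimately show ?case
    unfolding list.map sum_list.Cons by (intro subset_trans[OF Poly_Mapping.keys_add] Un_least)
qed simp

lemma lookup_sum_list:
  "Poly_Mapping.lookup (\<Sum>t\<leftarrow>l. frag_cmul (c t) (frag_of (s t))) u = (\<Sum>t\<leftarrow>l. if s t = u then c t else 0)"
  by (induction l) (simp_all add: lookup_add lookup_single)

definition scale :: "int \<Rightarrow> elt_data \<Rightarrow> elt_data" where
  "scale c l = map (\<lambda>t. (c * fst t, snd t)) l"

text \<open>A list may mention the same cell several times, so coefficients are collected before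
  they are compared with 0.\<close>

definition is_zero :: "elt_data \<Rightarrow> bool" where
  "is_zero l \<longleftrightarrow> list_all (\<lambda>t. sum_list (map (\<lambda>u. if snd u = snd t then fst u else 0) l) = 0) l"

lemma cf_scale: assumes "cf e e_int c" "cf e e_elt l" shows "cf e e_elt (\<lambda>x. scale (c x) (l x))"
proof -
  have l: "cf e (e_list (e_prod e_int e_cell)) l" using assms(2) by (simp add: e_elt_def)
  have "cf (e_prod e (e_prod e_int e_cell)) e_int (\<lambda>p. c (fst p))"
    by (rule cf_compose[OF assms(1) cf_fst[OF cf_id]])
  then show ?thesis unfolding scale_def e_elt_def
    by (intro cf_map[OF l] cf_pair cf_int_times) (assumption | rule cf_fst cf_snd cf_id)+
qed

lemma cf_is_zero_elt: assumes "cf e e_elt l" shows "cf e e_bool (\<lambda>x. is_zero (l x))"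
proof -
  let ?t = "e_prod e_int e_cell"
  have l: "cf e (e_list ?t) l" using assms by (simp add: e_elt_def)
  have l': "cf (e_prod e ?t) (e_list ?t) (\<lambda>p. l (fst p))"
    by (rule cf_compose[OF l cf_fst[OF cf_id]])
  have "cf (e_prod (e_prod e ?t) ?t) e_bool (\<lambda>p. snd (snd p) = snd (snd (fst p)))"
    by (rule cf_eq[OF bij_is_inj[OF bij_e_cell]]) (rule cf_fst cf_snd cf_id)+
  then have "cf (e_prod (e_prod e ?t) ?t) e_int (\<lambda>p. if snd (snd p) = snd (snd (fst p)) then fst (snd p) else 0)"
    by (intro cf_if cf_const) (assumption | rule cf_fst cf_snd cf_id)+
  then show ?thesis unfolding is_zero_def
    by (intro cf_list_all[OF l] cf_eq_int cf_const cf_sum_list cf_map[OF l'])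
qed

context bianchi_complex begin

definition letter_mats :: "mat_data list" where
  "letter_mats = map (\<lambda>y. m_data (fst y)) letters"

text \<open>Row \<open>a\<close> re-bases the letters at letter \<open>a\<close>. An entry is
  meaningful if the re-based vertex is again a letter, as for two letters of a common simplex, the
  case met in \<open>cell_face\<close>.\<close>

definition letter_shift :: "nat list list" where
  "letter_shift = map (\<lambda>a. map (\<lambda>b. letter_index
    (adj_mat (fst (letters ! a)) * fst (letters ! b), snd (letters ! b))) [0..<B]) [0..<B]"

text \<open>Faces of the cell \<open>A \<tau>\<^sub>i\<close>: delete a vertex of \<open>\<tau>\<^sub>i\<close>, then move the first remaining vertex
  \<open>(h, c)\<close> to \<open>(1, c)\<close>, replacing \<open>A\<close> by \<open>A h\<close>.\<close>

definition cell_boundary :: "nat \<Rightarrow> mat_data \<times> nat \<Rightarrow> elt_data" where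
  "cell_boundary k x = map (\<lambda>q. (fst q, m_mul (fst x) (elem_at letter_mats (hd (snd q))),
      list_index (words (k - 1)) (map (\<lambda>b. elem_at (elem_at letter_shift (hd (snd q))) b) (snd q))))
    (signed_faces (elem_at (words k) (snd x)))"

definition elt_boundary :: "nat \<Rightarrow> elt_data \<Rightarrow> elt_data" where
  "elt_boundary k l = concat (map (\<lambda>t. scale (fst t) (cell_boundary k (snd t))) l)"

definition cell_ok :: "nat \<Rightarrow> mat_data \<times> nat \<Rightarrow> bool" where
  "cell_ok k x \<longleftrightarrow> mat_ok (fst x) \<and> snd x < rank k"

definition elt_ok :: "nat \<Rightarrow> elt_data \<Rightarrow> bool" where
  "elt_ok k l \<longleftrightarrow> list_all (\<lambda>t. cell_ok k (snd t)) l"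

definition cell_of :: "nat \<Rightarrow> mat_data \<times> nat \<Rightarrow> (complex mat \<times> nat) list" where
  "cell_of k x = R.cell k (snd x) (mat_of_data n d (fst x))"

definition chain_of :: "nat \<Rightarrow> elt_data \<Rightarrow> ((complex mat \<times> nat) list \<Rightarrow>\<^sub>0 int)" where
  "chain_of k l = (\<Sum>t\<leftarrow>l. frag_cmul (fst t) (frag_of (cell_of k (snd t))))"

lemma cell_of_simplices: "cell_ok k x \<Longrightarrow> cell_of k x \<in> R.simplices k"
  unfolding cell_ok_def cell_of_def using R.cell_simplices mat_ok by blast

lemma cell_of_inj: assumes "cell_ok k x" "cell_ok k y" shows "cell_of k x = cell_of k y \<longleftrightarrow> x = y"
proof
  assume "cell_of k x = cell_of k y"
  then have "snd x = snd y \<and> mat_of_data n d (fst x) = mat_of_data n d (fst y)"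
    using assms R.cell_inj unfolding cell_ok_def cell_of_def mat_ok by blast
  then show "x = y" using assms mat_of_data_inj unfolding cell_ok_def mat_ok by (simp add: prod_eq_iff)
qed simp

lemma elt_ok_simps [simp]:
  "elt_ok k []" "elt_ok k (t # l) \<longleftrightarrow> cell_ok k (snd t) \<and> elt_ok k l"
  "elt_ok k (l @ l') \<longleftrightarrow> elt_ok k l \<and> elt_ok k l'" "elt_ok k (scale c l) \<longleftrightarrow> elt_ok k l"
  by (auto simp: elt_ok_def scale_def list_all_iff)

lemma chain_of_simps [simp]:
  "chain_of k [] = 0"
  "chain_of k (t # l) = frag_cmul (fst t) (frag_of (cell_of k (snd t))) + chain_of k l"
  "chain_of k (l @ l') = chain_of k l + chain_of k l'"
  by (simp_all add: chain_of_def)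

lemma chain_of_scale [simp]: "chain_of k (scale c l) = frag_cmul c (chain_of k l)"
  by (induction l) (simp_all add: scale_def frag_cmul_distrib2 add_ac)

lemma keys_chain_of: "elt_ok k l \<Longrightarrow> Poly_Mapping.keys (chain_of k l) \<subseteq> R.simplices k"
  unfolding chain_of_def elt_ok_def list_all_iff
  by (rule keys_sum_list) (use cell_of_simplices in blast)

text \<open>Distinct valid data denote distinct cells, so the collected coefficients are precisely
  the coefficients of the chain.\<close>

lemma is_zero: assumes l: "elt_ok k l" shows "is_zero l \<longleftrightarrow> chain_of k l = 0"
proof -
  have lk: "Poly_Mapping.lookup (chain_of k l) (cell_of k (snd t)) =
      sum_list (map (\<lambda>u. if snd u = snd t then fst u else 0) l)" if t: "t \<in> set l" for t
  proof -
    have "cell_of k (snd u) = cell_of k (snd t) \<longleftrightarrow> snd u = snd t" if "u \<in> set l" for u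
      using cell_of_inj l that t unfolding elt_ok_def list_all_iff by blast
    then show ?thesis unfolding chain_of_def lookup_sum_list
      by (intro arg_cong[of _ _ sum_list] map_cong) simp_all
  qed
  show ?thesis
  proof
    assume z: "is_zero l"
    show "chain_of k l = 0"
    proof (rule poly_mapping_eqI)
      fix s
      show "Poly_Mapping.lookup (chain_of k l) s = Poly_Mapping.lookup 0 s"
      proof (cases "\<exists>t \<in> set l. s = cell_of k (snd t)")
        case True
        then show ?thesis using lk z by (auto simp: is_zero_def list_all_iff)
      next
        case False
        then have "Poly_Mapping.lookup (chain_of k l) s = (\<Sum>t\<leftarrow>l. 0)"
          unfolding chain_of_def lookup_sum_list by (intro arg_cong[of _ _ sum_list] map_cong) auto
        then show ?thesis by simp
      qed
    qed
  next
    assume "chain_of k l = 0"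
    then show "is_zero l" using lk by (simp add: is_zero_def list_all_iff)
  qed
qed

lemma chain_of_surj:
  assumes "Poly_Mapping.keys z \<subseteq> R.simplices k"
  shows "\<exists>l. elt_ok k l \<and> chain_of k l = z"
  using assms
proof (induction z rule: frag_induction)
  case zero
  show ?case by (rule exI[of _ "[]"]) simp
next
  case (one s)
  then obtain i g where ig: "i < rank k" "g \<in> carrier G" "s = R.cell k i g" by (rule R.cell_surj)
  then have "cell_ok k (m_data g, i) \<and> cell_of k (m_data g, i) = s"
    by (simp add: cell_ok_def cell_of_def mat_ok m_data)
  then show ?case by (intro exI[of _ "[(1, m_data g, i)]"]) simp
next
  case (diff a b)
  then obtain l l' where "elt_ok k l" "chain_of k l = a" "elt_ok k l'" "chain_of k l' = b" by blast
  then show ?case by (intro exI[of _ "l @ scale (-1) l'"]) simp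
qed

lemma translate_word: "R.translate g (word_simplex w) = map (\<lambda>a. (g * fst (letters ! a), snd (letters ! a))) w"
  by (simp add: R.translate_def SL_ops case_prod_unfold comp_def)

text \<open>With \<open>h\<close> the group component of the first vertex of \<open>t\<close>, the
  face \<open>A t\<close> is the translate by \<open>A h\<close> of \<open>adj_mat h\<close> applied
  to \<open>t\<close>. The latter is a simplex by translation invariance and begins over the
  identity, so it is one of the enumerated words.\<close>

lemma cell_face:
  assumes w: "word_ok w" "length w = Suc (Suc k)" and t: "length t = Suc k" "set t \<subseteq> set w"
    and A: "mat_ok A"
  defines "x \<equiv> (m_mul A (elem_at letter_mats (hd t)),
    list_index (words k) (map (\<lambda>b. elem_at (elem_at letter_shift (hd t)) b) t))"
  shows "cell_ok k x" "cell_of k x = R.translate (mat_of_data n d A) (word_simplex t)"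
proof -
  have wB: "set w \<subseteq> {..<B}" and wS: "word_simplex w \<in> S" using w(1) word_ok by auto
  have t0: "t \<noteq> []" using t(1) by auto
  define a where "a = hd t"
  have a: "a \<in> set t" "a < B" using t0 t(2) wB hd_in_set[OF t0] unfolding a_def by blast+
  define h where "h = fst (letters ! a)"
  have h: "h \<in> carrier G" unfolding h_def using letter_carrier[OF a(2)] by auto
  note h' = SL_adj[OF h]
  have g: "length A = n * n" "mat_of_data n d A \<in> carrier G" using A mat_ok by auto
  have tS: "word_simplex t \<in> S" using face[OF wS, of "word_simplex t"] t(2) by auto
  let ?y = "\<lambda>b. (adj_mat h * fst (letters ! b), snd (letters ! b))"
  have ts: "map ?y t \<in> S" using S_translate[OF h'(1) tS] by (simp add: case_prod_unfold comp_def)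
  have hd_ts: "hd (map ?y t) = (1\<^sub>m n, snd (letters ! a))"
    using t0 h'(3) by (simp add: hd_map a_def h_def)
  have y: "?y b \<in> letter_set" if "b \<in> set t" for b
    by (rule letter_setI[OF ts hd_ts]) (use that in simp)
  let ?t = "map (\<lambda>b. elem_at (elem_at letter_shift a) b) t"
  have tt: "elem_at (elem_at letter_shift a) b = letter_index (?y b)" if "b \<in> set t" for b
  proof -
    have "b < B" using that t(2) wB by auto
    then show ?thesis using a(2) by (simp add: letter_shift_def at_nth h_def)
  qed
  have lt: "letters ! (elem_at (elem_at letter_shift a) b) = ?y b" "elem_at (elem_at letter_shift a) b < B"
    if "b \<in> set t" for b
    using tt[OF that] letter_index[OF y[OF that]] by simp_all
  have ws: "word_simplex ?t = map ?y t" using lt(1) by simp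
  have "fst (letters ! hd ?t) = fst (hd (word_simplex ?t))" using t0 by (simp add: hd_map)
  then have "fst (letters ! hd ?t) = 1\<^sub>m n" unfolding ws hd_ts by simp
  then have "word_ok ?t" unfolding word_ok ws using t0 ts lt(2) by auto
  then have tw: "?t \<in> set (words k)" using words(2) t(1) by simp
  have idx: "snd x < rank k" "words k ! snd x = ?t"
    using list_index[OF tw] by (simp_all add: x_def a_def rank_def)
  have ma: "elem_at letter_mats a = m_data h" using a(2) by (simp add: letter_mats_def at_nth h_def)
  have fx: "length (fst x) = n * n" "mat_of_data n d (fst x) = mat_of_data n d A * h"
    using m_mul[OF g(1) m_data(1)[OF h]] m_data(2)[OF h] by (simp_all add: x_def ma[unfolded a_def])
  show "cell_ok k x"
    unfolding cell_ok_def mat_ok fx(2) using idx(1) fx(1) SL_mult[OF g(2) h] by blast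
  have tg: "word_simplex t \<in> R.glists" using S_lists tS by blast
  have "cell_of k x = R.translate (mat_of_data n d A * h) (map ?y t)"
    by (simp add: cell_of_def R.cell_def base_simplex_def idx(2) fx(2) ws del: map_map)
  also have "map ?y t = R.translate (adj_mat h) (word_simplex t)" by (simp add: translate_word)
  also have "R.translate (mat_of_data n d A * h) \<dots> = R.translate (mat_of_data n d A * h * adj_mat h) (word_simplex t)"
    using R.translate_mult[OF SL_mult[OF g(2) h] h'(1) tg] by (simp add: SL_ops)
  also have "mat_of_data n d A * h * adj_mat h = mat_of_data n d A * (h * adj_mat h)"
    by (rule assoc_mult_mat[OF SL_carrier[OF g(2)] SL_carrier[OF h] SL_carrier[OF h'(1)]])
  also have "\<dots> = mat_of_data n d A" using SL_carrier[OF g(2)] by (simp add: h'(2))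
  finally show "cell_of k x = R.translate (mat_of_data n d A) (word_simplex t)" .
qed

lemma cell_boundary:
  assumes x: "cell_ok (Suc k) x"
  shows "elt_ok k (cell_boundary (Suc k) x)"
    "chain_of k (cell_boundary (Suc k) x) = simplex_boundary (cell_of (Suc k) x)"
proof -
  define w where "w = words (Suc k) ! snd x"
  have i: "snd x < length (words (Suc k))" and A: "mat_ok (fst x)" using x by (auto simp: cell_ok_def rank_def)
  then have "w \<in> set (words (Suc k))" by (simp add: w_def)
  then have w: "word_ok w" "length w = Suc (Suc k)" using words(2) by auto
  define f where "f = (\<lambda>q :: int \<times> nat list. (m_mul (fst x) (elem_at letter_mats (hd (snd q))),
      list_index (words k) (map (\<lambda>b. elem_at (elem_at letter_shift (hd (snd q))) b) (snd q))))"
  have eq: "cell_boundary (Suc k) x = map (\<lambda>q. (fst q, f q)) (signed_faces w)"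
    using i by (simp add: cell_boundary_def at_nth w_def f_def)
  have q: "cell_ok k (f q)" "cell_of k (f q) = R.translate (mat_of_data n d (fst x)) (word_simplex (snd q))"
    if "q \<in> set (signed_faces w)" for q
    using cell_face[OF w _ _ A, of "snd q"] signed_faces_length[OF that] w(2) unfolding f_def by simp_all
  show "elt_ok k (cell_boundary (Suc k) x)" unfolding eq elt_ok_def using q(1) by (simp add: list_all_iff)
  have "chain_of k (cell_boundary (Suc k) x) =
      (\<Sum>q\<leftarrow>signed_faces w. frag_cmul (fst q) (frag_of (R.translate (mat_of_data n d (fst x)) (word_simplex (snd q)))))"
    unfolding eq chain_of_def map_map comp_def
    using q(2) by (intro arg_cong[of _ _ sum_list] map_cong) simp_all
  also have "\<dots> = simplex_boundary (R.translate (mat_of_data n d (fst x)) (word_simplex w))"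
    unfolding translate_word simplex_boundary_signed_faces signed_faces_map map_map comp_def by simp
  finally show "chain_of k (cell_boundary (Suc k) x) = simplex_boundary (cell_of (Suc k) x)"
    by (simp add: cell_of_def R.cell_def base_simplex_def w_def)
qed

lemma elt_boundary:
  assumes "elt_ok (Suc k) l"
  shows "elt_ok k (elt_boundary (Suc k) l)" "chain_of k (elt_boundary (Suc k) l) = boundary (chain_of (Suc k) l)"
proof -
  have "elt_ok k (elt_boundary (Suc k) l) \<and> chain_of k (elt_boundary (Suc k) l) = boundary (chain_of (Suc k) l)"
    using assms by (induction l) (simp_all add: elt_boundary_def cell_boundary)
  then show "elt_ok k (elt_boundary (Suc k) l)"
    "chain_of k (elt_boundary (Suc k) l) = boundary (chain_of (Suc k) l)" by blast+
qed

lemma cf_cell_ok: assumes "cf e e_nat f" "cf e e_cell g" shows "cf e e_bool (\<lambda>x. cell_ok (f x) (g x))"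
proof -
  have g: "cf e (e_prod e_mat e_nat) g" using assms(2) by (simp add: e_cell_def)
  show ?thesis unfolding cell_ok_def rank_def
    by (intro cf_and cf_mat_ok cf_less cf_fst[OF g] cf_snd[OF g] cf_length[OF cf_words[OF assms(1)]])
qed

lemma cf_elt_ok: assumes "cf e e_nat f" "cf e e_elt g" shows "cf e e_bool (\<lambda>x. elt_ok (f x) (g x))"
proof -
  have g: "cf e (e_list (e_prod e_int e_cell)) g" using assms(2) by (simp add: e_elt_def)
  show ?thesis unfolding elt_ok_def
    by (intro cf_list_all[OF g] cf_cell_ok cf_compose[OF assms(1) cf_fst[OF cf_id]]) (rule cf_snd cf_id)+
qed

lemma cf_cell_boundary:
  assumes "cf e e_nat f" "cf e e_cell g" shows "cf e e_elt (\<lambda>x. cell_boundary (f x) (g x))"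
proof -
  have g: "cf e (e_prod e_mat e_nat) g" using assms(2) by (simp add: e_cell_def)
  let ?q = "e_prod e_int e_word"
  have q: "cf (e_prod e ?q) e_word (\<lambda>p. snd (snd p))" by (rule cf_snd cf_id)+
  have f': "cf (e_prod e ?q) e_nat (\<lambda>p. f (fst p) - 1)"
    by (intro cf_minus cf_const cf_compose[OF assms(1) cf_fst[OF cf_id]])
  have g': "cf (e_prod e ?q) e_mat (\<lambda>p. fst (g (fst p)))"
    by (rule cf_fst[OF cf_compose[OF g cf_fst[OF cf_id]]])
  have sh: "cf (e_prod (e_prod e ?q) e_nat) e_nat (\<lambda>p. elem_at (elem_at letter_shift (hd (snd (snd (fst p))))) (snd p))"
    by (rule cf_at[OF cf_snd[OF cf_id] cf_at[OF _ cf_const]]) (rule cf_hd cf_fst cf_snd cf_id)+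
  show ?thesis
    unfolding cell_boundary_def e_elt_def e_cell_def
    by (intro cf_map[OF cf_signed_faces[OF cf_at[OF cf_snd[OF g] cf_words[OF assms(1)]]]] cf_pair
        cf_m_mul[OF g' cf_at[OF cf_hd[OF q] cf_const]]
        cf_list_index[OF bij_is_inj[OF bij_e_list[OF bij_e_nat]] cf_words[OF f'] cf_map[OF q sh]])
       (rule cf_fst cf_snd cf_id)+
qed

lemma cf_elt_boundary:
  assumes "cf e e_nat f" "cf e e_elt g" shows "cf e e_elt (\<lambda>x. elt_boundary (f x) (g x))"
proof -
  have g: "cf e (e_list (e_prod e_int e_cell)) g" using assms(2) by (simp add: e_elt_def)
  have "cf (e_prod e (e_prod e_int e_cell)) (e_list (e_prod e_int e_cell))
      (\<lambda>p. scale (fst (snd p)) (cell_boundary (f (fst p)) (snd (snd p))))"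
    unfolding e_elt_def[symmetric]
    by (intro cf_scale cf_cell_boundary cf_compose[OF assms(1) cf_fst[OF cf_id]]) (rule cf_fst cf_snd cf_id)+
  then show ?thesis unfolding elt_boundary_def e_elt_def
    by (intro cf_concat cf_map[OF g])
qed

section \<open>Search for fillings, and the homotopy\<close>

text \<open>In degree 0 the boundary is a multiple of the empty simplex, which has no
  \<open>elt_data\<close>; the sum of the coefficients stands for it.\<close>

definition is_cycle :: "nat \<Rightarrow> elt_data \<Rightarrow> bool" where
  "is_cycle k z \<longleftrightarrow> (if k = 0 then sum_list (map fst z) = 0 else is_zero (elt_boundary k z))"

text \<open>On input that is not a cycle every \<open>N\<close> counts as a filling, so that the search always
  halts.\<close>

definition filling :: "nat \<times> elt_data \<Rightarrow> nat \<Rightarrow> bool" where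
  "filling p N \<longleftrightarrow> \<not> (elt_ok (fst p) (snd p) \<and> is_cycle (fst p) (snd p)) \<or>
    (elt_ok (Suc (fst p)) (inv_into UNIV e_elt N) \<and>
     is_zero (elt_boundary (Suc (fst p)) (inv_into UNIV e_elt N) @ scale (-1) (snd p)))"

definition fill_search :: "nat \<times> elt_data \<Rightarrow> elt_data" where
  "fill_search p = inv_into UNIV e_elt (LEAST N. filling p N)"

lemma is_cycle:
  assumes "elt_ok k z" shows "is_cycle k z \<longleftrightarrow> boundary (chain_of k z) = 0"
proof (cases k)
  case 0
  have "boundary (chain_of 0 z) = frag_cmul (sum_list (map fst z)) (frag_of [])" using assms[unfolded 0]
  proof (induction z)
    case (Cons t z)
    then have "cell_of 0 (snd t) \<in> R.simplices 0" by (simp add: cell_of_simplices)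
    then obtain v where "cell_of 0 (snd t) = [v]" by (auto simp: R.simplices_def length_Suc_conv)
    then show ?case using Cons by (simp add: frag_cmul_distrib)
  qed simp
  then show ?thesis by (simp add: is_cycle_def 0)
next
  case (Suc j)
  then show ?thesis
    using is_zero[OF elt_boundary(1)[of j z]] elt_boundary(2)[of j z] assms by (simp add: is_cycle_def)
qed

text \<open>Acyclicity provides a filling of the right degree, and \<open>chain_of_surj\<close> a
  list that denotes it: this is why the search halts.\<close>

lemma filling_ex: "\<exists>N. filling p N"
proof (cases "elt_ok (fst p) (snd p) \<and> is_cycle (fst p) (snd p)")
  case True
  define k where "k = fst p"
  define z where "z = snd p"
  have z: "elt_ok k z" "boundary (chain_of k z) = 0" using True is_cycle by (auto simp: k_def z_def)
  have "Poly_Mapping.keys (chain_of k z) \<subseteq> S \<inter> {s. length s = Suc k}"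
    using keys_chain_of[OF z(1)] by (auto simp: R.simplices_def)
  then obtain w where w: "Poly_Mapping.keys w \<subseteq> S \<inter> {s. length s = Suc (Suc k)}" "boundary w = chain_of k z"
    using acyclic_complex_homogeneous[OF S_acyclic _ z(2)] by blast
  then have "Poly_Mapping.keys w \<subseteq> R.simplices (Suc k)" by (auto simp: R.simplices_def)
  then obtain l where l: "elt_ok (Suc k) l" "chain_of (Suc k) l = w" using chain_of_surj by blast
  have "is_zero (elt_boundary (Suc k) l @ scale (-1) z)"
    using l z(1) w(2) elt_boundary[OF l(1)] by (subst is_zero[of k]) simp_all
  then have "filling p (e_elt l)"
    unfolding filling_def using l(1) bij_e_elt by (simp add: bij_is_inj k_def z_def)
  then show ?thesis by blast
next
  case False
  then show ?thesis unfolding filling_def by blast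
qed

lemma fill_search:
  assumes "elt_ok k z" "boundary (chain_of k z) = 0"
  shows "elt_ok (Suc k) (fill_search (k, z))" "boundary (chain_of (Suc k) (fill_search (k, z))) = chain_of k z"
proof -
  let ?l = "fill_search (k, z)"
  have "filling (k, z) (LEAST N. filling (k, z) N)" using filling_ex by (rule LeastI_ex)
  then have l: "elt_ok (Suc k) ?l" "is_zero (elt_boundary (Suc k) ?l @ scale (-1) z)"
    using assms is_cycle unfolding filling_def fill_search_def by simp_all
  show "elt_ok (Suc k) ?l" by (rule l(1))
  have "chain_of k (elt_boundary (Suc k) ?l @ scale (-1) z) = 0"
    using l(2) is_zero[of k] elt_boundary(1)[OF l(1)] assms(1) by simp
  then show "boundary (chain_of (Suc k) ?l) = chain_of k z" using elt_boundary(2)[OF l(1)] by simp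
qed

lemma cf_fill_search: "cf (e_prod e_nat e_elt) e_elt fill_search"
proof -
  let ?e = "e_prod e_nat e_elt"
  have l: "cf (e_prod ?e e_nat) e_elt (\<lambda>q. inv_into UNIV e_elt (snd q))"
    by (rule cf_inv[OF bij_e_elt cf_snd[OF cf_id]])
  have kz: "cf (e_prod ?e e_nat) e_nat (\<lambda>q. fst (fst q))" "cf (e_prod ?e e_nat) e_elt (\<lambda>q. snd (fst q))"
    by (rule cf_fst cf_snd cf_id)+
  have app: "cf e e_elt (\<lambda>x. f x @ g x)" if "cf e e_elt f" "cf e e_elt g" for e :: "'z \<Rightarrow> nat" and f g
    using that cf_append unfolding e_elt_def by blast
  have "cf (e_prod ?e e_nat) e_int (\<lambda>q. sum_list (map fst (snd (fst q))))"
    by (rule cf_sum_list[OF cf_map[where h = "\<lambda>_. fst", OF kz(2)[unfolded e_elt_def] cf_fst[OF cf_snd[OF cf_id]]],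
          folded e_elt_def])
  then have "cf (e_prod ?e e_nat) e_bool (\<lambda>q. is_cycle (fst (fst q)) (snd (fst q)))"
    unfolding is_cycle_def
    by (rule cf_if[OF cf_eq_nat[OF kz(1) cf_const] cf_eq_int[OF _ cf_const] cf_is_zero_elt[OF cf_elt_boundary[OF kz]]])
  then have "cf (e_prod ?e e_nat) e_bool (\<lambda>q. filling (fst q) (snd q))"
    unfolding filling_def
    by (intro cf_or cf_not cf_and cf_elt_ok cf_is_zero_elt app cf_scale cf_elt_boundary cf_Suc cf_const kz l)
  then have "cf ?e e_nat (\<lambda>p. LEAST N. filling p N)"
    by (rule cf_least[OF _ filling_ex]) (use bij_is_surj[OF bij_e_prod[OF bij_e_nat bij_e_elt]] in \<open>simp add: surj_def, metis\<close>)
  then show ?thesis unfolding fill_search_def by (rule cf_inv[OF bij_e_elt])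
qed

definition base_cell :: "mat_data \<times> nat" where
  "base_cell = (m_data (1\<^sub>m n), list_index (words 0) [letter_index (1\<^sub>m n, 0)])"

text \<open>On a multiple \<open>c x\<close> of a cell the homotopy is \<open>c\<close> times the first filling of \<open>x - h (d x)\<close>.\<close>

primrec homotopy_term :: "nat \<Rightarrow> int \<times> mat_data \<times> nat \<Rightarrow> elt_data" where
  "homotopy_term 0 t = scale (fst t) (fill_search (0, (1, snd t) # [(-1, base_cell)]))"
| "homotopy_term (Suc k) t = scale (fst t) (fill_search (Suc k,
     (1, snd t) # scale (-1) (concat (map (homotopy_term k) (cell_boundary (Suc k) (snd t))))))"

definition elt_homotopy :: "nat \<Rightarrow> elt_data \<Rightarrow> elt_data" where
  "elt_homotopy k l = concat (map (homotopy_term k) l)"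

text \<open>One value of degree \<open>k + 1\<close> calls for values at all faces of a cell, a
  recursion that branches and is therefore an instance of \<open>cf_tree_recursion\<close>.\<close>

lemma cf_homotopy_term:
  "cf (e_prod e_nat (e_prod e_int e_cell)) e_elt (\<lambda>p. homotopy_term (fst p) (snd p))"
proof (rule cf_tree_recursion[where g = "homotopy_term 0"
      and L = "\<lambda>k t. cell_boundary (Suc k) (snd t)"
      and s = "\<lambda>k t ls. scale (fst t) (fill_search (Suc k, (1, snd t) # scale (-1) (concat ls)))"])
  show "inj (e_prod e_int e_cell)" by (intro bij_is_inj bij_e_prod bij_int_encode bij_e_cell)
  let ?t = "e_prod e_int e_cell"
  have cons: "cf e e_elt (\<lambda>x. (1, f x) # g x)" if "cf e e_cell f" "cf e e_elt g" for e :: "'z \<Rightarrow> nat" and f g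
    unfolding e_elt_def by (intro cf_Cons cf_pair cf_const that(1) that(2)[unfolded e_elt_def])
  have fs: "cf e e_elt (\<lambda>x. fill_search (f x, g x))" if "cf e e_nat f" "cf e e_elt g" for e :: "'z \<Rightarrow> nat" and f g
    by (rule cf_compose[OF cf_fill_search cf_pair[OF that]])
  have "cf ?t e_elt (\<lambda>t. scale (fst t) (fill_search (0, (1, snd t) # [(-1, base_cell)])))"
    by (intro cf_scale fs cons cf_const) (rule cf_fst cf_snd cf_id)+
  then show "cf ?t e_elt (homotopy_term 0)" unfolding homotopy_term.simps(1)[abs_def] .
  show "cf (e_prod e_nat ?t) (e_list ?t) (\<lambda>p. cell_boundary (Suc (fst p)) (snd (snd p)))"
    unfolding e_elt_def[symmetric] by (intro cf_cell_boundary cf_Suc) (rule cf_fst cf_snd cf_id)+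
  have "cf (e_prod (e_prod e_nat ?t) (e_list e_elt)) e_elt (\<lambda>p. concat (snd p))"
    unfolding e_elt_def by (rule cf_concat cf_snd cf_id)+
  then show "cf (e_prod (e_prod e_nat ?t) (e_list e_elt)) e_elt
      (\<lambda>p. scale (fst (snd (fst p))) (fill_search (Suc (fst (fst p)), (1, snd (snd (fst p))) # scale (-1) (concat (snd p)))))"
    by (intro cf_scale fs cons cf_Suc cf_const) (assumption | rule cf_fst cf_snd cf_id)+
qed simp_all


lemma base_cell: "cell_ok 0 base_cell" "cell_of 0 base_cell = [(1\<^sub>m n, 0)]"
proof -
  have v: "[(1\<^sub>m n, 0)] \<in> S" using S_vertex[of "(1\<^sub>m n, 0)"] m_pos SL_one by simp
  have "(1\<^sub>m n, 0) \<in> letter_set" by (rule letter_setI[OF v]) simp_all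
  then have a: "letter_index (1\<^sub>m n, 0) < B" "letters ! letter_index (1\<^sub>m n, 0) = (1\<^sub>m n, 0)"
    using letter_index by blast+
  then have "[letter_index (1\<^sub>m n, 0)] \<in> set (words 0)"
    using v by (simp add: words(2) word_ok)
  then have w: "snd base_cell < rank 0" "words 0 ! snd base_cell = [letter_index (1\<^sub>m n, 0)]"
    using list_index[of _ "words 0"] by (simp_all add: base_cell_def rank_def)
  have g: "length (fst base_cell) = n * n" "mat_of_data n d (fst base_cell) = 1\<^sub>m n"
    using m_data[OF SL_one] by (simp_all add: base_cell_def)
  show "cell_ok 0 base_cell" unfolding cell_ok_def mat_ok g(2) using w(1) g(1) SL_one by blast
  show "cell_of 0 base_cell = [(1\<^sub>m n, 0)]"
    by (simp add: cell_of_def R.cell_def base_simplex_def w(2) a(2) g(2) SL_ops)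
qed

text \<open>The operator on simplices behind \<open>homotopy_term\<close>. On the empty simplex it
  is the base vertex; elsewhere it is evaluated at the unique data of the cell.\<close>

definition cone_operator :: "(complex mat \<times> nat) list \<Rightarrow> (complex mat \<times> nat) list \<Rightarrow>\<^sub>0 int" where
  "cone_operator s = (if s = [] then frag_of [(1\<^sub>m n, 0)] else
    let k = length s - 1; p = R.coords k s in chain_of (Suc k) (homotopy_term k (1, m_data (snd p), fst p)))"

lemma cone_operator_cell:
  assumes "cell_ok k x" shows "cone_operator (cell_of k x) = chain_of (Suc k) (homotopy_term k (1, x))"
proof -
  have "length (cell_of k x) = Suc k" using cell_of_simplices[OF assms] by (simp add: R.simplices_def)
  moreover have "R.coords k (cell_of k x) = (snd x, mat_of_data n d (fst x))"
    unfolding cell_of_def using assms by (intro R.coords_cell) (auto simp: cell_ok_def mat_ok)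
  moreover have "m_data (mat_of_data n d (fst x)) = fst x"
    using assms by (intro m_data_of) (auto simp: cell_ok_def mat_ok)
  ultimately show ?thesis by (cases "cell_of k x") (simp_all add: cone_operator_def Let_def)
qed

text \<open>The search sees the cell with coefficient 1 and its result is scaled afterwards. This is
  what makes the homotopy additive; a search run on whole chains need not be.\<close>

lemma homotopy_term_scale:
  "chain_of (Suc k) (homotopy_term k (c, x)) = frag_cmul c (chain_of (Suc k) (homotopy_term k (1, x)))"
  "elt_ok (Suc k) (homotopy_term k (c, x)) \<longleftrightarrow> elt_ok (Suc k) (homotopy_term k (1, x))"
  by (cases k; simp)+

text \<open>The value depends on the chain denoted by \<open>l\<close> and not on the list, so every
  representation of an element leads to the same image.\<close>

lemma chain_of_elt_homotopy:
  "elt_ok k l \<Longrightarrow> chain_of (Suc k) (elt_homotopy k l) = frag_extend cone_operator (chain_of k l)"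
proof (induction l)
  case (Cons t l)
  then have "chain_of (Suc k) (homotopy_term k t) = frag_cmul (fst t) (cone_operator (cell_of k (snd t)))"
    using homotopy_term_scale(1)[of k "fst t" "snd t"] by (simp add: cone_operator_cell)
  then show ?case using Cons by (simp add: elt_homotopy_def frag_extend_add frag_extend_cmul)
qed (simp add: elt_homotopy_def)

definition homotopy_ok :: "nat \<Rightarrow> bool" where
  "homotopy_ok k \<longleftrightarrow> (\<forall>x. cell_ok k x \<longrightarrow> elt_ok (Suc k) (homotopy_term k (1, x)) \<and>
    boundary (cone_operator (cell_of k x)) =
      frag_of (cell_of k x) - frag_extend cone_operator (simplex_boundary (cell_of k x)))"

lemma elt_homotopy_ok:
  assumes "homotopy_ok k" "elt_ok k l"
  shows "elt_ok (Suc k) (elt_homotopy k l)"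
    "boundary (frag_extend cone_operator (chain_of k l)) =
      chain_of k l - frag_extend cone_operator (boundary (chain_of k l))"
proof -
  have "elt_ok (Suc k) (elt_homotopy k l) \<and> boundary (frag_extend cone_operator (chain_of k l)) =
      chain_of k l - frag_extend cone_operator (boundary (chain_of k l))"
    using assms(2)
  proof (induction l)
    case (Cons t l)
    then have t: "cell_ok k (snd t)" by simp
    then have "elt_ok (Suc k) (homotopy_term k t)"
      using assms(1) homotopy_term_scale(2)[of k "fst t" "snd t"] unfolding homotopy_ok_def prod.collapse by blast
    moreover have "boundary (cone_operator (cell_of k (snd t))) =
        frag_of (cell_of k (snd t)) - frag_extend cone_operator (simplex_boundary (cell_of k (snd t)))"
      using assms(1) t unfolding homotopy_ok_def by blast
    ultimately show ?case
      using Cons t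
      by (simp add: elt_homotopy_def frag_extend_add frag_extend_cmul frag_cmul_diff)
  qed (simp add: elt_homotopy_def)
  then show "elt_ok (Suc k) (elt_homotopy k l)"
    "boundary (frag_extend cone_operator (chain_of k l)) =
      chain_of k l - frag_extend cone_operator (boundary (chain_of k l))" by blast+
qed

text \<open>The search is entitled to succeed because x - h(d x) is a cycle: by induction d h(d x) =
  d x - h(d d x) = d x.\<close>

lemma homotopy_ok: "homotopy_ok k"
proof (induction k)
  case 0
  show ?case unfolding homotopy_ok_def
  proof (intro allI impI)
    fix x assume x: "cell_ok 0 x"
    obtain v where v: "cell_of 0 x = [v]"
      using cell_of_simplices[OF x] by (auto simp: R.simplices_def length_Suc_conv)
    \<comment> \<open>The boundary of a vertex is the empty simplex, which goes to the base vertex;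
      this is x - h(d x) in degree 0.\<close>
    let ?z = "(1, x) # [(-1, base_cell)]"
    have z: "elt_ok 0 ?z" using x base_cell(1) by simp
    have c: "chain_of 0 ?z = frag_of [v] - frag_of [(1\<^sub>m n, 0)]" by (simp add: v base_cell(2))
    have "boundary (chain_of 0 ?z) = 0" unfolding c by simp
    note f = fill_search[OF z this]
    have "elt_ok (Suc 0) (homotopy_term 0 (1, x))" using f(1) by simp
    moreover have "boundary (cone_operator (cell_of 0 x)) = frag_of [v] - frag_of [(1\<^sub>m n, 0)]"
      using f(2) unfolding cone_operator_cell[OF x] c by simp
    ultimately show "elt_ok (Suc 0) (homotopy_term 0 (1, x)) \<and> boundary (cone_operator (cell_of 0 x)) =
        frag_of (cell_of 0 x) - frag_extend cone_operator (simplex_boundary (cell_of 0 x))"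
      unfolding v by (simp add: cone_operator_def)
  qed
next
  case (Suc k)
  show ?case unfolding homotopy_ok_def
  proof (intro allI impI)
    fix x assume x: "cell_ok (Suc k) x"
    let ?b = "cell_boundary (Suc k) x"
    let ?z = "(1, x) # scale (-1) (elt_homotopy k ?b)"
    note b = cell_boundary[OF x]
    have z: "elt_ok (Suc k) ?z" using x elt_homotopy_ok(1)[OF Suc b(1)] by simp
    have c: "chain_of (Suc k) ?z =
        frag_of (cell_of (Suc k) x) - frag_extend cone_operator (simplex_boundary (cell_of (Suc k) x))"
      using chain_of_elt_homotopy[OF b(1)] by (simp add: b(2))
    have "boundary (simplex_boundary (cell_of (Suc k) x)) = 0"
      using boundary_boundary[of "frag_of (cell_of (Suc k) x)"] by simp
    then have "boundary (chain_of (Suc k) ?z) = 0"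
      unfolding c using elt_homotopy_ok(2)[OF Suc b(1)] by (simp add: b(2))
    note f = fill_search[OF z this]
    have e: "homotopy_term (Suc k) (1, x) = scale 1 (fill_search (Suc k, ?z))"
      by (simp add: elt_homotopy_def)
    show "elt_ok (Suc (Suc k)) (homotopy_term (Suc k) (1, x)) \<and> boundary (cone_operator (cell_of (Suc k) x)) =
        frag_of (cell_of (Suc k) x) - frag_extend cone_operator (simplex_boundary (cell_of (Suc k) x))"
      unfolding cone_operator_cell[OF x] e using f c by simp
  qed
qed

lemma cone_operator: "R.homotopy_operator cone_operator"
proof -
  have "Poly_Mapping.keys (cone_operator s) \<subseteq> R.simplices (Suc k) \<and>
      boundary (cone_operator s) = frag_of s - frag_extend cone_operator (simplex_boundary s)"
    if s: "s \<in> R.simplices k" for k s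
  proof -
    obtain i g where ig: "i < rank k" "g \<in> carrier G" "s = R.cell k i g" by (fact R.cell_surj[OF s])
    then have x: "cell_ok k (m_data g, i)" "s = cell_of k (m_data g, i)"
      by (simp_all add: cell_ok_def cell_of_def mat_ok m_data)
    show ?thesis
      unfolding x(2) using homotopy_ok[unfolded homotopy_ok_def] x(1) keys_chain_of
      by (metis cone_operator_cell)
  qed
  then show ?thesis unfolding R.homotopy_operator_def by (simp add: cone_operator_def SL_ops)
qed

section \<open>Module elements and their data\<close>

text \<open>A triple \<open>(c, A, i)\<close> in the prescribed representation stands for
  \<open>c\<close> times a single cell.\<close>

lemma smult_monomial_unit_elt:
  assumes i: "i < rank k" and g: "g \<in> carrier G"
  shows "monomial c g \<odot>\<^bsub>R.M k\<^esub> unit_elt G i = R.of_chain k (frag_cmul c (frag_of (R.cell k i g)))"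
proof -
  have "{x. monomial c g x \<noteq> 0} \<subseteq> {g}" by (auto simp: monomial_def)
  then have "monomial c g \<in> carrier R.ZG"
    using g finite_subset[of "{x. monomial c g x \<noteq> 0}" "{g}"] unfolding R.ZG_carrier by auto
  then have "monomial c g \<odot>\<^bsub>R.M k\<^esub> unit_elt G i = (\<lambda>j. if j = i then monomial c g else (\<lambda>_. 0))"
    by (rule R.smult_unit_elt)
  also have "\<dots> = R.of_chain k (frag_cmul c (frag_of (R.cell k i g)))"
  proof (intro ext)
    fix j h
    have "R.cell k i g = R.cell k j h \<longleftrightarrow> i = j \<and> g = h" if "j < rank k" "h \<in> carrier G"
      using R.cell_inj[of k i g j h] that i g by blast
    then show "(if j = i then monomial c g else (\<lambda>_. 0)) h =
        R.of_chain k (frag_cmul c (frag_of (R.cell k i g))) j h"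
      using i g by (auto simp: R.of_chain_def monomial_def lookup_single when_def)
  qed
  finally show ?thesis .
qed

text \<open>Translates the prescribed representation of module elements into chains, so that the
  correctness of the programs becomes a statement about \<open>chain_of\<close>.\<close>

lemma represents_iff:
  "represents n d (R.M k) (rank k) (unit_elt G) l w \<longleftrightarrow> elt_ok k l \<and> w = R.of_chain k (chain_of k l)"
proof -
  have "(\<forall>(c, A, i) \<in> set l. length A = n * n \<and> mat_of_data n d A \<in> carrier G \<and> i < rank k) \<longleftrightarrow> elt_ok k l"
    unfolding elt_ok_def cell_ok_def list_all_iff mat_ok by auto
  moreover have "foldr (\<lambda>(c, A, i) v. monomial c (mat_of_data n d A) \<odot>\<^bsub>R.M k\<^esub> unit_elt G i \<oplus>\<^bsub>R.M k\<^esub> v) l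
      \<zero>\<^bsub>R.M k\<^esub> = R.of_chain k (chain_of k l)" if "elt_ok k l"
    using that
  proof (induction l)
    case Nil
    show ?case by (simp add: free_mod_simps R.of_chain_0)
  next
    case (Cons t l)
    obtain c A i where t: "t = (c, A, i)" by (metis prod.exhaust)
    have "i < rank k" "mat_of_data n d A \<in> carrier G"
      using Cons.prems by (auto simp: t cell_ok_def mat_ok)
    from smult_monomial_unit_elt[OF this] show ?case
      using Cons by (simp add: t R.of_chain_add cell_of_def free_mod_simps(3))
  qed
  ultimately show ?thesis unfolding represents_def by auto
qed

lemma represents_chain:
  assumes "represents n d (R.M k) (rank k) (unit_elt G) l w"
  shows "elt_ok k l" "R.to_chain k w = chain_of k l"
  using assms R.to_chain_of_chain[OF keys_chain_of] unfolding represents_iff by auto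

lemma implementable:
  "implementable n d R.M rank (\<lambda>k. unit_elt G) R.D (R.homotopy cone_operator)"
  unfolding implementable_def
proof (intro conjI allI ballI)
  have "cf e_nat e_nat rank" unfolding rank_def[abs_def] by (rule cf_length[OF cf_words[OF cf_id]])
  then show "\<exists>p. \<forall>k. rec_eval p [k] (rank k)" unfolding cf_def .
  show "\<exists>l. represents n d (R.M k) (rank k) (unit_elt G) l w" if w: "w \<in> carrier (R.M k)" for k w
    using chain_of_surj[OF R.keys_to_chain[OF w]] R.of_chain_to_chain[OF w] unfolding represents_iff by metis
  have "cf (e_prod e_nat e_elt) e_elt (\<lambda>p. elt_boundary (fst p) (snd p))"
    by (rule cf_elt_boundary) (rule cf_fst cf_snd cf_id)+
  from cf_two_args[OF this] obtain p where p: "\<And>k l. rec_eval p [k, elt_code l] (elt_code (elt_boundary k l))"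
    unfolding elt_code_e_elt by auto
  have "represents n d (R.M (k - 1)) (rank (k - 1)) (unit_elt G) (elt_boundary k l) (R.D k w)"
    if k: "k > 0" and "represents n d (R.M k) (rank k) (unit_elt G) l w" for k l w
  proof -
    obtain j where j: "k = Suc j" using k by (cases k) auto
    show ?thesis
      using represents_chain[OF that(2)] elt_boundary[of j l] unfolding represents_iff R.D_def j by simp
  qed
  then show "\<exists>p. \<forall>k>0. \<forall>w\<in>carrier (R.M k). \<forall>l. represents n d (R.M k) (rank k) (unit_elt G) l w \<longrightarrow>
      (\<exists>l'. rec_eval p [k, elt_code l] (elt_code l') \<and>
        represents n d (R.M (k - 1)) (rank (k - 1)) (unit_elt G) l' (R.D k w))"
    using p by blast
  have "cf (e_prod e_nat e_elt) e_elt (\<lambda>p. elt_homotopy (fst p) (snd p))"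
  proof -
    let ?t = "e_prod e_int e_cell"
    have "cf (e_prod (e_prod e_nat e_elt) ?t) (e_prod e_nat ?t) (\<lambda>q. (fst (fst q), snd q))"
      by (rule cf_pair cf_fst cf_snd cf_id)+
    from cf_compose[OF cf_homotopy_term this]
    have "cf (e_prod (e_prod e_nat e_elt) ?t) (e_list ?t) (\<lambda>q. homotopy_term (fst (fst q)) (snd q))"
      by (simp add: e_elt_def)
    moreover have "cf (e_prod e_nat e_elt) (e_list ?t) snd"
      unfolding e_elt_def by (rule cf_snd[OF cf_id])
    ultimately show ?thesis
      unfolding elt_homotopy_def unfolding e_elt_def by (intro cf_concat cf_map)
  qed
  from cf_two_args[OF this] obtain p where p: "\<And>k l. rec_eval p [k, elt_code l] (elt_code (elt_homotopy k l))"
    unfolding elt_code_e_elt by auto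
  have "represents n d (R.M (Suc k)) (rank (Suc k)) (unit_elt G) (elt_homotopy k l) (R.homotopy cone_operator k w)"
    if "represents n d (R.M k) (rank k) (unit_elt G) l w" for k l w
    using represents_chain[OF that] elt_homotopy_ok(1)[OF homotopy_ok] chain_of_elt_homotopy
    unfolding represents_iff R.homotopy_def by simp
  then show "\<exists>p. \<forall>k. \<forall>w\<in>carrier (R.M k). \<forall>l. represents n d (R.M k) (rank k) (unit_elt G) l w \<longrightarrow>
      (\<exists>l'. rec_eval p [k, elt_code l] (elt_code l') \<and>
        represents n d (R.M (Suc k)) (rank (Suc k)) (unit_elt G) l' (R.homotopy cone_operator k w))"
    using p by blast
qed

end

theorem proposition13p4:
  fixes d :: int and n :: nat
  assumes "d < 0" and "squarefree d" and "n \<ge> 2"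
  shows "\<exists>(R :: nat \<Rightarrow> (complex mat \<Rightarrow> int, nat \<Rightarrow> complex mat \<Rightarrow> int) module) D h r b.
           free_resolution (SL n d) R D \<and>
           (\<forall>k. is_basis (group_ring (SL n d)) (R k) {..<r k} (b k)) \<and>
           contracting_homotopy R D h \<and>
           implementable n d R r b D h"
proof -
  interpret L: bianchi_lattice d n by unfold_locales (rule assms(1))
  obtain m :: nat and S :: "(complex mat \<times> nat) list set" where
    S: "0 < m" "acyclic_complex S" "S \<subseteq> lists (carrier (SL n d) \<times> {..<m})" "face_closed S"
    "\<And>g s. g \<in> carrier (SL n d) \<Longrightarrow> s \<in> S \<Longrightarrow> map (\<lambda>(h, c). (g * h, c)) s \<in> S"
    "\<And>x. x \<in> carrier (SL n d) \<times> {..<m} \<Longrightarrow> [x] \<in> S"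
    "\<And>x. finite {y. [x, y] \<in> S}"
    by (fact L.simplicial_model)
  interpret C: bianchi_complex d n m S by unfold_locales (fact S)+
  have "is_basis (group_ring (SL n d)) (C.R.M k) {..<C.rank k} (unit_elt (SL n d))" for k 
    by (rule C.R.free_mod_is_basis[where e = id]) simp_all
  then show ?thesis
    by (intro exI conjI allI)
       (rule C.R.free_resolution, assumption, rule C.R.contracting_homotopy[OF C.cone_operator], rule C.implementable)
qed

end
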